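(* Let $f$ be of either ignition type or general KPP type, let $u\in C^1(\mathbb R\times[0,H])$ be a percolating flow with tubes $D_j^\pm=\{\rho\in[c_j-h_j,c_j+h_j]\}$ as described in the context, and let $T(x,y,t)=U(x-ct,x,y)$, with $U(s,x,y)$ periodic in the last two variables, be a traveling wave-type solution with speed $c$ of $$T_t+u\cdot\nabla T=\kappa\Delta T+\frac{v_0^2}\kappa f(T)\ \text{ in }\mathbb R\times[0,H].$$ Then $$c\ge C\left(v_0+\sum_j\left(1+\frac l{h_j}\right)^{-1}\int_{c_j-h_j}^{c_j+h_j}|u(\rho,\xi)|E_1(\rho,\xi)\frac{d\rho}H\right),\qquad l=\frac\kappa{v_0},$$ where the sum is over all tubes and the constant $C>0$ depends only on the function $f$ and on the constant $K$ in the bounds on the streamline coordinates in the context. (The integrand is independent of $\xi$.)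
   Context: $\kappa,v_0,H>0$ are constants, $\Omega=\mathbb R\times[0,H]$. The nonlinearity $f\in C^1[0,1]$ satisfies $f(0)=f(1)=0$, $f\ge0$ on $(0,1)$, $f\not\equiv0$. General KPP type: $f>0$ on $(0,1)$. Ignition type: for some $\theta_0\in(0,1)$, $f=0$ on $[0,\theta_0]$ and at $1$, $f>0$ on $(\theta_0,1)$. A traveling wave-type solution $U(s,x,y)$ takes values in $[0,1]$, is periodic in $x$ with the $x$-period of $u$ and satisfies the (Neumann: $T_y=0$ at $y=0,H$; or periodic: $T(x,y+H,t)=T(x,y,t)$) boundary conditions in $y$ (periodicity in $y$ is understood through these), and $U\to1$ as $s\to-\infty$, $U\to0$ as $s\to+\infty$; it is known that such fronts are monotonically decreasing in $s$. Percolating flow: $u=(u_1,u_2)\in C^1(\Omega)$ is time independent, $\nabla\cdot u=0$, $\int_0^Hu_1(x,y)\,dy=0$ for all $x$, and $u$ is periodic in space (in $x$, and $H$-periodic in $y$ in the case of periodic boundary conditions); in the Neumann case $u_2=0$ at $y=0,H$. There are finitely many pairwise disjoint regions (tubes) $D_j^+$ and $D_j^-$, each bounded by streamlines of $u$, such that the projection onto the $x$-axis of each streamline contained in $D_j^\pm$ is the whole real line. Inside each tube there is a one-to-one $C^2$ change of coordinates $(x,y)\to(\rho,\xi)$, with $\rho$ constant on streamlines and $\xi$ an orthogonal coordinate, $\rho\in[c_j-h_j,c_j+h_j]$ and $\xi\in(-\infty,\infty)$ ($c_j,h_j$ depending on the tube), with $u\cdot\nabla\xi>0$ in $D_j^+$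 and $u\cdot\nabla\xi<0$ in $D_j^-$. Write $dx^2+dy^2=E_1^2(\rho,\xi)\,d\rho^2+E_2^2(\rho,\xi)\,d\xi^2$ and $\omega=E_2/E_1$. It is assumed that for some constant $K>0$, on all tubes, $$K^{-1}\le E_{1},E_2,\qquad K^{-1}\le|\omega|\le K,\qquad\left|\frac{\partial\omega}{\partial\xi}\right|,\left|\frac{\partial\omega}{\partial\rho}\right|\le\frac K{h_j},$$ and that on each tube $$\tfrac12\|E_1u\|_{\infty,j}\le E_1(\rho,\xi)|u(\rho,\xi)|\le\|E_1u\|_{\infty,j},\qquad\|E_1u\|_{\infty,j}=\sup_{D_j^\pm}E_1|u|.$$ The quantity $E_1(\rho,\xi)|u(\rho,\xi)|$ does not depend on $\xi$ by incompressibility. *)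

theory Defs
  imports "HOL-Analysis.Analysis"
begin

text \<open>Derivatives are taken within the set, so they are one-sided at boundary points and continuous
  up to the boundary. The sets used below are closed intervals, closed strips, the plane, and
  diffeomorphic images of closed strips; derivatives within such sets are unique.\<close>

definition C1_on :: "'a::real_normed_vector set \<Rightarrow> ('a \<Rightarrow> 'b::real_normed_vector) \<Rightarrow> bool" where
  "C1_on S g \<longleftrightarrow> (\<exists>g'::'a \<Rightarrow> 'a \<Rightarrow>\<^sub>L 'b.
     (\<forall>z\<in>S. (g has_derivative blinfun_apply (g' z)) (at z within S)) \<and> continuous_on S g')"

definition C2_on :: "'a::real_normed_vector set \<Rightarrow> ('a \<Rightarrow> 'b::real_normed_vector) \<Rightarrow> bool" where
  "C2_on S g \<longleftrightarrow> (\<exists>g'::'a \<Rightarrow> 'a \<Rightarrow>\<^sub>L 'b.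
     (\<forall>z\<in>S. (g has_derivative blinfun_apply (g' z)) (at z within S)) \<and> C1_on S g')"

text \<open>Only the values on \<open>[0,1]\<close> matter.\<close>

definition nonlinearity :: "(real \<Rightarrow> real) \<Rightarrow> bool" where
  "nonlinearity f \<longleftrightarrow> C1_on {0..1} f \<and> f 0 = 0 \<and> f 1 = 0
     \<and> (\<forall>s\<in>{0<..<1}. 0 \<le> f s) \<and> (\<exists>s\<in>{0..1}. f s \<noteq> 0)"

definition general_KPP_type :: "(real \<Rightarrow> real) \<Rightarrow> bool" where
  "general_KPP_type f \<longleftrightarrow> nonlinearity f \<and> (\<forall>s\<in>{0<..<1}. 0 < f s)"

definition ignition_type :: "(real \<Rightarrow> real) \<Rightarrow> bool" where
  "ignition_type f \<longleftrightarrow> nonlinearity f \<and>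
     (\<exists>\<theta>\<^sub>0\<in>{0<..<1}. (\<forall>s\<in>{0..\<theta>\<^sub>0}. f s = 0) \<and> (\<forall>s\<in>{\<theta>\<^sub>0<..<1}. 0 < f s))"

datatype bdry = Neumann | Periodic

text \<open>Functions that are \<open>H\<close>-periodic in \<open>y\<close> are functions on the whole plane, so that regularity and
  the equation hold across \<open>y = 0\<close> and \<open>y = H\<close>.\<close>

definition y_range :: "bdry \<Rightarrow> real \<Rightarrow> real set" where
  "y_range b H = (case b of Neumann \<Rightarrow> {0..H} | Periodic \<Rightarrow> UNIV)"

definition domain :: "bdry \<Rightarrow> real \<Rightarrow> (real \<times> real) set" where
  "domain b H = UNIV \<times> y_range b H"

definition divergence_free_on :: "(real \<times> real) set \<Rightarrow> (real \<times> real \<Rightarrow> real \<times> real) \<Rightarrow> bool" where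
  "divergence_free_on S u \<longleftrightarrow> (\<forall>z\<in>S. \<exists>L. (u has_derivative L) (at z within S)
     \<and> fst (L (1, 0)) + snd (L (0, 1)) = 0)"

text \<open>The flows considered are \<open>C\<^sup>1\<close>, bounded and tangential to the boundary, so every
  maximal integral curve is defined for all times.\<close>

definition streamline ::
  "(real \<times> real) set \<Rightarrow> (real \<times> real \<Rightarrow> real \<times> real) \<Rightarrow> (real \<times> real) set \<Rightarrow> bool" where
  "streamline S u A \<longleftrightarrow> (\<exists>\<gamma>. (\<forall>t::real. \<gamma> t \<in> S \<and> (\<gamma> has_vector_derivative u (\<gamma> t)) (at t))
     \<and> A = range \<gamma>)"

datatype orientation = Plus | Minus

text \<open>The chart of a tube is \<open>(x, y) \<mapsto> (\<rho>, \<xi>)\<close>; the scale factors \<open>E1\<close>, \<open>E2\<close> are functions of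
  \<open>(\<rho>, \<xi>)\<close>.\<close>

record tube =
  region :: "(real \<times> real) set"
  orient :: orientation
  chart :: "real \<times> real \<Rightarrow> real \<times> real"
  centre :: real
  half_width :: real
  E1 :: "real \<times> real \<Rightarrow> real"
  E2 :: "real \<times> real \<Rightarrow> real"

definition rho_range :: "tube \<Rightarrow> real set" where
  "rho_range D = {centre D - half_width D .. centre D + half_width D}"

definition coord_strip :: "tube \<Rightarrow> (real \<times> real) set" where
  "coord_strip D = rho_range D \<times> UNIV"

definition point_at :: "tube \<Rightarrow> real \<times> real \<Rightarrow> real \<times> real" where
  "point_at D = inv_into (region D) (chart D)"

definition omega :: "tube \<Rightarrow> real \<times> real \<Rightarrow> real" where
  "omega D q = E2 D q / E1 D q"

definition E1u :: "(real \<times> real \<Rightarrow> real \<times> real) \<Rightarrow> tube \<Rightarrow> real \<times> real \<Rightarrow> real" where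
  "E1u u D q = E1 D q * norm (u (point_at D q))"

definition E1u_sup :: "(real \<times> real \<Rightarrow> real \<times> real) \<Rightarrow> tube \<Rightarrow> real" where
  "E1u_sup u D = (SUP q\<in>coord_strip D. E1u u D q)"

definition C2_coordinates :: "tube \<Rightarrow> bool" where
  "C2_coordinates D \<longleftrightarrow> 0 < half_width D
     \<and> bij_betw (chart D) (region D) (coord_strip D)
     \<and> C2_on (region D) (chart D) \<and> C2_on (coord_strip D) (point_at D)"

text \<open>The metric identity \<open>dx\<^sup>2 + dy\<^sup>2 = E\<^sub>1\<^sup>2 d\<rho>\<^sup>2 + E\<^sub>2\<^sup>2 d\<xi>\<^sup>2\<close>, evaluated on a
  tangent vector \<open>(a, b)\<close>. It contains the orthogonality of the coordinates.\<close>

definition orthogonal_metric :: "tube \<Rightarrow> bool" where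
  "orthogonal_metric D \<longleftrightarrow> (\<forall>q\<in>coord_strip D. \<exists>L.
     (point_at D has_derivative L) (at q within coord_strip D)
     \<and> (\<forall>a b. (norm (L (a, b)))\<^sup>2 = (E1 D q)\<^sup>2 * a\<^sup>2 + (E2 D q)\<^sup>2 * b\<^sup>2))"

definition coordinate_bounds :: "real \<Rightarrow> tube \<Rightarrow> bool" where
  "coordinate_bounds K D \<longleftrightarrow> (\<forall>\<rho>\<in>rho_range D. \<forall>\<xi>.
     1 / K \<le> E1 D (\<rho>, \<xi>) \<and> 1 / K \<le> E2 D (\<rho>, \<xi>)
     \<and> 1 / K \<le> \<bar>omega D (\<rho>, \<xi>)\<bar> \<and> \<bar>omega D (\<rho>, \<xi>)\<bar> \<le> K
     \<and> (\<exists>w. ((\<lambda>s. omega D (\<rho>, s)) has_real_derivative w) (at \<xi>) \<and> \<bar>w\<bar> \<le> K / half_width D)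
     \<and> (\<exists>w. ((\<lambda>r. omega D (r, \<xi>)) has_real_derivative w) (at \<rho> within rho_range D)
          \<and> \<bar>w\<bar> \<le> K / half_width D))"

text \<open>That the tube is bounded by streamlines and that \<open>\<rho>\<close> is constant on streamlines is the
  statement that the lines of constant \<open>\<rho>\<close> in the closed tube are streamlines. The quantity
  \<open>L (u z)\<close> below is \<open>(u \<sqdot> \<nabla>\<xi>)(z)\<close>.\<close>

definition percolating_tube ::
  "(real \<times> real) set \<Rightarrow> (real \<times> real \<Rightarrow> real \<times> real) \<Rightarrow> real \<Rightarrow> tube \<Rightarrow> bool" where
  "percolating_tube S u K D \<longleftrightarrow>
     region D \<subseteq> S \<and> C2_coordinates D \<and> orthogonal_metric D \<and> coordinate_bounds K D
   \<and> (\<forall>r\<in>rho_range D. streamline S u {z \<in> region D. fst (chart D z) = r})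
   \<and> (\<forall>A. streamline S u A \<and> A \<subseteq> region D \<longrightarrow> fst ` A = UNIV)
   \<and> (\<forall>z\<in>region D. \<exists>L. ((\<lambda>z. snd (chart D z)) has_derivative L) (at z within region D)
        \<and> (case orient D of Plus \<Rightarrow> 0 < L (u z) | Minus \<Rightarrow> L (u z) < 0))
   \<and> (\<forall>q\<in>coord_strip D. E1u_sup u D / 2 \<le> E1u u D q \<and> E1u u D q \<le> E1u_sup u D)"

text \<open>In the periodic case a region is represented by a lift to the plane, so that it may cross
  the lines \<open>y = k H\<close>; disjointness then means disjointness modulo vertical translations by
  multiples of \<open>H\<close>, including that no region meets a translate of itself.\<close>

definition disjoint_regions :: "bdry \<Rightarrow> real \<Rightarrow> nat \<Rightarrow> (nat \<Rightarrow> tube) \<Rightarrow> bool" where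
  "disjoint_regions b H n D \<longleftrightarrow> (\<forall>i<n. \<forall>j<n. case b of
      Neumann \<Rightarrow> i \<noteq> j \<longrightarrow> region (D i) \<inter> region (D j) = {}
    | Periodic \<Rightarrow> (\<forall>k::int. i \<noteq> j \<or> k \<noteq> 0 \<longrightarrow>
        (\<lambda>z. z + (0, of_int k * H)) ` region (D i) \<inter> region (D j) = {}))"

text \<open>Here \<open>p\<close> is the period of the flow in \<open>x\<close>.\<close>

definition percolating_flow ::
  "bdry \<Rightarrow> real \<Rightarrow> real \<Rightarrow> real \<Rightarrow> (real \<times> real \<Rightarrow> real \<times> real) \<Rightarrow> nat \<Rightarrow> (nat \<Rightarrow> tube) \<Rightarrow> bool" where
  "percolating_flow b H p K u n D \<longleftrightarrow>
     C1_on (domain b H) u \<and> divergence_free_on (domain b H) u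
   \<and> (\<forall>x. integral {0..H} (\<lambda>y. fst (u (x, y))) = 0)
   \<and> 0 < p \<and> (\<forall>x. \<forall>y\<in>y_range b H. u (x + p, y) = u (x, y))
   \<and> (case b of
        Neumann \<Rightarrow> \<forall>x. snd (u (x, 0)) = 0 \<and> snd (u (x, H)) = 0
      | Periodic \<Rightarrow> \<forall>x y. u (x, y + H) = u (x, y))
   \<and> (\<forall>j<n. percolating_tube (domain b H) u K (D j))
   \<and> disjoint_regions b H n D"

definition classical_solution ::
  "bdry \<Rightarrow> real \<Rightarrow> real \<Rightarrow> real \<Rightarrow> (real \<Rightarrow> real) \<Rightarrow> (real \<times> real \<Rightarrow> real \<times> real)
     \<Rightarrow> (real \<Rightarrow> real \<Rightarrow> real \<Rightarrow> real) \<Rightarrow> bool" where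
  "classical_solution b H \<kappa> v\<^sub>0 f u T \<longleftrightarrow> (\<exists>Tt Tx Ty Txx Tyy.
     (\<forall>g\<in>{Tt, Tx, Ty, Txx, Tyy}.
        continuous_on (UNIV \<times> y_range b H \<times> UNIV) (\<lambda>(x, y, t). g x y t))
   \<and> (\<forall>x t. \<forall>y\<in>y_range b H.
        ((\<lambda>r. T x y r) has_real_derivative Tt x y t) (at t)
      \<and> ((\<lambda>r. T r y t) has_real_derivative Tx x y t) (at x)
      \<and> ((\<lambda>r. Tx r y t) has_real_derivative Txx x y t) (at x)
      \<and> ((\<lambda>r. T x r t) has_real_derivative Ty x y t) (at y within y_range b H)
      \<and> ((\<lambda>r. Ty x r t) has_real_derivative Tyy x y t) (at y within y_range b H)
      \<and> Tt x y t + (fst (u (x, y)) * Tx x y t + snd (u (x, y)) * Ty x y t)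
          = \<kappa> * (Txx x y t + Tyy x y t) + v\<^sub>0\<^sup>2 / \<kappa> * f (T x y t)))"

definition boundary_condition :: "bdry \<Rightarrow> real \<Rightarrow> (real \<Rightarrow> real \<Rightarrow> real \<Rightarrow> real) \<Rightarrow> bool" where
  "boundary_condition b H T \<longleftrightarrow> (case b of
      Neumann \<Rightarrow> \<forall>x t. \<forall>y\<in>{0, H}. ((\<lambda>r. T x r t) has_real_derivative 0) (at y within {0..H})
    | Periodic \<Rightarrow> \<forall>x y t. T x (y + H) t = T x y t)"

text \<open>For \<open>c \<noteq> 0\<close> the function \<open>U\<close> is determined by \<open>T\<close>, but for \<open>c = 0\<close> it is not; hence the
  periodicity in \<open>y\<close> is also required of \<open>U\<close> itself. The limits in \<open>s\<close> are only required pointwise.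
  Monotonicity in \<open>s\<close> is not part of the definition.\<close>

definition traveling_wave ::
  "bdry \<Rightarrow> real \<Rightarrow> real \<Rightarrow> real \<Rightarrow> real \<Rightarrow> (real \<Rightarrow> real) \<Rightarrow> (real \<times> real \<Rightarrow> real \<times> real)
     \<Rightarrow> (real \<Rightarrow> real \<Rightarrow> real \<Rightarrow> real) \<Rightarrow> real \<Rightarrow> bool" where
  "traveling_wave b H p \<kappa> v\<^sub>0 f u U c \<longleftrightarrow>
     classical_solution b H \<kappa> v\<^sub>0 f u (\<lambda>x y t. U (x - c * t) x y)
   \<and> boundary_condition b H (\<lambda>x y t. U (x - c * t) x y)
   \<and> (\<forall>s x. \<forall>y\<in>y_range b H. U s x y \<in> {0..1})
   \<and> (\<forall>s x. \<forall>y\<in>y_range b H. U s (x + p) y = U s x y)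
   \<and> (b = Periodic \<longrightarrow> (\<forall>s x y. U s x (y + H) = U s x y))
   \<and> (\<forall>x. \<forall>y\<in>y_range b H. ((\<lambda>s. U s x y) \<longlongrightarrow> 1) at_bot \<and> ((\<lambda>s. U s x y) \<longlongrightarrow> 0) at_top)"

end

theory Submission
  imports Defs
begin

text \<open>Multiply the equation by \<open>G'(T)\<close> with \<open>G(T) = 2 T - T\<^sup>2 / 2\<close> and integrate over one time period
\<open>\<tau>\<close>, after which the front has moved by a multiple of the spatial period: this bounds the space-time
integral of \<open>\<kappa> |\<nabla>T|\<^sup>2 + v\<^sup>2 / \<kappa> f(T)\<close> by a multiple of \<open>c \<tau> H\<close>. Along each line parallel to the
\<open>x\<close>-axis, \<open>f(T) T\<^sub>x\<close> integrates to \<open>- \<integral> f\<close>, so that the two dissipation terms together are at least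
a multiple of \<open>v \<tau> H\<close>; this gives the term \<open>v\<close>.

For the flow, test the equation with \<open>f(T) \<Psi>\<close>, where \<open>\<Psi>\<close> is constant along streamlines: the advection
term becomes \<open>\<integral> f\<close> times the flux of \<open>\<Psi> u\<^sub>1\<close>, and all other terms are controlled by the dissipation
provided that \<open>|\<nabla>\<Psi>|\<close> is at most a multiple of \<open>v / \<kappa>\<close>. For \<open>\<Psi>\<close> take the sum over the tubes of bumps in
\<open>\<rho>\<close>, weighted by \<open>(1 + l / h\<^sub>j)\<^sup>-\<^sup>1\<close> and signed so that the fluxes add up.\<close>

section \<open>Integrals over slabs\<close>

text \<open>At infinity the definition of a wave gives pointwise limits of values and no decay of
  derivatives. Every identity is therefore taken with a cutoff in x - ct and arranged so that
  derivatives of the cutoff multiply functions of T alone. Such terms live in two windows which move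
  off by multiples of the period, where dominated convergence evaluates them. The second obstacle is
  the shape of a tube. Its streamlines may turn back in x and, under periodicity in y, wind
  vertically; the chart does not say in which x-direction \<xi> increases. The flux is therefore not
  read off on one cross section but averaged over 0 \<le> x \<le> 1 and transformed to (\<rho>,
  \<xi>). Finiteness of the area of that piece of the period cell then shows that almost all lines
  of a tube cross it in the same direction, so that nothing cancels. The dependence of the constant
  on K enters through the gradient of \<rho>, whose length is 1 / E1 \<le> K.\<close>

abbreviation slab :: "'b::euclidean_space \<Rightarrow> 'b \<Rightarrow> (real \<times> 'b) set" where
  "slab a b \<equiv> UNIV \<times> cbox a b"

text \<open>Continuity together with support bounded in x reduces every integral over the unbounded
  slab to one over a box, where integrability, Fubini and the fundamental theorem follow from
  continuity alone. The generic cross section serves for (y, t) as well as for y.\<close>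

definition bsupp_cont :: "'b::euclidean_space \<Rightarrow> 'b \<Rightarrow> (real \<times> 'b \<Rightarrow> real) \<Rightarrow> bool" where
  "bsupp_cont a b F \<longleftrightarrow> continuous_on (slab a b) F \<and>
     (\<exists>R. \<forall>x. \<forall>w\<in>cbox a b. R \<le> \<bar>x\<bar> \<longrightarrow> F (x, w) = 0)"

lemma bsupp_contI:
  assumes "continuous_on (slab a b) F"
    and "\<And>x w. w \<in> cbox a b \<Longrightarrow> R \<le> \<bar>x\<bar> \<Longrightarrow> F (x, w) = 0"
  shows "bsupp_cont a b F"
  using assms unfolding bsupp_cont_def by blast

text \<open>The interval [A, B] need not be symmetric, because in \<open>bsupp_cont_shift\<close> a
  translation by \<open>m\<close> carries [-R, R] to [-R - m, R - m].\<close>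

lemma bsupp_cont_has_integral_box:
  fixes F :: "real \<times> 'b::euclidean_space \<Rightarrow> real"
  assumes "continuous_on (slab a b) F"
    and "\<And>x w. w \<in> cbox a b \<Longrightarrow> x \<notin> {A..B} \<Longrightarrow> F (x, w) = 0"
  shows "(F has_integral integral (cbox (A, a) (B, b)) F) (slab a b)"
proof -
  have "continuous_on (cbox (A, a) (B, b)) F"
    by (rule continuous_on_subset[OF assms(1)]) (auto simp: cbox_Pair_eq)
  then have *: "(F has_integral integral (cbox (A, a) (B, b)) F) (cbox (A, a) (B, b))"
    using integrable_integral integrable_continuous by metis
  have 1: "{z \<in> cbox (A, a) (B, b) - slab a b. F z \<noteq> 0} = {}"
    by (auto simp: cbox_Pair_eq)
  have 2: "F (x, w) = 0" if "w \<in> cbox a b" "(x, w) \<notin> cbox (A, a) (B, b)" for x w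
    using that by (intro assms(2)) (auto simp: cbox_Pair_eq)
  have 3: "{z \<in> slab a b - cbox (A, a) (B, b). F z \<noteq> 0} = {}"
    using 2 by auto
  have "negligible {z \<in> cbox (A, a) (B, b) - slab a b. F z \<noteq> 0}"
    "negligible {z \<in> slab a b - cbox (A, a) (B, b). F z \<noteq> 0}"
    unfolding 1 3 by auto
  from has_integral_spike_set_eq[OF this] * show ?thesis by blast
qed

lemma bsupp_cont_integrable:
  assumes "bsupp_cont a b F"
  shows "F integrable_on slab a b"
proof -
  obtain R where R: "\<And>x w. w \<in> cbox a b \<Longrightarrow> R \<le> \<bar>x\<bar> \<Longrightarrow> F (x, w) = 0"
    using assms unfolding bsupp_cont_def by blast
  have "(F has_integral integral (cbox (-R, a) (R, b)) F) (slab a b)"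
    using assms R by (intro bsupp_cont_has_integral_box) (auto simp: bsupp_cont_def abs_if)
  then show ?thesis by (rule has_integral_integrable)
qed

lemma bsupp_cont_mult:
  assumes "bsupp_cont a b F" "continuous_on (slab a b) g"
  shows "bsupp_cont a b (\<lambda>z. F z * g z)" "bsupp_cont a b (\<lambda>z. g z * F z)"
proof -
  obtain R where "\<And>x w. w \<in> cbox a b \<Longrightarrow> R \<le> \<bar>x\<bar> \<Longrightarrow> F (x, w) = 0"
    using assms(1) unfolding bsupp_cont_def by blast
  then show "bsupp_cont a b (\<lambda>z. F z * g z)" "bsupp_cont a b (\<lambda>z. g z * F z)"
    using assms by (auto intro!: bsupp_contI[where R = R] continuous_intros simp: bsupp_cont_def)
qed

lemma bsupp_cont_cmult:
  assumes "bsupp_cont a b F"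
  shows "bsupp_cont a b (\<lambda>z. r * F z)"
  using bsupp_cont_mult(2)[OF assms, of "\<lambda>_. r"] by simp

lemma bsupp_cont_add:
  assumes "bsupp_cont a b F" "bsupp_cont a b G"
  shows "bsupp_cont a b (\<lambda>z. F z + G z)"
proof -
  obtain R S where "\<And>x w. w \<in> cbox a b \<Longrightarrow> R \<le> \<bar>x\<bar> \<Longrightarrow> F (x, w) = 0"
    "\<And>x w. w \<in> cbox a b \<Longrightarrow> S \<le> \<bar>x\<bar> \<Longrightarrow> G (x, w) = 0"
    using assms unfolding bsupp_cont_def by metis
  then show ?thesis
    using assms by (intro bsupp_contI[where R = "max R S"])
      (auto simp: bsupp_cont_def intro!: continuous_intros)
qed

lemma bsupp_cont_diff:
  assumes "bsupp_cont a b F" "bsupp_cont a b G"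
  shows "bsupp_cont a b (\<lambda>z. F z - G z)"
  using bsupp_cont_add[OF assms(1) bsupp_cont_cmult[OF assms(2), of "-1"]] by simp

lemma bsupp_cont_abs:
  assumes "bsupp_cont a b F"
  shows "bsupp_cont a b (\<lambda>z. \<bar>F z\<bar>)"
  using assms unfolding bsupp_cont_def by (auto intro!: continuous_intros)

lemma bsupp_cont_shift:
  assumes F: "bsupp_cont a b F"
  shows "bsupp_cont a b (\<lambda>(x, w). F (x + m, w))"
    and "integral (slab a b) (\<lambda>(x, w). F (x + m, w)) = integral (slab a b) F"
proof -
  obtain R where R: "\<And>x w. w \<in> cbox a b \<Longrightarrow> R \<le> \<bar>x\<bar> \<Longrightarrow> F (x, w) = 0"
    using F unfolding bsupp_cont_def by blast
  have cF: "continuous_on (slab a b) F" using F by (simp add: bsupp_cont_def)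
  have c: "continuous_on (slab a b) (\<lambda>(x, w). F (x + m, w))"
    unfolding case_prod_unfold
    by (rule continuous_on_compose2[OF cF]) (auto intro!: continuous_intros)
  show "bsupp_cont a b (\<lambda>(x, w). F (x + m, w))"
    using R by (intro bsupp_contI[OF c, where R = "R + \<bar>m\<bar>"]) auto
  have "((\<lambda>(x, w). F (x + m, w)) has_integral
      integral (cbox (-R - m, a) (R - m, b)) (\<lambda>(x, w). F (x + m, w))) (slab a b)"
    using c R by (intro bsupp_cont_has_integral_box) (auto simp: abs_if)
  moreover have "integral (cbox (-R - m, a) (R - m, b)) (\<lambda>(x, w). F (x + m, w))
      = integral (cbox (-R, a) (R, b)) F"
  proof -
    have "F \<circ> (+) (m, 0) = (\<lambda>(x, w). F (x + m, w))"
      by (auto simp: fun_eq_iff add.commute)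
    then show ?thesis
      using integral_shift_cbox_plus[of "(-R - m, a)" "(R - m, b)" F "(m, 0)"] by simp
  qed
  moreover have "(F has_integral integral (cbox (-R, a) (R, b)) F) (slab a b)"
    using cF R by (intro bsupp_cont_has_integral_box) (auto simp: abs_if)
  ultimately show "integral (slab a b) (\<lambda>(x, w). F (x + m, w)) = integral (slab a b) F"
    by (simp add: integral_unique)
qed

text \<open>Stated for all large R rather than for one, so that the same R can also be made to
  annihilate a primitive at both ends.\<close>

lemma slab_integral_fubini:
  fixes F :: "real \<times> 'b::euclidean_space \<Rightarrow> real"
  assumes F: "bsupp_cont a b F"
  shows "\<exists>R0. \<forall>R\<ge>R0. integral (slab a b) F = integral (cbox a b) (\<lambda>w. integral {-R..R} (\<lambda>x. F (x, w)))"
proof -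
  obtain R0 where R0: "\<And>x w. w \<in> cbox a b \<Longrightarrow> R0 \<le> \<bar>x\<bar> \<Longrightarrow> F (x, w) = 0"
    using F unfolding bsupp_cont_def by blast
  show ?thesis
  proof (intro exI[of _ R0] allI impI)
    fix R assume R: "R \<ge> R0"
    have c: "continuous_on (cbox (-R, a) (R, b)) F"
      using F by (auto simp: bsupp_cont_def cbox_Pair_eq intro: continuous_on_subset)
    have "integral (slab a b) F = integral (cbox (-R, a) (R, b)) F"
      using F R R0 by (intro integral_unique bsupp_cont_has_integral_box)
        (auto simp: bsupp_cont_def abs_if)
    also have "\<dots> = integral (cbox (-R) R) (\<lambda>x. integral (cbox a b) (\<lambda>w. F (x, w)))"
      by (rule integral_prod_continuous[OF c])
    also have "\<dots> = integral (cbox a b) (\<lambda>w. integral (cbox (-R) R) (\<lambda>x. F (x, w)))"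
      using c by (intro integral_swap_continuous) (simp add: case_prod_unfold)
    finally show "integral (slab a b) F = integral (cbox a b) (\<lambda>w. integral {-R..R} (\<lambda>x. F (x, w)))"
      by simp
  qed
qed

lemma slab_integral_dx:
  fixes F F' :: "real \<times> 'b::euclidean_space \<Rightarrow> real"
  assumes F: "bsupp_cont a b F" and F': "bsupp_cont a b F'"
    and d: "\<And>x w. w \<in> cbox a b \<Longrightarrow> ((\<lambda>r. F (r, w)) has_real_derivative F' (x, w)) (at x)"
  shows "integral (slab a b) F' = 0"
proof -
  obtain R0 where R0: "\<And>x w. w \<in> cbox a b \<Longrightarrow> R0 \<le> \<bar>x\<bar> \<Longrightarrow> F (x, w) = 0"
    using F unfolding bsupp_cont_def by blast
  obtain R1 where R1: "\<forall>R\<ge>R1. integral (slab a b) F' = integral (cbox a b) (\<lambda>w. integral {-R..R} (\<lambda>x. F' (x, w)))"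
    using slab_integral_fubini[OF F'] by blast
  \<comment> \<open>\<open>R0\<close> makes F vanish at both ends, \<open>R1\<close> allows Fubini,
    and 1 ensures -R \<le> R for the fundamental theorem.\<close>
  define R where "R = Max {1, R0, R1}"
  have R: "R \<ge> 1" "R \<ge> R0" "R \<ge> R1" by (auto simp: R_def)
  have "integral (slab a b) F' = integral (cbox a b) (\<lambda>w. integral {-R..R} (\<lambda>x. F' (x, w)))"
    using R1 R by blast
  also have "\<dots> = integral (cbox a b) (\<lambda>w. 0)"
  proof (rule integral_cong)
    fix w assume w: "w \<in> cbox a b"
    have "((\<lambda>x. F' (x, w)) has_integral F (R, w) - F (-R, w)) {-R..R}"
      using R d[OF w] by (intro fundamental_theorem_of_calculus)
        (auto simp: has_real_derivative_iff_has_vector_derivative[symmetric]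
           intro: has_field_derivative_at_within)
    then show "integral {-R..R} (\<lambda>x. F' (x, w)) = 0"
      using R R0[OF w, of R] R0[OF w, of "-R"] by (simp add: integral_unique)
  qed
  finally show ?thesis by simp
qed

text \<open>Two orders of integration are recorded: t innermost for integrating a t-derivative, y
  innermost for a y-derivative and for fluxes.\<close>

lemma box_integral_cong_inner:
  fixes F' :: "real \<times> real \<times> real \<Rightarrow> real"
  assumes "bsupp_cont (0, 0) (H, \<tau>) F'"
  shows "\<exists>R0. \<forall>R\<ge>R0. integral (slab (0, 0) (H, \<tau>)) F' =
     integral {-R..R} (\<lambda>x. integral {0..H} (\<lambda>y. integral {0..\<tau>} (\<lambda>t. F' (x, y, t))))
    \<and> integral (slab (0, 0) (H, \<tau>)) F' =
     integral {-R..R} (\<lambda>x. integral {0..\<tau>} (\<lambda>t. integral {0..H} (\<lambda>y. F' (x, y, t))))"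
proof -
  obtain R1 where R1: "\<And>x w. w \<in> cbox (0, 0) (H, \<tau>) \<Longrightarrow> R1 \<le> \<bar>x\<bar> \<Longrightarrow> F' (x, w) = 0"
    using assms unfolding bsupp_cont_def by blast
  show ?thesis
  proof (intro exI[of _ R1] allI impI)
    fix R assume R: "R \<ge> R1"
    have cS: "continuous_on (slab (0, 0) (H, \<tau>)) F'"
      using assms by (simp add: bsupp_cont_def)
    have c: "continuous_on (cbox (-R, 0, 0) (R, H, \<tau>)) F'"
      by (rule continuous_on_subset[OF cS]) (auto simp: cbox_Pair_eq)
    have cx: "continuous_on (cbox (0, 0) (H, \<tau>)) (\<lambda>w. F' (x, w))" for x
      by (rule continuous_on_compose2[OF cS]) (auto intro!: continuous_intros)
    have i1: "integral (cbox (0, 0) (H, \<tau>)) (\<lambda>w. F' (x, w))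
        = integral {0..H} (\<lambda>y. integral {0..\<tau>} (\<lambda>t. F' (x, y, t)))" for x
      using integral_prod_continuous[OF cx] by simp
    have i2: "integral {0..H} (\<lambda>y. integral {0..\<tau>} (\<lambda>t. F' (x, y, t)))
        = integral {0..\<tau>} (\<lambda>t. integral {0..H} (\<lambda>y. F' (x, y, t)))" for x
      using integral_swap_continuous[of 0 0 H \<tau> "\<lambda>y t. F' (x, y, t)"] cx[of x]
      by (simp add: case_prod_unfold)
    have "integral (slab (0, 0) (H, \<tau>)) F' = integral (cbox (-R, 0, 0) (R, H, \<tau>)) F'"
      using assms R R1 by (intro integral_unique bsupp_cont_has_integral_box)
        (auto simp: bsupp_cont_def abs_if)
    also have "\<dots> = integral {-R..R} (\<lambda>x. integral (cbox (0, 0) (H, \<tau>)) (\<lambda>w. F' (x, w)))"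
      using integral_prod_continuous[OF c] by simp
    finally show "integral (slab (0, 0) (H, \<tau>)) F' =
       integral {-R..R} (\<lambda>x. integral {0..H} (\<lambda>y. integral {0..\<tau>} (\<lambda>t. F' (x, y, t))))
      \<and> integral (slab (0, 0) (H, \<tau>)) F' =
       integral {-R..R} (\<lambda>x. integral {0..\<tau>} (\<lambda>t. integral {0..H} (\<lambda>y. F' (x, y, t))))"
      by (simp add: i1 i2)
  qed
qed

text \<open>Only the equality of \<open>F\<close> at y = 0 and y = H enters. Both boundary
  conditions provide it: Neumann because the two values vanish, periodicity because they
  agree.\<close>

lemma slab_integral_dy:
  fixes F F' :: "real \<times> real \<times> real \<Rightarrow> real"
  assumes F': "bsupp_cont (0, 0) (H, \<tau>) F'" and H: "H \<ge> 0"
    and d: "\<And>x y t. y \<in> {0..H} \<Longrightarrow> t \<in> {0..\<tau>} \<Longrightarrow>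
        ((\<lambda>r. F (x, r, t)) has_real_derivative F' (x, y, t)) (at y within {0..H})"
    and bc: "\<And>x t. t \<in> {0..\<tau>} \<Longrightarrow> F (x, 0, t) = F (x, H, t)"
  shows "integral (slab (0, 0) (H, \<tau>)) F' = 0"
proof -
  obtain R where R: "integral (slab (0, 0) (H, \<tau>)) F' =
      integral {-R..R} (\<lambda>x. integral {0..\<tau>} (\<lambda>t. integral {0..H} (\<lambda>y. F' (x, y, t))))"
    using box_integral_cong_inner[OF F'] by blast
  have "integral {0..H} (\<lambda>y. F' (x, y, t)) = 0" if t: "t \<in> {0..\<tau>}" for x t
  proof -
    have "((\<lambda>y. F' (x, y, t)) has_integral F (x, H, t) - F (x, 0, t)) {0..H}"
      using H d[OF _ t] by (intro fundamental_theorem_of_calculus)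
        (auto simp: has_real_derivative_iff_has_vector_derivative[symmetric])
    then show ?thesis using bc[OF t] by (simp add: integral_unique)
  qed
  then have "integral {0..\<tau>} (\<lambda>t. integral {0..H} (\<lambda>y. F' (x, y, t))) = 0" for x
    by (metis (mono_tags, lifting) integral_cong integral_0)
  then show ?thesis using R by simp
qed

lemma slab_integral_dt:
  fixes F F' :: "real \<times> real \<times> real \<Rightarrow> real"
  assumes F: "bsupp_cont (0, 0) (H, \<tau>) F" and F': "bsupp_cont (0, 0) (H, \<tau>) F'"
    and \<tau>: "\<tau> \<ge> 0"
    and d: "\<And>x y t. y \<in> {0..H} \<Longrightarrow> t \<in> {0..\<tau>} \<Longrightarrow>
        ((\<lambda>r. F (x, y, r)) has_real_derivative F' (x, y, t)) (at t within {0..\<tau>})"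
  shows "integral (slab (0, 0) (H, \<tau>)) F' =
     integral (slab 0 H) (\<lambda>(x, y). F (x, y, \<tau>)) - integral (slab 0 H) (\<lambda>(x, y). F (x, y, 0))"
proof -
  obtain R0 where R0: "\<And>x w. w \<in> cbox (0, 0) (H, \<tau>) \<Longrightarrow> R0 \<le> \<bar>x\<bar> \<Longrightarrow> F (x, w) = 0"
    using F unfolding bsupp_cont_def by blast
  obtain R1 where R1: "\<forall>R\<ge>R1. integral (slab (0, 0) (H, \<tau>)) F' =
      integral {-R..R} (\<lambda>x. integral {0..H} (\<lambda>y. integral {0..\<tau>} (\<lambda>t. F' (x, y, t))))"
    using box_integral_cong_inner[OF F'] by blast
  define R where "R = max R0 R1"
  have cF: "continuous_on (slab (0, 0) (H, \<tau>)) F" using F by (simp add: bsupp_cont_def)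
  have c: "continuous_on (slab 0 H) (\<lambda>(x, y). F (x, y, t))" if "t \<in> {0..\<tau>}" for t
    unfolding case_prod_unfold using that
    by (intro continuous_on_compose2[OF cF]) (auto intro!: continuous_intros)
  have c': "continuous_on (cbox (-R, 0) (R, H)) (\<lambda>(x, y). F (x, y, t))" if "t \<in> {0..\<tau>}" for t
    by (rule continuous_on_subset[OF c[OF that]]) (auto simp: cbox_Pair_eq)
  have bx: "integral (slab 0 H) (\<lambda>(x, y). F (x, y, t))
      = integral (cbox (-R, 0) (R, H)) (\<lambda>(x, y). F (x, y, t))" if "t \<in> {0..\<tau>}" for t
  proof (intro integral_unique bsupp_cont_has_integral_box c[OF that])
    fix x y assume y: "y \<in> cbox 0 H" and "x \<notin> {-R..R}"
    then have "R0 \<le> \<bar>x\<bar>" by (auto simp: R_def)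
    then show "(case (x, y) of (x, y) \<Rightarrow> F (x, y, t)) = 0"
      using R0[of "(y, t)" x] y that by simp
  qed
  have "integral {0..\<tau>} (\<lambda>t. F' (x, y, t)) = F (x, y, \<tau>) - F (x, y, 0)" if "y \<in> {0..H}" for x y
    using d[OF that] \<tau> by (intro integral_unique fundamental_theorem_of_calculus)
      (auto simp: has_real_derivative_iff_has_vector_derivative[symmetric])
  then have "integral {0..H} (\<lambda>y. integral {0..\<tau>} (\<lambda>t. F' (x, y, t)))
      = integral {0..H} (\<lambda>y. F (x, y, \<tau>) - F (x, y, 0))" for x
    by (intro integral_cong)
  then have "integral (slab (0, 0) (H, \<tau>)) F' =
      integral {-R..R} (\<lambda>x. integral {0..H} (\<lambda>y. F (x, y, \<tau>) - F (x, y, 0)))"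
    using R1 by (simp add: R_def)
  also have "\<dots> = integral (cbox (-R, 0) (R, H)) (\<lambda>(x, y). F (x, y, \<tau>) - F (x, y, 0))"
    using integral_prod_continuous[of "-R" 0 R H "\<lambda>(x, y). F (x, y, \<tau>) - F (x, y, 0)"]
      c'[of 0] c'[of \<tau>] \<tau>
    by (simp add: case_prod_unfold continuous_on_diff)
  also have "\<dots> = integral (cbox (-R, 0) (R, H)) (\<lambda>(x, y). F (x, y, \<tau>))
      - integral (cbox (-R, 0) (R, H)) (\<lambda>(x, y). F (x, y, 0))"
    using integral_diff[OF integrable_continuous[OF c'[of \<tau>]] integrable_continuous[OF c'[of 0]]] \<tau>
    by (simp add: case_prod_unfold)
  finally show ?thesis using bx[of 0] bx[of \<tau>] \<tau> by simp
qed

section \<open>A smooth step\<close>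

text \<open>Squaring the positive part removes its corner; the regularity of both
  \<open>step_d\<close> and \<open>bump\<close> comes from here.\<close>

lemma DERIV_max_0_square:
  "((\<lambda>w::real. (max 0 w)\<^sup>2) has_real_derivative 2 * max 0 w) (at w)"
proof (cases "w = 0")
  case True
  have "((\<lambda>h::real. ((max 0 (0 + h))\<^sup>2 - (max 0 0)\<^sup>2) / h) \<longlongrightarrow> 2 * max 0 0) (at 0)"
  proof -
    have "((\<lambda>h::real. max 0 h) \<longlongrightarrow> max 0 0) (at 0)"
      by (intro tendsto_intros)
    moreover have "((max 0 (0 + h))\<^sup>2 - (max 0 0)\<^sup>2) / h = max 0 h" for h :: real
      by (auto simp: max_def power2_eq_square)
    ultimately show ?thesis by simp
  qed
  then show ?thesis using True by (simp add: DERIV_def)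
next
  case False
  show ?thesis
  proof (cases "w > 0")
    case True
    have "((\<lambda>w. w\<^sup>2) has_real_derivative 2 * max 0 w) (at w)"
      using True by (auto intro!: derivative_eq_intros)
    moreover have "eventually (\<lambda>w. w\<^sup>2 = (max 0 w)\<^sup>2) (nhds w)"
      using eventually_nhds_in_open[of "{0<..}" w] True by (auto elim!: eventually_mono)
    ultimately show ?thesis by (rule DERIV_cong_ev[OF refl _ refl, THEN iffD1, rotated])
  next
    case F: False
    with False have w: "w < 0" by simp
    have "((\<lambda>w. 0) has_real_derivative 2 * max 0 w) (at w)"
      using w by simp
    moreover have "eventually (\<lambda>w. 0 = (max 0 w)\<^sup>2) (nhds w)"
      using eventually_nhds_in_open[of "{..<0}" w] w by (auto elim!: eventually_mono)
    ultimately show ?thesis by (rule DERIV_cong_ev[OF refl _ refl, THEN iffD1, rotated])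
  qed
qed

text \<open>The factor 30 normalises the integral of the squared parabola over [0, 1] to 1. The
  double zeros at 0 and 1 give a continuous derivative and the comparison
  \<open>step_mult_compl_le\<close>.\<close>

definition step_d :: "real \<Rightarrow> real" where
  "step_d r = 30 * (max 0 (r * (1 - r)))\<^sup>2"

definition step_dd :: "real \<Rightarrow> real" where
  "step_dd r = 60 * max 0 (r * (1 - r)) * (1 - 2 * r)"

text \<open>Starting at -1 keeps 0 in the interior of the interval of integration, so that the
  derivative in \<open>DERIV_step\<close> is two-sided at 0 as well. For r < -1 the interval is
  empty and the value is 0, as it should be.\<close>

definition step :: "real \<Rightarrow> real" where
  "step r = integral {-1..r} step_d"

lemma step_d_nonneg: "0 \<le> step_d r" by (simp add: step_d_def)

lemma step_d_zero: "r \<le> 0 \<or> 1 \<le> r \<Longrightarrow> step_d r = 0"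
  by (auto simp: step_d_def max_def zero_le_mult_iff)

lemma step_dd_zero: "r \<le> 0 \<or> 1 \<le> r \<Longrightarrow> step_dd r = 0"
  by (auto simp: step_dd_def max_def zero_le_mult_iff)

lemma continuous_step_d: "continuous_on A step_d"
  unfolding step_d_def by (intro continuous_intros)

lemma continuous_step_dd: "continuous_on A step_dd"
  unfolding step_dd_def by (intro continuous_intros)

lemma DERIV_step_d: "(step_d has_real_derivative step_dd r) (at r)"
proof -
  have "((\<lambda>r. r * (1 - r)) has_real_derivative 1 - 2 * r) (at r)"
    by (auto intro!: derivative_eq_intros)
  from DERIV_chain2[OF DERIV_max_0_square this]
  have "((\<lambda>r. (max 0 (r * (1 - r)))\<^sup>2) has_real_derivative
    2 * max 0 (r * (1 - r)) * (1 - 2 * r)) (at r)" .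
  from DERIV_cmult[OF this, of 30] show ?thesis
    by (simp add: step_d_def[abs_def] step_dd_def mult.assoc)
qed

lemma step_le_0: "r \<le> 0 \<Longrightarrow> step r = 0"
proof -
  assume "r \<le> 0"
  then have "integral {-1..r} step_d = integral {-1..r} (\<lambda>_. 0)"
    by (intro integral_cong step_d_zero) auto
  then show ?thesis by (simp add: step_def)
qed

lemma DERIV_step: "(step has_real_derivative step_d r) (at r)"
proof (cases "r < 0")
  case True
  have "((\<lambda>r. 0) has_real_derivative step_d r) (at r)"
    using True by (simp add: step_d_zero)
  moreover have "eventually (\<lambda>r. 0 = step r) (nhds r)"
    using eventually_nhds_in_open[of "{..<0}" r] True
    by (auto elim!: eventually_mono simp: step_le_0)
  ultimately show ?thesis by (rule DERIV_cong_ev[OF refl _ refl, THEN iffD1, rotated])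
next
  case False
  have "((\<lambda>x. integral {-1..x} step_d) has_real_derivative step_d r) (at r within {-1..r+1})"
    using False by (intro integral_has_real_derivative continuous_step_d) auto
  moreover have "at r within {-1..r+1} = at r"
    using False by (intro at_within_interior) auto
  ultimately show ?thesis by (simp add: step_def[abs_def])
qed

text \<open>Both sides have the same derivative on [0, 1] and agree at 0. The polynomial is the
  quintic smoothstep; its value at 1 shows that the total mass of \<open>step_d\<close> is
  1.\<close>

lemma step_poly: assumes "0 \<le> r" "r \<le> 1" shows "step r = r^3 * (10 - 15 * r + 6 * r\<^sup>2)"
proof -
  have "((\<lambda>r. step r - r^3 * (10 - 15 * r + 6 * r\<^sup>2)) has_real_derivative 0) (at x within {0..1})"
    if "x \<in> {0..1}" for x
  proof -
    have "max 0 (x * (1 - x)) = x * (1 - x)" using that by simp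
    then have "step_d x = 30 * (x * (1 - x))\<^sup>2" by (simp add: step_d_def)
    then have "((\<lambda>r. step r - r^3 * (10 - 15 * r + 6 * r\<^sup>2)) has_real_derivative 0) (at x)"
      by (auto intro!: derivative_eq_intros DERIV_step simp: field_simps eval_nat_numeral)
    then show ?thesis by (rule has_field_derivative_at_within)
  qed
  then have "\<exists>C. \<forall>x\<in>{0..1}. step x - x^3 * (10 - 15 * x + 6 * x\<^sup>2) = C"
    by (intro has_field_derivative_zero_constant) auto
  then obtain C where C: "\<And>x. x \<in> {0..1} \<Longrightarrow> step x - x^3 * (10 - 15 * x + 6 * x\<^sup>2) = C" by blast
  from C[of 0] have "C = 0" by (simp add: step_le_0)
  with C[of r] assms show ?thesis by simp
qed

lemma step_ge_1: "1 \<le> r \<Longrightarrow> step r = 1"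
proof -
  assume r: "1 \<le> r"
  have "step r - step 1 = 0"
  proof (cases "r = 1")
    case False
    have "((step_d) has_integral (step r - step 1)) {1..r}"
      using r DERIV_step by (intro fundamental_theorem_of_calculus)
        (auto simp: has_real_derivative_iff_has_vector_derivative[symmetric]
          intro: has_field_derivative_at_within)
    moreover have "(step_d has_integral 0) {1..r}"
      by (rule has_integral_is_0) (auto simp: step_d_zero)
    ultimately show ?thesis using has_integral_unique by blast
  qed simp
  then show ?thesis using step_poly[of 1] by simp
qed

lemma mono_step: "r \<le> r' \<Longrightarrow> step r \<le> step r'"
  by (rule DERIV_nonneg_imp_nondecreasing) (use DERIV_step step_d_nonneg in blast)+

lemma step_range: "0 \<le> step r" "step r \<le> 1"
  using mono_step[of "min r 0" r] step_le_0[of "min r 0"] mono_step[of r "max r 1"]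
    step_ge_1[of "max r 1"] by auto

text \<open>The exponents in \<open>step_d\<close> make \<open>step\<close> reach its limits slowly enough for this; it shows that
  a curve along which \<open>step_d\<close> is integrable can only accumulate where \<open>step\<close> is \<open>0\<close> or \<open>1\<close>.\<close>

lemma step_mult_compl_le: "step r * (1 - step r) \<le> 4 * step_d r"
proof (cases "0 \<le> r \<and> r \<le> 1")
  case True
  have m: "max 0 (r * (1 - r)) = r * (1 - r)" using True by simp
  \<comment> \<open>This is the symmetry 1 - step r = step (1 - r): one estimate near 0 then serves
    near 1 too.\<close>
  have "1 - step r = (1 - r)^3 * (10 - 15 * (1 - r) + 6 * (1 - r)\<^sup>2)"
    using step_poly True by (simp add: field_simps eval_nat_numeral)
  moreover have b: "r^3 * (10 - 15 * r + 6 * r\<^sup>2) \<le> 10 * r\<^sup>2" if "0 \<le> r" "r \<le> 1" for r :: real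
  proof -
    have "r\<^sup>2 \<le> r" using that by (simp add: power2_eq_square mult_left_le)
    then have "10 - 15 * r + 6 * r\<^sup>2 \<le> 10" using that by simp
    then have "r * (10 - 15 * r + 6 * r\<^sup>2) \<le> r * 10"
      using that by (intro mult_left_mono) auto
    then have "r * (10 - 15 * r + 6 * r\<^sup>2) \<le> 10" using that by simp
    then have "r\<^sup>2 * (r * (10 - 15 * r + 6 * r\<^sup>2)) \<le> r\<^sup>2 * 10"
      by (intro mult_left_mono) auto
    then show ?thesis by (simp add: power2_eq_square power3_eq_cube mult_ac)
  qed
  ultimately have "1 - step r \<le> 10 * (1 - r)\<^sup>2"
    using b[of "1 - r"] True by simp
  moreover have "step r \<le> 10 * r\<^sup>2" using b[of r] True step_poly by simp
  ultimately have "step r * (1 - step r) \<le> (10 * r\<^sup>2) * (10 * (1 - r)\<^sup>2)"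
    using step_range[of r] by (intro mult_mono) auto
  also have "\<dots> = 100 * (r * (1 - r))\<^sup>2" by (simp add: power_mult_distrib)
  \<comment> \<open>120 = 4 * 30, with the 30 of \<open>step_d\<close>.\<close>
  also have "\<dots> \<le> 120 * (r * (1 - r))\<^sup>2" by simp
  finally show ?thesis by (simp add: step_d_def m)
next
  case False
  then show ?thesis using step_le_0[of r] step_ge_1[of r] step_d_nonneg[of r] by auto
qed

section \<open>The weak form of the equation\<close>

text \<open>One time period of the wave, with all derivatives as named functions. The assumptions
  \<open>bc\<close> are a common form of both boundary conditions: Neumann supplies zeros,
  periodicity equal values. The limits of T are asked for along translates by multiples of
  \<open>p\<close> only, since such translates leave the second argument of a p-periodic profile
  unchanged. By \<open>c\<tau>\<close> and \<open>per_T\<close> the state at time \<tau> is a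
  translate of the initial one by a period of the flow.\<close>

locale front =
  fixes H \<tau> p c \<kappa> v :: real and m :: int
    and u1 u2 u1x u2y :: "real \<Rightarrow> real \<Rightarrow> real"
    and T Tt Tx Ty Txx Tyy :: "real \<Rightarrow> real \<Rightarrow> real \<Rightarrow> real"
    and f f' :: "real \<Rightarrow> real"
  assumes pos: "0 < H" "0 < \<tau>" "0 < p" "0 < \<kappa>" "0 < v"
    and c\<tau>: "c * \<tau> = of_int m * p"
    and cont_u: "continuous_on (slab 0 H) (\<lambda>z. u1 (fst z) (snd z))"
      "continuous_on (slab 0 H) (\<lambda>z. u2 (fst z) (snd z))"
      "continuous_on (slab 0 H) (\<lambda>z. u1x (fst z) (snd z))"
      "continuous_on (slab 0 H) (\<lambda>z. u2y (fst z) (snd z))"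
    and der_u: "\<And>x y. y \<in> {0..H} \<Longrightarrow> ((\<lambda>r. u1 r y) has_real_derivative u1x x y) (at x)"
      "\<And>x y. y \<in> {0..H} \<Longrightarrow> ((\<lambda>r. u2 x r) has_real_derivative u2y x y) (at y within {0..H})"
    and div_u: "\<And>x y. y \<in> {0..H} \<Longrightarrow> u1x x y + u2y x y = 0"
    and mean_u1: "\<And>x. integral {0..H} (u1 x) = 0"
    and per_u: "\<And>x y. y \<in> {0..H} \<Longrightarrow> u1 (x + p) y = u1 x y"
      "\<And>x y. y \<in> {0..H} \<Longrightarrow> u2 (x + p) y = u2 x y"
    and cont_T: "continuous_on (slab (0, 0) (H, \<tau>)) (\<lambda>z. T (fst z) (fst (snd z)) (snd (snd z)))"
      "continuous_on (slab (0, 0) (H, \<tau>)) (\<lambda>z. Tt (fst z) (fst (snd z)) (snd (snd z)))"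
      "continuous_on (slab (0, 0) (H, \<tau>)) (\<lambda>z. Tx (fst z) (fst (snd z)) (snd (snd z)))"
      "continuous_on (slab (0, 0) (H, \<tau>)) (\<lambda>z. Ty (fst z) (fst (snd z)) (snd (snd z)))"
      "continuous_on (slab (0, 0) (H, \<tau>)) (\<lambda>z. Txx (fst z) (fst (snd z)) (snd (snd z)))"
      "continuous_on (slab (0, 0) (H, \<tau>)) (\<lambda>z. Tyy (fst z) (fst (snd z)) (snd (snd z)))"
    and der_T: "\<And>x y t. y \<in> {0..H} \<Longrightarrow> t \<in> {0..\<tau>} \<Longrightarrow>
        ((\<lambda>r. T x y r) has_real_derivative Tt x y t) (at t within {0..\<tau>})"
      "\<And>x y t. y \<in> {0..H} \<Longrightarrow> t \<in> {0..\<tau>} \<Longrightarrow>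
        ((\<lambda>r. T r y t) has_real_derivative Tx x y t) (at x)"
      "\<And>x y t. y \<in> {0..H} \<Longrightarrow> t \<in> {0..\<tau>} \<Longrightarrow>
        ((\<lambda>r. Tx r y t) has_real_derivative Txx x y t) (at x)"
      "\<And>x y t. y \<in> {0..H} \<Longrightarrow> t \<in> {0..\<tau>} \<Longrightarrow>
        ((\<lambda>r. T x r t) has_real_derivative Ty x y t) (at y within {0..H})"
      "\<And>x y t. y \<in> {0..H} \<Longrightarrow> t \<in> {0..\<tau>} \<Longrightarrow>
        ((\<lambda>r. Ty x r t) has_real_derivative Tyy x y t) (at y within {0..H})"
    and pde: "\<And>x y t. y \<in> {0..H} \<Longrightarrow> t \<in> {0..\<tau>} \<Longrightarrow>
        Tt x y t + (u1 x y * Tx x y t + u2 x y * Ty x y t)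
          = \<kappa> * (Txx x y t + Tyy x y t) + v\<^sup>2 / \<kappa> * f (T x y t)"
    and range_T: "\<And>x y t. y \<in> {0..H} \<Longrightarrow> t \<in> {0..\<tau>} \<Longrightarrow> T x y t \<in> {0..1}"
    and bc: "\<And>x. u2 x 0 = u2 x H" "\<And>x t. t \<in> {0..\<tau>} \<Longrightarrow> Ty x 0 t = Ty x H t"
      "\<And>x t. t \<in> {0..\<tau>} \<Longrightarrow> (u2 x 0 = 0 \<and> Ty x 0 t = 0) \<or> T x 0 t = T x H t"
    and lim_T: "\<And>x y t. y \<in> {0..H} \<Longrightarrow> t \<in> {0..\<tau>} \<Longrightarrow> (\<lambda>k. T (x - real k * p) y t) \<longlonglongrightarrow> 1"
      "\<And>x y t. y \<in> {0..H} \<Longrightarrow> t \<in> {0..\<tau>} \<Longrightarrow> (\<lambda>k. T (x + real k * p) y t) \<longlonglongrightarrow> 0"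
    and per_T: "\<And>x y. y \<in> {0..H} \<Longrightarrow> T x y \<tau> = T (x - c * \<tau>) y 0"
    and f_der: "\<And>s. s \<in> {0..1} \<Longrightarrow> (f has_real_derivative f' s) (at s within {0..1})"
    and f'_cont: "continuous_on {0..1} f'"
    and f_nonneg: "\<And>s. s \<in> {0..1} \<Longrightarrow> 0 \<le> f s"
begin

abbreviation "Q \<equiv> slab (0::real, 0::real) (H, \<tau>)"

abbreviation Sint :: "(real \<Rightarrow> real \<Rightarrow> real \<Rightarrow> real) \<Rightarrow> real" where
  "Sint F \<equiv> integral Q (\<lambda>z. F (fst z) (fst (snd z)) (snd (snd z)))"

abbreviation tame :: "(real \<Rightarrow> real \<Rightarrow> real \<Rightarrow> real) \<Rightarrow> bool" where
  "tame F \<equiv> bsupp_cont (0::real, 0::real) (H, \<tau>) (\<lambda>z. F (fst z) (fst (snd z)) (snd (snd z)))"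

abbreviation ccont :: "(real \<Rightarrow> real \<Rightarrow> real \<Rightarrow> real) \<Rightarrow> bool" where
  "ccont F \<equiv> continuous_on Q (\<lambda>z. F (fst z) (fst (snd z)) (snd (snd z)))"

abbreviation ccont2 :: "(real \<Rightarrow> real \<Rightarrow> real) \<Rightarrow> bool" where
  "ccont2 F \<equiv> continuous_on (slab 0 H) (\<lambda>z. F (fst z) (snd z))"

lemma ccont_of_ccont2: "ccont2 F \<Longrightarrow> ccont (\<lambda>x y t. F x y)"
proof -
  assume "ccont2 F"
  then have "continuous_on Q (\<lambda>z. (\<lambda>z. F (fst z) (snd z)) (fst z, fst (snd z)))"
    by (rule continuous_on_compose2) (auto intro!: continuous_intros)
  then show ?thesis by simp
qed

lemma ccont_comp_T: "continuous_on {0..1} g \<Longrightarrow> ccont (\<lambda>x y t. g (T x y t))"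
  by (rule continuous_on_compose2[OF _ cont_T(1)]) (use range_T in auto)

lemma ccont_comp_s: "continuous_on UNIV g \<Longrightarrow> ccont (\<lambda>x y t. g (x - c * t))"
  by (rule continuous_on_compose2[of UNIV]) (auto intro!: continuous_intros)

text \<open>Cutoffs are supported in the moving variable x - ct, whereas \<open>bsupp_cont\<close>
  looks at x; over 0 \<le> t \<le> \<tau> the two differ by at most |c| \<tau>.\<close>

lemma tameI:
  assumes "ccont F" and "\<And>x y t. y \<in> {0..H} \<Longrightarrow> t \<in> {0..\<tau>} \<Longrightarrow> R \<le> \<bar>x - c * t\<bar> \<Longrightarrow> F x y t = 0"
  shows "tame F"
proof (rule bsupp_contI[where R = "R + \<bar>c\<bar> * \<tau>"])
  fix x :: real and w :: "real \<times> real"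
  assume w: "w \<in> cbox (0, 0) (H, \<tau>)" and x: "R + \<bar>c\<bar> * \<tau> \<le> \<bar>x\<bar>"
  obtain y t where wyt: "w = (y, t)" by (cases w)
  have t: "t \<in> {0..\<tau>}" "y \<in> {0..H}" using w by (auto simp: wyt)
  have "\<bar>c * t\<bar> \<le> \<bar>c\<bar> * \<tau>" using t by (auto simp: abs_mult intro!: mult_left_mono)
  then have "R \<le> \<bar>x - c * t\<bar>" using x by linarith
  then show "F (fst (x, w)) (fst (snd (x, w))) (snd (snd (x, w))) = 0"
    using assms(2) t by (simp add: wyt)
qed (use assms(1) in simp)

text \<open>Weights that commute with advection, because u . grad \<Psi> = 0. Only first derivatives
  are asked for: in the weak form the gradient of \<Psi> is paired with the gradient of T and never
  differentiated. Equality at y = 0 and y = H removes the boundary terms.\<close>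

definition admissible :: "(real \<Rightarrow> real \<Rightarrow> real) \<Rightarrow> (real \<Rightarrow> real \<Rightarrow> real) \<Rightarrow> (real \<Rightarrow> real \<Rightarrow> real) \<Rightarrow> bool" where
  "admissible \<Psi> \<Psi>x \<Psi>y \<longleftrightarrow> ccont2 \<Psi> \<and> ccont2 \<Psi>x \<and> ccont2 \<Psi>y
    \<and> (\<forall>x. \<forall>y\<in>{0..H}. ((\<lambda>r. \<Psi> r y) has_real_derivative \<Psi>x x y) (at x))
    \<and> (\<forall>x. \<forall>y\<in>{0..H}. ((\<lambda>r. \<Psi> x r) has_real_derivative \<Psi>y x y) (at y within {0..H}))
    \<and> (\<forall>x. \<Psi> x 0 = \<Psi> x H)
    \<and> (\<forall>x. \<forall>y\<in>{0..H}. u1 x y * \<Psi>x x y + u2 x y * \<Psi>y x y = 0)"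

text \<open>\<open>G\<close> is differentiable within [0, 1] only and T may take the values 0 and 1,
  so the outer derivative is restricted to the range of the inner function.\<close>

lemma chain_T:
  assumes "\<And>s. s \<in> {0..1} \<Longrightarrow> (G has_real_derivative g s) (at s within {0..1})"
    and "(h has_real_derivative d) (at r within S)" "h ` S \<subseteq> {0..1}" "r \<in> S"
  shows "((\<lambda>r. G (h r)) has_real_derivative g (h r) * d) (at r within S)"
proof -
  have "(G has_real_derivative g (h r)) (at (h r) within h ` S)"
    using assms has_field_derivative_subset by (metis image_subset_iff)
  from DERIV_image_chain[OF this assms(2)] show ?thesis by (simp add: o_def)
qed

text \<open>The equation times g(T) \<Psi> \<eta> is put in divergence form. The arrangement
  matters: derivatives of T occur only next to \<eta> itself, while \<eta>1 and \<eta>2, which live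
  far out, multiply G(T) alone. Hence no information on the gradient of T at infinity is ever
  required.\<close>

lemma weak_identity:
  assumes adm: "admissible \<Psi> \<Psi>x \<Psi>y"
    and G: "\<And>s. s \<in> {0..1} \<Longrightarrow> (G has_real_derivative g s) (at s within {0..1})"
      "\<And>s. s \<in> {0..1} \<Longrightarrow> (g has_real_derivative g' s) (at s within {0..1})"
      "continuous_on {0..1} g'"
    and \<eta>: "\<And>s. (\<eta> has_real_derivative \<eta>1 s) (at s)" "\<And>s. (\<eta>1 has_real_derivative \<eta>2 s) (at s)"
      "continuous_on UNIV \<eta>2" "\<And>s. R \<le> \<bar>s\<bar> \<Longrightarrow> \<eta> s = 0 \<and> \<eta>1 s = 0 \<and> \<eta>2 s = 0"
  shows "integral (slab 0 H) (\<lambda>(x, y). \<Psi> x y * \<eta> (x - c * \<tau>) * G (T x y \<tau>))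
       - integral (slab 0 H) (\<lambda>(x, y). \<Psi> x y * \<eta> x * G (T x y 0))
       + Sint (\<lambda>x y t. (\<eta>1 (x - c * t) * (c * \<Psi> x y - \<Psi> x y * u1 x y - \<kappa> * \<Psi>x x y)
           - \<kappa> * \<Psi> x y * \<eta>2 (x - c * t)) * G (T x y t))
     = Sint (\<lambda>x y t. \<eta> (x - c * t) *
          (v\<^sup>2 / \<kappa> * \<Psi> x y * f (T x y t) * g (T x y t)
           - \<kappa> * g (T x y t) * (\<Psi>x x y * Tx x y t + \<Psi>y x y * Ty x y t)
           - \<kappa> * \<Psi> x y * g' (T x y t) * ((Tx x y t)\<^sup>2 + (Ty x y t)\<^sup>2)))"
    (is "?B1 - ?B0 + Sint ?W = Sint ?R")
proof -
  have cG: "continuous_on {0..1} G" "continuous_on {0..1} g" "continuous_on {0..1} f"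
    using G f_der by (meson DERIV_continuous_on)+
  have c\<eta>: "continuous_on UNIV \<eta>" "continuous_on UNIV \<eta>1"
    using \<eta> by (meson DERIV_continuous_on has_field_derivative_at_within)+
  note cs = ccont_comp_s[OF c\<eta>(1)] ccont_comp_s[OF c\<eta>(2)] ccont_comp_s[OF \<eta>(3)]
    ccont_comp_T[OF cG(1)] ccont_comp_T[OF cG(2)] ccont_comp_T[OF G(3)] ccont_comp_T[OF cG(3)]
    cont_T cont_u[THEN ccont_of_ccont2]
  have c\<Psi>: "ccont (\<lambda>x y t. \<Psi> x y)" "ccont (\<lambda>x y t. \<Psi>x x y)" "ccont (\<lambda>x y t. \<Psi>y x y)"
    using adm by (auto simp: admissible_def intro: ccont_of_ccont2)
  have d\<Psi>x: "((\<lambda>r. \<Psi> r y) has_real_derivative \<Psi>x x y) (at x)"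
    and d\<Psi>y: "((\<lambda>r. \<Psi> x r) has_real_derivative \<Psi>y x y) (at y within {0..H})"
    and u\<Psi>: "u1 x y * \<Psi>x x y + u2 x y * \<Psi>y x y = 0" if "y \<in> {0..H}" for x y
    using adm that by (auto simp: admissible_def)
  define Ft where "Ft = (\<lambda>x y t. \<Psi> x y * \<eta> (x - c * t) * G (T x y t))"
  define Dt where "Dt = (\<lambda>x y t. \<Psi> x y * (\<eta>1 (x - c * t) * (- c)) * G (T x y t)
      + (g (T x y t) * Tt x y t) * (\<Psi> x y * \<eta> (x - c * t)))"
  \<comment> \<open>The last term moves the x-derivative in \<kappa> \<Psi> \<eta>1 g(T) Tx from T
    to the weight; it is responsible for the terms with \<eta>2 and \<Psi>x in the window
    integral.\<close>
  define Fx where "Fx = (\<lambda>x y t. \<Psi> x y * \<eta> (x - c * t) * (u1 x y * G (T x y t))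
      - \<kappa> * (\<Psi> x y * \<eta> (x - c * t) * (g (T x y t) * Tx x y t))
      + \<kappa> * (\<Psi> x y * \<eta>1 (x - c * t) * G (T x y t)))"
  define Dx where "Dx = (\<lambda>x y t.
      (\<Psi>x x y * \<eta> (x - c * t) + \<eta>1 (x - c * t) * \<Psi> x y) * (u1 x y * G (T x y t))
        + (u1x x y * G (T x y t) + g (T x y t) * Tx x y t * u1 x y) * (\<Psi> x y * \<eta> (x - c * t))
      - \<kappa> * ((\<Psi>x x y * \<eta> (x - c * t) + \<eta>1 (x - c * t) * \<Psi> x y) * (g (T x y t) * Tx x y t)
        + (g' (T x y t) * Tx x y t * Tx x y t + Txx x y t * g (T x y t)) * (\<Psi> x y * \<eta> (x - c * t)))
      + \<kappa> * ((\<Psi>x x y * \<eta>1 (x - c * t) + \<eta>2 (x - c * t) * \<Psi> x y) * G (T x y t)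
        + g (T x y t) * Tx x y t * (\<Psi> x y * \<eta>1 (x - c * t))))"
  define Fy where "Fy = (\<lambda>x y t. \<Psi> x y * \<eta> (x - c * t) * (u2 x y * G (T x y t))
      - \<kappa> * (\<Psi> x y * \<eta> (x - c * t) * (g (T x y t) * Ty x y t)))"
  define Dy where "Dy = (\<lambda>x y t.
      \<Psi>y x y * \<eta> (x - c * t) * (u2 x y * G (T x y t))
        + (u2y x y * G (T x y t) + g (T x y t) * Ty x y t * u2 x y) * (\<Psi> x y * \<eta> (x - c * t))
      - \<kappa> * (\<Psi>y x y * \<eta> (x - c * t) * (g (T x y t) * Ty x y t)
        + (g' (T x y t) * Ty x y t * Ty x y t + Tyy x y t * g (T x y t)) * (\<Psi> x y * \<eta> (x - c * t))))"
  have tm: "tame Ft" "tame Dt" "tame Fx" "tame Dx" "tame Dy" "tame ?W" "tame ?R"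
    unfolding Ft_def Dt_def Fx_def Dx_def Dy_def
    by (rule tameI[where R = R]; (intro continuous_intros cs c\<Psi>)?; simp add: \<eta>(4))+
  have d\<eta>x: "((\<lambda>r. \<eta> (r - c * t)) has_real_derivative \<eta>1 (x - c * t)) (at x)"
    "((\<lambda>r. \<eta>1 (r - c * t)) has_real_derivative \<eta>2 (x - c * t)) (at x)" for x t
  proof -
    have "((\<lambda>r. r - c * t) has_real_derivative 1) (at x)"
      by (auto intro!: derivative_eq_intros)
    then show "((\<lambda>r. \<eta> (r - c * t)) has_real_derivative \<eta>1 (x - c * t)) (at x)"
      "((\<lambda>r. \<eta>1 (r - c * t)) has_real_derivative \<eta>2 (x - c * t)) (at x)"
      using DERIV_chain2[OF \<eta>(1), of "\<lambda>r. r - c * t" 1 x UNIV]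
        DERIV_chain2[OF \<eta>(2), of "\<lambda>r. r - c * t" 1 x UNIV] by simp_all
  qed
  have d\<eta>t: "((\<lambda>r. \<eta> (x - c * r)) has_real_derivative \<eta>1 (x - c * t) * (- c)) (at t within {0..\<tau>})" for x t
    by (rule DERIV_chain2[OF \<eta>(1)]) (auto intro!: derivative_eq_intros)
  have It: "Sint Dt = ?B1 - ?B0"
  proof -
    have "Sint Dt = integral (slab 0 H) (\<lambda>(x, y). (\<lambda>z. Ft (fst z) (fst (snd z)) (snd (snd z))) (x, y, \<tau>))
        - integral (slab 0 H) (\<lambda>(x, y). (\<lambda>z. Ft (fst z) (fst (snd z)) (snd (snd z))) (x, y, 0))"
    proof (rule slab_integral_dt[OF tm(1,2)])
      show "0 \<le> \<tau>" using pos by simp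
      fix x y t assume yt: "y \<in> {0..H}" "t \<in> {0..\<tau>}"
      have "((\<lambda>r. G (T x y r)) has_real_derivative g (T x y t) * Tt x y t) (at t within {0..\<tau>})"
        using yt range_T by (intro chain_T[OF G(1)] der_T) auto
      then have "((\<lambda>r. Ft x y r) has_real_derivative Dt x y t) (at t within {0..\<tau>})"
        unfolding Ft_def Dt_def by (auto intro!: derivative_eq_intros d\<eta>t)
      then show "((\<lambda>r. Ft (fst (x, y, r)) (fst (snd (x, y, r))) (snd (snd (x, y, r)))) has_real_derivative
          Dt (fst (x, y, t)) (fst (snd (x, y, t))) (snd (snd (x, y, t)))) (at t within {0..\<tau>})" by simp
    qed
    then show ?thesis by (simp add: Ft_def)
  qed
  have Ix: "Sint Dx = 0"
  proof (rule slab_integral_dx[OF tm(3,4)])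
    fix x :: real and w :: "real \<times> real"
    assume w: "w \<in> cbox (0, 0) (H, \<tau>)"
    obtain y t where wyt: "w = (y, t)" by (cases w)
    have yt: "y \<in> {0..H}" "t \<in> {0..\<tau>}" using w by (auto simp: wyt)
    have GT: "((\<lambda>r. G (T r y t)) has_real_derivative g (T x y t) * Tx x y t) (at x)"
      using yt range_T by (intro chain_T[OF G(1)] der_T) auto
    have gT: "((\<lambda>r. g (T r y t)) has_real_derivative g' (T x y t) * Tx x y t) (at x)"
      using yt range_T by (intro chain_T[OF G(2)] der_T) auto
    have p1: "((\<lambda>r. \<Psi> r y * \<eta> (r - c * t)) has_real_derivative
        \<Psi>x x y * \<eta> (x - c * t) + \<eta>1 (x - c * t) * \<Psi> x y) (at x)"
      by (rule DERIV_mult[OF d\<Psi>x[OF yt(1)] d\<eta>x(1)])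
    have p2: "((\<lambda>r. \<Psi> r y * \<eta>1 (r - c * t)) has_real_derivative
        \<Psi>x x y * \<eta>1 (x - c * t) + \<eta>2 (x - c * t) * \<Psi> x y) (at x)"
      by (rule DERIV_mult[OF d\<Psi>x[OF yt(1)] d\<eta>x(2)])
    have "((\<lambda>r. Fx r y t) has_real_derivative Dx x y t) (at x)"
      unfolding Fx_def Dx_def
      by (intro DERIV_add DERIV_diff DERIV_cmult
          DERIV_mult[OF p1 DERIV_mult[OF der_u(1)[OF yt(1)] GT]]
          DERIV_mult[OF p1 DERIV_mult[OF gT der_T(3)[OF yt]]]
          DERIV_mult[OF p2 GT])
    then show "((\<lambda>r. Fx (fst (r, w)) (fst (snd (r, w))) (snd (snd (r, w)))) has_real_derivative
          Dx (fst (x, w)) (fst (snd (x, w))) (snd (snd (x, w)))) (at x)" by (simp add: wyt)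
  qed
  have Iy: "Sint Dy = 0"
  proof (rule slab_integral_dy[OF tm(5), where F = "\<lambda>z. Fy (fst z) (fst (snd z)) (snd (snd z))"])
    show "0 \<le> H" using pos by simp
    fix x t assume t: "t \<in> {0..\<tau>}"
    have "\<Psi> x 0 = \<Psi> x H" using adm by (simp add: admissible_def)
    then show "Fy (fst (x, 0, t)) (fst (snd (x, 0, t))) (snd (snd (x, 0, t)))
        = Fy (fst (x, H, t)) (fst (snd (x, H, t))) (snd (snd (x, H, t)))"
      using bc(1)[of x] bc(2,3)[OF t, of x] by (auto simp: Fy_def)
  next
    fix x y t assume yt: "y \<in> {0..H}" "t \<in> {0..\<tau>}"
    have GT: "((\<lambda>r. G (T x r t)) has_real_derivative g (T x y t) * Ty x y t) (at y within {0..H})"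
      using yt range_T by (intro chain_T[OF G(1)] der_T) auto
    have gT: "((\<lambda>r. g (T x r t)) has_real_derivative g' (T x y t) * Ty x y t) (at y within {0..H})"
      using yt range_T by (intro chain_T[OF G(2)] der_T) auto
    have p1: "((\<lambda>r. \<Psi> x r * \<eta> (x - c * t)) has_real_derivative
        \<Psi>y x y * \<eta> (x - c * t)) (at y within {0..H})"
      by (rule DERIV_cmult_right[OF d\<Psi>y[OF yt(1)]])
    have "((\<lambda>r. Fy x r t) has_real_derivative Dy x y t) (at y within {0..H})"
      unfolding Fy_def Dy_def
      by (intro DERIV_add DERIV_diff DERIV_cmult
          DERIV_mult[OF p1 DERIV_mult[OF der_u(2)[OF yt(1)] GT]]
          DERIV_mult[OF p1 DERIV_mult[OF gT der_T(5)[OF yt]]])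
    then show "((\<lambda>r. Fy (fst (x, r, t)) (fst (snd (x, r, t))) (snd (snd (x, r, t)))) has_real_derivative
          Dy (fst (x, y, t)) (fst (snd (x, y, t))) (snd (snd (x, y, t)))) (at y within {0..H})" by simp
  qed
  have pw: "Dt x y t + (Dx x y t + Dy x y t) + ?W x y t = ?R x y t"
    if yt: "y \<in> {0..H}" "t \<in> {0..\<tau>}" for x y t
  proof -
    \<comment> \<open>The difference is a combination of three quantities that vanish: the equation,
      u . grad \<Psi> and div u.\<close>
    have a: "Dt x y t + (Dx x y t + Dy x y t) + ?W x y t - ?R x y t =
        \<Psi> x y * \<eta> (x - c * t) * g (T x y t) *
          (Tt x y t + (u1 x y * Tx x y t + u2 x y * Ty x y t)
          - \<kappa> * (Txx x y t + Tyy x y t) - v\<^sup>2 / \<kappa> * f (T x y t))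
        + \<eta> (x - c * t) * G (T x y t) * (u1 x y * \<Psi>x x y + u2 x y * \<Psi>y x y)
        + \<eta> (x - c * t) * G (T x y t) * \<Psi> x y * (u1x x y + u2y x y)"
      unfolding Dt_def Dx_def Dy_def by (simp add: algebra_simps power2_eq_square)
    then show ?thesis using pde[OF yt, of x] u\<Psi>[OF yt(1), of x] div_u[OF yt(1), of x] by simp
  qed
  have int: "(\<lambda>z. F (fst z) (fst (snd z)) (snd (snd z))) integrable_on Q" if "tame F" for F
    using that bsupp_cont_integrable by blast
  have "Sint ?R = Sint (\<lambda>x y t. Dt x y t + (Dx x y t + Dy x y t) + ?W x y t)"
    using pw by (intro integral_cong) auto
  also have "\<dots> = Sint Dt + (Sint Dx + Sint Dy) + Sint ?W"
    using integral_add[OF integrable_add[OF int[OF tm(2)] integrable_add[OF int[OF tm(4)] int[OF tm(5)]]] int[OF tm(6)]]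
      integral_add[OF int[OF tm(2)] integrable_add[OF int[OF tm(4)] int[OF tm(5)]]]
      integral_add[OF int[OF tm(4)] int[OF tm(5)]] by simp
  finally show ?thesis using It Ix Iy by simp
qed

end

context front
begin

section \<open>Cutoffs in the moving frame\<close>

text \<open>A window of unit mass in \<open>s\<close>, supported in [0, p].\<close>

definition wt :: "real \<Rightarrow> real" where "wt s = step_d (s / p) / p"

definition wt1 :: "real \<Rightarrow> real" where "wt1 s = step_dd (s / p) / p\<^sup>2"

text \<open>Its ramps lie on [-kp, (1 - k) p] and [kp, (k + 1) p] and keep the width p for every k.
  The ramp terms are thus not made small by stretching; they are evaluated exactly, because the two
  ramps are translates of one window by multiples of the period, to which \<open>lim_T\<close>
  applies.\<close>

definition cut :: "nat \<Rightarrow> real \<Rightarrow> real" where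
  "cut k s = step (s / p + real k) - step (s / p - real k)"

definition cut1 :: "nat \<Rightarrow> real \<Rightarrow> real" where
  "cut1 k s = wt (s + real k * p) - wt (s - real k * p)"

definition cut2 :: "nat \<Rightarrow> real \<Rightarrow> real" where
  "cut2 k s = wt1 (s + real k * p) - wt1 (s - real k * p)"

lemma wt_nonneg: "0 \<le> wt s" using pos step_d_nonneg by (simp add: wt_def)

lemma wt_zero: "s \<le> 0 \<or> p \<le> s \<Longrightarrow> wt s = 0" "s \<le> 0 \<or> p \<le> s \<Longrightarrow> wt1 s = 0"
  using pos step_d_zero[of "s / p"] step_dd_zero[of "s / p"]
  by (auto simp: wt_def wt1_def divide_le_0_iff)

lemma cont_wt: "continuous_on A wt" "continuous_on A wt1"
proof -
  have "p \<noteq> 0" using pos by simp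
  then show "continuous_on A wt" "continuous_on A wt1"
    unfolding wt_def wt1_def
    by (auto intro!: continuous_intros continuous_on_compose2[OF continuous_step_d[of UNIV]]
        continuous_on_compose2[OF continuous_step_dd[of UNIV]])
qed

lemma DERIV_wt: "(wt has_real_derivative wt1 s) (at s)"
proof -
  have "((\<lambda>s. s / p) has_real_derivative 1 / p) (at s)"
    using DERIV_cdivide[OF DERIV_ident] .
  from DERIV_cdivide[OF DERIV_chain2[OF DERIV_step_d this], of p]
  show ?thesis by (simp add: wt_def[abs_def] wt1_def power2_eq_square)
qed

lemma DERIV_step_scaled: "((\<lambda>s. step (s / p + q)) has_real_derivative wt (s + q * p)) (at s)"
proof -
  have "((\<lambda>s. s / p + q) has_real_derivative 1 / p) (at s)"
    using DERIV_add[OF DERIV_cdivide[OF DERIV_ident] DERIV_const] by simp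
  from DERIV_chain2[OF DERIV_step this] show ?thesis
    using pos by (simp add: wt_def add_divide_distrib)
qed

lemma DERIV_cut: "(cut k has_real_derivative cut1 k s) (at s)"
  using DERIV_diff[OF DERIV_step_scaled[of "real k"] DERIV_step_scaled[of "- real k"]]
  by (simp add: cut_def[abs_def] cut1_def)

lemma DERIV_cut1: "(cut1 k has_real_derivative cut2 k s) (at s)"
proof -
  have "((\<lambda>s. wt (s + q)) has_real_derivative wt1 (s + q)) (at s)" for q
    using DERIV_chain2[OF DERIV_wt DERIV_add[OF DERIV_ident DERIV_const]] by simp
  from DERIV_diff[OF this[of "real k * p"] this[of "- (real k * p)"]]
  show ?thesis by (simp add: cut1_def[abs_def] cut2_def)
qed

lemma cont_cut2: "continuous_on UNIV (cut2 k)"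
  unfolding cut2_def
  by (intro continuous_intros continuous_on_compose2[OF cont_wt(2)[of UNIV]]) auto

lemma cont_cut: "continuous_on UNIV (cut k)" "continuous_on UNIV (cut1 k)"
  by (meson DERIV_cut DERIV_cut1 DERIV_continuous_on has_field_derivative_at_within)+

lemma cut_range: "0 \<le> cut k s" "cut k s \<le> 1"
  using mono_step[of "s / p - real k" "s / p + real k"] step_range[of "s / p + real k"]
    step_range[of "s / p - real k"] by (auto simp: cut_def)

lemma cut_supp: "(real k + 1) * p \<le> \<bar>s\<bar> \<Longrightarrow> cut k s = 0 \<and> cut1 k s = 0 \<and> cut2 k s = 0"
proof -
  assume a: "(real k + 1) * p \<le> \<bar>s\<bar>"
  have kp: "0 \<le> real k * p" using pos by simp
  consider "(real k + 1) * p \<le> s" | "(real k + 1) * p \<le> - s" using a by linarith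
  then show ?thesis
  proof cases
    case 1
    then have "1 \<le> s / p - real k" using pos by (simp add: field_simps)
    then have "cut k s = 0" using step_ge_1[of "s / p - real k"] step_ge_1[of "s / p + real k"]
      by (simp add: cut_def)
    moreover have "p \<le> s - real k * p" "p \<le> s + real k * p" using 1 kp by (auto simp: algebra_simps)
    ultimately show ?thesis using wt_zero by (simp add: cut1_def cut2_def)
  next
    case 2
    then have sp: "s + p \<le> - (real k * p)" by (simp add: algebra_simps)
    then have "(s + p) / p \<le> - (real k * p) / p" using pos by (intro divide_right_mono) auto
    then have "s / p + real k \<le> 0" using pos by (simp add: add_divide_distrib)
    then have "cut k s = 0" using step_le_0[of "s / p - real k"] step_le_0[of "s / p + real k"]
      by (simp add: cut_def)
    moreover have "s - real k * p \<le> 0" "s + real k * p \<le> 0" using sp kp pos by linarith+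
    ultimately show ?thesis using wt_zero by (simp add: cut1_def cut2_def)
  qed
qed

lemma ccont_wt: "ccont (\<lambda>x y t. wt (x - c * t + q))" "ccont (\<lambda>x y t. wt1 (x - c * t + q))"
  by (rule continuous_on_compose2[OF cont_wt(1)[of UNIV]] continuous_on_compose2[OF cont_wt(2)[of UNIV]];
      auto intro!: continuous_intros)+

lemma tame_wt: "ccont F \<Longrightarrow> tame (\<lambda>x y t. wt (x - c * t + q) * F x y t)"
    "ccont F \<Longrightarrow> tame (\<lambda>x y t. wt1 (x - c * t + q) * F x y t)"
    "ccont F \<Longrightarrow> tame (\<lambda>x y t. (wt (x - c * t + q) + \<bar>wt1 (x - c * t + q)\<bar>) * F x y t)"
proof -
  have z: "wt (s + q) = 0 \<and> wt1 (s + q) = 0" if "p + \<bar>q\<bar> \<le> \<bar>s\<bar>" for s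
  proof -
    have "s + q \<le> 0 \<or> p \<le> s + q" using that by linarith
    then show ?thesis using wt_zero by blast
  qed
  assume F: "ccont F"
  show "tame (\<lambda>x y t. wt (x - c * t + q) * F x y t)"
    by (rule tameI[where R = "p + \<bar>q\<bar>"]) (intro continuous_intros ccont_wt F, simp add: z)
  show "tame (\<lambda>x y t. wt1 (x - c * t + q) * F x y t)"
    by (rule tameI[where R = "p + \<bar>q\<bar>"]) (intro continuous_intros ccont_wt F, simp add: z)
  show "tame (\<lambda>x y t. (wt (x - c * t + q) + \<bar>wt1 (x - c * t + q)\<bar>) * F x y t)"
    by (rule tameI[where R = "p + \<bar>q\<bar>"]) (intro continuous_intros ccont_wt F, simp add: z)
qed

lemma tame_cut: "ccont F \<Longrightarrow> tame (\<lambda>x y t. cut k (x - c * t) * F x y t)"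
    "ccont F \<Longrightarrow> tame (\<lambda>x y t. cut1 k (x - c * t) * F x y t)"
proof -
  assume F: "ccont F"
  show "tame (\<lambda>x y t. cut k (x - c * t) * F x y t)"
    by (rule tameI[where R = "(real k + 1) * p"])
      (intro continuous_intros ccont_comp_s cont_cut F, simp add: cut_supp)
  show "tame (\<lambda>x y t. cut1 k (x - c * t) * F x y t)"
    by (rule tameI[where R = "(real k + 1) * p"])
      (intro continuous_intros ccont_comp_s cont_cut F, simp add: cut_supp)
qed

lemma tame_int: "tame F \<Longrightarrow> (\<lambda>z. F (fst z) (fst (snd z)) (snd (snd z))) integrable_on Q"
  by (rule bsupp_cont_integrable)

lemma Sint_add: "tame F \<Longrightarrow> tame G \<Longrightarrow> Sint (\<lambda>x y t. F x y t + G x y t) = Sint F + Sint G"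
  by (rule integral_add[OF tame_int tame_int])

lemma Sint_diff: "tame F \<Longrightarrow> tame G \<Longrightarrow> Sint (\<lambda>x y t. F x y t - G x y t) = Sint F - Sint G"
  by (rule integral_diff[OF tame_int tame_int])

lemma Sint_cmult: "Sint (\<lambda>x y t. r * F x y t) = r * Sint F"
  by (rule integral_mult_right)

lemma Sint_mono: "tame F \<Longrightarrow> tame G \<Longrightarrow> (\<And>x y t. y \<in> {0..H} \<Longrightarrow> t \<in> {0..\<tau>} \<Longrightarrow> F x y t \<le> G x y t)
   \<Longrightarrow> Sint F \<le> Sint G"
  by (rule integral_le[OF tame_int tame_int]) auto

lemma Sint_cong: "(\<And>x y t. y \<in> {0..H} \<Longrightarrow> t \<in> {0..\<tau>} \<Longrightarrow> F x y t = G x y t) \<Longrightarrow> Sint F = Sint G"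
  by (rule integral_cong) auto

lemma Sint_abs_le: "tame F \<Longrightarrow> tame G \<Longrightarrow> (\<And>x y t. y \<in> {0..H} \<Longrightarrow> t \<in> {0..\<tau>} \<Longrightarrow> \<bar>F x y t\<bar> \<le> G x y t)
   \<Longrightarrow> \<bar>Sint F\<bar> \<le> Sint G"
  using integral_norm_bound_integral[OF tame_int tame_int, of F G] by auto

lemma Sint_shift: "tame F \<Longrightarrow> Sint (\<lambda>x y t. F (x + q) y t) = Sint F"
  using bsupp_cont_shift(2)[of "(0, 0)" "(H, \<tau>)" "\<lambda>z. F (fst z) (fst (snd z)) (snd (snd z))" q]
  by (simp add: case_prod_unfold)

lemma Sint_wt: "Sint (\<lambda>x y t. wt (x - c * t + q)) = H * \<tau>"
proof -
  have "tame (\<lambda>x y t. wt (x - c * t + q) * 1)" by (rule tame_wt) (rule continuous_on_const)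
  then have "tame (\<lambda>x y t. wt (x - c * t + q))" by simp
  from slab_integral_fubini[OF this] obtain R0 where R0: "\<forall>R\<ge>R0. Sint (\<lambda>x y t. wt (x - c * t + q)) =
      integral (cbox (0, 0) (H, \<tau>)) (\<lambda>w. integral {-R..R} (\<lambda>x. wt (x - c * snd w + q)))"
    by auto
  define R where "R = max R0 (\<bar>c\<bar> * \<tau> + \<bar>q\<bar> + p)"
  have "integral {-R..R} (\<lambda>x. wt (x - c * snd w + q)) = 1" if w: "w \<in> cbox (0, 0) (H, \<tau>)" for w
  proof -
    obtain y t where wyt: "w = (y, t)" by (cases w)
    have t: "0 \<le> t" "t \<le> \<tau>" using w by (auto simp: wyt)
    have ct: "\<bar>c * t\<bar> \<le> \<bar>c\<bar> * \<tau>" using t by (auto simp: abs_mult intro!: mult_left_mono)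
    \<comment> \<open>The shift is measured in units of p so that \<open>DERIV_step_scaled\<close>
      supplies a primitive.\<close>
    define r where "r = (q - c * t) / p"
    have rp: "r * p = q - c * t" using pos by (simp add: r_def)
    have R: "R \<ge> \<bar>c\<bar> * \<tau> + \<bar>q\<bar> + p" by (simp add: R_def)
    have "0 \<le> \<bar>c\<bar> * \<tau>" using pos by simp
    then have "0 \<le> R" using R pos by linarith
    then have "((\<lambda>x. wt (x + r * p)) has_integral step (R / p + r) - step (- R / p + r)) {-R..R}"
      using DERIV_step_scaled[of r] by (intro fundamental_theorem_of_calculus)
        (auto simp: has_real_derivative_iff_has_vector_derivative[symmetric]
          intro: has_field_derivative_at_within)
    moreover have "step (R / p + r) = 1"
    proof (rule step_ge_1)
      have "p \<le> R + r * p" using R ct unfolding rp by linarith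
      then have "p / p \<le> (R + r * p) / p" using pos by (intro divide_right_mono) auto
      then show "1 \<le> R / p + r" using pos by (simp add: add_divide_distrib)
    qed
    moreover have "step (- R / p + r) = 0"
    proof (rule step_le_0)
      have "- R + r * p \<le> 0" using R ct pos unfolding rp by linarith
      then have "(- R + r * p) / p \<le> 0" using pos by (intro divide_nonpos_pos) auto
      moreover have "(- R + r * p) / p = - R / p + r" using pos by (simp add: field_simps)
      ultimately show "- R / p + r \<le> 0" by simp
    qed
    ultimately have "((\<lambda>x. wt (x + r * p)) has_integral 1) {-R..R}" by simp
    moreover have "wt (x + r * p) = wt (x - c * snd w + q)" for x
      by (rule arg_cong[where f = wt]) (simp add: wyt rp)
    ultimately show ?thesis by (simp add: integral_unique)
  qed
  then have "integral (cbox (0, 0) (H, \<tau>)) (\<lambda>w. integral {-R..R} (\<lambda>x. wt (x - c * snd w + q)))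
      = integral (cbox (0, 0) (H, \<tau>)) (\<lambda>w::real\<times>real. 1::real)"
    by (rule integral_cong)
  also have "\<dots> = H * \<tau>" using pos by (simp add: content_Pair)
  finally show ?thesis using R0[rule_format, of R] by (simp add: R_def)
qed

lemma Sint_wt_flux:
  assumes \<Psi>: "ccont2 \<Psi>" and F: "\<And>x. integral {0..H} (\<Psi> x) = F"
  shows "Sint (\<lambda>x y t. wt (x - c * t + q) * \<Psi> x y) = \<tau> * F"
proof -
  have 1: "tame (\<lambda>x y t. wt (x - c * t + q) * \<Psi> x y)"
    by (rule tame_wt[OF ccont_of_ccont2[OF \<Psi>]])
  have 2: "tame (\<lambda>x y t. wt (x - c * t + q) * 1)" by (rule tame_wt) (rule continuous_on_const)
  obtain R1 where R1: "\<forall>R\<ge>R1. Sint (\<lambda>x y t. wt (x - c * t + q) * \<Psi> x y) =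
      integral {-R..R} (\<lambda>x. integral {0..\<tau>} (\<lambda>t. integral {0..H} (\<lambda>y. wt (x - c * t + q) * \<Psi> x y)))"
    using box_integral_cong_inner[OF 1] by auto
  obtain R2 where R2: "\<forall>R\<ge>R2. Sint (\<lambda>x y t. wt (x - c * t + q) * 1) =
      integral {-R..R} (\<lambda>x. integral {0..\<tau>} (\<lambda>t. integral {0..H} (\<lambda>y. wt (x - c * t + q) * 1)))"
    using box_integral_cong_inner[OF 2] by auto
  define R where "R = max R1 R2"
  \<comment> \<open>After multiplication by H the integral is compared with F times the mass of the
    window: once the y-integral is carried out both are the same iterated integral, and
    \<open>Sint_wt\<close> gives its value.\<close>
  have "H * Sint (\<lambda>x y t. wt (x - c * t + q) * \<Psi> x y)
     = H * integral {-R..R} (\<lambda>x. integral {0..\<tau>} (\<lambda>t. wt (x - c * t + q) * F))"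
    using R1 F by (simp add: R_def)
  also have "\<dots> = F * integral {-R..R} (\<lambda>x. integral {0..\<tau>} (\<lambda>t. wt (x - c * t + q) * H))"
    by simp
  also have "\<dots> = F * Sint (\<lambda>x y t. wt (x - c * t + q) * 1)"
  proof -
    have "\<forall>R\<ge>R2. Sint (\<lambda>x y t. wt (x - c * t + q) * 1) =
      integral {-R..R} (\<lambda>x. integral {0..\<tau>} (\<lambda>t. wt (x - c * t + q) * H))"
      using R2 pos by (simp add: mult.commute[of H])
    from this[rule_format, of R] show ?thesis by (simp add: R_def)
  qed
  also have "\<dots> = H * (\<tau> * F)" by (simp add: Sint_wt)
  finally show ?thesis using pos by simp
qed

text \<open>The window stays fixed and T is translated, so that dominated convergence applies with
  the majorant \<open>2 * M\<close> times the window, whose support does not depend on k. The limit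
  point \<open>l\<close> is 1 on the left and 0 on the right. The second derivative of the cutoff is
  covered by \<open>wt1\<close>.\<close>

lemma window_limit:
  assumes G: "continuous_on {0..1} G" and lim: "\<And>x y t. y \<in> {0..H} \<Longrightarrow> t \<in> {0..\<tau>} \<Longrightarrow>
      (\<lambda>k. T (x + \<sigma> k) y t) \<longlonglongrightarrow> l" and l: "l \<in> {0..1}"
  shows "(\<lambda>k. Sint (\<lambda>x y t. (wt (x - c * t) + \<bar>wt1 (x - c * t)\<bar>) * \<bar>G (T (x + \<sigma> k) y t) - G l\<bar>)) \<longlonglongrightarrow> 0"
proof -
  obtain M where M: "\<And>s. s \<in> {0..1} \<Longrightarrow> \<bar>G s\<bar> \<le> M"
    using compact_imp_bounded[OF compact_continuous_image[OF G compact_Icc]]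
    unfolding bounded_iff by force
  have cT: "ccont (\<lambda>x y t. G (T (x + q) y t))" for q
    by (rule continuous_on_compose2[OF ccont_comp_T[OF G], of Q "\<lambda>z. (fst z + q, snd z)", simplified])
      (auto intro!: continuous_intros)
  have t1: "tame (\<lambda>x y t. (wt (x - c * t) + \<bar>wt1 (x - c * t)\<bar>) * \<bar>G (T (x + \<sigma> k) y t) - G l\<bar>)" for k
    using tame_wt(3)[of "\<lambda>x y t. \<bar>G (T (x + \<sigma> k) y t) - G l\<bar>" 0]
      continuous_on_rabs[OF continuous_on_diff[OF cT[of "\<sigma> k"] continuous_on_const[of Q "G l"]]]
    by simp
  have t2: "tame (\<lambda>x y t. (wt (x - c * t) + \<bar>wt1 (x - c * t)\<bar>) * (2 * M))"
    using tame_wt(3)[of "\<lambda>x y t. 2 * M" 0] by auto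
  have "(\<lambda>k. Sint (\<lambda>x y t. (wt (x - c * t) + \<bar>wt1 (x - c * t)\<bar>) * \<bar>G (T (x + \<sigma> k) y t) - G l\<bar>))
      \<longlonglongrightarrow> Sint (\<lambda>x y t. 0)"
  proof (rule dominated_convergence(2)[OF tame_int[OF t1] tame_int[OF t2]])
    fix k and z :: "real \<times> real \<times> real" assume z: "z \<in> Q"
    obtain x y t where xyt: "z = (x, y, t)" by (cases z)
    have yt: "y \<in> {0..H}" "t \<in> {0..\<tau>}" using z by (auto simp: xyt)
    have "\<bar>G (T (x + \<sigma> k) y t) - G l\<bar> \<le> 2 * M"
      using M[OF range_T[OF yt, of "x + \<sigma> k"]] M[OF l] by linarith
    then show "norm ((wt (fst z - c * snd (snd z)) + \<bar>wt1 (fst z - c * snd (snd z))\<bar>) *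
        \<bar>G (T (fst z + \<sigma> k) (fst (snd z)) (snd (snd z))) - G l\<bar>)
       \<le> (wt (fst z - c * snd (snd z)) + \<bar>wt1 (fst z - c * snd (snd z))\<bar>) * (2 * M)"
      using wt_nonneg[of "x - c * t"] by (auto simp: xyt abs_mult intro!: mult_left_mono)
  next
    fix z :: "real \<times> real \<times> real" assume z: "z \<in> Q"
    obtain x y t where xyt: "z = (x, y, t)" by (cases z)
    have yt: "y \<in> {0..H}" "t \<in> {0..\<tau>}" using z by (auto simp: xyt)
    have "(\<lambda>k. G (T (x + \<sigma> k) y t)) \<longlonglongrightarrow> G l"
      by (rule continuous_on_tendsto_compose[OF G lim[OF yt] l]) (use range_T[OF yt] in auto)
    then have "(\<lambda>k. (wt (x - c * t) + \<bar>wt1 (x - c * t)\<bar>) * \<bar>G (T (x + \<sigma> k) y t) - G l\<bar>)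
       \<longlonglongrightarrow> (wt (x - c * t) + \<bar>wt1 (x - c * t)\<bar>) * \<bar>G l - G l\<bar>"
      by (intro tendsto_intros)
    then show "(\<lambda>k. (wt (fst z - c * snd (snd z)) + \<bar>wt1 (fst z - c * snd (snd z))\<bar>) *
        \<bar>G (T (fst z + \<sigma> k) (fst (snd z)) (snd (snd z))) - G l\<bar>) \<longlonglongrightarrow> 0"
      by (simp add: xyt)
  qed
  then show ?thesis by simp
qed

text \<open>The combined error of replacing T by 1 in the left window and by 0 in the right one. The
  shifts are written as sums to fit \<open>window_limit\<close>.\<close>

definition werr :: "(real \<Rightarrow> real) \<Rightarrow> nat \<Rightarrow> real" where
  "werr G k = Sint (\<lambda>x y t. (wt (x - c * t) + \<bar>wt1 (x - c * t)\<bar>) * \<bar>G (T (x + - (real k * p)) y t) - G 1\<bar>)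
    + Sint (\<lambda>x y t. (wt (x - c * t) + \<bar>wt1 (x - c * t)\<bar>) * \<bar>G (T (x + real k * p) y t) - G 0\<bar>)"

lemma werr_limit: "continuous_on {0..1} G \<Longrightarrow> werr G \<longlonglongrightarrow> 0"
  unfolding werr_def
  using tendsto_add[OF window_limit[of G "\<lambda>k. - (real k * p)" 1] window_limit[of G "\<lambda>k. real k * p" 0]] lim_T
  by simp

text \<open>A window far out sees \<open>T\<close> only through its limit.\<close>

lemma window_estimate:
  assumes G: "continuous_on {0..1} G" and cA: "ccont2 A" "ccont2 B"
    and bA: "\<And>x y. y \<in> {0..H} \<Longrightarrow> \<bar>A x y\<bar> \<le> M" "\<And>x y. y \<in> {0..H} \<Longrightarrow> \<bar>B x y\<bar> \<le> M"
  shows "\<bar>Sint (\<lambda>x y t. (wt (x - c * t - q) * A x y + wt1 (x - c * t - q) * B x y) * (G (T x y t) - r))\<bar>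
    \<le> M * Sint (\<lambda>x y t. (wt (x - c * t) + \<bar>wt1 (x - c * t)\<bar>) * \<bar>G (T (x + q) y t) - r\<bar>)"
proof -
  have cG: "ccont (\<lambda>x y t. G (T x y t) - r)" by (intro continuous_intros ccont_comp_T G)
  have t1: "tame (\<lambda>x y t. (wt (x - c * t - q) * A x y + wt1 (x - c * t - q) * B x y) * (G (T x y t) - r))"
    using bsupp_cont_add[OF tame_wt(1)[of "\<lambda>x y t. A x y * (G (T x y t) - r)" "-q"]
        tame_wt(2)[of "\<lambda>x y t. B x y * (G (T x y t) - r)" "-q"]]
      continuous_on_mult[OF ccont_of_ccont2[OF cA(1)] cG] continuous_on_mult[OF ccont_of_ccont2[OF cA(2)] cG]
    by (simp add: distrib_right mult.assoc)
  have t2: "tame (\<lambda>x y t. (wt (x - c * t - q) + \<bar>wt1 (x - c * t - q)\<bar>) * \<bar>G (T x y t) - r\<bar>)"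
    using tame_wt(3)[of "\<lambda>x y t. \<bar>G (T x y t) - r\<bar>" "-q"] continuous_on_rabs[OF cG] by simp
  have "\<bar>Sint (\<lambda>x y t. (wt (x - c * t - q) * A x y + wt1 (x - c * t - q) * B x y) * (G (T x y t) - r))\<bar>
     \<le> Sint (\<lambda>x y t. M * ((wt (x - c * t - q) + \<bar>wt1 (x - c * t - q)\<bar>) * \<bar>G (T x y t) - r\<bar>))"
  proof (rule Sint_abs_le[OF t1 bsupp_cont_cmult[OF t2]])
    fix x y t :: real assume y: "y \<in> {0..H}"
    have "\<bar>wt (x - c * t - q) * A x y + wt1 (x - c * t - q) * B x y\<bar>
       \<le> wt (x - c * t - q) * M + \<bar>wt1 (x - c * t - q)\<bar> * M"
      using bA[OF y, of x] wt_nonneg[of "x - c * t - q"]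
      by (intro order_trans[OF abs_triangle_ineq] add_mono) (auto simp: abs_mult intro!: mult_left_mono)
    then have "\<bar>wt (x - c * t - q) * A x y + wt1 (x - c * t - q) * B x y\<bar> * \<bar>G (T x y t) - r\<bar>
       \<le> (wt (x - c * t - q) * M + \<bar>wt1 (x - c * t - q)\<bar> * M) * \<bar>G (T x y t) - r\<bar>"
      by (rule mult_right_mono) simp
    then show "\<bar>(wt (x - c * t - q) * A x y + wt1 (x - c * t - q) * B x y) * (G (T x y t) - r)\<bar>
       \<le> M * ((wt (x - c * t - q) + \<bar>wt1 (x - c * t - q)\<bar>) * \<bar>G (T x y t) - r\<bar>)"
      unfolding abs_mult by (simp add: algebra_simps)
  qed
  also have "\<dots> = M * Sint (\<lambda>x y t. (wt (x - c * t - q) + \<bar>wt1 (x - c * t - q)\<bar>) * \<bar>G (T x y t) - r\<bar>)"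
    by (rule Sint_cmult)
  \<comment> \<open>Translation by q brings the window back to the origin and moves T
    instead.\<close>
  also have "Sint (\<lambda>x y t. (wt (x - c * t - q) + \<bar>wt1 (x - c * t - q)\<bar>) * \<bar>G (T x y t) - r\<bar>)
     = Sint (\<lambda>x y t. (wt (x - c * t) + \<bar>wt1 (x - c * t)\<bar>) * \<bar>G (T (x + q) y t) - r\<bar>)"
    using Sint_shift[OF t2, of q] by (simp add: algebra_simps)
  finally show ?thesis .
qed

end

context front
begin

section \<open>Energy and speed\<close>

lemma per_u_int: "y \<in> {0..H} \<Longrightarrow> u1 (x + of_int i * p) y = u1 x y \<and> u2 (x + of_int i * p) y = u2 x y"
proof (induction i arbitrary: x rule: int_induct[where k = 0])
  case base then show ?case by simp
next
  case (step1 i)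
  then show ?case using per_u[of y "x + of_int i * p"] by (simp add: algebra_simps)
next
  case (step2 i)
  then show ?case using per_u[of y "x + of_int (i - 1) * p"] by (simp add: algebra_simps)
qed

lemma u1_bounded: obtains M where "M \<ge> 0" "\<And>x y. y \<in> {0..H} \<Longrightarrow> \<bar>u1 x y\<bar> \<le> M"
proof -
  have "compact ({0..p} \<times> {0..H})" by (intro compact_Times compact_Icc)
  moreover have "continuous_on ({0..p} \<times> {0..H}) (\<lambda>z. u1 (fst z) (snd z))"
    by (rule continuous_on_subset[OF cont_u(1)]) auto
  ultimately have "bounded ((\<lambda>z. u1 (fst z) (snd z)) ` ({0..p} \<times> {0..H}))"
    by (intro compact_imp_bounded compact_continuous_image)
  then obtain M where M: "\<And>z. z \<in> {0..p} \<times> {0..H} \<Longrightarrow> \<bar>u1 (fst z) (snd z)\<bar> \<le> M"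
    unfolding bounded_iff by force
  have "\<bar>u1 x y\<bar> \<le> M" if y: "y \<in> {0..H}" for x y
  proof -
    define i where "i = \<lfloor>x / p\<rfloor>"
    have "of_int i \<le> x / p" "x / p \<le> of_int i + 1" unfolding i_def by linarith+
    then have "of_int i * p \<le> x" "x \<le> (of_int i + 1) * p"
      using pos by (simp_all add: field_simps)
    then have "x + of_int (- i) * p \<in> {0..p}" by (simp add: algebra_simps)
    then show ?thesis using M[of "(x + of_int (- i) * p, y)"] per_u_int[OF y, of x "- i"] y by simp
  qed
  moreover have "M \<ge> 0" using M[of "(0, 0)"] pos by force
  ultimately show ?thesis using that by blast
qed

text \<open>The field \<Psi> u is divergence free, as \<Psi> is constant along u. Hence the
  x-derivative of the flux is minus the integral of the y-derivative of \<Psi> u2, which vanishes by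
  equality at the two ends.\<close>

lemma flux_constant:
  assumes adm: "admissible \<Psi> \<Psi>x \<Psi>y"
  obtains F where "\<And>x. integral {0..H} (\<lambda>y. \<Psi> x y * u1 x y) = F"
proof -
  have c: "ccont2 \<Psi>" "ccont2 \<Psi>x" "ccont2 \<Psi>y" using adm by (auto simp: admissible_def)
  have D: "((\<lambda>x. integral (cbox 0 H) (\<lambda>y. \<Psi> x y * u1 x y)) has_field_derivative 0) (at x)" for x
  proof -
    have "((\<lambda>x. integral (cbox 0 H) (\<lambda>y. \<Psi> x y * u1 x y)) has_field_derivative
        integral (cbox 0 H) (\<lambda>y. \<Psi>x x y * u1 x y + u1x x y * \<Psi> x y)) (at x within UNIV)"
    proof (rule leibniz_rule_field_derivative)
      fix x y assume "y \<in> cbox 0 H"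
      then show "((\<lambda>x. \<Psi> x y * u1 x y) has_field_derivative \<Psi>x x y * u1 x y + u1x x y * \<Psi> x y) (at x)"
        using adm der_u(1)[of y x] by (intro DERIV_mult) (auto simp: admissible_def)
    next
      fix x
      have "continuous_on (slab 0 H) (\<lambda>z. \<Psi> (fst z) (snd z) * u1 (fst z) (snd z))"
        by (intro continuous_intros c cont_u)
      then have "continuous_on (cbox 0 H) (\<lambda>y. (\<lambda>z. \<Psi> (fst z) (snd z) * u1 (fst z) (snd z)) (x, y))"
        by (rule continuous_on_compose2) (auto intro!: continuous_intros)
      then show "(\<lambda>y. \<Psi> x y * u1 x y) integrable_on cbox 0 H"
        by (intro integrable_continuous) simp
    next
      show "continuous_on (slab 0 H) (\<lambda>(x, y). \<Psi>x x y * u1 x y + u1x x y * \<Psi> x y)"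
        unfolding case_prod_unfold by (intro continuous_intros c cont_u)
    qed auto
    moreover have "integral (cbox 0 H) (\<lambda>y. \<Psi>x x y * u1 x y + u1x x y * \<Psi> x y) = 0"
    proof -
      have "((\<lambda>y. \<Psi>y x y * u2 x y + u2y x y * \<Psi> x y) has_integral \<Psi> x H * u2 x H - \<Psi> x 0 * u2 x 0) {0..H}"
        using adm der_u(2) pos
        by (intro fundamental_theorem_of_calculus)
          (auto simp: has_real_derivative_iff_has_vector_derivative[symmetric] admissible_def
             intro!: DERIV_mult)
      moreover have "\<Psi> x 0 = \<Psi> x H" using adm by (simp add: admissible_def)
      ultimately have "((\<lambda>y. \<Psi>y x y * u2 x y + u2y x y * \<Psi> x y) has_integral 0) {0..H}"
        using bc(1)[of x] by simp
      from has_integral_neg[OF this]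
      have 1: "((\<lambda>y. - (\<Psi>y x y * u2 x y + u2y x y * \<Psi> x y)) has_integral 0) {0..H}" by simp
      have 2: "- (\<Psi>y x y * u2 x y + u2y x y * \<Psi> x y) = \<Psi>x x y * u1 x y + u1x x y * \<Psi> x y"
        if y: "y \<in> {0..H}" for y
      proof -
        have "u1 x y * \<Psi>x x y + u2 x y * \<Psi>y x y = 0" using adm y by (simp add: admissible_def)
        moreover have "\<Psi> x y * (u1x x y + u2y x y) = 0" using div_u[OF y] by simp
        ultimately show ?thesis by (simp add: algebra_simps)
      qed
      have "((\<lambda>y. \<Psi>x x y * u1 x y + u1x x y * \<Psi> x y) has_integral 0) {0..H}"
        by (rule has_integral_eq[OF _ 1]) (rule 2)
      then show ?thesis by (simp add: integral_unique)
    qed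
    ultimately show ?thesis by simp
  qed
  have "integral {0..H} (\<lambda>y. \<Psi> x y * u1 x y) = integral {0..H} (\<lambda>y. \<Psi> 0 y * u1 0 y)" for x
    using DERIV_isconst_all[of "\<lambda>x. integral (cbox 0 H) (\<lambda>y. \<Psi> x y * u1 x y)" x 0] D by simp
  then show ?thesis by (rule that)
qed

text \<open>The derivatives of the cutoff form a left window minus a right one. The right one sees G
  0 = 0. In the left one G(T) is replaced by G 1, after which the integral is exact: advection
  yields \<tau> F, diffusion integrates to zero, and the drift term is kept since \<Psi> need not be
  constant.\<close>

lemma window_identity:
  assumes adm: "admissible \<Psi> \<Psi>x \<Psi>y"
    and F: "\<And>x. integral {0..H} (\<lambda>y. \<Psi> x y * u1 x y) = F"
    and b: "\<And>x y. y \<in> {0..H} \<Longrightarrow> \<bar>\<Psi> x y\<bar> \<le> 1" "\<And>x y. y \<in> {0..H} \<Longrightarrow> \<bar>\<Psi>x x y\<bar> \<le> B"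
    and Mu: "Mu \<ge> 0" "\<And>x y. y \<in> {0..H} \<Longrightarrow> \<bar>u1 x y\<bar> \<le> Mu"
    and G: "continuous_on {0..1} G" "G 0 = 0"
  shows "\<bar>Sint (\<lambda>x y t. (cut1 k (x - c * t) * (c * \<Psi> x y - \<Psi> x y * u1 x y - \<kappa> * \<Psi>x x y)
           - \<kappa> * \<Psi> x y * cut2 k (x - c * t)) * G (T x y t))
         - G 1 * (c * Sint (\<lambda>x y t. wt (x - c * t + real k * p) * \<Psi> x y) - \<tau> * F)\<bar>
      \<le> (\<bar>c\<bar> + Mu + \<kappa> * B + \<kappa>) * werr G k"
proof -
  define A where "A = (\<lambda>x y. c * \<Psi> x y - \<Psi> x y * u1 x y - \<kappa> * \<Psi>x x y)"
  define D where "D = (\<lambda>x y. - (\<kappa> * \<Psi> x y))"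
  define M where "M = \<bar>c\<bar> + Mu + \<kappa> * B + \<kappa>"
  have c\<Psi>: "ccont2 \<Psi>" "ccont2 \<Psi>x" using adm by (auto simp: admissible_def)
  have cAD: "ccont2 A" "ccont2 D" unfolding A_def D_def by (intro continuous_intros c\<Psi> cont_u)+
  have "B \<ge> 0" using b(2)[of 0 0] pos by force
  then have B\<kappa>: "0 \<le> \<kappa> * B" using pos by simp
  have bA: "\<bar>A x y\<bar> \<le> M" "\<bar>D x y\<bar> \<le> M" if y: "y \<in> {0..H}" for x y
  proof -
    have "\<bar>c * \<Psi> x y\<bar> \<le> \<bar>c\<bar> * 1" unfolding abs_mult using b(1)[OF y] by (intro mult_left_mono) auto
    moreover have "\<bar>\<Psi> x y * u1 x y\<bar> \<le> 1 * Mu" unfolding abs_mult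
      using b(1)[OF y] Mu(2)[OF y] by (intro mult_mono) auto
    moreover have "\<bar>\<kappa> * \<Psi>x x y\<bar> \<le> \<kappa> * B" unfolding abs_mult
      using b(2)[OF y] pos by (auto intro!: mult_left_mono)
    moreover have "\<bar>\<kappa> * \<Psi> x y\<bar> \<le> \<kappa> * 1" unfolding abs_mult
      using b(1)[OF y] pos by (auto intro!: mult_left_mono)
    ultimately show "\<bar>A x y\<bar> \<le> M" "\<bar>D x y\<bar> \<le> M"
      unfolding A_def D_def M_def using B\<kappa> Mu(1) by linarith+
  qed
  have ccAD: "ccont (\<lambda>x y t. A x y)" "ccont (\<lambda>x y t. D x y)" using cAD by (auto intro: ccont_of_ccont2)
  have tA: "tame (\<lambda>x y t. wt (x - c * t - q) * A x y + wt1 (x - c * t - q) * D x y)" for q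
    using bsupp_cont_add[OF tame_wt(1)[OF ccAD(1), of "-q"] tame_wt(2)[OF ccAD(2), of "-q"]] by simp
  have cG: "ccont (\<lambda>x y t. G (T x y t) - r)" for r by (intro continuous_intros ccont_comp_T G)
  define L where "L = (\<lambda>q r. Sint (\<lambda>x y t. (wt (x - c * t - q) * A x y + wt1 (x - c * t - q) * D x y) * (G (T x y t) - r)))"
  have tAG: "tame (\<lambda>x y t. (wt (x - c * t - q) * A x y + wt1 (x - c * t - q) * D x y) * (G (T x y t) - r))" for q r
    by (rule bsupp_cont_mult(1)[OF tA cG])
  have est: "\<bar>L q r\<bar> \<le> M * Sint (\<lambda>x y t. (wt (x - c * t) + \<bar>wt1 (x - c * t)\<bar>) * \<bar>G (T (x + q) y t) - r\<bar>)" for q r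
    unfolding L_def by (rule window_estimate[OF G(1) cAD bA])
  have exact: "Sint (\<lambda>x y t. wt (x - c * t - q) * A x y + wt1 (x - c * t - q) * D x y)
      = c * Sint (\<lambda>x y t. wt (x - c * t - q) * \<Psi> x y) - \<tau> * F" for q
  proof -
    have t1: "tame (\<lambda>x y t. wt (x - c * t - q) * \<Psi> x y)"
      using tame_wt(1)[OF ccont_of_ccont2[OF c\<Psi>(1)], of "-q"] by simp
    have c2: "ccont2 (\<lambda>x y. \<Psi> x y * u1 x y)" by (intro continuous_intros c\<Psi> cont_u)
    have t2: "tame (\<lambda>x y t. wt (x - c * t - q) * (\<Psi> x y * u1 x y))"
      using tame_wt(1)[OF ccont_of_ccont2[OF c2], of "-q"] by simp
    have t3: "tame (\<lambda>x y t. wt (x - c * t - q) * \<Psi>x x y + wt1 (x - c * t - q) * \<Psi> x y)"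
      using bsupp_cont_add[OF tame_wt(1)[OF ccont_of_ccont2[OF c\<Psi>(2)], of "-q"]
          tame_wt(2)[OF ccont_of_ccont2[OF c\<Psi>(1)], of "-q"]] by simp
    \<comment> \<open>The integrand is the x-derivative of the window times \<Psi>, so the diffusive
      parts cancel without any estimate.\<close>
    have z: "Sint (\<lambda>x y t. wt (x - c * t - q) * \<Psi>x x y + wt1 (x - c * t - q) * \<Psi> x y) = 0"
    proof (rule slab_integral_dx[OF t1 t3])
      fix x :: real and w :: "real \<times> real"
      assume w: "w \<in> cbox (0, 0) (H, \<tau>)"
      obtain y t where wyt: "w = (y, t)" by (cases w)
      have y: "y \<in> {0..H}" using w by (auto simp: wyt)
      have "((\<lambda>r. r - c * t - q) has_real_derivative 1) (at x)"
        by (auto intro!: derivative_eq_intros)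
      from DERIV_chain2[OF DERIV_wt this]
      have "((\<lambda>r. wt (r - c * t - q)) has_real_derivative wt1 (x - c * t - q)) (at x)" by simp
      from DERIV_mult[OF this, of "\<lambda>r. \<Psi> r y" "\<Psi>x x y"]
      have "((\<lambda>r. wt (r - c * t - q) * \<Psi> r y) has_real_derivative
         wt (x - c * t - q) * \<Psi>x x y + wt1 (x - c * t - q) * \<Psi> x y) (at x)"
        using adm y by (auto simp: admissible_def algebra_simps)
      then show "((\<lambda>r. wt (fst (r, w) - c * snd (snd (r, w)) - q) * \<Psi> (fst (r, w)) (fst (snd (r, w))))
         has_real_derivative wt (fst (x, w) - c * snd (snd (x, w)) - q) * \<Psi>x (fst (x, w)) (fst (snd (x, w))) +
           wt1 (fst (x, w) - c * snd (snd (x, w)) - q) * \<Psi> (fst (x, w)) (fst (snd (x, w)))) (at x)"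
        by (simp add: wyt)
    qed
    have fl: "Sint (\<lambda>x y t. wt (x - c * t - q) * (\<Psi> x y * u1 x y)) = \<tau> * F"
      using Sint_wt_flux[OF c2 F, of "- q"] by simp
    have "Sint (\<lambda>x y t. wt (x - c * t - q) * A x y + wt1 (x - c * t - q) * D x y)
      = Sint (\<lambda>x y t. (c * (wt (x - c * t - q) * \<Psi> x y) - wt (x - c * t - q) * (\<Psi> x y * u1 x y))
          - \<kappa> * (wt (x - c * t - q) * \<Psi>x x y + wt1 (x - c * t - q) * \<Psi> x y))"
      by (rule Sint_cong) (simp add: A_def D_def algebra_simps)
    also have "\<dots> = (c * Sint (\<lambda>x y t. wt (x - c * t - q) * \<Psi> x y)
          - Sint (\<lambda>x y t. wt (x - c * t - q) * (\<Psi> x y * u1 x y)))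
        - \<kappa> * Sint (\<lambda>x y t. wt (x - c * t - q) * \<Psi>x x y + wt1 (x - c * t - q) * \<Psi> x y)"
      by (simp only: Sint_diff[OF bsupp_cont_diff[OF bsupp_cont_cmult[OF t1] t2] bsupp_cont_cmult[OF t3]]
           Sint_diff[OF bsupp_cont_cmult[OF t1] t2] integral_mult_right)
    finally show ?thesis using z fl by simp
  qed
  \<comment> \<open>G 1 is subtracted and added on the left window; on the right window G 0 = 0 is
    subtracted for symmetry with \<open>window_estimate\<close>.\<close>
  have "Sint (\<lambda>x y t. (cut1 k (x - c * t) * (c * \<Psi> x y - \<Psi> x y * u1 x y - \<kappa> * \<Psi>x x y)
           - \<kappa> * \<Psi> x y * cut2 k (x - c * t)) * G (T x y t))
      = Sint (\<lambda>x y t. ((wt (x - c * t - (- (real k * p))) * A x y + wt1 (x - c * t - (- (real k * p))) * D x y) * (G (T x y t) - G 1)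
         + G 1 * (wt (x - c * t - (- (real k * p))) * A x y + wt1 (x - c * t - (- (real k * p))) * D x y))
         - (wt (x - c * t - real k * p) * A x y + wt1 (x - c * t - real k * p) * D x y) * (G (T x y t) - G 0))"
    by (rule Sint_cong) (simp add: cut1_def cut2_def A_def D_def G(2) algebra_simps)
  also have "\<dots> = (L (- (real k * p)) (G 1) + G 1 * (c * Sint (\<lambda>x y t. wt (x - c * t - (- (real k * p))) * \<Psi> x y) - \<tau> * F))
      - L (real k * p) (G 0)"
    unfolding L_def
    by (simp only: Sint_diff[OF bsupp_cont_add[OF tAG bsupp_cont_cmult[OF tA]] tAG]
         Sint_add[OF tAG bsupp_cont_cmult[OF tA]] integral_mult_right exact)
  finally have eq: "Sint (\<lambda>x y t. (cut1 k (x - c * t) * (c * \<Psi> x y - \<Psi> x y * u1 x y - \<kappa> * \<Psi>x x y)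
           - \<kappa> * \<Psi> x y * cut2 k (x - c * t)) * G (T x y t))
       - G 1 * (c * Sint (\<lambda>x y t. wt (x - c * t + real k * p) * \<Psi> x y) - \<tau> * F)
      = L (- (real k * p)) (G 1) - L (real k * p) (G 0)"
    by simp
  have "M * werr G k = M * Sint (\<lambda>x y t. (wt (x - c * t) + \<bar>wt1 (x - c * t)\<bar>) * \<bar>G (T (x + - (real k * p)) y t) - G 1\<bar>)
     + M * Sint (\<lambda>x y t. (wt (x - c * t) + \<bar>wt1 (x - c * t)\<bar>) * \<bar>G (T (x + real k * p) y t) - G 0\<bar>)"
    by (simp only: werr_def distrib_left)
  then show ?thesis unfolding eq M_def[symmetric]
    using est[of "- (real k * p)" "G 1"] est[of "real k * p" "G 0"] by linarith
qed

text \<open>After one time period the front has moved by \<open>c * \<tau>\<close>, a multiple of the spatial period.\<close>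

lemma boundary_shift:
  assumes \<Psi>: "ccont2 \<Psi>" and G: "continuous_on {0..1} G"
  shows "integral (slab 0 H) (\<lambda>(x, y). \<Psi> x y * cut k (x - c * \<tau>) * G (T x y \<tau>))
       - integral (slab 0 H) (\<lambda>(x, y). \<Psi> x y * cut k x * G (T x y 0))
    = integral (slab 0 H) (\<lambda>(x, y). (\<Psi> (x + c * \<tau>) y - \<Psi> x y) * (cut k x * G (T x y 0)))"
    and "bsupp_cont 0 H (\<lambda>(x, y). cut k x * G (T x y 0))"
    and "\<And>q. ccont2 (\<lambda>x y. \<Psi> (x + q) y)"
proof -
  have cT0: "continuous_on (slab 0 H) (\<lambda>z. G (T (fst z) (snd z) 0))"
  proof -
    have "continuous_on (slab 0 H) (\<lambda>z. (\<lambda>w. G (T (fst w) (fst (snd w)) (snd (snd w)))) (fst z, snd z, 0))"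
      by (rule continuous_on_compose2[OF ccont_comp_T[OF G]])
        (use pos in \<open>auto intro!: continuous_intros\<close>)
    then show ?thesis by simp
  qed
  show b: "bsupp_cont 0 H (\<lambda>(x, y). cut k x * G (T x y 0))"
  proof (rule bsupp_contI[where R = "(real k + 1) * p"])
    have "continuous_on (slab 0 H) (\<lambda>z. cut k (fst z))"
      by (rule continuous_on_compose2[OF cont_cut(1)]) (auto intro!: continuous_intros)
    then show "continuous_on (slab 0 H) (\<lambda>(x, y). cut k x * G (T x y 0))"
      unfolding case_prod_unfold by (intro continuous_on_mult cT0)
  qed (simp add: cut_supp)
  show c\<Psi>: "ccont2 (\<lambda>x y. \<Psi> (x + q) y)" for q
  proof -
    have "continuous_on (slab 0 H) (\<lambda>z. (\<lambda>w. \<Psi> (fst w) (snd w)) (fst z + q, snd z))"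
      by (rule continuous_on_compose2[OF \<Psi>]) (auto intro!: continuous_intros)
    then show ?thesis by simp
  qed
  have b1: "bsupp_cont 0 H (\<lambda>z. \<Psi> (fst z + q) (snd z) * (cut k (fst z) * G (T (fst z) (snd z) 0)))" for q
    using bsupp_cont_mult(2)[OF b c\<Psi>] by (simp add: case_prod_unfold)
  have "integral (slab 0 H) (\<lambda>(x, y). \<Psi> x y * cut k (x - c * \<tau>) * G (T x y \<tau>))
     = integral (slab 0 H) (\<lambda>(x, w). (\<lambda>z. \<Psi> (fst z + c * \<tau>) (snd z) * (cut k (fst z) * G (T (fst z) (snd z) 0))) (x + - (c * \<tau>), w))"
    by (rule integral_cong) (auto simp: per_T)
  also have "\<dots> = integral (slab 0 H) (\<lambda>z. \<Psi> (fst z + c * \<tau>) (snd z) * (cut k (fst z) * G (T (fst z) (snd z) 0)))"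
    by (rule bsupp_cont_shift(2)[OF b1])
  finally have 1: "integral (slab 0 H) (\<lambda>(x, y). \<Psi> x y * cut k (x - c * \<tau>) * G (T x y \<tau>)) = \<dots>" .
  have 2: "integral (slab 0 H) (\<lambda>(x, y). \<Psi> x y * cut k x * G (T x y 0))
      = integral (slab 0 H) (\<lambda>z. \<Psi> (fst z + 0) (snd z) * (cut k (fst z) * G (T (fst z) (snd z) 0)))"
    by (rule integral_cong) (auto simp: mult.assoc)
  show "integral (slab 0 H) (\<lambda>(x, y). \<Psi> x y * cut k (x - c * \<tau>) * G (T x y \<tau>))
       - integral (slab 0 H) (\<lambda>(x, y). \<Psi> x y * cut k x * G (T x y 0))
    = integral (slab 0 H) (\<lambda>(x, y). (\<Psi> (x + c * \<tau>) y - \<Psi> x y) * (cut k x * G (T x y 0)))"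
    unfolding 1 2 by (subst integral_diff[OF bsupp_cont_integrable[OF b1] bsupp_cont_integrable[OF b1], symmetric])
      (simp add: case_prod_unfold left_diff_distrib)
qed

definition energy :: "real \<Rightarrow> real \<Rightarrow> real \<Rightarrow> real" where
  "energy x y t = \<kappa> * ((Tx x y t)\<^sup>2 + (Ty x y t)\<^sup>2) + v\<^sup>2 / \<kappa> * f (T x y t)"

lemma f_cont: "continuous_on {0..1} f"
  using f_der by (meson DERIV_continuous_on)

lemma energy_nonneg: "y \<in> {0..H} \<Longrightarrow> t \<in> {0..\<tau>} \<Longrightarrow> 0 \<le> energy x y t"
  unfolding energy_def using pos f_nonneg range_T by auto

lemma cont_energy: "ccont energy"
  unfolding energy_def by (intro continuous_intros cont_T ccont_comp_T f_cont)

text \<open>On [0, 1] the chosen G has G' = 2 - s \<ge> 1, which keeps at least the whole reaction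
  term, and G'' = -1, which produces the squared gradient with the right sign. With \<Psi> = 1 the
  time boundary terms cancel and the flux is the mean of u1, which is zero; only the drift c G 1 H
  \<tau> remains, and G 1 = 3 / 2.\<close>

lemma energy_bound:
  obtains \<epsilon> where "\<epsilon> \<longlonglongrightarrow> 0"
    "\<And>k. Sint (\<lambda>x y t. cut k (x - c * t) * energy x y t) \<le> 3 / 2 * (c * \<tau> * H) + \<epsilon> k"
proof -
  define G where "G = (\<lambda>s::real. 2 * s - s\<^sup>2 / 2)"
  obtain Mu where Mu: "Mu \<ge> 0" "\<And>x y. y \<in> {0..H} \<Longrightarrow> \<bar>u1 x y\<bar> \<le> Mu" by (rule u1_bounded) blast
  have cG: "continuous_on {0..1} G" unfolding G_def by (intro continuous_intros) auto
  have adm: "admissible (\<lambda>x y. 1) (\<lambda>x y. 0) (\<lambda>x y. 0)"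
    unfolding admissible_def by auto
  define R where "R = (\<lambda>k. Sint (\<lambda>x y t. cut k (x - c * t) *
          (v\<^sup>2 / \<kappa> * 1 * f (T x y t) * (2 - T x y t)
           - \<kappa> * (2 - T x y t) * (0 * Tx x y t + 0 * Ty x y t)
           - \<kappa> * 1 * (-1) * ((Tx x y t)\<^sup>2 + (Ty x y t)\<^sup>2))))"
  define W where "W = (\<lambda>k. Sint (\<lambda>x y t. (cut1 k (x - c * t) * (c * 1 - 1 * u1 x y - \<kappa> * 0)
           - \<kappa> * 1 * cut2 k (x - c * t)) * G (T x y t)))"
  have id: "W k = R k" for k
  proof -
    have "integral (slab 0 H) (\<lambda>(x, y). 1 * cut k (x - c * \<tau>) * G (T x y \<tau>))
       - integral (slab 0 H) (\<lambda>(x, y). 1 * cut k x * G (T x y 0)) + W k = R k"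
      unfolding W_def R_def
      by (rule weak_identity[OF adm _ _ _ DERIV_cut DERIV_cut1 cont_cut2 cut_supp])
        (auto simp: G_def intro!: derivative_eq_intros)
    moreover have "ccont2 (\<lambda>x y. 1)" by simp
    ultimately show ?thesis using boundary_shift(1)[of "\<lambda>x y. 1" G k, OF _ cG]
      by (simp add: case_prod_unfold)
  qed
  have W: "\<bar>W k - G 1 * (c * Sint (\<lambda>x y t. wt (x - c * t + real k * p) * 1) - \<tau> * 0)\<bar>
     \<le> (\<bar>c\<bar> + Mu + \<kappa> * 0 + \<kappa>) * werr G k" for k
    unfolding W_def
    by (rule window_identity[OF adm _ _ _ Mu cG]) (auto simp: mean_u1 G_def)
  show ?thesis
  proof (rule that)
    show "(\<lambda>k. (\<bar>c\<bar> + Mu + \<kappa> * 0 + \<kappa>) * werr G k) \<longlonglongrightarrow> 0"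
      by (rule tendsto_mult_right_zero[OF werr_limit[OF cG]])
    fix k
    have "Sint (\<lambda>x y t. cut k (x - c * t) * energy x y t) \<le> R k"
      unfolding R_def
    proof (rule Sint_mono)
      show "tame (\<lambda>x y t. cut k (x - c * t) * energy x y t)" by (rule tame_cut[OF cont_energy])
      show "tame (\<lambda>x y t. cut k (x - c * t) *
          (v\<^sup>2 / \<kappa> * 1 * f (T x y t) * (2 - T x y t)
           - \<kappa> * (2 - T x y t) * (0 * Tx x y t + 0 * Ty x y t)
           - \<kappa> * 1 * (-1) * ((Tx x y t)\<^sup>2 + (Ty x y t)\<^sup>2)))"
        by (rule tame_cut, intro continuous_intros cont_T ccont_comp_T f_cont)
      fix x y t assume yt: "y \<in> {0..H}" "t \<in> {0..\<tau>}"
      have "v\<^sup>2 / \<kappa> * f (T x y t) * 1 \<le> v\<^sup>2 / \<kappa> * f (T x y t) * (2 - T x y t)"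
        using range_T[OF yt, of x] f_nonneg[OF range_T[OF yt, of x]] pos
        by (intro mult_left_mono) auto
      then show "cut k (x - c * t) * energy x y t \<le> cut k (x - c * t) *
          (v\<^sup>2 / \<kappa> * 1 * f (T x y t) * (2 - T x y t)
           - \<kappa> * (2 - T x y t) * (0 * Tx x y t + 0 * Ty x y t)
           - \<kappa> * 1 * (-1) * ((Tx x y t)\<^sup>2 + (Ty x y t)\<^sup>2))"
        using cut_range by (intro mult_left_mono) (auto simp: energy_def)
    qed
    also have "\<dots> \<le> 3 / 2 * (c * \<tau> * H) + (\<bar>c\<bar> + Mu + \<kappa> * 0 + \<kappa>) * werr G k"
    proof -
      have "Sint (\<lambda>x y t. wt (x - c * t + real k * p) * 1) = H * \<tau>"
        using Sint_wt[of "real k * p"] by simp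
      then have "G 1 * (c * Sint (\<lambda>x y t. wt (x - c * t + real k * p) * 1) - \<tau> * 0) = 3 / 2 * (c * \<tau> * H)"
        by (simp only:) (simp add: G_def)
      with W[of k] show ?thesis unfolding id by linarith
    qed
    finally show "Sint (\<lambda>x y t. cut k (x - c * t) * energy x y t)
       \<le> 3 / 2 * (c * \<tau> * H) + (\<bar>c\<bar> + Mu + \<kappa> * 0 + \<kappa>) * werr G k" .
  qed
qed

end

section \<open>Lower bounds for the speed from the primitive of the nonlinearity\<close>

context front
begin

text \<open>With this primitive the test function g(T) of \<open>weak_identity\<close> becomes f(T),
  and f(T) times the gradient of T is an exact gradient. From here on G is fixed; before it was a
  parameter of the lemmas.\<close>

abbreviation "G \<equiv> \<lambda>s. integral {0..s} f"

lemma DERIV_G: "s \<in> {0..1} \<Longrightarrow> (G has_real_derivative f s) (at s within {0..1})"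
  by (rule integral_has_real_derivative[OF f_cont])

lemma G_cont: "continuous_on {0..1} G"
  using DERIV_G by (meson DERIV_continuous_on)

text \<open>The dissipation is nonnegative, so its upper bound is too. The sign is used in
  \<open>flux_estimate\<close>, where c multiplies an integral that is only bounded in absolute
  value.\<close>

lemma speed_nonneg: "0 \<le> c"
proof -
  obtain \<epsilon> where \<epsilon>: "\<epsilon> \<longlonglongrightarrow> 0"
    "\<And>k. Sint (\<lambda>x y t. cut k (x - c * t) * energy x y t) \<le> 3 / 2 * (c * \<tau> * H) + \<epsilon> k"
    by (rule energy_bound) blast
  have "0 \<le> 3 / 2 * (c * \<tau> * H) + \<epsilon> k" for k
  proof (rule order_trans[OF integral_nonneg \<epsilon>(2)])
    show "(\<lambda>z. cut k (fst z - c * snd (snd z)) * energy (fst z) (fst (snd z)) (snd (snd z))) integrable_on Q"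
      by (rule tame_int[OF tame_cut(1)[OF cont_energy]])
  qed (auto intro!: mult_nonneg_nonneg cut_range energy_nonneg)
  moreover have "(\<lambda>k. 3 / 2 * (c * \<tau> * H) + \<epsilon> k) \<longlonglongrightarrow> 3 / 2 * (c * \<tau> * H) + 0"
    by (intro tendsto_intros \<epsilon>(1))
  ultimately have "0 \<le> 3 / 2 * (c * \<tau> * H) + 0"
    using LIMSEQ_le_const by blast
  then show ?thesis using pos by (simp add: zero_le_mult_iff)
qed

text \<open>Young's inequality 2 v f |a| \<le> \<kappa> |a|^2 + (v^2 / \<kappa>) f^2 for each
  component of the gradient; then f^2 \<le> Mf f turns the square into the reaction part of the
  energy. The power of v on the left is what makes the final bound linear in v.\<close>

lemma young_energy:
  assumes yt: "y \<in> {0..H}" "t \<in> {0..\<tau>}" and Mf: "\<And>s. s \<in> {0..1} \<Longrightarrow> f s \<le> Mf"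
  shows "v * f (T x y t) * (\<bar>Tx x y t\<bar> + \<bar>Ty x y t\<bar>) \<le> (1 + Mf) * energy x y t"
proof -
  define F where "F = f (T x y t)"
  have F: "0 \<le> F" "F \<le> Mf" using f_nonneg Mf range_T[OF yt, of x] by (auto simp: F_def)
  have y: "2 * (v * F * \<bar>a\<bar>) \<le> \<kappa> * a\<^sup>2 + v\<^sup>2 / \<kappa> * F\<^sup>2" for a
  proof -
    have "0 \<le> (\<kappa> * \<bar>a\<bar> - v * F)\<^sup>2 / \<kappa>" using pos by simp
    also have "\<dots> = \<kappa> * a\<^sup>2 + v\<^sup>2 / \<kappa> * F\<^sup>2 - 2 * (v * F * \<bar>a\<bar>)"
      using pos by (simp add: power2_diff power_mult_distrib field_simps power2_eq_square)
    finally show ?thesis by simp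
  qed
  have F2: "v\<^sup>2 / \<kappa> * F\<^sup>2 \<le> v\<^sup>2 / \<kappa> * (F * Mf)"
    using F pos by (intro mult_left_mono) (auto simp: power2_eq_square intro!: mult_left_mono)
  have n: "0 \<le> \<kappa> * ((Tx x y t)\<^sup>2 + (Ty x y t)\<^sup>2)" "0 \<le> v\<^sup>2 / \<kappa> * F"
    "0 \<le> Mf * (\<kappa> * ((Tx x y t)\<^sup>2 + (Ty x y t)\<^sup>2))"
    using pos F by auto
  have "v * F * (\<bar>Tx x y t\<bar> + \<bar>Ty x y t\<bar>)
      \<le> (\<kappa> * ((Tx x y t)\<^sup>2 + (Ty x y t)\<^sup>2)) / 2 + v\<^sup>2 / \<kappa> * F\<^sup>2"
    using y[of "Tx x y t"] y[of "Ty x y t"] unfolding distrib_left add_divide_distrib by linarith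
  also have "\<dots> \<le> \<kappa> * ((Tx x y t)\<^sup>2 + (Ty x y t)\<^sup>2) + v\<^sup>2 / \<kappa> * F * Mf"
    using F2 n by (simp add: mult.assoc)
  also have "\<dots> \<le> (1 + Mf) * (\<kappa> * ((Tx x y t)\<^sup>2 + (Ty x y t)\<^sup>2) + v\<^sup>2 / \<kappa> * F)"
  proof -
    have "(1 + Mf) * (a + w) = a + w * Mf + (w + Mf * a)" for a w by (simp add: algebra_simps)
    then show ?thesis using n by simp
  qed
  finally show ?thesis by (simp add: energy_def F_def)
qed

text \<open>The factor 1 + Mf comes from \<open>young_energy\<close> and the 3 is twice the 3 / 2 of
  \<open>energy_bound\<close>. The equation enters through \<open>energy_bound\<close> alone; the
  rest is calculus along horizontal lines.\<close>

theorem reaction_speed: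
  assumes Mf: "\<And>s. s \<in> {0..1} \<Longrightarrow> f s \<le> Mf"
  shows "2 * v * G 1 \<le> 3 * (1 + Mf) * c"
proof -
  obtain \<epsilon> where \<epsilon>: "\<epsilon> \<longlonglongrightarrow> 0"
    "\<And>k. Sint (\<lambda>x y t. cut k (x - c * t) * energy x y t) \<le> 3 / 2 * (c * \<tau> * H) + \<epsilon> k"
    by (rule energy_bound) blast
  have Mf0: "0 \<le> Mf" using Mf[of 0] f_nonneg[of 0] by simp
  have main: "v * (G 1 * (H * \<tau>) - werr G k) \<le> (1 + Mf) * (3 / 2 * (c * \<tau> * H) + \<epsilon> k)" for k
  proof -
    have tG: "tame (\<lambda>x y t. cut k (x - c * t) * G (T x y t))"
      by (rule tame_cut(1)[OF ccont_comp_T[OF G_cont]])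
    have t1: "tame (\<lambda>x y t. cut1 k (x - c * t) * G (T x y t))"
      by (rule tame_cut(2)[OF ccont_comp_T[OF G_cont]])
    have t2: "tame (\<lambda>x y t. cut k (x - c * t) * (f (T x y t) * Tx x y t))"
      by (rule tame_cut(1), intro continuous_intros ccont_comp_T[OF f_cont] cont_T)
    \<comment> \<open>Integrating the x-derivative of the cutoff times G(T) trades f(T) Tx for the
      derivative of the cutoff, whose left window reads off G 1.\<close>
    have z: "Sint (\<lambda>x y t. cut1 k (x - c * t) * G (T x y t) + cut k (x - c * t) * (f (T x y t) * Tx x y t)) = 0"
    proof (rule slab_integral_dx[OF tG bsupp_cont_add[OF t1 t2]])
      fix x :: real and w :: "real \<times> real"
      assume w: "w \<in> cbox (0, 0) (H, \<tau>)"
      obtain y t where wyt: "w = (y, t)" by (cases w)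
      have yt: "y \<in> {0..H}" "t \<in> {0..\<tau>}" using w by (auto simp: wyt)
      have 1: "((\<lambda>r. G (T r y t)) has_real_derivative f (T x y t) * Tx x y t) (at x)"
        using yt range_T by (intro chain_T[OF DERIV_G] der_T) auto
      have "((\<lambda>r. r - c * t) has_real_derivative 1) (at x)"
        by (auto intro!: derivative_eq_intros)
      from DERIV_chain2[OF DERIV_cut this]
      have 2: "((\<lambda>r. cut k (r - c * t)) has_real_derivative cut1 k (x - c * t)) (at x)" by simp
      show "((\<lambda>r. cut k (fst (r, w) - c * snd (snd (r, w))) * G (T (fst (r, w)) (fst (snd (r, w))) (snd (snd (r, w)))))
         has_real_derivative cut1 k (fst (x, w) - c * snd (snd (x, w))) * G (T (fst (x, w)) (fst (snd (x, w))) (snd (snd (x, w))))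
          + cut k (fst (x, w) - c * snd (snd (x, w))) * (f (T (fst (x, w)) (fst (snd (x, w))) (snd (snd (x, w))))
              * Tx (fst (x, w)) (fst (snd (x, w))) (snd (snd (x, w))))) (at x)"
        using DERIV_mult[OF 2 1] by (simp add: wyt mult_ac)
    qed
    define L where "L = (\<lambda>q r. Sint (\<lambda>x y t. wt (x - c * t + - q) * (G (T x y t) - r)))"
    have cG: "ccont (\<lambda>x y t. G (T x y t) - r)" for r by (intro continuous_intros ccont_comp_T G_cont)
    have est: "\<bar>L q r\<bar> \<le> Sint (\<lambda>x y t. (wt (x - c * t) + \<bar>wt1 (x - c * t)\<bar>) * \<bar>G (T (x + q) y t) - r\<bar>)" for q r
      using window_estimate[OF G_cont, of "\<lambda>x y. 1" "\<lambda>x y. 0" 1 q r] by (simp add: L_def)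
    have tw: "tame (\<lambda>x y t. wt (x - c * t + q))" for q
      using tame_wt(1)[of "\<lambda>x y t. 1" q] by simp
    have "Sint (\<lambda>x y t. cut1 k (x - c * t) * G (T x y t))
      = Sint (\<lambda>x y t. (wt (x - c * t + - (- (real k * p))) * (G (T x y t) - G 1)
         + G 1 * wt (x - c * t + real k * p)) - wt (x - c * t + - (real k * p)) * (G (T x y t) - G 0))"
      by (rule Sint_cong) (simp add: cut1_def algebra_simps)
    also have "\<dots> = (L (- (real k * p)) (G 1) + G 1 * (H * \<tau>)) - L (real k * p) (G 0)"
      unfolding L_def
      by (simp only: Sint_diff[OF bsupp_cont_add[OF tame_wt(1)[OF cG] bsupp_cont_cmult[OF tw]] tame_wt(1)[OF cG]]
         Sint_add[OF tame_wt(1)[OF cG] bsupp_cont_cmult[OF tw]] integral_mult_right Sint_wt)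
    finally have lower: "G 1 * (H * \<tau>) - werr G k \<le> Sint (\<lambda>x y t. cut1 k (x - c * t) * G (T x y t))"
      using est[of "- (real k * p)" "G 1"] est[of "real k * p" "G 0"] unfolding werr_def by linarith
    have "v * Sint (\<lambda>x y t. cut1 k (x - c * t) * G (T x y t))
       = v * - Sint (\<lambda>x y t. cut k (x - c * t) * (f (T x y t) * Tx x y t))"
    proof -
      have "Sint (\<lambda>x y t. cut1 k (x - c * t) * G (T x y t))
        = - Sint (\<lambda>x y t. cut k (x - c * t) * (f (T x y t) * Tx x y t))"
        using z Sint_add[OF t1 t2] by linarith
      then show ?thesis by (rule arg_cong)
    qed
    also have "\<dots> = Sint (\<lambda>x y t. - v * (cut k (x - c * t) * (f (T x y t) * Tx x y t)))"
      by simp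
    also have "\<dots> \<le> Sint (\<lambda>x y t. (1 + Mf) * (cut k (x - c * t) * energy x y t))"
    proof (rule Sint_mono[OF bsupp_cont_cmult[OF t2] bsupp_cont_cmult[OF tame_cut(1)[OF cont_energy]]])
      fix x y t assume yt: "y \<in> {0..H}" "t \<in> {0..\<tau>}"
      have f0: "0 \<le> f (T x y t)" using f_nonneg range_T[OF yt] by blast
      have "- v * (f (T x y t) * Tx x y t) = (v * f (T x y t)) * (- Tx x y t)" by simp
      also have "\<dots> \<le> (v * f (T x y t)) * (\<bar>Tx x y t\<bar> + \<bar>Ty x y t\<bar>)"
        using f0 pos by (intro mult_left_mono) auto
      also have "\<dots> \<le> (1 + Mf) * energy x y t" by (rule young_energy[OF yt Mf])
      finally have "cut k (x - c * t) * (- v * (f (T x y t) * Tx x y t)) \<le> cut k (x - c * t) * ((1 + Mf) * energy x y t)"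
        using cut_range by (intro mult_left_mono) auto
      then show "- v * (cut k (x - c * t) * (f (T x y t) * Tx x y t)) \<le> (1 + Mf) * (cut k (x - c * t) * energy x y t)"
        by (simp add: mult_ac)
    qed
    also have "\<dots> = (1 + Mf) * Sint (\<lambda>x y t. cut k (x - c * t) * energy x y t)" by simp
    also have "\<dots> \<le> (1 + Mf) * (3 / 2 * (c * \<tau> * H) + \<epsilon> k)"
      using \<epsilon>(2) Mf0 by (intro mult_left_mono) auto
    finally have "v * Sint (\<lambda>x y t. cut1 k (x - c * t) * G (T x y t)) \<le> (1 + Mf) * (3 / 2 * (c * \<tau> * H) + \<epsilon> k)" .
    moreover have "v * (G 1 * (H * \<tau>) - werr G k) \<le> v * Sint (\<lambda>x y t. cut1 k (x - c * t) * G (T x y t))"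
      using lower pos by (intro mult_left_mono) auto
    ultimately show ?thesis by linarith
  qed
  have "v * (G 1 * (H * \<tau>) - 0) \<le> (1 + Mf) * (3 / 2 * (c * \<tau> * H) + 0)"
  proof (rule LIMSEQ_le)
    show "(\<lambda>k. v * (G 1 * (H * \<tau>) - werr G k)) \<longlonglongrightarrow> v * (G 1 * (H * \<tau>) - 0)"
      by (intro tendsto_intros werr_limit G_cont)
    show "(\<lambda>k. (1 + Mf) * (3 / 2 * (c * \<tau> * H) + \<epsilon> k)) \<longlonglongrightarrow> (1 + Mf) * (3 / 2 * (c * \<tau> * H) + 0)"
      by (intro tendsto_intros \<epsilon>)
  qed (use main in blast)
  then have "(2 * v * G 1) * (H * \<tau>) \<le> (3 * (1 + Mf) * c) * (H * \<tau>)" by (simp add: algebra_simps)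
  then show ?thesis using pos by (simp add: mult_le_cancel_right)
qed

text \<open>\<open>weak_identity\<close> with g = f. On its right side the reaction term costs Mf
  since f^2 \<le> Mf f, the mixed gradient term costs B (1 + Mf) by \<open>young_energy\<close> and
  the bound B v / \<kappa> on the gradient of \<Psi>, and the term with f' costs Mf', each times the
  energy. The drift in the left window is at most c H \<tau> times G 1 since |\<Psi>| \<le> 1. The
  time boundary term is left as it stands.\<close>

lemma flux_estimate:
  assumes adm: "admissible \<Psi> \<Psi>x \<Psi>y"
    and F: "\<And>x. integral {0..H} (\<lambda>y. \<Psi> x y * u1 x y) = F"
    and b: "\<And>x y. y \<in> {0..H} \<Longrightarrow> \<bar>\<Psi> x y\<bar> \<le> 1"
      "\<And>x y. y \<in> {0..H} \<Longrightarrow> \<bar>\<Psi>x x y\<bar> \<le> B * v / \<kappa>"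
      "\<And>x y. y \<in> {0..H} \<Longrightarrow> \<bar>\<Psi>y x y\<bar> \<le> B * v / \<kappa>"
    and Mf: "\<And>s. s \<in> {0..1} \<Longrightarrow> f s \<le> Mf" "\<And>s. s \<in> {0..1} \<Longrightarrow> \<bar>f' s\<bar> \<le> Mf'"
    and Mu: "Mu \<ge> 0" "\<And>x y. y \<in> {0..H} \<Longrightarrow> \<bar>u1 x y\<bar> \<le> Mu"
  shows "\<tau> * G 1 * \<bar>F\<bar> \<le> G 1 * c * (H * \<tau>)
     + \<bar>integral (slab 0 H) (\<lambda>(x, y). (\<Psi> (x + c * \<tau>) y - \<Psi> x y) * (cut k x * G (T x y 0)))\<bar>
     + (\<bar>c\<bar> + Mu + \<kappa> * (B * v / \<kappa>) + \<kappa>) * werr G k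
     + (Mf + B * (1 + Mf) + Mf') * Sint (\<lambda>x y t. cut k (x - c * t) * energy x y t)"
proof -
  have c\<Psi>: "ccont2 \<Psi>" "ccont2 \<Psi>x" "ccont2 \<Psi>y" using adm by (auto simp: admissible_def)
  have G1: "0 \<le> G 1" by (rule integral_nonneg) (auto intro: f_nonneg integrable_continuous_real f_cont)
  have G0: "G 0 = 0" by simp
  define R where "R = Sint (\<lambda>x y t. cut k (x - c * t) *
          (v\<^sup>2 / \<kappa> * \<Psi> x y * f (T x y t) * f (T x y t)
           - \<kappa> * f (T x y t) * (\<Psi>x x y * Tx x y t + \<Psi>y x y * Ty x y t)
           - \<kappa> * \<Psi> x y * f' (T x y t) * ((Tx x y t)\<^sup>2 + (Ty x y t)\<^sup>2)))"
  define W where "W = Sint (\<lambda>x y t. (cut1 k (x - c * t) * (c * \<Psi> x y - \<Psi> x y * u1 x y - \<kappa> * \<Psi>x x y)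
           - \<kappa> * \<Psi> x y * cut2 k (x - c * t)) * G (T x y t))"
  have id: "integral (slab 0 H) (\<lambda>(x, y). (\<Psi> (x + c * \<tau>) y - \<Psi> x y) * (cut k x * G (T x y 0))) + W = R"
    unfolding W_def R_def boundary_shift(1)[OF c\<Psi>(1) G_cont, symmetric]
    by (rule weak_identity[OF adm DERIV_G f_der f'_cont DERIV_cut DERIV_cut1 cont_cut2 cut_supp])
  have W: "\<bar>W - G 1 * (c * Sint (\<lambda>x y t. wt (x - c * t + real k * p) * \<Psi> x y) - \<tau> * F)\<bar>
      \<le> (\<bar>c\<bar> + Mu + \<kappa> * (B * v / \<kappa>) + \<kappa>) * werr G k"
    unfolding W_def by (rule window_identity[OF adm F b(1,2) Mu G_cont G0])
  have wts: "\<bar>Sint (\<lambda>x y t. wt (x - c * t + real k * p) * \<Psi> x y)\<bar> \<le> H * \<tau>"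
  proof -
    have "\<bar>Sint (\<lambda>x y t. wt (x - c * t + real k * p) * \<Psi> x y)\<bar> \<le> Sint (\<lambda>x y t. wt (x - c * t + real k * p) * 1)"
    proof (rule Sint_abs_le)
      show "tame (\<lambda>x y t. wt (x - c * t + real k * p) * \<Psi> x y)"
        by (rule tame_wt(1)[OF ccont_of_ccont2[OF c\<Psi>(1)]])
      show "tame (\<lambda>x y t. wt (x - c * t + real k * p) * 1)"
        by (rule tame_wt(1)) (rule continuous_on_const)
      fix x y t :: real assume "y \<in> {0..H}"
      then show "\<bar>wt (x - c * t + real k * p) * \<Psi> x y\<bar> \<le> wt (x - c * t + real k * p) * 1"
        unfolding abs_mult using b(1) wt_nonneg by (auto intro!: mult_mono simp del: mult_1_right)
    qed
    then show ?thesis using Sint_wt[of "real k * p"] by simp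
  qed
  have R: "\<bar>R\<bar> \<le> (Mf + B * (1 + Mf) + Mf') * Sint (\<lambda>x y t. cut k (x - c * t) * energy x y t)"
  proof -
    have "\<bar>R\<bar> \<le> Sint (\<lambda>x y t. (Mf + B * (1 + Mf) + Mf') * (cut k (x - c * t) * energy x y t))"
      unfolding R_def
    proof (rule Sint_abs_le[OF _ bsupp_cont_cmult[OF tame_cut(1)[OF cont_energy]]])
      show "tame (\<lambda>x y t. cut k (x - c * t) *
          (v\<^sup>2 / \<kappa> * \<Psi> x y * f (T x y t) * f (T x y t)
           - \<kappa> * f (T x y t) * (\<Psi>x x y * Tx x y t + \<Psi>y x y * Ty x y t)
           - \<kappa> * \<Psi> x y * f' (T x y t) * ((Tx x y t)\<^sup>2 + (Ty x y t)\<^sup>2)))"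
        by (rule tame_cut(1), intro continuous_intros cont_T ccont_comp_T f_cont f'_cont c\<Psi>[THEN ccont_of_ccont2])
      fix x y t assume yt: "y \<in> {0..H}" "t \<in> {0..\<tau>}"
      define e where "e = f (T x y t)"
      define g where "g = (Tx x y t)\<^sup>2 + (Ty x y t)\<^sup>2"
      have e: "0 \<le> e" "e \<le> Mf" "\<bar>f' (T x y t)\<bar> \<le> Mf'"
        using f_nonneg Mf range_T[OF yt, of x] by (auto simp: e_def)
      have g: "0 \<le> g" by (simp add: g_def)
      have en: "energy x y t = \<kappa> * g + v\<^sup>2 / \<kappa> * e" by (simp add: energy_def g_def e_def)
      have n: "0 \<le> \<kappa> * g" "0 \<le> v\<^sup>2 / \<kappa> * e" using pos e g by auto
      have B0: "0 \<le> B * v / \<kappa>" using b(2)[of 0 0] pos by force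
      then have B0: "0 \<le> B" using pos by (simp add: zero_le_divide_iff zero_le_mult_iff)
      have a1: "\<bar>v\<^sup>2 / \<kappa> * \<Psi> x y * e * e\<bar> \<le> Mf * energy x y t"
      proof -
        have "\<bar>v\<^sup>2 / \<kappa> * \<Psi> x y * e * e\<bar> = v\<^sup>2 / \<kappa> * e * (\<bar>\<Psi> x y\<bar> * e)"
          using e pos by (simp add: abs_mult mult_ac)
        also have "\<dots> \<le> v\<^sup>2 / \<kappa> * e * (1 * Mf)"
          using n(2) b(1)[OF yt(1)] e by (intro mult_left_mono mult_mono) auto
        also have "\<dots> \<le> Mf * energy x y t"
          unfolding en using n e by (simp add: algebra_simps)
        finally show ?thesis .
      qed
      have a2: "\<bar>\<kappa> * e * (\<Psi>x x y * Tx x y t + \<Psi>y x y * Ty x y t)\<bar> \<le> B * (1 + Mf) * energy x y t"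
      proof -
        have "\<bar>\<Psi>x x y * Tx x y t + \<Psi>y x y * Ty x y t\<bar> \<le> B * v / \<kappa> * (\<bar>Tx x y t\<bar> + \<bar>Ty x y t\<bar>)"
          unfolding distrib_left using b(2,3)[OF yt(1), of x]
          by (intro order_trans[OF abs_triangle_ineq] add_mono) (simp_all only: abs_mult mult_right_mono abs_ge_zero)
        then have "\<kappa> * e * \<bar>\<Psi>x x y * Tx x y t + \<Psi>y x y * Ty x y t\<bar>
            \<le> \<kappa> * e * (B * v / \<kappa> * (\<bar>Tx x y t\<bar> + \<bar>Ty x y t\<bar>))"
          using e pos by (intro mult_left_mono) auto
        also have "\<dots> = B * (v * f (T x y t) * (\<bar>Tx x y t\<bar> + \<bar>Ty x y t\<bar>))"
          using pos by (simp add: e_def)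
        also have "\<dots> \<le> B * ((1 + Mf) * energy x y t)"
          using young_energy[OF yt Mf(1)] B0 by (intro mult_left_mono) auto
        finally show ?thesis using e pos by (simp add: abs_mult mult_ac)
      qed
      have a3: "\<bar>\<kappa> * \<Psi> x y * f' (T x y t) * g\<bar> \<le> Mf' * energy x y t"
      proof -
        have "\<bar>\<kappa> * \<Psi> x y * f' (T x y t) * g\<bar> = \<kappa> * g * (\<bar>\<Psi> x y\<bar> * \<bar>f' (T x y t)\<bar>)"
          using g pos by (simp add: abs_mult mult_ac)
        also have "\<dots> \<le> \<kappa> * g * (1 * Mf')"
          using n(1) b(1)[OF yt(1)] e by (intro mult_left_mono mult_mono) auto
        also have "\<dots> \<le> Mf' * energy x y t"
        proof -
          have "0 \<le> Mf'" using e(3) by simp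
          then have "0 \<le> Mf' * (v\<^sup>2 / \<kappa> * e)" using n(2) by (rule mult_nonneg_nonneg)
          then show ?thesis unfolding en distrib_left by (simp add: mult.commute)
        qed
        finally show ?thesis .
      qed
      have "\<bar>v\<^sup>2 / \<kappa> * \<Psi> x y * e * e - \<kappa> * e * (\<Psi>x x y * Tx x y t + \<Psi>y x y * Ty x y t)
          - \<kappa> * \<Psi> x y * f' (T x y t) * g\<bar> \<le> Mf * energy x y t + B * (1 + Mf) * energy x y t + Mf' * energy x y t"
        using a1 a2 a3 by linarith
      also have "\<dots> = (Mf + B * (1 + Mf) + Mf') * energy x y t" by (simp only: distrib_right)
      finally have "cut k (x - c * t) * \<bar>v\<^sup>2 / \<kappa> * \<Psi> x y * e * e - \<kappa> * e * (\<Psi>x x y * Tx x y t + \<Psi>y x y * Ty x y t)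
          - \<kappa> * \<Psi> x y * f' (T x y t) * g\<bar> \<le> cut k (x - c * t) * ((Mf + B * (1 + Mf) + Mf') * energy x y t)"
        using cut_range by (intro mult_left_mono) auto
      then show "\<bar>cut k (x - c * t) * (v\<^sup>2 / \<kappa> * \<Psi> x y * f (T x y t) * f (T x y t)
           - \<kappa> * f (T x y t) * (\<Psi>x x y * Tx x y t + \<Psi>y x y * Ty x y t)
           - \<kappa> * \<Psi> x y * f' (T x y t) * ((Tx x y t)\<^sup>2 + (Ty x y t)\<^sup>2))\<bar>
         \<le> (Mf + B * (1 + Mf) + Mf') * (cut k (x - c * t) * energy x y t)"
        using cut_range by (simp add: abs_mult e_def g_def mult.left_commute)
    qed
    then show ?thesis by simp
  qed
  have "\<bar>G 1 * (c * Sint (\<lambda>x y t. wt (x - c * t + real k * p) * \<Psi> x y))\<bar> \<le> G 1 * (c * (H * \<tau>))"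
    unfolding abs_mult using G1 speed_nonneg wts by (intro mult_mono) (auto intro!: mult_left_mono)
  moreover have "\<bar>G 1 * (\<tau> * F)\<bar> = \<tau> * G 1 * \<bar>F\<bar>" using G1 pos by (simp add: abs_mult)
  moreover have "G 1 * (c * Sint (\<lambda>x y t. wt (x - c * t + real k * p) * \<Psi> x y) - \<tau> * F)
     = G 1 * (c * Sint (\<lambda>x y t. wt (x - c * t + real k * p) * \<Psi> x y)) - G 1 * (\<tau> * F)"
    by (rule right_diff_distrib)
  moreover have "G 1 * (c * (H * \<tau>)) = G 1 * c * (H * \<tau>)" by simp
  ultimately show ?thesis using id W R by linarith
qed

text \<open>Translates of \<Psi> by q = c \<tau> are admissible because q is a multiple of the
  period of the flow. They obey the same bounds and have the same flux, since the flux does not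
  depend on x. So their averages may replace \<Psi> in \<open>flux_estimate\<close>, and only the
  boundary term changes.\<close>

theorem flux_bound:
  assumes adm: "admissible \<Psi> \<Psi>x \<Psi>y"
    and F: "\<And>x. integral {0..H} (\<lambda>y. \<Psi> x y * u1 x y) = F"
    and b: "\<And>x y. y \<in> {0..H} \<Longrightarrow> \<bar>\<Psi> x y\<bar> \<le> 1"
      "\<And>x y. y \<in> {0..H} \<Longrightarrow> \<bar>\<Psi>x x y\<bar> \<le> B * v / \<kappa>"
      "\<And>x y. y \<in> {0..H} \<Longrightarrow> \<bar>\<Psi>y x y\<bar> \<le> B * v / \<kappa>"
    and Mf: "\<And>s. s \<in> {0..1} \<Longrightarrow> f s \<le> Mf" "\<And>s. s \<in> {0..1} \<Longrightarrow> \<bar>f' s\<bar> \<le> Mf'"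
  shows "G 1 * \<bar>F\<bar> \<le> (G 1 + 3 / 2 * (Mf + B * (1 + Mf) + Mf')) * c * H"
proof -
  obtain Mu where Mu: "Mu \<ge> 0" "\<And>x y. y \<in> {0..H} \<Longrightarrow> \<bar>u1 x y\<bar> \<le> Mu" by (rule u1_bounded) blast
  obtain \<epsilon> where \<epsilon>: "\<epsilon> \<longlonglongrightarrow> 0"
    "\<And>k. Sint (\<lambda>x y t. cut k (x - c * t) * energy x y t) \<le> 3 / 2 * (c * \<tau> * H) + \<epsilon> k"
    by (rule energy_bound) blast
  have "0 \<le> B * v / \<kappa>" using b(2)[of 0 0] pos by force
  then have B0: "0 \<le> B" using pos by (simp add: zero_le_divide_iff zero_le_mult_iff)
  have "0 \<le> Mf" "0 \<le> Mf'" using Mf[of 0] f_nonneg[of 0] by auto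
  define C where "C = Mf + B * (1 + Mf) + Mf'"
  have C: "0 \<le> C" using B0 \<open>0 \<le> Mf\<close> \<open>0 \<le> Mf'\<close> by (simp add: C_def)
  define M where "M = \<bar>c\<bar> + Mu + \<kappa> * (B * v / \<kappa>) + \<kappa>"
  define q where "q = c * \<tau>"
  text \<open>Averaging over translates makes the boundary term small, although the test function
    itself need not be periodic in \<open>x\<close>.\<close>
  define av where "av = (\<lambda>N (\<Phi> :: real \<Rightarrow> real \<Rightarrow> real) x y. (\<Sum>i<N. \<Phi> (x + real i * q) y) / real N)"
  have c\<Psi>: "ccont2 \<Psi>" "ccont2 \<Psi>x" "ccont2 \<Psi>y" using adm by (auto simp: admissible_def)
  have cs: "ccont2 \<Phi> \<Longrightarrow> ccont2 (\<lambda>x y. \<Phi> (x + r) y)" for \<Phi> r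
    by (rule boundary_shift(3)[OF _ G_cont])
  have cav: "ccont2 \<Phi> \<Longrightarrow> ccont2 (av N \<Phi>)" for \<Phi> N
    unfolding av_def divide_inverse by (intro continuous_on_mult continuous_on_sum continuous_on_const cs)
  have bav: "\<bar>av N \<Phi> x y\<bar> \<le> M" if "\<And>x. \<bar>\<Phi> x y\<bar> \<le> M" "N > 0" for N \<Phi> x y M
  proof -
    have "\<bar>\<Sum>i<N. \<Phi> (x + real i * q) y\<bar> \<le> (\<Sum>i<N. \<bar>\<Phi> (x + real i * q) y\<bar>)" by (rule sum_abs)
    also have "\<dots> \<le> (\<Sum>i<N. M)" using that by (intro sum_mono) auto
    finally show ?thesis using that by (simp add: av_def field_simps)
  qed
  have uq: "u1 (x + real i * q) y = u1 x y" "u2 (x + real i * q) y = u2 x y" if "y \<in> {0..H}" for x y i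
    using per_u_int[OF that, of x "int i * m"] by (simp_all add: q_def c\<tau> mult.assoc)
  have adm': "admissible (av N \<Psi>) (av N \<Psi>x) (av N \<Psi>y)" for N
    unfolding admissible_def
  proof (intro conjI allI ballI cav c\<Psi>)
    fix x y assume y: "y \<in> {0..H}"
    show "((\<lambda>r. av N \<Psi> r y) has_real_derivative av N \<Psi>x x y) (at x)"
    proof -
      have "((\<lambda>r. \<Psi> (r + real i * q) y) has_real_derivative \<Psi>x (x + real i * q) y) (at x)" for i
      proof -
        have "((\<lambda>r. \<Psi> r y) has_real_derivative \<Psi>x (x + real i * q) y) (at (x + real i * q))"
          using adm y by (simp add: admissible_def)
        from DERIV_chain2[OF this DERIV_add[OF DERIV_ident DERIV_const]] show ?thesis by simp
      qed
      then show ?thesis unfolding av_def by (intro DERIV_cdivide DERIV_sum)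
    qed
    show "((\<lambda>r. av N \<Psi> x r) has_real_derivative av N \<Psi>y x y) (at y within {0..H})"
      unfolding av_def using adm y by (intro DERIV_cdivide DERIV_sum) (auto simp: admissible_def)
    have "u1 x y * \<Psi>x (x + real i * q) y + u2 x y * \<Psi>y (x + real i * q) y = 0" for i
      using adm y uq[OF y, of x i] unfolding admissible_def by metis
    then have "(\<Sum>i<N. u1 x y * \<Psi>x (x + real i * q) y + u2 x y * \<Psi>y (x + real i * q) y) = 0" by simp
    then have "u1 x y * (\<Sum>i<N. \<Psi>x (x + real i * q) y) + u2 x y * (\<Sum>i<N. \<Psi>y (x + real i * q) y) = 0"
      by (simp add: sum.distrib sum_distrib_left)
    then show "u1 x y * av N \<Psi>x x y + u2 x y * av N \<Psi>y x y = 0"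
      unfolding av_def by (simp add: add_divide_distrib[symmetric])
  next
    fix x show "av N \<Psi> x 0 = av N \<Psi> x H" using adm by (simp add: admissible_def av_def)
  qed
  have F': "integral {0..H} (\<lambda>y. av N \<Psi> x y * u1 x y) = F" if N: "N > 0" for N x
  proof -
    have int: "((\<lambda>y. \<Psi> x y * u1 x y) has_integral F) {0..H}" for x
    proof -
      have "ccont2 (\<lambda>x y. \<Psi> x y * u1 x y)" by (intro continuous_intros c\<Psi> cont_u)
      then have "continuous_on {0..H} (\<lambda>y. (\<lambda>z. \<Psi> (fst z) (snd z) * u1 (fst z) (snd z)) (x, y))"
        by (rule continuous_on_compose2) (auto intro!: continuous_intros)
      then show ?thesis using F[of x] integrable_integral[OF integrable_continuous_real] by fastforce
    qed
    have "((\<lambda>y. (\<Sum>i<N. \<Psi> (x + real i * q) y * u1 (x + real i * q) y) / real N) has_integral (\<Sum>i<N. F) / real N) {0..H}"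
      by (intro has_integral_divide has_integral_sum int finite_lessThan)
    moreover have "(\<Sum>i<N. \<Psi> (x + real i * q) y * u1 (x + real i * q) y) / real N = av N \<Psi> x y * u1 x y" if "y \<in> {0..H}" for y
      by (simp add: av_def uq[OF that] sum_distrib_right)
    ultimately have "((\<lambda>y. av N \<Psi> x y * u1 x y) has_integral (\<Sum>i<N. F) / real N) {0..H}"
      using has_integral_eq by (metis (no_types, lifting))
    then show ?thesis using N by (simp add: integral_unique)
  qed
  have bd: "\<bar>integral (slab 0 H) (\<lambda>(x, y). (av N \<Psi> (x + c * \<tau>) y - av N \<Psi> x y) * (cut k x * G (T x y 0)))\<bar>
     \<le> 2 / real N * integral (slab 0 H) (\<lambda>z. \<bar>(\<lambda>(x, y). cut k x * G (T x y 0)) z\<bar>)" if N: "N > 0" for N k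
  proof -
    have bc: "bsupp_cont 0 H (\<lambda>(x, y). cut k x * G (T x y 0))" by (rule boundary_shift(2)[OF c\<Psi>(1) G_cont])
    have "\<bar>integral (slab 0 H) (\<lambda>(x, y). (av N \<Psi> (x + c * \<tau>) y - av N \<Psi> x y) * (cut k x * G (T x y 0)))\<bar>
       \<le> integral (slab 0 H) (\<lambda>z. 2 / real N * \<bar>(\<lambda>(x, y). cut k x * G (T x y 0)) z\<bar>)"
    proof (subst real_norm_def[symmetric], rule integral_norm_bound_integral)
      have "continuous_on (slab 0 H) (\<lambda>z. av N \<Psi> (fst z + c * \<tau>) (snd z) - av N \<Psi> (fst z) (snd z))"
        by (intro continuous_on_diff cav cs c\<Psi>)
      from bsupp_cont_integrable[OF bsupp_cont_mult(2)[OF bc this]]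
      show "(\<lambda>(x, y). (av N \<Psi> (x + c * \<tau>) y - av N \<Psi> x y) * (cut k x * G (T x y 0))) integrable_on slab 0 H"
        by (simp add: case_prod_unfold)
      show "(\<lambda>z. 2 / real N * \<bar>(\<lambda>(x, y). cut k x * G (T x y 0)) z\<bar>) integrable_on slab 0 H"
        by (rule bsupp_cont_integrable[OF bsupp_cont_cmult[OF bsupp_cont_abs[OF bc]]])
      fix z :: "real \<times> real" assume z: "z \<in> slab 0 H"
      obtain x y where xy: "z = (x, y)" by (cases z)
      have y: "y \<in> {0..H}" using z by (simp add: xy)
      \<comment> \<open>The sum telescopes: the two averages share all translates but one each,
        which leaves at most 2 / N.\<close>
      have "av N \<Psi> (x + c * \<tau>) y - av N \<Psi> x y = (\<Sum>i<N. \<Psi> (x + real (Suc i) * q) y - \<Psi> (x + real i * q) y) / real N"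
        by (simp add: av_def diff_divide_distrib sum_subtractf q_def algebra_simps)
      also have "\<dots> = (\<Psi> (x + real N * q) y - \<Psi> x y) / real N"
        using sum_lessThan_telescope[of "\<lambda>i. \<Psi> (x + real i * q) y" N] by simp
      finally have "\<bar>av N \<Psi> (x + c * \<tau>) y - av N \<Psi> x y\<bar> \<le> 2 / real N"
        using b(1)[OF y, of x] b(1)[OF y, of "x + real N * q"] N by (simp add: divide_le_cancel)
      from mult_right_mono[OF this abs_ge_zero[of "cut k x * G (T x y 0)"]]
      show "norm (case z of (x, y) \<Rightarrow> (av N \<Psi> (x + c * \<tau>) y - av N \<Psi> x y) * (cut k x * G (T x y 0)))
         \<le> 2 / real N * \<bar>case z of (x, y) \<Rightarrow> cut k x * G (T x y 0)\<bar>"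
        unfolding real_norm_def xy prod.case abs_mult by simp
    qed
    then show ?thesis by simp
  qed
  have step1: "\<tau> * G 1 * \<bar>F\<bar> \<le> G 1 * c * (H * \<tau>) + M * werr G k + C * (3 / 2 * (c * \<tau> * H) + \<epsilon> k)" for k
  proof -
    \<comment> \<open>Finite for each k but growing with the support of the cutoff; hence N tends to
      infinity at fixed k, and only afterwards k does.\<close>
    define K where "K = integral (slab 0 H) (\<lambda>z. \<bar>(\<lambda>(x, y). cut k x * G (T x y 0)) z\<bar>)"
    have "\<tau> * G 1 * \<bar>F\<bar> \<le> G 1 * c * (H * \<tau>) + 2 * K / real N + M * werr G k + C * (3 / 2 * (c * \<tau> * H) + \<epsilon> k)"
      if N: "N > 0" for N
    proof -
      have "\<tau> * G 1 * \<bar>F\<bar> \<le> G 1 * c * (H * \<tau>)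
       + \<bar>integral (slab 0 H) (\<lambda>(x, y). (av N \<Psi> (x + c * \<tau>) y - av N \<Psi> x y) * (cut k x * G (T x y 0)))\<bar>
       + M * werr G k + C * Sint (\<lambda>x y t. cut k (x - c * t) * energy x y t)"
        unfolding M_def C_def
        by (rule flux_estimate[OF adm' F'[OF N] _ _ _ Mf Mu]) (rule bav[OF _ N], erule b)+
      moreover have "C * Sint (\<lambda>x y t. cut k (x - c * t) * energy x y t) \<le> C * (3 / 2 * (c * \<tau> * H) + \<epsilon> k)"
        by (rule mult_left_mono[OF \<epsilon>(2) C])
      moreover have "2 / real N * K = 2 * K / real N" by simp
      ultimately show ?thesis using bd[OF N, of k] unfolding K_def by linarith
    qed
    then have le: "\<And>N. \<tau> * G 1 * \<bar>F\<bar> \<le> G 1 * c * (H * \<tau>) + 2 * K / real (Suc N) + M * werr G k + C * (3 / 2 * (c * \<tau> * H) + \<epsilon> k)"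
      by blast
    have "(\<lambda>N. 2 * K * inverse (real (Suc N))) \<longlonglongrightarrow> 2 * K * 0"
      by (intro tendsto_intros LIMSEQ_inverse_real_of_nat)
    then have "(\<lambda>N. 2 * K / real (Suc N)) \<longlonglongrightarrow> 0"
      by (simp add: divide_inverse)
    then have "(\<lambda>N. G 1 * c * (H * \<tau>) + 2 * K / real (Suc N) + M * werr G k + C * (3 / 2 * (c * \<tau> * H) + \<epsilon> k))
       \<longlonglongrightarrow> G 1 * c * (H * \<tau>) + 0 + M * werr G k + C * (3 / 2 * (c * \<tau> * H) + \<epsilon> k)"
      by (intro tendsto_intros)
    from LIMSEQ_le_const[OF this] le show ?thesis by auto
  qed
  have "(\<lambda>k. G 1 * c * (H * \<tau>) + M * werr G k + C * (3 / 2 * (c * \<tau> * H) + \<epsilon> k))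
     \<longlonglongrightarrow> G 1 * c * (H * \<tau>) + M * 0 + C * (3 / 2 * (c * \<tau> * H) + 0)"
    by (intro tendsto_intros werr_limit[OF G_cont] \<epsilon>)
  from LIMSEQ_le_const[OF this] step1
  have "\<tau> * G 1 * \<bar>F\<bar> \<le> G 1 * c * (H * \<tau>) + M * 0 + C * (3 / 2 * (c * \<tau> * H) + 0)" by blast
  then have "(G 1 * \<bar>F\<bar>) * \<tau> \<le> ((G 1 + 3 / 2 * C) * c * H) * \<tau>" by (simp add: algebra_simps)
  then show ?thesis unfolding C_def using pos by (simp add: mult_le_cancel_right)
qed

end

section \<open>Change of variables in the plane\<close>

text \<open>Transport between pairs and \<open>real^2\<close>, on which the change of variables
  formula is stated with the determinant of a matrix.\<close>

definition of_vec2 :: "real^2 \<Rightarrow> real \<times> real" where "of_vec2 v = (v $ 1, v $ 2)"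

definition to_vec2 :: "real \<times> real \<Rightarrow> real^2" where "to_vec2 z = vector [fst z, snd z]"

lemma vec2_inverse [simp]: "of_vec2 (to_vec2 z) = z" "to_vec2 (of_vec2 v) = v"
  by (simp_all add: of_vec2_def to_vec2_def vec_eq_iff forall_2)

lemma bounded_linear_of_vec2: "bounded_linear of_vec2"
  unfolding of_vec2_def by (intro bounded_linear_Pair bounded_linear_vec_nth)

lemma linear_to_vec2: "linear to_vec2"
  by (rule linearI) (simp_all add: to_vec2_def vec_eq_iff forall_2)

lemma bounded_linear_to_vec2: "bounded_linear to_vec2"
  using linear_to_vec2 by (rule linear_conv_bounded_linear[THEN iffD1])

lemma measurable_of_vec2 [measurable]: "of_vec2 \<in> borel_measurable borel"
  by (intro borel_measurable_continuous_onI linear_continuous_on bounded_linear_of_vec2)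

text \<open>Both measures assign to a box the product of its sides, and this characterises Lebesgue
  measure.\<close>

lemma distr_of_vec2: "distr lborel borel of_vec2 = (lborel :: (real \<times> real) measure)"
proof (rule lborel_eqI[symmetric])
  fix l w :: "real \<times> real" assume le: "\<And>b. b \<in> Basis \<Longrightarrow> l \<bullet> b \<le> w \<bullet> b"
  have le1: "fst l \<le> fst w" "snd l \<le> snd w"
    using le[of "(1, 0)"] le[of "(0, 1)"] by (simp_all add: Basis_prod_def inner_prod_def)
  have b: "of_vec2 -` box l w = box (to_vec2 l) (to_vec2 w)"
    by (auto simp: of_vec2_def to_vec2_def mem_box_cart mem_box Basis_prod_def inner_prod_def forall_2)
  have B: "(Basis :: (real^2) set) = {axis 1 1, axis 2 1}"
    by (auto simp: Basis_vec_def UNIV_2)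
  have ne: "axis 1 (1::real) \<noteq> (axis 2 1 :: real^2)"
    by (simp add: axis_eq_axis)
  have BP: "(Basis :: (real \<times> real) set) = {(1, 0), (0, 1)}"
    by (auto simp: Basis_prod_def)
  have "emeasure (distr lborel borel of_vec2) (box l w) = emeasure lborel (box (to_vec2 l) (to_vec2 w))"
    by (subst emeasure_distr) (auto simp: b)
  also have "\<dots> = ennreal (\<Prod>b\<in>Basis. (to_vec2 w - to_vec2 l) \<bullet> b)"
    using le1 by (intro emeasure_lborel_box) (auto simp: B inner_axis to_vec2_def)
  also have "(\<Prod>b\<in>Basis. (to_vec2 w - to_vec2 l) \<bullet> b) = (\<Prod>b\<in>Basis. (w - l) \<bullet> b)"
    unfolding B BP using ne by (simp add: inner_axis to_vec2_def inner_prod_def)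
  finally show "emeasure (distr lborel borel of_vec2) (box l w) = ennreal (\<Prod>b\<in>Basis. (w - l) \<bullet> b)" .
qed simp

definition jacobian :: "(real \<times> real \<Rightarrow> real \<times> real) \<Rightarrow> real" where
  "jacobian L = fst (L (1, 0)) * snd (L (0, 1)) - fst (L (0, 1)) * snd (L (1, 0))"

lemma integrable_of_vec2:
  fixes h :: "real \<times> real \<Rightarrow> real"
  assumes "h \<in> borel_measurable borel"
  shows "integrable lborel h \<longleftrightarrow> integrable lborel (\<lambda>v. h (of_vec2 v))"
    and "integral\<^sup>L lborel h = integral\<^sup>L lborel (\<lambda>v. h (of_vec2 v))"
  using integrable_distr_eq[of of_vec2 lborel borel h] integral_distr[of of_vec2 lborel borel h] assms
  by (simp_all add: distr_of_vec2)

text \<open>For Borel integrands passing to the completion changes neither integrability nor the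
  integral. This links the change of variables formula on Lebesgue sets with product measure
  arguments on \<open>lborel\<close>.\<close>

lemma absolutely_integrable_lborel:
  fixes h :: "'a::euclidean_space \<Rightarrow> real"
  assumes "(\<lambda>z. indicator S z * h z) \<in> borel_measurable borel"
  shows "h absolutely_integrable_on S \<longleftrightarrow> integrable lborel (\<lambda>z. indicator S z * h z)"
    and "integrable lborel (\<lambda>z. indicator S z * h z) \<Longrightarrow> integral S h = integral\<^sup>L lborel (\<lambda>z. indicator S z * h z)"
proof -
  show 1: "h absolutely_integrable_on S \<longleftrightarrow> integrable lborel (\<lambda>z. indicator S z * h z)"
    unfolding set_integrable_def using assms by (simp add: integrable_completion)
  assume "integrable lborel (\<lambda>z. indicator S z * h z)"
  then have "h absolutely_integrable_on S" using 1 by simp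
  then have "integral S h = (LINT z:S|lebesgue. h z)" by (simp add: set_lebesgue_integral_eq_integral)
  also have "\<dots> = integral\<^sup>L lborel (\<lambda>z. indicator S z * h z)"
    unfolding set_lebesgue_integral_def using assms by (simp add: integral_completion)
  finally show "integral S h = integral\<^sup>L lborel (\<lambda>z. indicator S z * h z)" .
qed

text \<open>Integrability is assumed on the image and deduced on the chart. In this direction
  finiteness of an area in the plane becomes control of the coordinates as \<xi> tends to
  infinity.\<close>

theorem change_of_variables_plane:
  fixes g :: "real \<times> real \<Rightarrow> real \<times> real" and f :: "real \<times> real \<Rightarrow> real"
  assumes S: "S \<in> sets borel"
    and g: "\<And>x. x \<in> S \<Longrightarrow> (g has_derivative g' x) (at x within S)" and inj: "inj_on g S"
    and mf: "(\<lambda>z. indicator (g ` S) z * f z) \<in> borel_measurable borel"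
    and mg: "(\<lambda>x. indicator S x * (\<bar>jacobian (g' x)\<bar> * f (g x))) \<in> borel_measurable borel"
    and int: "integrable lborel (\<lambda>z. indicator (g ` S) z * f z)"
  shows "integrable lborel (\<lambda>x. indicator S x * (\<bar>jacobian (g' x)\<bar> * f (g x)))"
    and "integral\<^sup>L lborel (\<lambda>x. indicator S x * (\<bar>jacobian (g' x)\<bar> * f (g x)))
      = integral\<^sup>L lborel (\<lambda>z. indicator (g ` S) z * f z)"
proof -
  define S' where "S' = of_vec2 -` S"
  define G where "G = (\<lambda>v. to_vec2 (g (of_vec2 v)))"
  define G' where "G' = (\<lambda>v w. to_vec2 (g' (of_vec2 v) (of_vec2 w)))"
  have S': "S' \<in> sets lebesgue"
    using measurable_sets_borel[OF measurable_of_vec2 S] by (simp add: S'_def)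
  have GS: "G ` S' = of_vec2 -` (g ` S)"
  proof (intro equalityI subsetI)
    fix v assume "v \<in> of_vec2 -` (g ` S)"
    then obtain z where "z \<in> S" "of_vec2 v = g z" by blast
    then have "to_vec2 z \<in> S'" "v = G (to_vec2 z)"
      unfolding S'_def G_def by (metis vec2_inverse(1) vimageI, metis vec2_inverse)
    then show "v \<in> G ` S'" by blast
  qed (auto simp: G_def S'_def)
  have der: "(G has_derivative G' v) (at v within S')" if "v \<in> S'" for v
  proof -
    have 1: "(of_vec2 has_derivative of_vec2) (at v within S')"
      by (rule bounded_linear_imp_has_derivative[OF bounded_linear_of_vec2])
    have 2: "(g has_derivative g' (of_vec2 v)) (at (of_vec2 v) within of_vec2 ` S')"
      using g[of "of_vec2 v"] that by (auto simp: S'_def intro: has_derivative_subset)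
    from bounded_linear.has_derivative[OF bounded_linear_to_vec2 diff_chain_within[OF 1 2]]
    show ?thesis by (simp add: G_def G'_def o_def)
  qed
  have injG: "inj_on G S'"
    using inj unfolding inj_on_def G_def S'_def by (metis vec2_inverse vimageE)
  have det: "det (matrix (G' v)) = jacobian (g' (of_vec2 v))" for v
    by (simp add: det_2 matrix_def G'_def jacobian_def to_vec2_def of_vec2_def axis_def)
  define b where "b = integral\<^sup>L lborel (\<lambda>z. indicator (g ` S) z * f z)"
  have "(\<lambda>v. indicator (g ` S) (of_vec2 v) * f (of_vec2 v)) \<in> borel_measurable borel"
    using measurable_compose[OF measurable_of_vec2 mf] by simp
  then have mfv: "(\<lambda>v. indicator (G ` S') v * f (of_vec2 v)) \<in> borel_measurable borel"
    unfolding GS by (simp add: indicator_vimage)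
  have "integrable lborel (\<lambda>v. indicator (G ` S') v * f (of_vec2 v))"
    and bv: "b = integral\<^sup>L lborel (\<lambda>v. indicator (G ` S') v * f (of_vec2 v))"
    using integrable_of_vec2[OF mf] int unfolding GS b_def by (simp_all add: indicator_vimage)
  then have A: "(\<lambda>v. f (of_vec2 v)) absolutely_integrable_on G ` S'"
    "integral (G ` S') (\<lambda>v. f (of_vec2 v)) = b"
    using absolutely_integrable_lborel[OF mfv] by simp_all
  \<comment> \<open>The formula is for vector-valued integrands, so the scalar one is viewed in
    \<open>real^1\<close>.\<close>
  have "(\<lambda>v. vec (f (of_vec2 v)) :: real^1) absolutely_integrable_on G ` S' \<and>
      integral (G ` S') (\<lambda>v. vec (f (of_vec2 v)) :: real^1) = vec b"
    using A by (simp add: absolutely_integrable_on_1_iff integral_on_1_eq)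
  then have "(\<lambda>v. \<bar>det (matrix (G' v))\<bar> *\<^sub>R (vec (f (of_vec2 (G v))) :: real^1)) absolutely_integrable_on S' \<and>
      integral S' (\<lambda>v. \<bar>det (matrix (G' v))\<bar> *\<^sub>R (vec (f (of_vec2 (G v))) :: real^1)) = vec b"
    using has_absolute_integral_change_of_variables[OF S' der injG, of "\<lambda>v. vec (f (of_vec2 v)) :: real^1" "vec b"]
    by blast
  then have B: "(\<lambda>v. \<bar>jacobian (g' (of_vec2 v))\<bar> * f (g (of_vec2 v))) absolutely_integrable_on S'"
    "integral S' (\<lambda>v. \<bar>jacobian (g' (of_vec2 v))\<bar> * f (g (of_vec2 v))) = b"
    by (simp_all add: absolutely_integrable_on_1_iff integral_on_1_eq det G_def)
  have mgv: "(\<lambda>v. indicator S' v * (\<bar>jacobian (g' (of_vec2 v))\<bar> * f (g (of_vec2 v)))) \<in> borel_measurable borel"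
    using measurable_compose[OF measurable_of_vec2 mg] by (simp add: S'_def indicator_vimage)
  have C: "integrable lborel (\<lambda>v. indicator S' v * (\<bar>jacobian (g' (of_vec2 v))\<bar> * f (g (of_vec2 v))))"
    using absolutely_integrable_lborel(1)[OF mgv] B(1) by simp
  then show "integrable lborel (\<lambda>x. indicator S x * (\<bar>jacobian (g' x)\<bar> * f (g x)))"
    using integrable_of_vec2(1)[OF mg] by (simp add: S'_def indicator_vimage)
  have "integral\<^sup>L lborel (\<lambda>x. indicator S x * (\<bar>jacobian (g' x)\<bar> * f (g x)))
     = integral\<^sup>L lborel (\<lambda>v. indicator S' v * (\<bar>jacobian (g' (of_vec2 v))\<bar> * f (g (of_vec2 v))))"
    using integrable_of_vec2(2)[OF mg] by (simp add: S'_def indicator_vimage)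
  then show "integral\<^sup>L lborel (\<lambda>x. indicator S x * (\<bar>jacobian (g' x)\<bar> * f (g x)))
      = integral\<^sup>L lborel (\<lambda>z. indicator (g ` S) z * f z)"
    using absolutely_integrable_lborel(2)[OF mgv C] B(2) by (simp add: b_def)
qed

section \<open>Calculus lemmas\<close>

text \<open>Schwarz's theorem: two applications of the mean value theorem in either order express
  the same second difference over a small square by a value of \<open>fxy\<close> and by a value of
  \<open>fyx\<close>, each close to the value at the corner.\<close>

lemma mixed_partials_eq:
  fixes f fx fy fxy fyx :: "real \<Rightarrow> real \<Rightarrow> real"
  assumes V: "open V" "(a, b) \<in> V"
    and fx: "\<And>x y. (x, y) \<in> V \<Longrightarrow> ((\<lambda>r. f r y) has_real_derivative fx x y) (at x)"
    and fy: "\<And>x y. (x, y) \<in> V \<Longrightarrow> ((\<lambda>r. f x r) has_real_derivative fy x y) (at y)"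
    and fxy: "\<And>x y. (x, y) \<in> V \<Longrightarrow> ((\<lambda>r. fx x r) has_real_derivative fxy x y) (at y)"
    and fyx: "\<And>x y. (x, y) \<in> V \<Longrightarrow> ((\<lambda>r. fy r y) has_real_derivative fyx x y) (at x)"
    and cont: "continuous_on V (\<lambda>(x, y). fxy x y)" "continuous_on V (\<lambda>(x, y). fyx x y)"
  shows "fxy a b = fyx a b"
proof (rule ccontr)
  assume ne: "fxy a b \<noteq> fyx a b"
  define e where "e = \<bar>fxy a b - fyx a b\<bar> / 2"
  have e: "e > 0" using ne by (simp add: e_def)
  have ev1: "\<forall>\<^sub>F z in nhds (a, b). \<bar>(\<lambda>(x, y). fxy x y) z - fxy a b\<bar> < e"
    and ev2: "\<forall>\<^sub>F z in nhds (a, b). \<bar>(\<lambda>(x, y). fyx x y) z - fyx a b\<bar> < e"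
    using tendstoD[OF _ e, of "\<lambda>(x, y). fxy x y" "fxy a b" "nhds (a, b)"]
      tendstoD[OF _ e, of "\<lambda>(x, y). fyx x y" "fyx a b" "nhds (a, b)"]
      cont[unfolded continuous_on_eq_continuous_at[OF V(1)]] V(2)
    by (force simp: isCont_def tendsto_at_iff_tendsto_nhds dist_real_def)+
  have ev3: "\<forall>\<^sub>F z in nhds (a, b). z \<in> V" using V by (rule eventually_nhds_in_open)
  from eventually_conj[OF ev1 eventually_conj[OF ev2 ev3]] obtain d where d: "d > 0"
    and D: "\<And>z. dist z (a, b) < d \<Longrightarrow> \<bar>(\<lambda>(x, y). fxy x y) z - fxy a b\<bar> < e
      \<and> \<bar>(\<lambda>(x, y). fyx x y) z - fyx a b\<bar> < e \<and> z \<in> V"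
    unfolding eventually_nhds_metric by blast
  \<comment> \<open>With d / 3 the square of side s at (a, b) lies in the ball, as its points are at
    distance at most 2 d / 3.\<close>
  define s where "s = d / 3"
  have s: "s > 0" using d by (simp add: s_def)
  have near: "dist (x, y) (a, b) < d" if "a \<le> x" "x \<le> a + s" "b \<le> y" "y \<le> b + s" for x y
  proof -
    have "dist (x, y) (a, b) \<le> \<bar>x - a\<bar> + \<bar>y - b\<bar>"
      unfolding dist_prod_def by (simp add: dist_real_def sqrt_sum_squares_le_sum_abs)
    also have "\<dots> < d" using that s d by (simp add: s_def)
    finally show ?thesis .
  qed
  define \<Delta> where "\<Delta> = f (a + s) (b + s) - f (a + s) b - (f a (b + s) - f a b)"
  have "\<exists>x y. a \<le> x \<and> x \<le> a + s \<and> b \<le> y \<and> y \<le> b + s \<and> \<Delta> = s * (s * fxy x y)"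
  proof -
    have "\<exists>x>a. x < a + s \<and> (\<lambda>x. f x (b + s) - f x b) (a + s) - (\<lambda>x. f x (b + s) - f x b) a = (a + s - a) * (fx x (b + s) - fx x b)"
      using s D near by (intro MVT2) (auto intro!: DERIV_diff fx)
    then obtain x where x: "a < x" "x < a + s" "\<Delta> = s * (fx x (b + s) - fx x b)"
      by (auto simp: \<Delta>_def)
    have "\<exists>y>b. y < b + s \<and> fx x (b + s) - fx x b = (b + s - b) * fxy x y"
      using s D near x by (intro MVT2) (auto intro!: fxy)
    then show ?thesis using x by (metis add_diff_cancel_left' less_imp_le)
  qed
  then obtain x y where xy: "a \<le> x" "x \<le> a + s" "b \<le> y" "y \<le> b + s" "\<Delta> = s * (s * fxy x y)" by blast
  have "\<exists>x y. a \<le> x \<and> x \<le> a + s \<and> b \<le> y \<and> y \<le> b + s \<and> \<Delta> = s * (s * fyx x y)"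
  proof -
    have "\<exists>y>b. y < b + s \<and> (\<lambda>y. f (a + s) y - f a y) (b + s) - (\<lambda>y. f (a + s) y - f a y) b = (b + s - b) * (fy (a + s) y - fy a y)"
      using s D near by (intro MVT2) (auto intro!: DERIV_diff fy)
    then obtain y where y: "b < y" "y < b + s" "\<Delta> = s * (fy (a + s) y - fy a y)"
      by (auto simp: \<Delta>_def)
    have "\<exists>x>a. x < a + s \<and> fy (a + s) y - fy a y = (a + s - a) * fyx x y"
      using s D near y by (intro MVT2) (auto intro!: fyx)
    then show ?thesis using y by (metis add_diff_cancel_left' less_imp_le)
  qed
  then obtain x' y' where xy': "a \<le> x'" "x' \<le> a + s" "b \<le> y'" "y' \<le> b + s" "\<Delta> = s * (s * fyx x' y')" by blast
  have "fxy x y = fyx x' y'" using xy(5) xy'(5) s by simp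
  moreover have "\<bar>fxy x y - fxy a b\<bar> < e" using D[OF near[OF xy(1-4)]] by simp
  moreover have "\<bar>fyx x' y' - fyx a b\<bar> < e" using D[OF near[OF xy'(1-4)]] by simp
  ultimately show False unfolding e_def by (simp add: abs_if split: if_splits)
qed

lemma linear_prod_eq:
  fixes v :: "real \<times> real"
  assumes "linear L"
  shows "L v = fst v *\<^sub>R L (1, 0) + snd v *\<^sub>R L (0, 1)"
proof -
  have "v = fst v *\<^sub>R (1, 0) + snd v *\<^sub>R (0, 1)" by (cases v) simp
  then have "L v = L (fst v *\<^sub>R (1, 0) + snd v *\<^sub>R (0, 1))" by (rule arg_cong)
  then show ?thesis by (simp only: linear_add[OF assms] linear_scale[OF assms])
qed

lemma partials_within:
  fixes F :: "real \<times> real \<Rightarrow> real"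
  assumes F: "(F has_derivative B) (at (x, y) within S)"
  shows "(\<And>r. (r, y) \<in> S) \<Longrightarrow> ((\<lambda>r. F (r, y)) has_real_derivative B (1, 0)) (at x)"
    and "(\<And>r. r \<in> A \<Longrightarrow> (x, r) \<in> S) \<Longrightarrow> ((\<lambda>r. F (x, r)) has_real_derivative B (0, 1)) (at y within A)"
proof -
  have lin: "linear B" using F by (rule has_derivative_linear)
  have 1: "(\<lambda>r. B (r, 0)) = (*) (B (1, 0))"
  proof
    fix r show "B (r, 0) = B (1, 0) * r" using linear_prod_eq[OF lin, of "(r, 0)"] by simp
  qed
  have 2: "(\<lambda>r. B (0, r)) = (*) (B (0, 1))"
  proof
    fix r show "B (0, r) = B (0, 1) * r" using linear_prod_eq[OF lin, of "(0, r)"] by simp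
  qed
  show "((\<lambda>r. F (r, y)) has_real_derivative B (1, 0)) (at x)" if S: "\<And>r. (r, y) \<in> S"
  proof -
    have "((\<lambda>r. (r, y)) has_derivative (\<lambda>r. (r, 0))) (at x within UNIV)"
      by (intro has_derivative_Pair has_derivative_ident has_derivative_const)
    moreover have "(F has_derivative B) (at (x, y) within (\<lambda>r. (r, y)) ` UNIV)"
      using S by (intro has_derivative_subset[OF F]) auto
    ultimately show ?thesis
      unfolding has_field_derivative_def 1[symmetric] by (rule diff_chain_within[unfolded o_def])
  qed
  show "((\<lambda>r. F (x, r)) has_real_derivative B (0, 1)) (at y within A)" if S: "\<And>r. r \<in> A \<Longrightarrow> (x, r) \<in> S"
  proof -
    have "((\<lambda>r. (x, r)) has_derivative (\<lambda>r. (0, r))) (at y within A)"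
      by (intro has_derivative_Pair has_derivative_ident has_derivative_const)
    moreover have "(F has_derivative B) (at (x, y) within (\<lambda>r. (x, r)) ` A)"
      using S by (intro has_derivative_subset[OF F]) auto
    ultimately show ?thesis
      unfolding has_field_derivative_def 2[symmetric] by (rule diff_chain_within[unfolded o_def])
  qed
qed

lemma DERIV_line_real:
  fixes F :: "real \<times> real \<Rightarrow> real"
  assumes "(F has_derivative B) (at (x, y))"
  shows "((\<lambda>r. F (r, y)) has_real_derivative B (1, 0)) (at x)"
    and "((\<lambda>r. F (x, r)) has_real_derivative B (0, 1)) (at y)"
  using partials_within(1)[OF assms] partials_within(2)[OF assms, where A = UNIV] by simp_all

text \<open>F differs by a constant from the integral of F' over {..y}, which converges at both ends
  by dominated convergence. It is applied to the smoothed position along a streamline.\<close>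

lemma limits_of_integrable_derivative:
  fixes F F' :: "real \<Rightarrow> real"
  assumes F: "\<And>x. (F has_real_derivative F' x) (at x)" and cont: "continuous_on UNIV F'"
    and int: "integrable lborel F'"
  obtains Lp Lm where "(F \<longlongrightarrow> Lp) at_top" "(F \<longlongrightarrow> Lm) at_bot" "integral\<^sup>L lborel F' = Lp - Lm"
proof -
  define I where "I = (\<lambda>y. \<integral>x. indicator {..y} x *\<^sub>R F' x \<partial>lborel)"
  have top: "(I \<longlongrightarrow> integral\<^sup>L lborel F') at_top"
    unfolding I_def by (rule tendsto_integral_at_top[OF _ int]) simp
  have bot: "(I \<longlongrightarrow> 0) at_bot"
  proof -
    have "((\<lambda>t. \<integral>x. indicator {..-t} x *\<^sub>R F' x \<partial>lborel) \<longlongrightarrow> (\<integral>(x::real). (0::real) \<partial>lborel)) at_top"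
    proof (rule integral_dominated_convergence_at_top[where w = "\<lambda>x. norm (F' x)" and f = "\<lambda>x. 0"
          and s = "\<lambda>t x. indicator {..-t} x *\<^sub>R F' x" and M = lborel])
      show "\<forall>\<^sub>F t in at_top. AE x in lborel. norm (indicator {..-t} x *\<^sub>R F' x) \<le> norm (F' x)"
        by (auto intro!: always_eventually AE_I2 split: split_indicator)
      show "AE x in lborel. ((\<lambda>t. indicator {..-t} x *\<^sub>R F' x) \<longlongrightarrow> 0) at_top"
      proof (intro AE_I2)
        fix x :: real
        have "\<forall>\<^sub>F t in at_top. indicator {..-t} x *\<^sub>R F' x = 0"
          using eventually_gt_at_top[of "-x"] by eventually_elim (auto split: split_indicator)
        then show "((\<lambda>t. indicator {..-t} x *\<^sub>R F' x) \<longlongrightarrow> 0) at_top"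
          by (rule tendsto_eventually)
      qed
    qed (use int in auto)
    then show ?thesis unfolding I_def at_bot_mirror filterlim_filtermap by simp
  qed
  have FI: "F y - F 0 = I y - I 0" for y
  proof -
    have le: "F y - F x = I y - I x" if "x \<le> y" for x y
    proof -
      have "(\<integral>t. indicator {x..y} t *\<^sub>R F' t \<partial>lborel) = F y - F x"
        using that F by (intro integral_FTC_Icc)
          (auto simp: has_real_derivative_iff_has_vector_derivative[symmetric]
            intro: has_field_derivative_at_within continuous_on_subset[OF cont])
      moreover have "(\<integral>t. indicator {x..y} t *\<^sub>R F' t \<partial>lborel) = (\<integral>t. indicator {..y} t *\<^sub>R F' t - indicator {..x} t *\<^sub>R F' t \<partial>lborel)"
        using that AE_lborel_singleton[of x]
        by (intro integral_cong_AE) (use int in \<open>auto split: split_indicator\<close>)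
      moreover have "\<dots> = I y - I x"
        unfolding I_def using int by (intro Bochner_Integration.integral_diff integrable_mult_indicator) auto
      ultimately show ?thesis by simp
    qed
    show ?thesis using le[of 0 y] le[of y 0] by (cases "0 \<le> y") auto
  qed
  have eq: "F = (\<lambda>y. F 0 - I 0 + I y)" using FI by (auto simp: fun_eq_iff algebra_simps)
  have "(F \<longlongrightarrow> F 0 - I 0 + integral\<^sup>L lborel F') at_top"
    by (subst eq) (intro tendsto_intros top)
  moreover have "(F \<longlongrightarrow> F 0 - I 0 + 0) at_bot"
    by (subst eq) (intro tendsto_intros bot)
  ultimately show ?thesis by (rule that) simp
qed

section \<open>Geometry of a tube\<close>

text \<open>The sign is returned as a factor in {-1, 1}, ready to be taken out of an
  integral.\<close>

lemma constant_sign: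
  fixes g :: "'a::topological_space \<Rightarrow> real"
  assumes "connected S" "continuous_on S g" "\<And>q. q \<in> S \<Longrightarrow> g q \<noteq> 0"
  obtains \<sigma> where "\<sigma> \<in> {-1, 1 :: real}" "\<And>q. q \<in> S \<Longrightarrow> \<bar>g q\<bar> = \<sigma> * g q"
proof (cases "\<exists>q\<in>S. g q < 0")
  case True
  then obtain q where q: "q \<in> S" "g q < 0" by blast
  have "g q' < 0" if "q' \<in> S" for q'
  proof (rule ccontr)
    assume "\<not> g q' < 0"
    then have "0 \<in> g ` S"
      using connectedD_interval[OF connected_continuous_image[OF assms(2,1)], of "g q" "g q'" 0] q that by auto
    then show False using assms(3) by auto
  qed
  then have "\<bar>g q\<bar> = -1 * g q" if "q \<in> S" for q using that by fastforce
  then show ?thesis by (intro that[of "-1"]) auto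
next
  case False
  then have "\<bar>g q\<bar> = 1 * g q" if "q \<in> S" for q using that by fastforce
  then show ?thesis by (intro that[of 1]) auto
qed

text \<open>One tube without its bounding lines, so that \<open>V\<close> is open and all
  derivatives are two-sided. \<open>X\<close> is the inverse of the chart \<open>ch\<close>,
  \<open>rx\<close> and \<open>ry\<close> are the partial derivatives of \<rho>, and
  \<open>Gs\<close> stands for the supremum of E1 |u|. The assumptions \<open>disj\<close> and
  \<open>u_shift\<close> let both boundary conditions be treated as periodicity modulo H; under
  Neumann conditions they are met because \<open>V\<close> lies strictly between the walls.
  \<open>same_line\<close> says that points with the same \<rho> are on one trajectory.\<close>

locale tube_geometry =
  fixes u :: "real \<times> real \<Rightarrow> real \<times> real" and H K h c0 Gs :: real
    and X ch :: "real \<times> real \<Rightarrow> real \<times> real" and Ch :: "real \<times> real \<Rightarrow> real \<times> real \<Rightarrow> real \<times> real"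
    and Xr Xs :: "real \<times> real \<Rightarrow> real \<times> real" and e1 e2 :: "real \<times> real \<Rightarrow> real"
    and rx ry rxy ryx :: "real \<Rightarrow> real \<Rightarrow> real"
    and Q0 V :: "(real \<times> real) set"
  assumes Q0_def: "Q0 = {c0 - h<..<c0 + h} \<times> UNIV" and V_def: "V = X ` Q0"
    and pos: "0 < H" "0 < K" "0 < h" "0 \<le> Gs"
    and ch_X: "\<And>q. q \<in> Q0 \<Longrightarrow> ch (X q) = q"
    and X_der: "\<And>q. q \<in> Q0 \<Longrightarrow> (X has_derivative (\<lambda>v. fst v *\<^sub>R Xr q + snd v *\<^sub>R Xs q)) (at q)"
    and X_cont': "continuous_on Q0 Xr" "continuous_on Q0 Xs"
    and metric: "\<And>q. q \<in> Q0 \<Longrightarrow> (norm (Xr q))\<^sup>2 = (e1 q)\<^sup>2" "\<And>q. q \<in> Q0 \<Longrightarrow> (norm (Xs q))\<^sup>2 = (e2 q)\<^sup>2"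
      "\<And>q. q \<in> Q0 \<Longrightarrow> Xr q \<bullet> Xs q = 0"
    and e_lower: "\<And>q. q \<in> Q0 \<Longrightarrow> 1 / K \<le> e1 q" "\<And>q. q \<in> Q0 \<Longrightarrow> 1 / K \<le> e2 q"
    and ch_der: "\<And>z. z \<in> V \<Longrightarrow> (ch has_derivative Ch z) (at z)"
    and Ch_fst: "\<And>x y v. (x, y) \<in> V \<Longrightarrow> fst (Ch (x, y) v) = fst v * rx x y + snd v * ry x y"
    and r_diff: "\<And>z. z \<in> V \<Longrightarrow> (\<lambda>(x, y). rx x y) differentiable (at z)"
      "\<And>z. z \<in> V \<Longrightarrow> (\<lambda>(x, y). ry x y) differentiable (at z)"
    and rxy: "\<And>x y. (x, y) \<in> V \<Longrightarrow> ((\<lambda>r. rx x r) has_real_derivative rxy x y) (at y)"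
    and ryx: "\<And>x y. (x, y) \<in> V \<Longrightarrow> ((\<lambda>r. ry r y) has_real_derivative ryx x y) (at x)"
    and r_cont: "continuous_on V (\<lambda>(x, y). rxy x y)" "continuous_on V (\<lambda>(x, y). ryx x y)"
    and u_div: "\<And>z. z \<in> V \<Longrightarrow> \<exists>L. (u has_derivative L) (at z) \<and> fst (L (1, 0)) + snd (L (0, 1)) = 0"
    and u_nz: "\<And>z. z \<in> V \<Longrightarrow> u z \<noteq> 0"
    and u_rho: "\<And>x y. (x, y) \<in> V \<Longrightarrow> fst (u (x, y)) * rx x y + snd (u (x, y)) * ry x y = 0"
    and same_line: "\<And>q q'. q \<in> Q0 \<Longrightarrow> q' \<in> Q0 \<Longrightarrow> fst q = fst q' \<Longrightarrow>
       \<exists>\<gamma> t t'. (\<forall>s. \<gamma> s \<in> V \<and> (\<gamma> has_vector_derivative u (\<gamma> s)) (at s)) \<and> \<gamma> t = X q \<and> \<gamma> t' = X q'"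
    and surj_x: "\<And>r. r \<in> {c0 - h<..<c0 + h} \<Longrightarrow> range (\<lambda>s. fst (X (r, s))) = UNIV"
    and disj: "\<And>k z. k \<noteq> (0::int) \<Longrightarrow> z \<in> V \<Longrightarrow> z + (0, of_int k * H) \<notin> V"
    and u_shift: "\<And>k z. z \<in> V \<Longrightarrow> z + (0, of_int k * H) \<in> UNIV \<times> {0..H} \<Longrightarrow> u (z + (0, of_int k * H)) = u z"
    and u_cont: "continuous_on (UNIV \<times> {0..H}) u"
    and g_lower: "\<And>q. q \<in> Q0 \<Longrightarrow> Gs / 2 \<le> e1 q * norm (u (X q))"
begin

lemma open_Q0: "open Q0" unfolding Q0_def by (intro open_Times open_greaterThanLessThan open_UNIV)

lemma connected_Q0: "connected Q0"
  unfolding Q0_def by (intro convex_connected convex_Times convex_real_interval convex_UNIV)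

lemma X_cont: "continuous_on Q0 X"
  by (rule has_derivative_continuous_on[OF has_derivative_at_withinI[OF X_der]])

lemma inj_X: "inj_on X Q0" using ch_X by (metis inj_onI)

lemma open_V: "open V"
  unfolding V_def by (rule invariance_of_domain[OF X_cont open_Q0 inj_X])

lemma X_in_V: "q \<in> Q0 \<Longrightarrow> X q \<in> V" by (simp add: V_def)

lemma ch_V: "z \<in> V \<Longrightarrow> ch z \<in> Q0 \<and> X (ch z) = z" using ch_X by (auto simp: V_def)

definition J :: "real \<times> real \<Rightarrow> real" where
  "J q = fst (Xr q) * snd (Xs q) - fst (Xs q) * snd (Xr q)"

lemma J_cont: "continuous_on Q0 J"
  unfolding J_def by (intro continuous_intros X_cont')

lemma e_pos: "q \<in> Q0 \<Longrightarrow> 0 < e1 q" "q \<in> Q0 \<Longrightarrow> 0 < e2 q"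
  using e_lower[of q] pos divide_pos_pos[of 1 K] by linarith+

lemma comps:
  assumes "q \<in> Q0"
  shows "(fst (Xr q))\<^sup>2 + (snd (Xr q))\<^sup>2 = (e1 q)\<^sup>2" "(fst (Xs q))\<^sup>2 + (snd (Xs q))\<^sup>2 = (e2 q)\<^sup>2"
    "fst (Xr q) * fst (Xs q) + snd (Xr q) * snd (Xs q) = 0"
  using metric[OF assms] by (simp_all add: norm_prod_def inner_prod_def)

text \<open>Lagrange's identity: the squared determinant plus the squared inner product of the
  columns is the product of their squared lengths, and the columns are orthogonal.\<close>

lemma J_abs: assumes q: "q \<in> Q0" shows "\<bar>J q\<bar> = e1 q * e2 q"
proof -
  have "(J q)\<^sup>2 + (fst (Xr q) * fst (Xs q) + snd (Xr q) * snd (Xs q))\<^sup>2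
     = ((fst (Xr q))\<^sup>2 + (snd (Xr q))\<^sup>2) * ((fst (Xs q))\<^sup>2 + (snd (Xs q))\<^sup>2)"
    unfolding J_def by algebra
  then have "(J q)\<^sup>2 = (e1 q * e2 q)\<^sup>2" using comps[OF q] by (simp add: power_mult_distrib)
  then have "\<bar>J q\<bar> = \<bar>e1 q * e2 q\<bar>" by (simp only: power2_eq_iff) (auto simp: abs_mult)
  then show ?thesis using e_pos[OF q] by simp
qed

lemma J_nz: "q \<in> Q0 \<Longrightarrow> J q \<noteq> 0" using J_abs[of q] e_pos[of q] by auto

text \<open>Differentiating ch (X q) = q gives two linear equations for the gradient of \<rho>,
  solved by Cramer's rule. Consequently this gradient has length 1 / e1 \<le> K, the only way in
  which the lower bound on E1 reaches the test function.\<close>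

lemma grad_rho:
  assumes q: "q \<in> Q0" and xy: "X q = (x, y)"
  shows "rx x y * J q = snd (Xs q)" "ry x y * J q = - fst (Xs q)"
    "((rx x y)\<^sup>2 + (ry x y)\<^sup>2) * (e1 q)\<^sup>2 = 1" "\<bar>rx x y\<bar> \<le> K" "\<bar>ry x y\<bar> \<le> K"
proof -
  have xyV: "(x, y) \<in> V" using X_in_V[OF q] xy by simp
  have "((\<lambda>q. ch (X q)) has_derivative (\<lambda>v. Ch (X q) (fst v *\<^sub>R Xr q + snd v *\<^sub>R Xs q))) (at q)"
    using diff_chain_at[OF X_der[OF q] ch_der[OF X_in_V[OF q]]] by (simp add: o_def)
  then have "((\<lambda>q. q) has_derivative (\<lambda>v. Ch (X q) (fst v *\<^sub>R Xr q + snd v *\<^sub>R Xs q))) (at q)"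
    by (rule has_derivative_transform_within_open[OF _ open_Q0 q]) (simp add: ch_X)
  from has_derivative_unique[OF this has_derivative_ident]
  have id: "Ch (X q) (fst v *\<^sub>R Xr q + snd v *\<^sub>R Xs q) = v" for v by metis
  have 1: "fst (Xr q) * rx x y + snd (Xr q) * ry x y = 1"
    using arg_cong[OF id[of "(1, 0)"], of fst] Ch_fst[OF xyV] by (simp add: xy)
  have 2: "fst (Xs q) * rx x y + snd (Xs q) * ry x y = 0"
    using arg_cong[OF id[of "(0, 1)"], of fst] Ch_fst[OF xyV] by (simp add: xy)
  have "rx x y * J q = (fst (Xr q) * rx x y + snd (Xr q) * ry x y) * snd (Xs q)
     - (fst (Xs q) * rx x y + snd (Xs q) * ry x y) * snd (Xr q)"
    by (simp add: J_def algebra_simps)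
  then show r1: "rx x y * J q = snd (Xs q)" using 1 2 by simp
  have "ry x y * J q = (fst (Xs q) * rx x y + snd (Xs q) * ry x y) * fst (Xr q)
     - (fst (Xr q) * rx x y + snd (Xr q) * ry x y) * fst (Xs q)"
    by (simp add: J_def algebra_simps)
  then show r2: "ry x y * J q = - fst (Xs q)" using 1 2 by simp
  have "((rx x y)\<^sup>2 + (ry x y)\<^sup>2) * (J q)\<^sup>2 = (rx x y * J q)\<^sup>2 + (ry x y * J q)\<^sup>2"
    by (simp add: power_mult_distrib algebra_simps)
  also have "\<dots> = (e2 q)\<^sup>2" unfolding r1 r2 using comps(2)[OF q] by simp
  finally have "((rx x y)\<^sup>2 + (ry x y)\<^sup>2) * \<bar>J q\<bar>\<^sup>2 = (e2 q)\<^sup>2" by simp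
  then have "(((rx x y)\<^sup>2 + (ry x y)\<^sup>2) * (e1 q)\<^sup>2) * (e2 q)\<^sup>2 = 1 * (e2 q)\<^sup>2"
    unfolding J_abs[OF q] by (simp add: power_mult_distrib mult_ac)
  then show 3: "((rx x y)\<^sup>2 + (ry x y)\<^sup>2) * (e1 q)\<^sup>2 = 1" using e_pos(2)[OF q] by simp
  have ek: "1 \<le> K * e1 q" using e_lower(1)[OF q] pos by (simp add: field_simps)
  have bd: "\<bar>a\<bar> \<le> K" if "a\<^sup>2 * (e1 q)\<^sup>2 \<le> 1" for a
  proof -
    have "(\<bar>a\<bar> * e1 q)\<^sup>2 \<le> 1\<^sup>2" using that by (simp add: power_mult_distrib)
    then have "\<bar>a\<bar> * e1 q \<le> 1" by (rule power2_le_imp_le) simp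
    then have "\<bar>a\<bar> * e1 q \<le> K * e1 q" using ek by linarith
    then show ?thesis using e_pos(1)[OF q] by simp
  qed
  show "\<bar>rx x y\<bar> \<le> K" "\<bar>ry x y\<bar> \<le> K"
    using 3 by (auto intro!: bd simp: distrib_right)
      (smt (verit) mult_nonneg_nonneg zero_le_power2)+
qed

text \<open>By the metric identity and the lower bounds on the scale factors, the derivative of
  \<open>X\<close> stretches every vector by at least 1 / K; the inverse derivative thus stretches
  by at most K.\<close>

lemma Ch_bound: assumes z: "z \<in> V" shows "norm (Ch z w) \<le> K * norm w"
proof -
  define q where "q = ch z"
  have q: "q \<in> Q0" "X q = z" using ch_V[OF z] by (auto simp: q_def)
  have "((\<lambda>z. X (ch z)) has_derivative (\<lambda>w. fst (Ch z w) *\<^sub>R Xr q + snd (Ch z w) *\<^sub>R Xs q)) (at z)"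
    using diff_chain_at[OF ch_der[OF z] X_der[OF q(1)[unfolded q_def]]] by (simp add: o_def q_def)
  then have "((\<lambda>z. z) has_derivative (\<lambda>w. fst (Ch z w) *\<^sub>R Xr q + snd (Ch z w) *\<^sub>R Xs q)) (at z)"
    by (rule has_derivative_transform_within_open[OF _ open_V z]) (simp add: ch_V)
  from has_derivative_unique[OF this has_derivative_ident]
  have id: "w = fst (Ch z w) *\<^sub>R Xr q + snd (Ch z w) *\<^sub>R Xs q" by metis
  define a where "a = fst (Ch z w)"
  define b where "b = snd (Ch z w)"
  have "(norm w)\<^sup>2 = (a * fst (Xr q) + b * fst (Xs q))\<^sup>2 + (a * snd (Xr q) + b * snd (Xs q))\<^sup>2"
    by (subst id) (simp add: norm_prod_def a_def b_def)
  also have "\<dots> = a\<^sup>2 * ((fst (Xr q))\<^sup>2 + (snd (Xr q))\<^sup>2) + b\<^sup>2 * ((fst (Xs q))\<^sup>2 + (snd (Xs q))\<^sup>2)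
     + 2 * a * b * (fst (Xr q) * fst (Xs q) + snd (Xr q) * snd (Xs q))"
    by (simp add: power2_eq_square algebra_simps)
  also have "\<dots> = a\<^sup>2 * (e1 q)\<^sup>2 + b\<^sup>2 * (e2 q)\<^sup>2" using comps[OF q(1)] by simp
  also have "\<dots> \<ge> a\<^sup>2 * (1 / K)\<^sup>2 + b\<^sup>2 * (1 / K)\<^sup>2"
    using e_lower[OF q(1)] pos by (intro add_mono mult_left_mono power_mono) auto
  finally have "K\<^sup>2 * (a\<^sup>2 * (1 / K)\<^sup>2 + b\<^sup>2 * (1 / K)\<^sup>2) \<le> K\<^sup>2 * (norm w)\<^sup>2"
    by (intro mult_left_mono) auto
  moreover have "K\<^sup>2 * (a\<^sup>2 * (1 / K)\<^sup>2 + b\<^sup>2 * (1 / K)\<^sup>2) = a\<^sup>2 + b\<^sup>2"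
    using pos by (simp add: field_simps power2_eq_square)
  moreover have "(norm (Ch z w))\<^sup>2 = a\<^sup>2 + b\<^sup>2"
    by (cases "Ch z w") (simp add: norm_prod_def a_def b_def)
  ultimately have "(norm (Ch z w))\<^sup>2 \<le> (K * norm w)\<^sup>2" by (simp add: power_mult_distrib)
  then show ?thesis by (rule power2_le_imp_le) (use pos in auto)
qed

text \<open>A segment starting in the inner half of the tube cannot leave the tube at once: its lift to the
  coordinates moves with speed at most \<open>K\<close>.\<close>

lemma ball_in_V:
  assumes q: "q \<in> Q0" "\<bar>fst q - c0\<bar> \<le> h / 2" shows "ball (X q) (h / (2 * K)) \<subseteq> V"
proof
  fix w assume w: "w \<in> ball (X q) (h / (2 * K))"
  show "w \<in> V"
  proof (rule ccontr)
    assume wV: "w \<notin> V"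
    define z where "z = X q"
    define \<gamma> where "\<gamma> = (\<lambda>t::real. z + t *\<^sub>R (w - z))"
    have c\<gamma>: "continuous_on UNIV \<gamma>" unfolding \<gamma>_def by (intro continuous_intros)
    \<comment> \<open>Parameters at which the segment is outside \<open>V\<close>; up to the least
      of them the segment lifts to the coordinates.\<close>
    define A where "A = {0..1} \<inter> \<gamma> -` (- V)"
    have "closed (\<gamma> -` (- V))" using open_V c\<gamma> by (intro closed_vimage) auto
    then have "compact A" unfolding A_def by (intro compact_Int_closed compact_Icc)
    moreover have "1 \<in> A" using wV by (simp add: A_def \<gamma>_def)
    ultimately obtain s where s: "s \<in> A" "\<And>t. t \<in> A \<Longrightarrow> s \<le> t"
      using compact_attains_inf[of A] by blast
    have zV: "z \<in> V" using X_in_V[OF q(1)] by (simp add: z_def)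
    have s0: "0 < s" using s(1) zV by (cases "s = 0") (auto simp: A_def \<gamma>_def)
    have inV: "\<gamma> t \<in> V" if "0 \<le> t" "t < s" for t
      using s(2)[of t] s(1) that by (force simp: A_def)
    have lip: "norm (ch (\<gamma> t) - ch (\<gamma> t')) \<le> K * norm (w - z) * norm (t - t')"
      if "t \<in> {0..<s}" "t' \<in> {0..<s}" for t t'
    proof (rule differentiable_bound[where S = "{0..<s}" and f = "\<lambda>t. ch (\<gamma> t)" and f' = "\<lambda>t r. Ch (\<gamma> t) (r *\<^sub>R (w - z))"])
      fix t assume t: "t \<in> {0..<s}"
      have "(\<gamma> has_derivative (\<lambda>r. r *\<^sub>R (w - z))) (at t within {0..<s})"
        unfolding \<gamma>_def by (auto intro!: derivative_eq_intros)
      from diff_chain_within[OF this has_derivative_at_withinI[OF ch_der]] inV t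
      show "((\<lambda>t. ch (\<gamma> t)) has_derivative (\<lambda>r. Ch (\<gamma> t) (r *\<^sub>R (w - z)))) (at t within {0..<s})"
        by (simp add: o_def)
      show "onorm (\<lambda>r. Ch (\<gamma> t) (r *\<^sub>R (w - z))) \<le> K * norm (w - z)"
      proof (rule onorm_bound)
        fix r :: real
        show "norm (Ch (\<gamma> t) (r *\<^sub>R (w - z))) \<le> K * norm (w - z) * norm r"
          using Ch_bound[OF inV, of t "r *\<^sub>R (w - z)"] t by (simp add: mult_ac)
      qed (use pos in simp)
    qed (use that in auto)
    \<comment> \<open>Parameters increasing to the exit time. Their lifts are Cauchy by the
      Lipschitz bound, and the limit will be a preimage of the exit point.\<close>
    define tn where "tn = (\<lambda>n. s * (1 - inverse (real (Suc n))))"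
    have tn: "tn n \<in> {0..<s}" for n
      using s0 by (auto simp: tn_def inverse_le_1_iff mult_less_cancel_left1)
    have tns: "tn \<longlonglongrightarrow> s"
      unfolding tn_def using tendsto_mult[OF tendsto_const tendsto_diff[OF tendsto_const LIMSEQ_inverse_real_of_nat], of s 1]
      by simp
    have "Cauchy (\<lambda>n. ch (\<gamma> (tn n)))"
    proof (rule metric_CauchyI)
      fix e :: real assume e: "e > 0"
      define L where "L = K * norm (w - z) + 1"
      have L: "L > 0" using pos by (simp add: L_def add_nonneg_pos)
      obtain N where N: "\<And>m n. m \<ge> N \<Longrightarrow> n \<ge> N \<Longrightarrow> dist (tn m) (tn n) < e / L"
        using LIMSEQ_imp_Cauchy[OF tns] e L by (meson Cauchy_def divide_pos_pos)
      have "dist (ch (\<gamma> (tn m))) (ch (\<gamma> (tn n))) < e" if "m \<ge> N" "n \<ge> N" for m n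
      proof -
        have "dist (ch (\<gamma> (tn m))) (ch (\<gamma> (tn n))) \<le> K * norm (w - z) * norm (tn m - tn n)"
          using lip[OF tn tn] by (simp add: dist_norm)
        also have "\<dots> \<le> L * norm (tn m - tn n)" by (intro mult_right_mono) (auto simp: L_def)
        also have "\<dots> < L * (e / L)" using N[OF that] L by (intro mult_strict_left_mono) (auto simp: dist_norm)
        finally show ?thesis using L by simp
      qed
      then show "\<exists>M. \<forall>m\<ge>M. \<forall>n\<ge>M. dist (ch (\<gamma> (tn m))) (ch (\<gamma> (tn n))) < e" by blast
    qed
    then obtain q' where q': "(\<lambda>n. ch (\<gamma> (tn n))) \<longlonglongrightarrow> q'"
      using Cauchy_convergent convergent_def by blast
    have "dist (ch (\<gamma> (tn n))) q \<le> K * norm (w - z) * s" for n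
    proof -
      have "ch (\<gamma> 0) = q" using ch_X[OF q(1)] by (simp add: \<gamma>_def z_def)
      then have "dist (ch (\<gamma> (tn n))) q \<le> K * norm (w - z) * norm (tn n - 0)"
        using lip[OF tn, of 0] s0 by (simp add: dist_norm)
      also have "\<dots> \<le> K * norm (w - z) * s" using tn[of n] pos by (intro mult_left_mono) auto
      finally show ?thesis .
    qed
    then have "dist q' q \<le> K * norm (w - z) * s"
      by (intro LIMSEQ_le_const2[OF tendsto_dist[OF q' tendsto_const]]) auto
    also have "\<dots> \<le> K * norm (w - z) * 1" using s(1) pos by (intro mult_left_mono) (auto simp: A_def)
    also have "\<dots> < K * (h / (2 * K))"
    proof -
      have "norm (w - z) < h / (2 * K)" using w by (simp add: z_def dist_norm norm_minus_commute)
      then show ?thesis using pos by (simp only: mult_1_right mult_strict_left_mono)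
    qed
    also have "\<dots> = h / 2" using pos by simp
    finally have "dist (fst q') (fst q) < h / 2" using dist_fst_le[of q' q] by linarith
    \<comment> \<open>The \<rho>-coordinate of q' is strictly closer than h / 2 to that of q, which
      is itself within h / 2 of the centre; so q' is in the open strip. This fixes the radius h / (2
      K).\<close>
    then have "q' \<in> Q0" using q(2) pos by (cases q') (auto simp: Q0_def dist_real_def abs_if split: if_splits)
    then have "isCont X q'" using X_cont open_Q0 by (simp add: continuous_on_eq_continuous_at)
    then have "(\<lambda>n. X (ch (\<gamma> (tn n)))) \<longlonglongrightarrow> X q'"
      using q' isCont_tendsto_compose by blast
    moreover have "X (ch (\<gamma> (tn n))) = \<gamma> (tn n)" for n using ch_V inV tn[of n] by auto
    moreover have "(\<lambda>n. \<gamma> (tn n)) \<longlonglongrightarrow> \<gamma> s"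
      using c\<gamma> tns by (intro continuous_on_tendsto_compose[OF c\<gamma>]) auto
    ultimately have "\<gamma> s = X q'" using LIMSEQ_unique by simp
    then have "\<gamma> s \<in> V" using X_in_V[OF \<open>q' \<in> Q0\<close>] by simp
    then show False using s(1) by (simp add: A_def)
  qed
qed

text \<open>The flow is \<open>b\<close> times the rotated gradient of \<open>\<rho>\<close>.\<close>

definition b :: "real \<times> real \<Rightarrow> real" where
  "b = (\<lambda>(x, y). (fst (u (x, y)) * ry x y - snd (u (x, y)) * rx x y) / ((rx x y)\<^sup>2 + (ry x y)\<^sup>2))"

lemma grad_nz: "(x, y) \<in> V \<Longrightarrow> 0 < (rx x y)\<^sup>2 + (ry x y)\<^sup>2"
proof -
  assume "(x, y) \<in> V"
  then obtain q where q: "q \<in> Q0" "X q = (x, y)" using ch_V by blast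
  have "(rx x y)\<^sup>2 + (ry x y)\<^sup>2 \<noteq> 0" using grad_rho(3)[OF q] by auto
  moreover have "0 \<le> (rx x y)\<^sup>2 + (ry x y)\<^sup>2" by simp
  ultimately show ?thesis by linarith
qed

lemma u_eq_b:
  assumes V: "(x, y) \<in> V"
  shows "fst (u (x, y)) = b (x, y) * ry x y" "snd (u (x, y)) = - (b (x, y) * rx x y)"
proof -
  define g where "g = (rx x y)\<^sup>2 + (ry x y)\<^sup>2"
  have g: "g \<noteq> 0" using grad_nz[OF V] unfolding g_def by linarith
  have b: "b (x, y) * g = fst (u (x, y)) * ry x y - snd (u (x, y)) * rx x y"
    using g by (simp add: b_def g_def)
  have "fst (u (x, y)) * g = b (x, y) * ry x y * g"
    using b u_rho[OF V] unfolding g_def by algebra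
  then show "fst (u (x, y)) = b (x, y) * ry x y" using g by simp
  have "snd (u (x, y)) * g = - (b (x, y) * rx x y) * g"
    using b u_rho[OF V] unfolding g_def by algebra
  then show "snd (u (x, y)) = - (b (x, y) * rx x y)" using g by (metis mult_cancel_right)
qed

text \<open>As grad \<rho> has length 1 / e1, the factor \<open>b\<close> is E1 |u| with a sign, the
  quantity for which \<open>g_lower\<close> gives a lower bound.\<close>

lemma b_abs: assumes q: "q \<in> Q0" shows "\<bar>b (X q)\<bar> = e1 q * norm (u (X q))"
proof -
  obtain x y where xy: "X q = (x, y)" by (cases "X q")
  have V: "(x, y) \<in> V" using X_in_V[OF q] xy by simp
  have "(norm (u (x, y)))\<^sup>2 = (fst (u (x, y)))\<^sup>2 + (snd (u (x, y)))\<^sup>2"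
    by (cases "u (x, y)") (simp add: norm_prod_def)
  also have "\<dots> = (b (x, y))\<^sup>2 * ((rx x y)\<^sup>2 + (ry x y)\<^sup>2)"
    unfolding u_eq_b[OF V] by (simp add: power_mult_distrib algebra_simps)
  finally have "(e1 q * norm (u (x, y)))\<^sup>2 = (b (x, y))\<^sup>2 * (((rx x y)\<^sup>2 + (ry x y)\<^sup>2) * (e1 q)\<^sup>2)"
    by (simp add: power_mult_distrib mult_ac)
  then have "(e1 q * norm (u (x, y)))\<^sup>2 = (\<bar>b (x, y)\<bar>)\<^sup>2" using grad_rho(3)[OF q xy] by simp
  then have "e1 q * norm (u (x, y)) = \<bar>b (x, y)\<bar>"
    by (rule power2_eq_imp_eq) (use e_pos(1)[OF q] in auto)
  then show ?thesis by (simp add: xy)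
qed

lemma b_diff: "z \<in> V \<Longrightarrow> b differentiable (at z)"
proof -
  assume z: "z \<in> V"
  obtain L where "(u has_derivative L) (at z)" using u_div[OF z] by blast
  then have u: "(\<lambda>z. fst (u z)) differentiable (at z)" "(\<lambda>z. snd (u z)) differentiable (at z)"
    unfolding differentiable_def using has_derivative_fst has_derivative_snd by blast+
  have r: "(\<lambda>z. rx (fst z) (snd z)) differentiable (at z)" "(\<lambda>z. ry (fst z) (snd z)) differentiable (at z)"
    using r_diff[OF z] by (simp_all add: case_prod_unfold)
  have "(rx (fst z) (snd z))\<^sup>2 + (ry (fst z) (snd z))\<^sup>2 \<noteq> 0"
    using grad_nz[of "fst z" "snd z", unfolded prod.collapse, OF z] by linarith
  then have "(\<lambda>z. (fst (u z) * ry (fst z) (snd z) - snd (u z) * rx (fst z) (snd z)) /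
      ((rx (fst z) (snd z))\<^sup>2 + (ry (fst z) (snd z))\<^sup>2)) differentiable (at z)"
    by (intro differentiable_divide differentiable_diff differentiable_mult differentiable_add
        differentiable_power u r)
  then show ?thesis by (simp add: b_def case_prod_unfold)
qed

lemma rho_partials:
  assumes "(x, y) \<in> V"
  shows "((\<lambda>r. fst (ch (r, y))) has_real_derivative rx x y) (at x)"
    "((\<lambda>r. fst (ch (x, r))) has_real_derivative ry x y) (at y)"
  using DERIV_line_real[OF has_derivative_fst[OF ch_der[OF assms]]] Ch_fst[OF assms] by simp_all

text \<open>In the divergence of \<open>b\<close> times the rotated gradient of \<rho> the mixed
  second derivatives cancel, so incompressibility says that the derivative of \<open>b\<close> in
  that direction, the direction of the flow, vanishes. This is why E1 |u| depends on \<rho>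
  only.\<close>

lemma b_along_flow:
  assumes z: "z \<in> V" and B: "(b has_derivative B) (at z)" shows "B (u z) = 0"
proof -
  obtain x y where xy: "z = (x, y)" by (cases z)
  have V: "(x, y) \<in> V" using z xy by simp
  obtain L where L: "(u has_derivative L) (at (x, y))" "fst (L (1, 0)) + snd (L (0, 1)) = 0"
    using u_div[OF V] by blast
  have sym: "rxy x y = ryx x y"
    by (rule mixed_partials_eq[OF open_V V rho_partials(1) rho_partials(2) rxy ryx r_cont])
  have evx: "\<forall>\<^sub>F r in nhds x. (r, y) \<in> V" and evy: "\<forall>\<^sub>F r in nhds y. (x, r) \<in> V"
  proof -
    have "open ((\<lambda>r. (r, y)) -` V)" "open ((\<lambda>r. (x, r)) -` V)"
      using open_V by (auto intro!: open_vimage continuous_intros)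
    then show "\<forall>\<^sub>F r in nhds x. (r, y) \<in> V" "\<forall>\<^sub>F r in nhds y. (x, r) \<in> V"
      using V eventually_nhds_in_open by (fastforce dest: eventually_nhds_in_open)+
  qed
  have "((\<lambda>r. b (r, y) * ry r y) has_real_derivative B (1, 0) * ry x y + ryx x y * b (x, y)) (at x)"
    using B xy by (intro DERIV_mult DERIV_line_real ryx[OF V]) simp
  then have "((\<lambda>r. fst (u (r, y))) has_real_derivative B (1, 0) * ry x y + ryx x y * b (x, y)) (at x)"
    by (rule DERIV_cong_ev[OF refl _ refl, THEN iffD1, rotated])
      (use evx u_eq_b(1) in \<open>auto elim!: eventually_mono\<close>)
  moreover have "((\<lambda>r. fst (u (r, y))) has_real_derivative fst (L (1, 0))) (at x)"
    by (rule DERIV_line_real(1)[OF has_derivative_fst[OF L(1)]])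
  ultimately have 1: "B (1, 0) * ry x y + ryx x y * b (x, y) = fst (L (1, 0))" by (rule DERIV_unique)
  have "((\<lambda>r. - (b (x, r) * rx x r)) has_real_derivative - (B (0, 1) * rx x y + rxy x y * b (x, y))) (at y)"
    using B xy by (intro DERIV_minus DERIV_mult DERIV_line_real rxy[OF V]) simp
  then have "((\<lambda>r. snd (u (x, r))) has_real_derivative - (B (0, 1) * rx x y + rxy x y * b (x, y))) (at y)"
    by (rule DERIV_cong_ev[OF refl _ refl, THEN iffD1, rotated])
      (use evy u_eq_b(2) in \<open>auto elim!: eventually_mono\<close>)
  moreover have "((\<lambda>r. snd (u (x, r))) has_real_derivative snd (L (0, 1))) (at y)"
    by (rule DERIV_line_real(2)[OF has_derivative_snd[OF L(1)]])
  ultimately have 2: "- (B (0, 1) * rx x y + rxy x y * b (x, y)) = snd (L (0, 1))" by (rule DERIV_unique)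
  have 3: "B (1, 0) * ry x y = B (0, 1) * rx x y" using 1 2 L(2) sym by simp
  interpret B: bounded_linear B using B by (rule has_derivative_bounded_linear)
  have "u z = fst (u z) *\<^sub>R (1, 0) + snd (u z) *\<^sub>R (0, 1)" by (cases "u z") simp
  then have "B (u z) = fst (u z) * B (1, 0) + snd (u z) * B (0, 1)"
    by (metis B.add B.scaleR real_scaleR_def)
  also have "\<dots> = b (x, y) * (B (1, 0) * ry x y - B (0, 1) * rx x y)"
    unfolding xy u_eq_b[OF V] by (simp add: algebra_simps)
  finally show ?thesis using 3 by simp
qed

text \<open>By \<open>b_along_flow\<close> the derivative along a trajectory vanishes, and by
  \<open>same_line\<close> both points are on one trajectory.\<close>

lemma b_const:
  assumes q: "q \<in> Q0" "q' \<in> Q0" "fst q = fst q'" shows "b (X q) = b (X q')"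
proof -
  obtain \<gamma> t t' where \<gamma>: "\<And>s. \<gamma> s \<in> V" "\<And>s. (\<gamma> has_vector_derivative u (\<gamma> s)) (at s)"
    "\<gamma> t = X q" "\<gamma> t' = X q'" using same_line[OF q] by blast
  have "((\<lambda>s. b (\<gamma> s)) has_real_derivative 0) (at s)" for s
  proof -
    obtain B where B: "(b has_derivative B) (at (\<gamma> s))" using b_diff[OF \<gamma>(1)] by (auto simp: differentiable_def)
    from diff_chain_at[OF \<gamma>(2)[unfolded has_vector_derivative_def] B]
    have "((\<lambda>s. b (\<gamma> s)) has_derivative (\<lambda>r. B (r *\<^sub>R u (\<gamma> s)))) (at s)" by (simp add: o_def)
    moreover have "(\<lambda>r. B (r *\<^sub>R u (\<gamma> s))) = (*) 0"
      using b_along_flow[OF \<gamma>(1) B] linear_scale[OF has_derivative_linear[OF B]] by (intro ext) simp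
    ultimately show ?thesis unfolding has_field_derivative_def by (simp only:)
  qed
  then have "b (\<gamma> t) = b (\<gamma> t')"
    using DERIV_isconst_all[of "\<lambda>s. b (\<gamma> s)" t t'] by blast
  then show ?thesis using \<gamma> by simp
qed

end

section \<open>Large values of integrable functions, and a bump profile\<close>

lemma not_integrable_if_large:
  fixes g :: "real \<Rightarrow> real"
  assumes g: "integrable lborel g" "\<And>x. 0 \<le> g x" and e: "0 < e"
    and large: "\<And>n. \<exists>a. \<forall>x\<in>{a..a + real n}. e \<le> g x"
  shows False
proof -
  obtain n where n: "integral\<^sup>L lborel g < real n * e" using reals_Archimedean3[OF e] by blast
  obtain a where a: "\<forall>x\<in>{a..a + real n}. e \<le> g x" using large by blast
  have "real n * e = (\<integral>x. indicator {a..a + real n} x * e \<partial>lborel)" by simp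
  also have "\<dots> \<le> integral\<^sup>L lborel g"
    using a g by (intro integral_mono integrable_real_mult_indicator) (auto split: split_indicator)
  finally show False using n by simp
qed

text \<open>Of class C^1 and supported in |s| \<le> 1 / 2. After scaling this is the inner half of
  the tube, for which \<open>ball_in_V\<close> gives a uniform distance to the complement.\<close>

definition bump :: "real \<Rightarrow> real" where "bump s = (max 0 (1 - 4 * s\<^sup>2))\<^sup>2"

definition bump_d :: "real \<Rightarrow> real" where "bump_d s = 2 * max 0 (1 - 4 * s\<^sup>2) * (- 8 * s)"

lemma DERIV_bump: "(bump has_real_derivative bump_d s) (at s)"
proof -
  have "((\<lambda>s. 1 - 4 * s\<^sup>2) has_real_derivative - 8 * s) (at s)"
    by (auto intro!: derivative_eq_intros)
  from DERIV_chain2[OF DERIV_max_0_square this] show ?thesis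
    by (simp add: bump_def[abs_def] bump_d_def)
qed

lemma bump_range: "0 \<le> bump s" "bump s \<le> 1"
  by (auto simp: bump_def intro!: power_le_one)

lemma bump_zero: "1 / 2 < \<bar>s\<bar> \<Longrightarrow> bump s = 0 \<and> bump_d s = 0"
proof -
  assume "1 / 2 < \<bar>s\<bar>"
  then have "(1 / 2)\<^sup>2 < \<bar>s\<bar>\<^sup>2" by (intro power_strict_mono) auto
  then have "max 0 (1 - 4 * s\<^sup>2) = 0" by (simp add: power2_eq_square)
  then show ?thesis by (simp add: bump_def bump_d_def)
qed

lemma bump_d_bound: "\<bar>bump_d s\<bar> \<le> 8"
proof (cases "1 / 2 < \<bar>s\<bar>")
  case True then show ?thesis using bump_zero by simp
next
  case False
  have "\<bar>bump_d s\<bar> = 16 * (max 0 (1 - 4 * s\<^sup>2) * \<bar>s\<bar>)" by (simp add: bump_d_def abs_mult)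
  also have "\<dots> \<le> 16 * (1 * (1 / 2))" using False by (intro mult_left_mono mult_mono) auto
  finally show ?thesis by simp
qed

lemma bump_lower: "\<bar>s\<bar> \<le> 1 / 4 \<Longrightarrow> 1 / 2 \<le> bump s"
proof -
  assume "\<bar>s\<bar> \<le> 1 / 4"
  then have "\<bar>s\<bar>\<^sup>2 \<le> (1 / 4)\<^sup>2" by (intro power_mono) auto
  then have "3 / 4 \<le> 1 - 4 * s\<^sup>2" by (simp add: power2_eq_square)
  then have "3 / 4 \<le> max 0 (1 - 4 * s\<^sup>2)" by linarith
  then have "(3 / 4)\<^sup>2 \<le> (max 0 (1 - 4 * s\<^sup>2))\<^sup>2" by (rule power_mono) simp
  moreover have "1 / 2 \<le> (3 / 4 :: real)\<^sup>2" by (simp add: power2_eq_square)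
  ultimately show ?thesis unfolding bump_def by linarith
qed

lemma continuous_bump: "continuous_on A bump" "continuous_on A bump_d"
  unfolding bump_def bump_d_def by (intro continuous_intros)+

context tube_geometry
begin

section \<open>The test function of a tube\<close>

lemma shift_shift: "z + (0, a) + (0, a') = z + (0::real, a + a' :: real)"
  by (simp add: add.assoc)

text \<open>The H-periodic extension by zero of a function on \<open>V\<close>. As \<open>V\<close>
  misses its own translates, the integer is unique by \<open>shift_unique\<close> and the choice is
  immaterial.\<close>

definition lift :: "(real \<times> real \<Rightarrow> real) \<Rightarrow> real \<times> real \<Rightarrow> real" where
  "lift q z = (if \<exists>k::int. z + (0, of_int k * H) \<in> V
     then q (z + (0, of_int (SOME k::int. z + (0, of_int k * H) \<in> V) * H)) else 0)"

lemma shift_unique: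
  assumes "z + (0, of_int k * H) \<in> V" "z + (0, of_int j * H) \<in> V"
  shows "j = (k :: int)"
proof (rule ccontr)
  assume "j \<noteq> k"
  then have "z + (0, of_int k * H) + (0, of_int (j - k) * H) \<notin> V"
    by (intro disj assms(1)) simp
  moreover have "z + (0, of_int k * H) + (0, of_int (j - k) * H) = z + (0, of_int j * H)"
    unfolding shift_shift by (simp add: algebra_simps)
  ultimately show False using assms(2) by metis
qed

lemma lift_eq: assumes "z + (0, of_int k * H) \<in> V" shows "lift q z = q (z + (0, of_int k * H))"
proof -
  have "(SOME k::int. z + (0, of_int k * H) \<in> V) = k"
    using assms shift_unique by (intro some_equality) blast+
  then show ?thesis using assms unfolding lift_def by auto
qed

lemma lift_zero: "(\<And>k::int. z + (0, of_int k * H) \<notin> V) \<Longrightarrow> lift q z = 0"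
  by (simp add: lift_def)

lemma lift_support: "lift q z \<noteq> 0 \<Longrightarrow> \<exists>k::int. z + (0, of_int k * H) \<in> V"
  using lift_zero by blast

lemma lift_periodic: "lift q (z + (0, H)) = lift q z"
proof (cases "\<exists>k::int. z + (0, of_int k * H) \<in> V")
  case True
  then obtain k :: int where k: "z + (0, of_int k * H) \<in> V" by blast
  have eq: "z + (0, H) + (0, of_int (k - 1) * H) = z + (0, of_int k * H)"
    unfolding shift_shift by (simp add: algebra_simps)
  then have "z + (0, H) + (0, of_int (k - 1) * H) \<in> V" using k by (simp only:)
  from lift_eq[OF this] lift_eq[OF k] eq show ?thesis by (simp only:)
next
  case False
  have "z + (0, H) + (0, of_int k * H) \<notin> V" for k :: int
  proof -
    have "z + (0, H) + (0, of_int k * H) = z + (0, of_int (k + 1) * H)"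
      unfolding shift_shift by (simp add: algebra_simps)
    then show ?thesis using False by metis
  qed
  then show ?thesis using False lift_zero by metis
qed

text \<open>Only points outside all translates of \<open>V\<close> are delicate, since infinitely
  many translates could accumulate there. If a nearby point had a translate in the inner half of the
  tube, then by \<open>ball_in_V\<close> a ball of the fixed radius h / (2 K) around it would lie in
  \<open>V\<close> and contain a translate of the given point. So near such a point only the outer
  half is met, where \<open>q\<close> vanishes.\<close>

lemma lift_local:
  assumes q: "\<And>z. z \<in> V \<Longrightarrow> h / 2 < \<bar>fst (ch z) - c0\<bar> \<Longrightarrow> q z = 0"
  shows "(\<exists>k::int. z + (0, of_int k * H) \<in> V \<and> (\<forall>\<^sub>F w in nhds z. lift q w = q (w + (0, of_int k * H))))
     \<or> ((\<forall>k::int. z + (0, of_int k * H) \<notin> V) \<and> (\<forall>\<^sub>F w in nhds z. lift q w = 0))"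
proof (cases "\<exists>k::int. z + (0, of_int k * H) \<in> V")
  case True
  then obtain k :: int where k: "z + (0, of_int k * H) \<in> V" by blast
  have "open ((\<lambda>w. w + (0, of_int k * H)) -` V)"
    using open_V by (intro open_vimage) (auto intro!: continuous_intros)
  then have "\<forall>\<^sub>F w in nhds z. w \<in> (\<lambda>w. w + (0, of_int k * H)) -` V"
    using k by (intro eventually_nhds_in_open) auto
  then have "\<forall>\<^sub>F w in nhds z. lift q w = q (w + (0, of_int k * H))"
    by (rule eventually_mono) (use lift_eq in auto)
  then show ?thesis using k by blast
next
  case False
  define r where "r = h / (2 * K)"
  have r: "r > 0" using pos by (simp add: r_def)
  have "\<forall>\<^sub>F w in nhds z. w \<in> ball z r" using r by (intro eventually_nhds_in_open) auto
  then have "\<forall>\<^sub>F w in nhds z. lift q w = 0"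
  proof (rule eventually_mono)
    fix w assume w: "w \<in> ball z r"
    show "lift q w = 0"
    proof (cases "\<exists>k::int. w + (0, of_int k * H) \<in> V")
      case True
      then obtain k :: int where k: "w + (0, of_int k * H) \<in> V" by blast
      have "h / 2 < \<bar>fst (ch (w + (0, of_int k * H))) - c0\<bar>"
      proof (rule ccontr)
        assume "\<not> h / 2 < \<bar>fst (ch (w + (0, of_int k * H))) - c0\<bar>"
        then have "ball (w + (0, of_int k * H)) r \<subseteq> V"
          using ball_in_V[of "ch (w + (0, of_int k * H))"] ch_V[OF k] by (auto simp: r_def)
        moreover have "z + (0, of_int k * H) \<in> ball (w + (0, of_int k * H)) r"
          using w by (simp add: dist_commute)
        ultimately show False using False by blast
      qed
      then show ?thesis using q[OF k] lift_eq[OF k] by simp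
    next
      case False then show ?thesis using lift_zero by blast
    qed
  qed
  then show ?thesis using False by blast
qed

lemma lift_cont:
  assumes q: "\<And>z. z \<in> V \<Longrightarrow> h / 2 < \<bar>fst (ch z) - c0\<bar> \<Longrightarrow> q z = 0" and c: "continuous_on V q"
  shows "continuous_on A (lift q)"
proof (rule continuous_at_imp_continuous_on, rule ballI)
  fix z
  consider (a) k :: int where "z + (0, of_int k * H) \<in> V" "\<forall>\<^sub>F w in nhds z. lift q w = q (w + (0, of_int k * H))"
    | (b) "\<forall>\<^sub>F w in nhds z. lift q w = 0"
    using lift_local[of q z] q by blast
  then show "isCont (lift q) z"
  proof cases
    case a
    have "isCont q (z + (0, of_int k * H))"
      using c a(1) open_V by (simp add: continuous_on_eq_continuous_at)
    then have "isCont (\<lambda>w. q (w + (0, of_int k * H))) z"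
      by (intro continuous_intros isCont_o2[of z "\<lambda>w. w + (0, of_int k * H)" q]) auto
    then show ?thesis using isCont_cong[OF a(2)] by simp
  next
    case b
    then show ?thesis using isCont_cong[OF b] by simp
  qed
qed

lemma lift_deriv:
  assumes q: "\<And>z. z \<in> V \<Longrightarrow> h / 2 < \<bar>fst (ch z) - c0\<bar> \<Longrightarrow> q z = 0"
  shows "(\<And>x y. (x, y) \<in> V \<Longrightarrow> ((\<lambda>r. q (r, y)) has_real_derivative q' (x, y)) (at x))
      \<Longrightarrow> ((\<lambda>r. lift q (r, y)) has_real_derivative lift q' (x, y)) (at x)"
    and "(\<And>x y. (x, y) \<in> V \<Longrightarrow> ((\<lambda>r. q (x, r)) has_real_derivative q' (x, y)) (at y))
      \<Longrightarrow> ((\<lambda>r. lift q (x, r)) has_real_derivative lift q' (x, y)) (at y)"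
proof -
  have evx: "\<forall>\<^sub>F r in nhds x. P (r, y)" and evy: "\<forall>\<^sub>F r in nhds y. P (x, r)"
    if P: "\<forall>\<^sub>F w in nhds (x, y). P w" for P
  proof -
    have "filterlim (\<lambda>r. (r, y)) (nhds (x, y)) (nhds x)" "filterlim (\<lambda>r. (x, r)) (nhds (x, y)) (nhds y)"
      by (intro tendsto_intros filterlim_ident)+
    then show "\<forall>\<^sub>F r in nhds x. P (r, y)" "\<forall>\<^sub>F r in nhds y. P (x, r)"
      using P by (auto simp: filterlim_iff)
  qed
  consider (a) k :: int where "(x, y) + (0, of_int k * H) \<in> V" "\<forall>\<^sub>F w in nhds (x, y). lift q w = q (w + (0, of_int k * H))"
    | (b) "\<And>k::int. (x, y) + (0, of_int k * H) \<notin> V" "\<forall>\<^sub>F w in nhds (x, y). lift q w = 0"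
    using lift_local[of q "(x, y)"] q by blast
  note cases = this
  show "((\<lambda>r. lift q (r, y)) has_real_derivative lift q' (x, y)) (at x)"
    if D: "\<And>x y. (x, y) \<in> V \<Longrightarrow> ((\<lambda>r. q (r, y)) has_real_derivative q' (x, y)) (at x)"
    using cases
  proof cases
    case a
    have "((\<lambda>r. q (r, y + of_int k * H)) has_real_derivative lift q' (x, y)) (at x)"
      using D[of x "y + of_int k * H"] a(1) lift_eq[OF a(1), of q'] by simp
    then show ?thesis
      by (rule DERIV_cong_ev[OF refl _ refl, THEN iffD2, rotated]) (use evx[OF a(2)] in simp)
  next
    case b
    have "((\<lambda>r. 0) has_real_derivative lift q' (x, y)) (at x)" using lift_zero[OF b(1)] by simp
    then show ?thesis
      by (rule DERIV_cong_ev[OF refl _ refl, THEN iffD2, rotated]) (use evx[OF b(2)] in simp)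
  qed
  show "((\<lambda>r. lift q (x, r)) has_real_derivative lift q' (x, y)) (at y)"
    if D: "\<And>x y. (x, y) \<in> V \<Longrightarrow> ((\<lambda>r. q (x, r)) has_real_derivative q' (x, y)) (at y)"
    using cases
  proof cases
    case a
    have "((\<lambda>r. q (x, r)) has_real_derivative lift q' (x, y)) (at (y + of_int k * H))"
      using D[of x "y + of_int k * H"] a(1) lift_eq[OF a(1), of q'] by simp
    then have "((\<lambda>r. q (x, r + of_int k * H)) has_real_derivative lift q' (x, y)) (at y)"
      by (simp add: DERIV_shift)
    then show ?thesis
      by (rule DERIV_cong_ev[OF refl _ refl, THEN iffD2, rotated]) (use evy[OF a(2)] in simp)
  next
    case b
    have "((\<lambda>r. 0) has_real_derivative lift q' (x, y)) (at y)" using lift_zero[OF b(1)] by simp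
    then show ?thesis
      by (rule DERIV_cong_ev[OF refl _ refl, THEN iffD2, rotated]) (use evy[OF b(2)] in simp)
  qed
qed

definition ph :: "real \<Rightarrow> real" where "ph r = bump ((r - c0) / h)"

definition ph_d :: "real \<Rightarrow> real" where "ph_d r = bump_d ((r - c0) / h) / h"

definition psi :: "real \<times> real \<Rightarrow> real" where "psi = lift (\<lambda>z. ph (fst (ch z)))"

definition psi_x :: "real \<times> real \<Rightarrow> real" where
  "psi_x = lift (\<lambda>z. ph_d (fst (ch z)) * rx (fst z) (snd z))"

definition psi_y :: "real \<times> real \<Rightarrow> real" where
  "psi_y = lift (\<lambda>z. ph_d (fst (ch z)) * ry (fst z) (snd z))"

lemma ph_zero: "h / 2 < \<bar>r - c0\<bar> \<Longrightarrow> ph r = 0 \<and> ph_d r = 0"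
proof -
  assume "h / 2 < \<bar>r - c0\<bar>"
  then have "1 / 2 < \<bar>(r - c0) / h\<bar>" using pos by (simp add: abs_divide field_simps)
  then show ?thesis using bump_zero by (simp add: ph_def ph_d_def)
qed

lemma DERIV_ph: "(ph has_real_derivative ph_d r) (at r)"
proof -
  have "((\<lambda>r. (r - c0) / h) has_real_derivative (1 - 0) / h) (at r)"
    by (intro DERIV_cdivide DERIV_diff DERIV_ident DERIV_const)
  from DERIV_chain2[OF DERIV_bump this] show ?thesis
    by (simp add: ph_def[abs_def] ph_d_def)
qed

lemma ph_cont: "continuous_on A ph" "continuous_on A ph_d"
proof -
  have "h \<noteq> 0" using pos by simp
  then show "continuous_on A ph" "continuous_on A ph_d"
    unfolding ph_def ph_d_def
    by (auto intro!: continuous_intros continuous_on_compose2[OF continuous_bump(1)[of UNIV]]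
        continuous_on_compose2[OF continuous_bump(2)[of UNIV]])
qed

lemma ch_cont: "continuous_on V ch"
  by (rule has_derivative_continuous_on[OF has_derivative_at_withinI[OF ch_der]])

lemma r_continuous: "continuous_on V (\<lambda>z. rx (fst z) (snd z))" "continuous_on V (\<lambda>z. ry (fst z) (snd z))"
  using r_diff[THEN differentiable_imp_continuous_within]
  by (simp_all add: continuous_at_imp_continuous_on case_prod_unfold)

lemma psi_cont: "continuous_on A psi" "continuous_on A psi_x" "continuous_on A psi_y"
  unfolding psi_def psi_x_def psi_y_def
  by (rule lift_cont; (simp add: ph_zero)?;
      intro continuous_intros r_continuous continuous_on_compose2[OF ph_cont(1)[of UNIV]]
        continuous_on_compose2[OF ph_cont(2)[of UNIV]] ch_cont; simp)+

lemma psi_deriv: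
  "((\<lambda>r. psi (r, y)) has_real_derivative psi_x (x, y)) (at x)"
  "((\<lambda>r. psi (x, r)) has_real_derivative psi_y (x, y)) (at y)"
  unfolding psi_def psi_x_def psi_y_def
  using DERIV_chain2[OF DERIV_ph rho_partials(1)] DERIV_chain2[OF DERIV_ph rho_partials(2)]
  by (auto intro!: lift_deriv simp: ph_zero)

lemma psi_periodic: "psi (x, y + H) = psi (x, y)"
  using lift_periodic[of _ "(x, y)"] by (simp add: psi_def)

lemma psi_range: "0 \<le> psi z" "psi z \<le> 1"
  using bump_range by (auto simp: psi_def lift_def ph_def)

text \<open>8 bounds the derivative of \<open>bump\<close>, 1 / h comes from scaling, and K bounds
  the gradient of \<rho>.\<close>

lemma psi_grad_bound: "\<bar>psi_x z\<bar> \<le> 8 * K / h" "\<bar>psi_y z\<bar> \<le> 8 * K / h"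
proof -
  have b: "\<bar>ph_d (fst (ch z)) * rx (fst z) (snd z)\<bar> \<le> 8 * K / h \<and> \<bar>ph_d (fst (ch z)) * ry (fst z) (snd z)\<bar> \<le> 8 * K / h"
    if "z \<in> V" for z
  proof -
    have "\<bar>ph_d (fst (ch z))\<bar> \<le> 8 / h"
      using bump_d_bound pos by (simp add: ph_d_def divide_right_mono)
    moreover have "\<bar>rx (fst z) (snd z)\<bar> \<le> K" "\<bar>ry (fst z) (snd z)\<bar> \<le> K"
      using grad_rho(4,5)[of "ch z" "fst z" "snd z"] ch_V[OF that] by auto
    ultimately have "\<bar>ph_d (fst (ch z))\<bar> * \<bar>rx (fst z) (snd z)\<bar> \<le> 8 / h * K"
      "\<bar>ph_d (fst (ch z))\<bar> * \<bar>ry (fst z) (snd z)\<bar> \<le> 8 / h * K"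
      using pos by (intro mult_mono; simp)+
    then show ?thesis by (simp add: abs_mult)
  qed
  have K: "0 \<le> 8 * K / h" using pos by simp
  have lb: "\<bar>lift q z\<bar> \<le> 8 * K / h" if q: "\<And>z. z \<in> V \<Longrightarrow> \<bar>q z\<bar> \<le> 8 * K / h" for q
  proof (cases "\<exists>k::int. z + (0, of_int k * H) \<in> V")
    case True
    then obtain k :: int where k: "z + (0, of_int k * H) \<in> V" by blast
    show ?thesis unfolding lift_eq[OF k] by (rule q[OF k])
  next
    case False
    then have "lift q z = 0" by (intro lift_zero) blast
    then show ?thesis using K by simp
  qed
  show "\<bar>psi_x z\<bar> \<le> 8 * K / h" unfolding psi_x_def by (rule lb) (use b in blast)
  show "\<bar>psi_y z\<bar> \<le> 8 * K / h" unfolding psi_y_def by (rule lb) (use b in blast)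
qed

lemma u_shift':
  assumes "z \<in> UNIV \<times> {0..H}" "z + (0, of_int k * H) \<in> V"
  shows "u (z + (0, of_int k * H)) = u z"
proof -
  have e: "z + (0, of_int k * H) + (0, of_int (- k) * H) = z"
    unfolding shift_shift by (simp add: prod_eq_iff)
  show ?thesis using u_shift[OF assms(2), of "- k", unfolded e, OF assms(1)] by (rule sym)
qed

lemma psi_flow: "y \<in> {0..H} \<Longrightarrow> fst (u (x, y)) * psi_x (x, y) + snd (u (x, y)) * psi_y (x, y) = 0"
proof (cases "\<exists>k::int. (x, y) + (0, of_int k * H) \<in> V")
  case True
  assume y: "y \<in> {0..H}"
  obtain k :: int where k: "(x, y) + (0, of_int k * H) \<in> V" using True by blast
  then have kV: "(x, y + of_int k * H) \<in> V" by simp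
  have "u (x, y + of_int k * H) = u (x, y)" using u_shift'[OF _ k] y by simp
  then have "fst (u (x, y)) * rx x (y + of_int k * H) + snd (u (x, y)) * ry x (y + of_int k * H) = 0"
    using u_rho[OF kV] by simp
  then have "ph_d (fst (ch (x, y + of_int k * H))) *
      (fst (u (x, y)) * rx x (y + of_int k * H) + snd (u (x, y)) * ry x (y + of_int k * H)) = 0" by simp
  then show ?thesis unfolding psi_x_def psi_y_def lift_eq[OF k] by (simp add: algebra_simps)
next
  case False
  then show ?thesis unfolding psi_x_def psi_y_def using lift_zero by auto
qed

end

context tube_geometry
begin

section \<open>The flux through a tube\<close>

text \<open>The chart folded modulo \<open>H\<close> into one period cell; \<open>S1\<close> omits the points which the fold tears.\<close>

definition fold_X :: "real \<times> real \<Rightarrow> real \<times> real" where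
  "fold_X q = X q + (0, of_int (- \<lfloor>snd (X q) / H\<rfloor>) * H)"

definition S1 :: "(real \<times> real) set" where "S1 = {q \<in> Q0. snd (X q) / H \<notin> \<int>}"

text \<open>The image of the fold, described without the chart; this makes it visibly open, hence
  measurable.\<close>

definition M1 :: "(real \<times> real) set" where
  "M1 = {z. snd z \<in> {0<..<H} \<and> (\<exists>k::int. z + (0, of_int k * H) \<in> V)}"

lemma open_S1: "open S1"
proof -
  have "continuous_on Q0 (\<lambda>q. snd (X q) / H)" using pos by (intro continuous_intros X_cont) auto
  then have "open (Q0 \<inter> (\<lambda>q. snd (X q) / H) -` (- \<int>))"
    by (intro continuous_open_preimage open_Q0 open_Compl closed_Ints)
  moreover have "S1 = Q0 \<inter> (\<lambda>q. snd (X q) / H) -` (- \<int>)" by (auto simp: S1_def)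
  ultimately show ?thesis by simp
qed

lemma open_M1: "open M1"
proof -
  have "open ((\<lambda>z. z + (0, of_int k * H)) -` V)" for k :: int
    using open_V by (intro open_vimage) (auto intro!: continuous_intros)
  then have "open ((UNIV \<times> {0<..<H}) \<inter> (\<Union>k::int. (\<lambda>z. z + (0, of_int k * H)) -` V))"
    by (intro open_Int open_UN open_Times) auto
  moreover have "M1 = (UNIV \<times> {0<..<H}) \<inter> (\<Union>k::int. (\<lambda>z. z + (0, of_int k * H)) -` V)"
    by (auto simp: M1_def)
  ultimately show ?thesis by simp
qed

lemma fold_X_back: "fold_X q + (0, of_int \<lfloor>snd (X q) / H\<rfloor> * H) = X q"
  unfolding fold_X_def shift_shift by (simp add: prod_eq_iff)

lemma fold_X_snd: "q \<in> S1 \<Longrightarrow> snd (fold_X q) \<in> {0<..<H}"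
proof -
  assume q: "q \<in> S1"
  define w where "w = snd (X q) / H"
  have w: "w \<notin> \<int>" using q by (simp add: S1_def w_def)
  have "of_int \<lfloor>w\<rfloor> \<noteq> w" using w by (metis Ints_of_int)
  then have "0 < w - of_int \<lfloor>w\<rfloor>" "w - of_int \<lfloor>w\<rfloor> < 1" using of_int_floor_le[of w] by linarith+
  then have "0 < (w - of_int \<lfloor>w\<rfloor>) * H" "(w - of_int \<lfloor>w\<rfloor>) * H < 1 * H"
    using pos by (auto intro: mult_strict_right_mono)
  moreover have "snd (fold_X q) = (w - of_int \<lfloor>w\<rfloor>) * H"
    using pos by (simp add: fold_X_def w_def algebra_simps)
  ultimately show ?thesis by simp
qed

lemma fold_X_image: "fold_X ` S1 = M1"
proof (intro equalityI subsetI)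
  fix z assume "z \<in> fold_X ` S1"
  then obtain q where q: "q \<in> S1" "z = fold_X q" by blast
  have "q \<in> Q0" using q by (simp add: S1_def)
  then have "z + (0, of_int \<lfloor>snd (X q) / H\<rfloor> * H) \<in> V"
    unfolding q(2) fold_X_back by (rule X_in_V)
  then show "z \<in> M1" using fold_X_snd[OF q(1)] q(2) unfolding M1_def by blast
next
  fix z assume z: "z \<in> M1"
  then obtain k :: int where k: "z + (0, of_int k * H) \<in> V" by (auto simp: M1_def)
  define q where "q = ch (z + (0, of_int k * H))"
  have q: "q \<in> Q0" "X q = z + (0, of_int k * H)" using ch_V[OF k] by (auto simp: q_def)
  have w: "snd (X q) / H = snd z / H + of_int k" using pos by (simp add: q(2) add_divide_distrib)
  have zH: "0 < snd z / H" "snd z / H < 1" using z pos by (auto simp: M1_def)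
  have fl: "\<lfloor>snd (X q) / H\<rfloor> = k" unfolding w using zH by (intro floor_unique) auto
  have "snd (X q) / H \<notin> \<int>"
  proof
    assume "snd (X q) / H \<in> \<int>"
    then have "of_int \<lfloor>snd (X q) / H\<rfloor> = snd (X q) / H" by (metis floor_of_int Ints_cases)
    then have "of_int k = snd (X q) / H" unfolding fl .
    then show False using w zH by linarith
  qed
  then have "q \<in> S1" using q by (simp add: S1_def)
  moreover have "fold_X q = z"
  proof -
    have "fold_X q = X q + (0, of_int (- k) * H)" by (simp only: fold_X_def fl)
    then show ?thesis unfolding q(2) shift_shift by (simp add: prod_eq_iff)
  qed
  ultimately show "z \<in> fold_X ` S1" by blast
qed

lemma inj_fold_X: "inj_on fold_X S1"
proof (rule inj_onI)
  fix q q' assume q: "q \<in> S1" "q' \<in> S1" and eq: "fold_X q = fold_X q'"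
  have Q: "q \<in> Q0" "q' \<in> Q0" using q by (auto simp: S1_def)
  have 1: "fold_X q + (0, of_int \<lfloor>snd (X q) / H\<rfloor> * H) \<in> V"
    unfolding fold_X_back by (rule X_in_V[OF Q(1)])
  have 2: "fold_X q + (0, of_int \<lfloor>snd (X q') / H\<rfloor> * H) \<in> V"
    unfolding eq fold_X_back by (rule X_in_V[OF Q(2)])
  have "\<lfloor>snd (X q') / H\<rfloor> = \<lfloor>snd (X q) / H\<rfloor>" by (rule shift_unique[OF 1 2])
  then have "X q = X q'" using fold_X_back[of q] fold_X_back[of q'] eq by metis
  then show "q = q'" using inj_X Q by (meson inj_onD)
qed

lemma fold_X_der:
  assumes q: "q \<in> S1"
  shows "(fold_X has_derivative (\<lambda>v. fst v *\<^sub>R Xr q + snd v *\<^sub>R Xs q)) (at q within S1)"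
proof -
  have Q: "q \<in> Q0" using q by (simp add: S1_def)
  define k where "k = \<lfloor>snd (X q) / H\<rfloor>"
  define w where "w = snd (X q) / H"
  have "w \<notin> \<int>" using q by (simp add: S1_def w_def)
  then have "of_int k \<noteq> w" by (metis Ints_of_int)
  then have kw: "w \<in> {of_int k<..<of_int k + 1}"
    using of_int_floor_le[of w] unfolding k_def w_def[symmetric] greaterThanLessThan_iff by linarith
  \<comment> \<open>A neighbourhood on which the floor in \<open>fold_X\<close> is constant, so that
    the fold is a translate of \<open>X\<close>.\<close>
  define W where "W = Q0 \<inter> (\<lambda>q. snd (X q) / H) -` {of_int k<..<of_int k + 1}"
  have "continuous_on Q0 (\<lambda>q. snd (X q) / H)" using pos by (intro continuous_intros X_cont) auto
  then have W: "open W" unfolding W_def by (intro continuous_open_preimage open_Q0) auto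
  have qW: "q \<in> W" using Q kw by (simp add: W_def w_def)
  have "((\<lambda>q. X q + (0, of_int (- k) * H)) has_derivative (\<lambda>v. fst v *\<^sub>R Xr q + snd v *\<^sub>R Xs q + 0)) (at q)"
    by (intro has_derivative_add X_der[OF Q] has_derivative_const)
  then have "(fold_X has_derivative (\<lambda>v. fst v *\<^sub>R Xr q + snd v *\<^sub>R Xs q + 0)) (at q)"
  proof (rule has_derivative_transform_within_open[OF _ W qW])
    fix q' assume "q' \<in> W"
    then have "\<lfloor>snd (X q') / H\<rfloor> = k" by (intro floor_unique) (auto simp: W_def)
    then show "X q' + (0, of_int (- k) * H) = fold_X q'" by (simp add: fold_X_def)
  qed
  then show ?thesis by (simp add: has_derivative_at_withinI)
qed

text \<open>The torn points are the image under the differentiable map \<open>ch\<close> of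
  countably many horizontal lines, and such a map sends null sets to null sets.\<close>

lemma null_tear: "AE q in lborel. q \<in> Q0 \<longrightarrow> q \<in> S1"
proof -
  define L where "L = (\<Union>k::int. {z :: real \<times> real. z \<bullet> (0, 1) = of_int k * H})"
  have "negligible {z :: real \<times> real. z \<bullet> (0, 1) = of_int k * H}" for k :: int
    by (rule negligible_standard_hyperplane) (simp add: Basis_prod_def)
  then have "negligible L" unfolding L_def
    by (intro negligible_countable_Union) auto
  then have "negligible (V \<inter> L)" by (rule negligible_subset) auto
  moreover have "ch differentiable_on (V \<inter> L)"
    unfolding differentiable_on_def using ch_der
    by (meson IntD1 differentiableI differentiable_at_withinI)
  ultimately have "negligible (ch ` (V \<inter> L))"
    by (intro negligible_differentiable_image_negligible) auto
  moreover have "Q0 - S1 \<subseteq> ch ` (V \<inter> L)"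
  proof
    fix q assume q: "q \<in> Q0 - S1"
    then have "snd (X q) / H \<in> \<int>" by (simp add: S1_def)
    then obtain k :: int where "snd (X q) / H = of_int k" by (auto elim: Ints_cases)
    then have "snd (X q) = of_int k * H" using pos by (simp add: field_simps)
    then have "X q \<in> L" by (auto simp: L_def inner_prod_def)
    then show "q \<in> ch ` (V \<inter> L)" using q ch_X[of q] X_in_V[of q] by force
  qed
  ultimately have "negligible (Q0 - S1)" using negligible_subset by blast
  then have "Q0 - S1 \<in> null_sets lebesgue" by (simp add: negligible_iff_null_sets)
  moreover have "Q0 - S1 \<in> sets lborel" using open_Q0 open_S1 by (simp add: borel_open)
  ultimately have "Q0 - S1 \<in> null_sets lborel" by (simp add: null_sets_completion_iff)
  from AE_not_in[OF this] show ?thesis by eventually_elim auto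
qed

lemma borel_Q0: "continuous_on Q0 w \<Longrightarrow> (\<lambda>q. indicator Q0 q * w q) \<in> borel_measurable borel"
  for w :: "real \<times> real \<Rightarrow> real"
  using borel_measurable_continuous_on_indicator[of Q0 w] open_Q0 by (simp add: borel_open)

text \<open>The weight \<open>w\<close> is continuous on the whole strip and compared with the
  pulled back integrand on \<open>S1\<close> only. Measurability then rests on continuity of
  \<open>w\<close> and not on the floor function, and the torn points are negligible.\<close>

lemma transfer_integral:
  fixes f w :: "real \<times> real \<Rightarrow> real"
  assumes f: "integrable lborel (\<lambda>z. indicator M1 z * f z)"
    and w: "continuous_on Q0 w" "\<And>q. q \<in> S1 \<Longrightarrow> w q = \<bar>J q\<bar> * f (fold_X q)"
  shows "integrable lborel (\<lambda>q. indicator Q0 q * w q)"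
    and "integral\<^sup>L lborel (\<lambda>q. indicator Q0 q * w q) = integral\<^sup>L lborel (\<lambda>z. indicator M1 z * f z)"
proof -
  have jac: "jacobian (\<lambda>v. fst v *\<^sub>R Xr q + snd v *\<^sub>R Xs q) = J q" for q
    by (simp add: jacobian_def J_def)
  have eq: "(\<lambda>q. indicator S1 q * (\<bar>jacobian (\<lambda>v. fst v *\<^sub>R Xr q + snd v *\<^sub>R Xs q)\<bar> * f (fold_X q)))
      = (\<lambda>q. indicator S1 q * w q)"
    using w(2) unfolding jac by (auto simp: fun_eq_iff split: split_indicator)
  have S1Q: "S1 \<subseteq> Q0" by (auto simp: S1_def)
  have m1: "(\<lambda>q. indicator S1 q * w q) \<in> borel_measurable borel"
    using borel_measurable_continuous_on_indicator[OF _ continuous_on_subset[OF w(1) S1Q]] open_S1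
    by (simp add: borel_open)
  have mQ: "(\<lambda>q. indicator Q0 q * w q) \<in> borel_measurable borel" by (rule borel_Q0[OF w(1)])
  have S1b: "S1 \<in> sets borel" using open_S1 by (rule borel_open)
  have mf: "(\<lambda>z. indicator (fold_X ` S1) z * f z) \<in> borel_measurable borel"
    unfolding fold_X_image using f by (auto dest: borel_measurable_integrable)
  have ff: "integrable lborel (\<lambda>z. indicator (fold_X ` S1) z * f z)"
    unfolding fold_X_image by (rule f)
  note cv = change_of_variables_plane[OF S1b fold_X_der inj_fold_X mf _ ff, unfolded eq fold_X_image, OF _ m1]
  have 1: "integrable lborel (\<lambda>q. indicator S1 q * w q)"
    "integral\<^sup>L lborel (\<lambda>q. indicator S1 q * w q) = integral\<^sup>L lborel (\<lambda>z. indicator M1 z * f z)"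
    using cv by simp_all
  have ae: "AE q in lborel. indicator S1 q * w q = indicator Q0 q * w q"
    using null_tear by eventually_elim (use S1Q in \<open>auto split: split_indicator\<close>)
  show "integrable lborel (\<lambda>q. indicator Q0 q * w q)"
    using 1(1) integrable_cong_AE[OF _ _ ae] m1 mQ by simp
  show "integral\<^sup>L lborel (\<lambda>q. indicator Q0 q * w q) = integral\<^sup>L lborel (\<lambda>z. indicator M1 z * f z)"
    using 1(2) integral_cong_AE[OF _ _ ae] m1 mQ by simp
qed

lemma M1_sub: "M1 \<subseteq> UNIV \<times> {0..H}" by (auto simp: M1_def)

lemma step_d_X_cont: "continuous_on Q0 (\<lambda>q. step_d (fst (X q)))"
  by (intro continuous_on_compose2[OF continuous_step_d[of UNIV]] continuous_intros X_cont) auto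

text \<open>The fold is injective, so the tube covers [0, 1] times [0, H] at most once and the
  weighted area is finite. All control of the chart for large \<xi> is drawn from this.\<close>

lemma area_integrable: "integrable lborel (\<lambda>q. indicator Q0 q * (\<bar>J q\<bar> * step_d (fst (X q))))"
proof (rule transfer_integral(1)[where f = "\<lambda>z. step_d (fst z)"])
  have c: "continuous_on ({0..1} \<times> {0..H}) (\<lambda>z. step_d (fst z))"
    by (intro continuous_on_compose2[OF continuous_step_d[of UNIV]] continuous_intros) auto
  have "compact ({0..1::real} \<times> {0..H})" by (intro compact_Times compact_Icc)
  from borel_integrable_compact[OF this c]
  have 1: "integrable lborel (\<lambda>z. indicator ({0..1} \<times> {0..H}) z *\<^sub>R step_d (fst z))" .
  have M: "M1 \<in> sets lborel" using open_M1 by (simp add: borel_open)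
  have "integrable lborel (\<lambda>z. indicator M1 z *\<^sub>R (indicator ({0..1} \<times> {0..H}) z *\<^sub>R step_d (fst z)))"
    by (rule integrable_mult_indicator[OF M 1])
  moreover have "indicator M1 z *\<^sub>R (indicator ({0..1} \<times> {0..H}) z *\<^sub>R step_d (fst z)) = indicator M1 z * step_d (fst z)" for z
    using M1_sub step_d_zero[of "fst z"] by (cases z) (force split: split_indicator)
  ultimately show "integrable lborel (\<lambda>z. indicator M1 z * step_d (fst z))" by (simp only:)
  show "continuous_on Q0 (\<lambda>q. \<bar>J q\<bar> * step_d (fst (X q)))"
    by (intro continuous_intros J_cont step_d_X_cont)
qed (simp add: fold_X_def)

lemma strip_integrable:
  assumes w: "continuous_on Q0 w" "\<And>q. q \<in> Q0 \<Longrightarrow> \<bar>w q\<bar> \<le> C * \<bar>J q\<bar>" "0 \<le> C"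
  shows "integrable lborel (\<lambda>q. indicator Q0 q * (step_d (fst (X q)) * w q))"
proof (rule Bochner_Integration.integrable_bound)
  show "integrable lborel (\<lambda>q. C * (indicator Q0 q * (\<bar>J q\<bar> * step_d (fst (X q)))))"
    by (rule integrable_mult_right[OF area_integrable])
  show "(\<lambda>q. indicator Q0 q * (step_d (fst (X q)) * w q)) \<in> borel_measurable lborel"
    using borel_Q0[OF continuous_on_mult[OF step_d_X_cont w(1)]] by simp
  show "AE q in lborel. norm (indicator Q0 q * (step_d (fst (X q)) * w q)) \<le> norm (C * (indicator Q0 q * (\<bar>J q\<bar> * step_d (fst (X q)))))"
  proof (intro AE_I2)
    fix q
    show "norm (indicator Q0 q * (step_d (fst (X q)) * w q)) \<le> norm (C * (indicator Q0 q * (\<bar>J q\<bar> * step_d (fst (X q)))))"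
    proof (cases "q \<in> Q0")
      case True
      have "step_d (fst (X q)) * \<bar>w q\<bar> \<le> step_d (fst (X q)) * (C * \<bar>J q\<bar>)"
        by (rule mult_left_mono[OF w(2)[OF True] step_d_nonneg])
      then show ?thesis using True w(3) step_d_nonneg[of "fst (X q)"] by (simp add: abs_mult mult_ac)
    qed simp
  qed
qed

text \<open>|J| = e1 e2 with both factors at least 1 / K, while e1 and e2 are the lengths of the two
  derivatives of \<open>X\<close>. So the area density dominates these derivatives and
  constants.\<close>

lemma J_lower:
  assumes q: "q \<in> Q0"
  shows "\<bar>fst (Xr q)\<bar> \<le> K * \<bar>J q\<bar>" "\<bar>fst (Xs q)\<bar> \<le> K * \<bar>J q\<bar>" "1 \<le> K\<^sup>2 * \<bar>J q\<bar>"
proof -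
  have e: "0 < e1 q" "0 < e2 q" "1 \<le> K * e1 q" "1 \<le> K * e2 q"
    using e_pos[OF q] e_lower[OF q] pos by (auto simp: field_simps)
  have le: "\<bar>a\<bar> \<le> e" if "a\<^sup>2 + a'\<^sup>2 = e\<^sup>2" "0 < e" for a a' e :: real
  proof -
    have "a\<^sup>2 \<le> e\<^sup>2" using that(1) zero_le_power2[of a'] by linarith
    then show ?thesis using that(2) by (simp add: abs_le_square_iff[symmetric])
  qed
  have r: "\<bar>fst (Xr q)\<bar> \<le> e1 q" "\<bar>fst (Xs q)\<bar> \<le> e2 q"
    using le[OF comps(1)[OF q] e(1)] le[OF comps(2)[OF q] e(2)] by auto
  have "e1 q * 1 \<le> e1 q * (K * e2 q)" using e by (intro mult_left_mono) auto
  then show "\<bar>fst (Xr q)\<bar> \<le> K * \<bar>J q\<bar>" using r(1) unfolding J_abs[OF q] by (simp add: mult_ac)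
  have "e2 q * 1 \<le> e2 q * (K * e1 q)" using e by (intro mult_left_mono) auto
  then show "\<bar>fst (Xs q)\<bar> \<le> K * \<bar>J q\<bar>" using r(2) unfolding J_abs[OF q] by (simp add: mult_ac)
  have "1 * 1 \<le> (K * e1 q) * (K * e2 q)" using e by (intro mult_mono) auto
  then show "1 \<le> K\<^sup>2 * \<bar>J q\<bar>" unfolding J_abs[OF q] by (simp add: power2_eq_square mult_ac)
qed

text \<open>A smoothed indicator of the position in x: 0 to the left of [0, 1] and 1 to the right.
  Its limits as \<xi> runs to the two ends tell in which direction the line crosses.\<close>

definition \<Theta> :: "real \<Rightarrow> real \<Rightarrow> real" where "\<Theta> r s = step (fst (X (r, s)))"

lemma X_lines:
  assumes q: "(r, s) \<in> Q0"
  shows "((\<lambda>s. fst (X (r, s))) has_real_derivative fst (Xs (r, s))) (at s)"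
    "((\<lambda>r. fst (X (r, s))) has_real_derivative fst (Xr (r, s))) (at r)"
  using DERIV_line_real[OF has_derivative_fst[OF X_der[OF q]]] by simp_all

lemma DERIV_\<Theta>:
  assumes q: "(r, s) \<in> Q0"
  shows "(\<Theta> r has_real_derivative step_d (fst (X (r, s))) * fst (Xs (r, s))) (at s)"
    "((\<lambda>r. \<Theta> r s) has_real_derivative step_d (fst (X (r, s))) * fst (Xr (r, s))) (at r)"
  unfolding \<Theta>_def[abs_def] using DERIV_chain2[OF DERIV_step X_lines(1)[OF q]] DERIV_chain2[OF DERIV_step X_lines(2)[OF q]]
  by simp_all

text \<open>The first integral forbids a line to linger over 0 \<le> x \<le> 1, the second makes
  \<Theta> converge along a line, and the third compares \<Theta> on different lines.\<close>

lemma D_int: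
  "integrable lborel (\<lambda>q. indicator Q0 q * (step_d (fst (X q)) * 1))"
  "integrable lborel (\<lambda>q. indicator Q0 q * (step_d (fst (X q)) * fst (Xs q)))"
  "integrable lborel (\<lambda>q. indicator Q0 q * (step_d (fst (X q)) * \<bar>fst (Xr q)\<bar>))"
  by (rule strip_integrable[where C = "K\<^sup>2"] strip_integrable[where C = K];
      (intro continuous_intros X_cont')?; use pos in \<open>simp add: J_lower\<close>)+

end

section \<open>Direction of the streamlines and evaluation of the flux\<close>

context tube_geometry
begin

text \<open>The lines singled out by Fubini from \<open>D_int\<close>; almost every line of the tube
  is one.\<close>

definition good :: "real \<Rightarrow> bool" where
  "good r \<longleftrightarrow> r \<in> {c0 - h<..<c0 + h} \<and> integrable lborel (\<lambda>s. step_d (fst (X (r, s))))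
     \<and> integrable lborel (\<lambda>s. step_d (fst (X (r, s))) * fst (Xs (r, s)))"

lemma Q0_iff: "(r, s) \<in> Q0 \<longleftrightarrow> r \<in> {c0 - h<..<c0 + h}" by (simp add: Q0_def)

lemma good_AE: "AE r in lborel. r \<in> {c0 - h<..<c0 + h} \<longrightarrow> good r"
proof -
  have "AE r in lborel. integrable lborel (\<lambda>s. indicator Q0 (r, s) * (step_d (fst (X (r, s))) * 1))"
    using lborel_pair.AE_integrable_fst'[of "\<lambda>q. indicator Q0 q * (step_d (fst (X q)) * 1)"] D_int(1)
    by (simp only: lborel_prod)
  moreover have "AE r in lborel. integrable lborel (\<lambda>s. indicator Q0 (r, s) * (step_d (fst (X (r, s))) * fst (Xs (r, s))))"
    using lborel_pair.AE_integrable_fst'[of "\<lambda>q. indicator Q0 q * (step_d (fst (X q)) * fst (Xs q))"] D_int(2)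
    by (simp only: lborel_prod)
  ultimately show ?thesis
    by eventually_elim (auto simp: good_def Q0_iff)
qed

lemma \<Theta>_range: "0 \<le> \<Theta> r s" "\<Theta> r s \<le> 1" by (simp_all add: \<Theta>_def step_range)

lemma X_line_cont: "r \<in> {c0 - h<..<c0 + h} \<Longrightarrow> continuous_on UNIV (\<lambda>s. g (r, s))"
  if "continuous_on Q0 g" for g :: "real \<times> real \<Rightarrow> 'a::topological_space"
  by (rule continuous_on_compose2[OF that]) (auto intro!: continuous_intros simp: Q0_iff)

text \<open>If the limit were strictly between 0 and 1, then by \<open>step_mult_compl_le\<close>
  the density \<open>step_d\<close> would stay above a positive constant near that end, contrary to
  its integrability along the line. The 8 is 2 for staying close to the limit times the 4 of that
  lemma.\<close>

lemma good_limit_01: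
  assumes r: "good r" and F: "F = at_top \<or> F = at_bot" and L: "(\<Theta> r \<longlongrightarrow> L) F"
  shows "L = 0 \<or> L = 1"
proof (rule ccontr)
  assume ne: "\<not> (L = 0 \<or> L = 1)"
  have Fb: "F \<noteq> bot" using F trivial_limit_at_top_linorder[where 'a = real] trivial_limit_at_bot_linorder[where 'a = real] by metis
  have "0 \<le> L" by (rule tendsto_lowerbound[OF L _ Fb]) (simp add: \<Theta>_range)
  moreover have "L \<le> 1" by (rule tendsto_upperbound[OF L _ Fb]) (simp add: \<Theta>_range)
  ultimately have l: "0 < L * (1 - L)" using ne by simp
  have "((\<lambda>s. \<Theta> r s * (1 - \<Theta> r s)) \<longlongrightarrow> L * (1 - L)) F" by (intro tendsto_intros L)
  then have "\<forall>\<^sub>F s in F. L * (1 - L) / 2 < \<Theta> r s * (1 - \<Theta> r s)"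
    by (rule order_tendstoD) (use l in simp)
  then have ev: "\<forall>\<^sub>F s in F. L * (1 - L) / 8 \<le> step_d (fst (X (r, s)))"
  proof eventually_elim
    case (elim s)
    then show ?case using step_mult_compl_le[of "fst (X (r, s))"] by (simp add: \<Theta>_def)
  qed
  have "\<exists>a. \<forall>s\<in>{a..a + real n}. L * (1 - L) / 8 \<le> step_d (fst (X (r, s)))" for n
    using F
  proof
    assume "F = at_top"
    then obtain N where "\<forall>s\<ge>N. L * (1 - L) / 8 \<le> step_d (fst (X (r, s)))"
      using ev by (auto simp: eventually_at_top_linorder)
    then show ?thesis by (intro exI[of _ N]) auto
  next
    assume "F = at_bot"
    then obtain N where "\<forall>s\<le>N. L * (1 - L) / 8 \<le> step_d (fst (X (r, s)))"
      using ev by (auto simp: eventually_at_bot_linorder)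
    then show ?thesis by (intro exI[of _ "N - real n"]) auto
  qed
  then show False
    using not_integrable_if_large[of "\<lambda>s. step_d (fst (X (r, s)))" "L * (1 - L) / 8"] r l step_d_nonneg
    by (auto simp: good_def)
qed

text \<open>The line projects onto the whole x-axis, while x is bounded over compact ranges of
  \<xi>. Were both limits 1, x would be bounded below along the line, and were both 0, bounded
  above; hence they differ. The sign encodes which is which: the limit at the upper end is (1 +
  \<epsilon>) / 2. Nothing is claimed about monotonicity of x.\<close>

lemma good_limits:
  assumes r: "good r"
  obtains \<epsilon> where "\<epsilon> \<in> {-1, 1 :: real}" "(\<Theta> r \<longlongrightarrow> (1 + \<epsilon>) / 2) at_top"
    "(\<integral>s. step_d (fst (X (r, s))) * fst (Xs (r, s)) \<partial>lborel) = \<epsilon>"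
proof -
  have rI: "r \<in> {c0 - h<..<c0 + h}" using r by (simp add: good_def)
  have cx: "continuous_on UNIV (\<lambda>s. fst (X (r, s)))"
    using X_line_cont[OF continuous_on_fst[OF X_cont] rI] .
  have "continuous_on Q0 (\<lambda>q. step_d (fst (X q)) * fst (Xs q))"
    by (intro continuous_intros step_d_X_cont X_cont')
  from X_line_cont[OF this rI]
  have c: "continuous_on UNIV (\<lambda>s. step_d (fst (X (r, s))) * fst (Xs (r, s)))" .
  obtain Lp Lm where L: "(\<Theta> r \<longlongrightarrow> Lp) at_top" "(\<Theta> r \<longlongrightarrow> Lm) at_bot"
    "(\<integral>s. step_d (fst (X (r, s))) * fst (Xs (r, s)) \<partial>lborel) = Lp - Lm"
    using limits_of_integrable_derivative[OF DERIV_\<Theta>(1) c] rI r by (auto simp: Q0_iff good_def)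
  have p: "Lp = 0 \<or> Lp = 1" by (rule good_limit_01[OF r _ L(1)]) simp
  have m: "Lm = 0 \<or> Lm = 1" by (rule good_limit_01[OF r _ L(2)]) simp
  have bd: "bounded ((\<lambda>s. fst (X (r, s))) ` {N'..N})" for N N' :: real
    by (intro compact_imp_bounded compact_continuous_image compact_Icc continuous_on_subset[OF cx]) auto
  have onto: "\<exists>s. fst (X (r, s)) = a" for a 
  proof -
    have "a \<in> range (\<lambda>s. fst (X (r, s)))" unfolding surj_x[OF rI] by simp
    then show ?thesis by (auto simp: image_iff)
  qed
  have "\<not> (Lp = 1 \<and> Lm = 1)"
  proof
    assume L1: "Lp = 1 \<and> Lm = 1"
    have "\<forall>\<^sub>F s in at_top. 0 < \<Theta> r s" "\<forall>\<^sub>F s in at_bot. 0 < \<Theta> r s"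
      using L L1 by (auto intro: order_tendstoD)
    then obtain N N' where N: "\<And>s. s \<ge> N \<Longrightarrow> 0 < \<Theta> r s" "\<And>s. s \<le> N' \<Longrightarrow> 0 < \<Theta> r s"
      unfolding eventually_at_top_linorder eventually_at_bot_linorder by blast
    obtain M where M: "\<And>s. s \<in> {N'..N} \<Longrightarrow> \<bar>fst (X (r, s))\<bar> \<le> M"
      using bd[of N' N] unfolding bounded_iff by force
    \<comment> \<open>Here \<Theta> vanishes, so s lies between N' and N, where |x| \<le> M: a
      contradiction.\<close>
    obtain s where s: "fst (X (r, s)) = - \<bar>M\<bar> - 1" using onto by blast
    have "s \<in> {N'..N}"
    proof (rule ccontr)
      assume "s \<notin> {N'..N}"
      then have "0 < \<Theta> r s" using N[of s] by (metis atLeastAtMost_iff linear)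
      moreover have "fst (X (r, s)) \<le> 0" unfolding s by linarith
      ultimately show False using step_le_0[of "fst (X (r, s))"] by (simp add: \<Theta>_def)
    qed
    then show False using M[of s] s by linarith
  qed
  moreover have "\<not> (Lp = 0 \<and> Lm = 0)"
  proof
    assume L0: "Lp = 0 \<and> Lm = 0"
    have "\<forall>\<^sub>F s in at_top. \<Theta> r s < 1" "\<forall>\<^sub>F s in at_bot. \<Theta> r s < 1"
      using L L0 by (auto intro: order_tendstoD)
    then obtain N N' where N: "\<And>s. s \<ge> N \<Longrightarrow> \<Theta> r s < 1" "\<And>s. s \<le> N' \<Longrightarrow> \<Theta> r s < 1"
      unfolding eventually_at_top_linorder eventually_at_bot_linorder by blast
    obtain M where M: "\<And>s. s \<in> {N'..N} \<Longrightarrow> \<bar>fst (X (r, s))\<bar> \<le> M"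
      using bd[of N' N] unfolding bounded_iff by force
    obtain s where s: "fst (X (r, s)) = \<bar>M\<bar> + 1" using onto by blast
    have "s \<in> {N'..N}"
    proof (rule ccontr)
      assume "s \<notin> {N'..N}"
      then have "\<Theta> r s < 1" using N[of s] by (metis atLeastAtMost_iff linear)
      moreover have "1 \<le> fst (X (r, s))" unfolding s by linarith
      ultimately show False using step_ge_1[of "fst (X (r, s))"] by (simp add: \<Theta>_def)
    qed
    then show False using M[of s] s by linarith
  qed
  ultimately consider "Lp = 1" "Lm = 0" | "Lp = 0" "Lm = 1" using p m by blast
  then show ?thesis
  proof cases
    case 1 then show ?thesis using that[of 1] L by simp
  next
    case 2 then show ?thesis using that[of "-1"] L by simp
  qed
qed

text \<open>Two lines running in opposite directions would force every late cross section to have length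
  at least \<open>1\<close> over \<open>0 \<le> x \<le> 1\<close>, against the finite area.\<close>

lemma same_direction:
  assumes r: "good r1" "good r2" "r1 < r2"
    and L: "(\<Theta> r1 \<longlongrightarrow> L1) at_top" "(\<Theta> r2 \<longlongrightarrow> L2) at_top"
  shows "L1 = L2"
proof (rule ccontr)
  assume ne: "L1 \<noteq> L2"
  define R where "R = (\<lambda>q. step_d (fst (X q)) * \<bar>fst (Xr q)\<bar>)"
  \<comment> \<open>The x-variation between the two lines along the cross section \<xi> = s,
    weighted by \<open>step_d\<close>. It dominates the difference of the two values of \<Theta> and
    is integrable in s by Fubini.\<close>
  define g where "g = (\<lambda>s. \<integral>r. indicator {r1..r2} r * (indicator Q0 (r, s) * R (r, s)) \<partial>lborel)"
  have sub: "{r1..r2} \<subseteq> {c0 - h<..<c0 + h}" using r by (auto simp: good_def)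
  have "integrable lborel (\<lambda>q. indicator ({r1..r2} \<times> UNIV) q *\<^sub>R (indicator Q0 q * R q))"
    unfolding R_def by (intro integrable_mult_indicator D_int(3)) (simp add: borel_closed closed_Times)
  then have "integrable (lborel \<Otimes>\<^sub>M lborel) (\<lambda>(r, s). indicator {r1..r2} r * (indicator Q0 (r, s) * R (r, s)))"
    unfolding lborel_prod by (simp add: case_prod_unfold indicator_def if_distrib mem_Times_iff cong: if_cong)
  from lborel_pair.integrable_snd[OF this]
  have gi: "integrable lborel g" by (simp add: g_def)
  have R0: "0 \<le> R q" for q by (simp add: R_def step_d_nonneg)
  have g0: "0 \<le> g s" for s unfolding g_def
    by (intro Bochner_Integration.integral_nonneg mult_nonneg_nonneg R0) auto
  have le: "\<bar>\<Theta> r2 s - \<Theta> r1 s\<bar> \<le> g s" for s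
  proof -
    have c: "continuous_on {r1..r2} (\<lambda>r. step_d (fst (X (r, s))) * fst (Xr (r, s)))"
    proof -
      have "continuous_on Q0 (\<lambda>q. step_d (fst (X q)) * fst (Xr q))"
        by (intro continuous_intros step_d_X_cont X_cont')
      then show ?thesis
        by (rule continuous_on_compose2) (use sub in \<open>auto intro!: continuous_intros simp: Q0_iff\<close>)
    qed
    have "(\<integral>r. indicator {r1..r2} r *\<^sub>R (step_d (fst (X (r, s))) * fst (Xr (r, s))) \<partial>lborel) = \<Theta> r2 s - \<Theta> r1 s"
    proof (rule integral_FTC_Icc[OF _ _ c])
      fix r assume "r1 \<le> r" "r \<le> r2"
      then have Q: "(r, s) \<in> Q0" using sub by (force simp: Q0_iff)
      show "((\<lambda>r. \<Theta> r s) has_vector_derivative step_d (fst (X (r, s))) * fst (Xr (r, s))) (at r within {r1..r2})"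
        unfolding has_real_derivative_iff_has_vector_derivative[symmetric]
        by (rule has_field_derivative_at_within[OF DERIV_\<Theta>(2)[OF Q]])
    qed (use r(3) in simp)
    then have "\<bar>\<Theta> r2 s - \<Theta> r1 s\<bar> \<le> (\<integral>r. \<bar>indicator {r1..r2} r *\<^sub>R (step_d (fst (X (r, s))) * fst (Xr (r, s)))\<bar> \<partial>lborel)"
      by (metis integral_abs_bound)
    also have "\<dots> = g s"
      unfolding g_def R_def
      by (rule Bochner_Integration.integral_cong[OF refl])
        (use sub in \<open>auto simp: abs_mult step_d_nonneg Q0_iff split: split_indicator\<close>)
    finally show ?thesis .
  qed
  have "((\<lambda>s. \<bar>\<Theta> r2 s - \<Theta> r1 s\<bar>) \<longlongrightarrow> \<bar>L2 - L1\<bar>) at_top" by (intro tendsto_intros L)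
  then have "\<forall>\<^sub>F s in at_top. \<bar>L2 - L1\<bar> / 2 < \<bar>\<Theta> r2 s - \<Theta> r1 s\<bar>"
    by (rule order_tendstoD) (use ne in simp)
  then obtain N where N: "\<And>s. s \<ge> N \<Longrightarrow> \<bar>L2 - L1\<bar> / 2 < \<bar>\<Theta> r2 s - \<Theta> r1 s\<bar>"
    unfolding eventually_at_top_linorder by blast
  have "\<exists>a. \<forall>s\<in>{a..a + real n}. \<bar>L2 - L1\<bar> / 2 \<le> g s" for n
  proof (intro exI[of _ N] ballI)
    fix s assume "s \<in> {N..N + real n}"
    then have "\<bar>L2 - L1\<bar> / 2 < \<bar>\<Theta> r2 s - \<Theta> r1 s\<bar>" using N by simp
    then show "\<bar>L2 - L1\<bar> / 2 \<le> g s" using le[of s] by linarith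
  qed
  then show False using not_integrable_if_large[OF gi g0, of "\<bar>L2 - L1\<bar> / 2"] ne by simp
qed

text \<open>All good lines share their limits at the upper end by \<open>same_direction\<close>,
  hence also the sign of the crossing.\<close>

lemma direction:
  obtains \<epsilon> where "\<epsilon> \<in> {-1, 1 :: real}"
    "AE r in lborel. r \<in> {c0 - h<..<c0 + h} \<longrightarrow>
       (\<integral>s. step_d (fst (X (r, s))) * fst (Xs (r, s)) \<partial>lborel) = \<epsilon>"
proof (cases "\<exists>r. good r")
  case True
  then obtain r0 where r0: "good r0" by blast
  obtain \<epsilon> where \<epsilon>: "\<epsilon> \<in> {-1, 1 :: real}" "(\<Theta> r0 \<longlongrightarrow> (1 + \<epsilon>) / 2) at_top"
    using good_limits[OF r0] by blast
  have "(\<integral>s. step_d (fst (X (r, s))) * fst (Xs (r, s)) \<partial>lborel) = \<epsilon>" if r: "good r" for r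
  proof -
    obtain \<epsilon>' where \<epsilon>': "(\<Theta> r \<longlongrightarrow> (1 + \<epsilon>') / 2) at_top"
      "(\<integral>s. step_d (fst (X (r, s))) * fst (Xs (r, s)) \<partial>lborel) = \<epsilon>'"
      using good_limits[OF r] by blast
    have "(1 + \<epsilon>') / 2 = (1 + \<epsilon>) / 2"
    proof (cases r r0 rule: linorder_cases)
      case less then show ?thesis using same_direction[OF r r0 _ \<epsilon>'(1) \<epsilon>(2)] by simp
    next
      case equal then show ?thesis using \<epsilon>'(1) \<epsilon>(2) tendsto_unique[OF trivial_limit_at_top_linorder] by blast
    next
      case greater then show ?thesis using same_direction[OF r0 r _ \<epsilon>(2) \<epsilon>'(1)] by simp
    qed
    then show ?thesis using \<epsilon>'(2) by simp
  qed
  then have "AE r in lborel. r \<in> {c0 - h<..<c0 + h} \<longrightarrow>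
       (\<integral>s. step_d (fst (X (r, s))) * fst (Xs (r, s)) \<partial>lborel) = \<epsilon>"
    using good_AE by (auto elim!: eventually_mono)
  then show ?thesis using that \<epsilon>(1) by blast
next
  \<comment> \<open>Without good lines the claim is vacuous by \<open>good_AE\<close>, and 1 is a
    default value.\<close>
  case False
  then have "AE r in lborel. r \<in> {c0 - h<..<c0 + h} \<longrightarrow>
       (\<integral>s. step_d (fst (X (r, s))) * fst (Xs (r, s)) \<partial>lborel) = 1"
    using good_AE by (auto elim!: eventually_mono)
  then show ?thesis by (intro that[of 1]) auto
qed

lemma u1_cont: "continuous_on (UNIV \<times> {0..H}) (\<lambda>z. fst (u z))"
  by (rule continuous_on_fst[OF u_cont])

text \<open>The flux does not depend on x, so averaging it against \<open>step_d\<close>, which has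
  mass 1, turns it into an integral over the plane to which the change of variables applies.
  Restriction to \<open>M1\<close> loses nothing, as \<open>psi\<close> vanishes off the translates
  of \<open>V\<close> and the lines y = 0 and y = H are negligible.\<close>

lemma flux_integral:
  assumes F: "\<And>x. integral {0..H} (\<lambda>y. psi (x, y) * fst (u (x, y))) = F"
  defines "f \<equiv> \<lambda>z. step_d (fst z) * (psi z * fst (u z))"
  shows "integrable lborel (\<lambda>z. indicator M1 z * f z)" "integral\<^sup>L lborel (\<lambda>z. indicator M1 z * f z) = F"
proof -
  have "continuous_on (UNIV \<times> {0..H}) f"
    unfolding f_def by (intro continuous_intros psi_cont u1_cont continuous_on_compose2[OF continuous_step_d[of UNIV]]) auto
  then have c: "continuous_on ({0..1} \<times> {0..H}) f" by (rule continuous_on_subset) auto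
  have "compact ({0..1::real} \<times> {0..H})" by (intro compact_Times compact_Icc)
  from borel_integrable_compact[OF this c]
  have 1: "integrable lborel (\<lambda>z. indicator ({0..1} \<times> {0..H}) z *\<^sub>R f z)" .
  have M: "M1 \<in> sets lborel" using open_M1 by (simp add: borel_open)
  have "integrable lborel (\<lambda>z. indicator M1 z *\<^sub>R (indicator ({0..1} \<times> {0..H}) z *\<^sub>R f z))"
    by (rule integrable_mult_indicator[OF M 1])
  moreover have "indicator M1 z *\<^sub>R (indicator ({0..1} \<times> {0..H}) z *\<^sub>R f z) = indicator M1 z * f z" for z
    using M1_sub step_d_zero[of "fst z"] by (cases z) (force simp: f_def split: split_indicator)
  ultimately show int: "integrable lborel (\<lambda>z. indicator M1 z * f z)" by (simp only:)
  have inner: "(\<integral>y. indicator M1 (x, y) * f (x, y) \<partial>lborel) = step_d x * F" for x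
  proof -
    have c: "continuous_on {0..H} (\<lambda>y. psi (x, y) * fst (u (x, y)))"
    proof -
      have "continuous_on (UNIV \<times> {0..H}) (\<lambda>z. psi z * fst (u z))" by (intro continuous_intros psi_cont u1_cont)
      then show ?thesis by (rule continuous_on_compose2) (auto intro!: continuous_intros)
    qed
    have si: "set_integrable lborel {0..H} (\<lambda>y. psi (x, y) * fst (u (x, y)))"
      by (rule borel_integrable_atLeastAtMost'[OF c])
    have eq: "indicator M1 (x, y) * f (x, y) = indicator {0<..<H} y * f (x, y)" for y
    proof (cases "y \<in> {0<..<H} \<and> (x, y) \<notin> M1")
      case True
      then have "psi (x, y) = 0" using lift_support[of _ "(x, y)"] unfolding psi_def M1_def by force
      then show ?thesis by (simp add: f_def)
    next
      case False
      then show ?thesis by (auto simp: M1_def split: split_indicator)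
    qed
    have m: "(\<lambda>y. indicator {0..H} y *\<^sub>R (psi (x, y) * fst (u (x, y)))) \<in> borel_measurable lborel"
      using si unfolding set_integrable_def by (rule borel_measurable_integrable)
    have "(\<integral>y. indicator M1 (x, y) * f (x, y) \<partial>lborel)
       = (\<integral>y. step_d x * (indicator {0<..<H} y * (indicator {0..H} y *\<^sub>R (psi (x, y) * fst (u (x, y))))) \<partial>lborel)"
      unfolding eq by (rule Bochner_Integration.integral_cong[OF refl]) (auto simp: f_def split: split_indicator)
    also have "\<dots> = step_d x * (\<integral>y. indicator {0<..<H} y * (indicator {0..H} y *\<^sub>R (psi (x, y) * fst (u (x, y)))) \<partial>lborel)"
      by simp
    also have "(\<integral>y. indicator {0<..<H} y * (indicator {0..H} y *\<^sub>R (psi (x, y) * fst (u (x, y)))) \<partial>lborel)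
        = (\<integral>y. indicator {0..H} y *\<^sub>R (psi (x, y) * fst (u (x, y))) \<partial>lborel)"
    proof (rule integral_cong_AE)
      show "AE y in lborel. indicator {0<..<H} y * (indicator {0..H} y *\<^sub>R (psi (x, y) * fst (u (x, y))))
          = indicator {0..H} y *\<^sub>R (psi (x, y) * fst (u (x, y)))"
        using AE_lborel_singleton[of 0] AE_lborel_singleton[of H]
        by eventually_elim (auto split: split_indicator)
    qed (use m in auto)
    also have "\<dots> = integral {0..H} (\<lambda>y. psi (x, y) * fst (u (x, y)))"
      using set_borel_integral_eq_integral(2)[OF si] by (simp add: set_lebesgue_integral_def)
    finally show ?thesis using F by simp
  qed
  have s1: "(\<integral>x. step_d x \<partial>lborel) = 1"
  proof -
    have "(\<integral>x. indicator {0..1} x *\<^sub>R step_d x \<partial>lborel) = step 1 - step 0"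
      by (intro integral_FTC_Icc continuous_step_d)
        (auto simp: has_real_derivative_iff_has_vector_derivative[symmetric] intro!: has_field_derivative_at_within DERIV_step)
    moreover have "indicator {0..1} x *\<^sub>R step_d x = step_d x" for x
      using step_d_zero[of x] by (auto split: split_indicator)
    ultimately show ?thesis by (simp only: step_le_0 step_ge_1 order_refl diff_zero)
  qed
  have "integral\<^sup>L lborel (\<lambda>z. indicator M1 z * f z) = (\<integral>x. (\<integral>y. indicator M1 (x, y) * f (x, y) \<partial>lborel) \<partial>lborel)"
    using lborel_pair.integral_fst'[of "\<lambda>z. indicator M1 z * f z"] int by (simp only: lborel_prod)
  also have "\<dots> = F" unfolding inner by (simp add: s1)
  finally show "integral\<^sup>L lborel (\<lambda>z. indicator M1 z * f z) = F" .
qed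

text \<open>In the coordinates the area density times u1 is, up to sign, \<open>b\<close> times the
  \<xi>-derivative of x. Since \<open>b\<close> and the bump depend on \<rho> only, the integral in
  \<xi> is the total change of \<Theta>, which is +1 or -1 with the same sign on almost every line.
  What is left is the integral over \<rho> of the bump times E1 |u|; constancy of all three signs
  excludes cancellation.\<close>

theorem flux_lower:
  assumes F: "\<And>x. integral {0..H} (\<lambda>y. psi (x, y) * fst (u (x, y))) = F"
  shows "h * Gs / 8 \<le> \<bar>F\<bar>"
proof -
  define I where "I = {c0 - h<..<c0 + h}"
  obtain \<sigma> where \<sigma>: "\<sigma> \<in> {-1, 1 :: real}" "\<And>q. q \<in> Q0 \<Longrightarrow> \<bar>J q\<bar> = \<sigma> * J q"
    using constant_sign[OF connected_Q0 J_cont J_nz] by metis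
  define \<beta> where "\<beta> = (\<lambda>r. b (X (r, 0)))"
  have b\<beta>: "b (X (r, s)) = \<beta> r" if "r \<in> I" for r s
    unfolding \<beta>_def using that by (intro b_const) (auto simp: Q0_iff I_def)
  have \<beta>_lower: "Gs / 2 \<le> \<bar>\<beta> r\<bar>" "\<beta> r \<noteq> 0" if "r \<in> I" for r
  proof -
    have q: "(r, 0) \<in> Q0" using that by (simp add: Q0_iff I_def)
    show "Gs / 2 \<le> \<bar>\<beta> r\<bar>" unfolding \<beta>_def b_abs[OF q] by (rule g_lower[OF q])
    have "0 < \<bar>\<beta> r\<bar>" unfolding \<beta>_def b_abs[OF q] using e_pos(1)[OF q] u_nz[OF X_in_V[OF q]] by simp
    then show "\<beta> r \<noteq> 0" by simp
  qed
  have b_cont: "continuous_on V b"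
    using b_diff differentiable_imp_continuous_within by (blast intro: continuous_at_imp_continuous_on)
  have bX_cont: "continuous_on Q0 (\<lambda>q. b (X q))"
    by (rule continuous_on_compose2[OF b_cont X_cont]) (simp add: V_def)
  have "continuous_on I \<beta>"
    unfolding \<beta>_def by (rule continuous_on_compose2[OF bX_cont]) (auto intro!: continuous_intros simp: Q0_iff I_def)
  moreover have "connected I" unfolding I_def by (rule convex_connected[OF convex_real_interval(8)])
  ultimately obtain s\<beta> where s\<beta>: "s\<beta> \<in> {-1, 1 :: real}" "\<And>r. r \<in> I \<Longrightarrow> \<bar>\<beta> r\<bar> = s\<beta> * \<beta> r"
    using constant_sign[of I \<beta>] \<beta>_lower(2) by blast
  obtain \<epsilon> where \<epsilon>: "\<epsilon> \<in> {-1, 1 :: real}" "AE r in lborel. r \<in> I \<longrightarrow>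
       (\<integral>s. step_d (fst (X (r, s))) * fst (Xs (r, s)) \<partial>lborel) = \<epsilon>"
    unfolding I_def by (rule direction) blast
  define w where "w = (\<lambda>q. - \<sigma> * (ph (fst q) * b (X q)) * (step_d (fst (X q)) * fst (Xs q)))"
  have w_cont: "continuous_on Q0 w"
    unfolding w_def
    by (intro continuous_intros bX_cont step_d_X_cont X_cont' continuous_on_compose2[OF ph_cont(1)[of UNIV]]) auto
  have w_eq: "w q = \<bar>J q\<bar> * (step_d (fst (fold_X q)) * (psi (fold_X q) * fst (u (fold_X q))))" if q: "q \<in> S1" for q
  proof -
    have Q: "q \<in> Q0" using q by (simp add: S1_def)
    define k where "k = \<lfloor>snd (X q) / H\<rfloor>"
    have unfold: "fold_X q + (0, of_int k * H) = X q" using fold_X_back[of q] by (simp add: k_def)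
    have kV: "fold_X q + (0, of_int k * H) \<in> V" unfolding unfold by (rule X_in_V[OF Q])
    have "psi (fold_X q) = ph (fst q)" unfolding psi_def lift_eq[OF kV] unfold by (simp add: ch_X[OF Q])
    moreover have "u (fold_X q) = u (X q)"
    proof -
      have "fold_X q \<in> UNIV \<times> {0..H}" using fold_X_snd[OF q] by (cases "fold_X q") auto
      from u_shift'[OF this kV] show ?thesis unfolding unfold by simp
    qed
    moreover have "fst (fold_X q) = fst (X q)" by (simp add: fold_X_def)
    \<comment> \<open>By \<open>grad_rho\<close> the y-derivative of \<rho> times J is minus the
      \<xi>-derivative of x; this converts the horizontal velocity.\<close>
    moreover have Ju: "\<bar>J q\<bar> * fst (u (X q)) = - \<sigma> * (b (X q) * fst (Xs q))"
    proof -
      obtain x y where xy: "X q = (x, y)" by (cases "X q")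
      have V: "(x, y) \<in> V" using X_in_V[OF Q] xy by simp
      have "\<bar>J q\<bar> * fst (u (X q)) = \<sigma> * b (X q) * (ry x y * J q)"
        unfolding \<sigma>(2)[OF Q] xy u_eq_b(1)[OF V] by (simp add: mult_ac)
      then show ?thesis unfolding grad_rho(2)[OF Q xy] by simp
    qed
    moreover have "\<bar>J q\<bar> * (a * (a' * fst (u (X q)))) = - \<sigma> * (a' * b (X q)) * (a * fst (Xs q))" for a a'
    proof -
      have "\<bar>J q\<bar> * (a * (a' * fst (u (X q)))) = a * a' * (\<bar>J q\<bar> * fst (u (X q)))" by (simp add: mult_ac)
      then show ?thesis unfolding Ju by (simp add: mult_ac)
    qed
    ultimately show ?thesis unfolding w_def by (simp only:)
  qed
  note tr = transfer_integral[OF flux_integral(1)[OF F] w_cont w_eq]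
  have F1: "integral\<^sup>L lborel (\<lambda>q. indicator Q0 q * w q) = F"
    using tr(2) flux_integral(2)[OF F] by simp
  have "integrable lborel (\<lambda>r. \<integral>s. indicator Q0 (r, s) * w (r, s) \<partial>lborel)"
    using lborel_pair.integrable_fst'[of "\<lambda>q. indicator Q0 q * w q"] tr(1) by (simp only: lborel_prod)
  note int_fst = this
  have F2: "(\<integral>r. (\<integral>s. indicator Q0 (r, s) * w (r, s) \<partial>lborel) \<partial>lborel) = F"
    using lborel_pair.integral_fst'[of "\<lambda>q. indicator Q0 q * w q"] tr(1) F1 by (simp only: lborel_prod)
  \<comment> \<open>The orientation of the chart, the direction of the lines and the sign of
    \<open>b\<close>, collected in one factor.\<close>
  define s0 where "s0 = - \<sigma> * \<epsilon> * s\<beta>"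
  have s0: "\<bar>s0\<bar> = 1" using \<sigma>(1) \<epsilon>(1) s\<beta>(1) by (auto simp: s0_def)
  define P where "P = (\<lambda>r. indicator I r * (ph r * \<bar>\<beta> r\<bar>))"
  have ae: "AE r in lborel. (\<integral>s. indicator Q0 (r, s) * w (r, s) \<partial>lborel) = s0 * P r"
    using \<epsilon>(2)
  proof eventually_elim
    case (elim r)
    show ?case
    proof (cases "r \<in> I")
      case True
      have "s\<beta> * s\<beta> = 1" using s\<beta>(1) by auto
      then have \<beta>: "\<beta> r = s\<beta> * \<bar>\<beta> r\<bar>" using s\<beta>(2)[OF True] by (metis mult.assoc mult_1)
      have "(\<integral>s. indicator Q0 (r, s) * w (r, s) \<partial>lborel)
         = (\<integral>s. - \<sigma> * (ph r * \<beta> r) * (step_d (fst (X (r, s))) * fst (Xs (r, s))) \<partial>lborel)"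
        using True b\<beta>[OF True] by (intro Bochner_Integration.integral_cong refl) (simp add: w_def Q0_iff I_def)
      also have "\<dots> = - \<sigma> * (ph r * \<beta> r) * \<epsilon>" using elim True by simp
      also have "\<dots> = s0 * P r" using True \<beta> by (simp add: s0_def P_def mult_ac)
      finally show ?thesis .
    next
      case False
      then show ?thesis by (simp add: P_def Q0_iff I_def)
    qed
  qed
  have mP: "P \<in> borel_measurable lborel"
  proof -
    have "continuous_on I (\<lambda>r. ph r * \<bar>\<beta> r\<bar>)" using \<open>continuous_on I \<beta>\<close> by (intro continuous_intros ph_cont)
    then show ?thesis
      using borel_measurable_continuous_on_indicator[of I "\<lambda>r. ph r * \<bar>\<beta> r\<bar>"] by (simp add: P_def I_def)
  qed
  have mI: "(\<lambda>r. \<integral>s. indicator Q0 (r, s) * w (r, s) \<partial>lborel) \<in> borel_measurable lborel"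
    using int_fst by (rule borel_measurable_integrable)
  have "integrable lborel (\<lambda>r. s0 * P r)"
    using int_fst integrable_cong_AE[OF mI _ ae] mP by simp
  then have Pi: "integrable lborel P" using s0 by (auto simp: abs_if split: if_splits)
  have "F = s0 * integral\<^sup>L lborel P"
    using F2 integral_cong_AE[OF mI _ ae] mP by simp
  moreover have "h * Gs / 8 \<le> integral\<^sup>L lborel P"
  proof -
    \<comment> \<open>Length h / 2 of the middle quarter, times 1 / 2 for the bump there, times Gs /
      2 for E1 |u|.\<close>
    have "h * Gs / 8 = (\<integral>r. indicator {c0 - h / 4..c0 + h / 4} r * (Gs / 4) \<partial>lborel)"
      using pos by simp
    also have "\<dots> \<le> integral\<^sup>L lborel P"
    proof (rule integral_mono[OF _ Pi])
      show "integrable lborel (\<lambda>r. indicator {c0 - h / 4..c0 + h / 4} r * (Gs / 4))"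
        by (intro integrable_mult_left integrable_real_indicator) (auto simp: emeasure_lborel_Icc_eq)
      fix r
      show "indicator {c0 - h / 4..c0 + h / 4} r * (Gs / 4) \<le> P r"
      proof (cases "r \<in> {c0 - h / 4..c0 + h / 4}")
        case True
        then have rI: "r \<in> I" using pos by (auto simp: I_def)
        have "\<bar>r - c0\<bar> \<le> h / 4" using True unfolding abs_le_iff atLeastAtMost_iff by linarith
        then have "\<bar>(r - c0) / h\<bar> \<le> 1 / 4" using pos by (simp add: abs_divide field_simps)
        then have "1 / 2 * (Gs / 2) \<le> ph r * \<bar>\<beta> r\<bar>"
          using bump_lower \<beta>_lower(1)[OF rI] pos by (intro mult_mono) (auto simp: ph_def bump_range)
        then show ?thesis using True rI by (simp add: P_def)
      next
        case False
        then show ?thesis by (auto simp: P_def ph_def bump_range intro!: mult_nonneg_nonneg)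
      qed
    qed
    finally show ?thesis .
  qed
  moreover have "0 \<le> h * Gs / 8" using pos by simp
  ultimately show ?thesis using s0 by (simp add: abs_mult)
qed

end

section \<open>Percolating flows and traveling waves\<close>

lemma DERIV_unique_Icc:
  assumes "(f has_real_derivative a) (at y within {0..H})" "(f has_real_derivative a') (at y within {0..H})"
    and "y \<in> {0..H}" "0 < H"
  shows "a = a'"
  using vector_derivative_unique_within_closed_interval[of 0 H y f a a'] assms
  by (simp add: has_real_derivative_iff_has_vector_derivative)

abbreviation open_strip :: "tube \<Rightarrow> (real \<times> real) set" where
  "open_strip D \<equiv> {centre D - half_width D<..<centre D + half_width D} \<times> UNIV"

lemma C1_on_continuous: "C1_on S g \<Longrightarrow> continuous_on S g"
proof -
  assume "C1_on S g"
  then obtain g' where "\<And>z. z \<in> S \<Longrightarrow> (g has_derivative blinfun_apply (g' z)) (at z within S)"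
    unfolding C1_on_def by blast
  then show ?thesis by (rule has_derivative_continuous_on)
qed

lemma C2_on_continuous: "C2_on S g \<Longrightarrow> continuous_on S g"
proof -
  assume "C2_on S g"
  then obtain g' where "\<And>z. z \<in> S \<Longrightarrow> (g has_derivative blinfun_apply (g' z)) (at z within S)"
    unfolding C2_on_def by blast
  then show ?thesis by (rule has_derivative_continuous_on)
qed

lemma slab_subset_domain: "UNIV \<times> {0..H} \<subseteq> domain b H"
  by (cases b) (auto simp: domain_def y_range_def)

lemma per_int:
  fixes g :: "real \<Rightarrow> 'a" and i :: int
  assumes "\<And>r. g (r + P) = g r" shows "g (r + of_int i * P) = g r"
proof (induction i arbitrary: r rule: int_induct[where k = 0])
  case base then show ?case by simp
next
  case (step1 i)
  then show ?case using assms[of "r + of_int i * P"] by (simp add: algebra_simps)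
next
  case (step2 i)
  then show ?case using assms[of "r + of_int (i - 1) * P"] by (simp add: algebra_simps)
qed

text \<open>An open subset of the closed strip lies in its interior. So the open tube keeps off the
  walls and cannot meet its translates by multiples of H.\<close>

lemma open_in_Neumann:
  assumes "open V" "V \<subseteq> UNIV \<times> {0..H}" shows "V \<subseteq> UNIV \<times> {0<..<H::real}"
  using interior_maximal[OF assms(2,1)] by (simp add: interior_Times)

text \<open>One tube of a given flow; its interior is shown to satisfy the assumptions of
  \<open>tube_geometry\<close>.\<close>

locale tube_chart =
  fixes b :: bdry and H p K :: real and u :: "real \<times> real \<Rightarrow> real \<times> real" and n :: nat and D :: "nat \<Rightarrow> tube" and j :: nat
  assumes H: "0 < H" and K: "0 < K" and flow: "percolating_flow b H p K u n D" and j: "j < n"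
begin

abbreviation "R \<equiv> region (D j)"
abbreviation "X \<equiv> point_at (D j)"
abbreviation "ch \<equiv> chart (D j)"
abbreviation "I \<equiv> open_strip (D j)"

lemma flow_facts: "C1_on (domain b H) u" "divergence_free_on (domain b H) u" "disjoint_regions b H n D"
  using flow by (simp_all add: percolating_flow_def)

lemma tube: "percolating_tube (domain b H) u K (D j)"
  using flow j by (simp add: percolating_flow_def)

lemma tube_facts:
  "orthogonal_metric (D j)" "coordinate_bounds K (D j)"
  "r \<in> rho_range (D j) \<Longrightarrow> streamline (domain b H) u {z \<in> R. fst (ch z) = r}"
  "streamline (domain b H) u A \<Longrightarrow> A \<subseteq> R \<Longrightarrow> fst ` A = UNIV"
  "z \<in> R \<Longrightarrow> \<exists>L. ((\<lambda>z. snd (ch z)) has_derivative L) (at z within R)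
        \<and> (case orient (D j) of Plus \<Rightarrow> 0 < L (u z) | Minus \<Rightarrow> L (u z) < 0)"
  "q \<in> coord_strip (D j) \<Longrightarrow> E1u_sup u (D j) / 2 \<le> E1u u (D j) q \<and> E1u u (D j) q \<le> E1u_sup u (D j)"
  using tube by (simp_all add: percolating_tube_def)

lemma half_width_pos: "0 < half_width (D j)"
  using tube by (simp add: percolating_tube_def C2_coordinates_def)

lemma I_sub: "I \<subseteq> coord_strip (D j)" by (auto simp: coord_strip_def rho_range_def)

lemma bij: "bij_betw ch R (coord_strip (D j))"
  using tube by (simp add: percolating_tube_def C2_coordinates_def)

lemma X_R: "q \<in> coord_strip (D j) \<Longrightarrow> X q \<in> R \<and> ch (X q) = q"
  using bij unfolding point_at_def bij_betw_def by (metis inv_into_into f_inv_into_f)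

lemma X_ch: "z \<in> R \<Longrightarrow> X (ch z) = z \<and> ch z \<in> coord_strip (D j)"
  using bij unfolding point_at_def bij_betw_def by (auto intro: inv_into_f_f)

lemma open_I: "open I" by (intro open_Times open_greaterThanLessThan open_UNIV)

lemma X_cont: "continuous_on (coord_strip (D j)) X"
  using tube by (auto simp: percolating_tube_def C2_coordinates_def intro: C2_on_continuous)

lemma open_V: "open (X ` I)"
proof (rule invariance_of_domain[OF continuous_on_subset[OF X_cont I_sub] open_I])
  show "inj_on X I" using X_R I_sub by (metis inj_onI subsetD)
qed

lemma V_sub: "X ` I \<subseteq> R" using X_R I_sub by blast

lemma R_sub: "R \<subseteq> domain b H" using tube by (simp add: percolating_tube_def)

lemma V_Neumann: "b = Neumann \<Longrightarrow> X ` I \<subseteq> UNIV \<times> {0<..<H}"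
  using V_sub R_sub by (intro open_in_Neumann open_V) (auto simp: domain_def y_range_def)

lemma V_snd: "b = Neumann \<Longrightarrow> z \<in> X ` I \<Longrightarrow> snd z \<in> {0<..<H}"
  using V_Neumann by (metis mem_Times_iff subsetD)

lemma V_iff: "z \<in> R \<Longrightarrow> fst (ch z) \<in> {centre (D j) - half_width (D j)<..<centre (D j) + half_width (D j)} \<Longrightarrow> z \<in> X ` I"
  using X_ch[of z] by (metis image_eqI mem_Times_iff UNIV_I)

lemma at_V: "z \<in> X ` I \<Longrightarrow> X ` I \<subseteq> S \<Longrightarrow> (F has_derivative L) (at z within S) \<Longrightarrow> (F has_derivative L) (at z)"
  using has_derivative_subset[of F L z S "X ` I"] at_within_open[OF _ open_V] by metis

lemma line_stream:
  assumes r: "r \<in> rho_range (D j)"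
  obtains \<gamma> where "\<And>t. (\<gamma> has_vector_derivative u (\<gamma> t)) (at t)" "{z \<in> R. fst (ch z) = r} = range \<gamma>"
  using tube_facts(3)[OF r] unfolding streamline_def by blast

lemma Gs_nonneg: "0 \<le> E1u_sup u (D j)"
proof -
  have "(centre (D j), 0) \<in> coord_strip (D j)" using half_width_pos by (simp add: coord_strip_def rho_range_def)
  from tube_facts(6)[OF this] show ?thesis by linarith
qed

text \<open>All derivatives are extracted within the closed region and become two-sided on the open
  image of the strip. The second derivatives of the chart are needed for the mixed derivatives of
  \<rho> only.\<close>

lemma ex_geometry:
  "\<exists>Ch Xr Xs rx ry rxy ryx. tube_geometry u H K (half_width (D j)) (centre (D j)) (E1u_sup u (D j)) X ch
     Ch Xr Xs (E1 (D j)) (E2 (D j)) rx ry rxy ryx I (X ` I)"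
proof -
  have "C2_on R ch" "C2_on (coord_strip (D j)) X"
    using tube by (auto simp: percolating_tube_def C2_coordinates_def)
  then obtain ch' X' where ch': "\<And>z. z \<in> R \<Longrightarrow> (ch has_derivative blinfun_apply (ch' z)) (at z within R)" "C1_on R ch'"
    and X': "\<And>q. q \<in> coord_strip (D j) \<Longrightarrow> (X has_derivative blinfun_apply (X' q)) (at q within coord_strip (D j))"
      "C1_on (coord_strip (D j)) X'"
    unfolding C2_on_def by blast
  obtain ch'' where ch'': "\<And>z. z \<in> R \<Longrightarrow> (ch' has_derivative blinfun_apply (ch'' z)) (at z within R)" "continuous_on R ch''"
    using ch'(2) unfolding C1_on_def by blast
  define Xr where "Xr = (\<lambda>q. blinfun_apply (X' q) (1, 0))"
  define Xs where "Xs = (\<lambda>q. blinfun_apply (X' q) (0, 1))"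
  define rx where "rx = (\<lambda>x y. fst (blinfun_apply (ch' (x, y)) (1, 0)))"
  define ry where "ry = (\<lambda>x y. fst (blinfun_apply (ch' (x, y)) (0, 1)))"
  define rxy where "rxy = (\<lambda>x y. fst (blinfun_apply (blinfun_apply (ch'' (x, y)) (0, 1)) (1, 0)))"
  define ryx where "ryx = (\<lambda>x y. fst (blinfun_apply (blinfun_apply (ch'' (x, y)) (1, 0)) (0, 1)))"
  have ch_at: "(ch has_derivative blinfun_apply (ch' z)) (at z)" if "z \<in> X ` I" for z
    using at_V[OF that V_sub ch'(1)] that V_sub by blast
  have ch'_at: "(ch' has_derivative blinfun_apply (ch'' z)) (at z)" if "z \<in> X ` I" for z
    using at_V[OF that V_sub ch''(1)] that V_sub by blast
  have X_at: "(X has_derivative blinfun_apply (X' q)) (at q)" if q: "q \<in> I" for q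
  proof -
    have "(X has_derivative blinfun_apply (X' q)) (at q within I)"
      using X'(1) I_sub q by (blast intro: has_derivative_subset)
    then show ?thesis using at_within_open[OF q open_I] by simp
  qed
  have X'_eq: "blinfun_apply (X' q) v = fst v *\<^sub>R Xr q + snd v *\<^sub>R Xs q" for q v
    unfolding Xr_def Xs_def by (rule linear_prod_eq) (rule bounded_linear.linear[OF blinfun.bounded_linear_right])
  have ch'_fst: "fst (blinfun_apply (ch' (x, y)) v) = fst v * rx x y + snd v * ry x y" for x y v
    unfolding rx_def ry_def
    by (subst linear_prod_eq[OF bounded_linear.linear[OF blinfun.bounded_linear_right]]) simp
  have ev: "bounded_linear (\<lambda>B. fst (blinfun_apply B v))" for v :: "real \<times> real"
    and B :: "(real \<times> real) \<Rightarrow>\<^sub>L (real \<times> real)"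
    by (rule bounded_linear_compose[OF bounded_linear_fst blinfun.bounded_linear_left])
  have r_der: "((\<lambda>z. fst (blinfun_apply (ch' z) v)) has_derivative (\<lambda>w. fst (blinfun_apply (blinfun_apply (ch'' z) w) v))) (at z)"
    if "z \<in> X ` I" for z v
    by (rule bounded_linear.has_derivative[OF ev ch'_at[OF that]])
  have metric: "(norm (Xr q))\<^sup>2 = (E1 (D j) q)\<^sup>2" "(norm (Xs q))\<^sup>2 = (E2 (D j) q)\<^sup>2" "Xr q \<bullet> Xs q = 0"
    if q: "q \<in> I" for q
  proof -
    have "q \<in> coord_strip (D j)" using q I_sub by blast
    then obtain L where L: "(X has_derivative L) (at q within coord_strip (D j))"
      "\<And>a b. (norm (L (a, b)))\<^sup>2 = (E1 (D j) q)\<^sup>2 * a\<^sup>2 + (E2 (D j) q)\<^sup>2 * b\<^sup>2"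
      using tube_facts(1) unfolding orthogonal_metric_def by blast
    have "(X has_derivative L) (at q)"
      using has_derivative_subset[OF L(1) I_sub] at_within_open[OF q open_I] by simp
    then have "L = blinfun_apply (X' q)" using has_derivative_unique X_at[OF q] by blast
    then have L': "L (a, b) = a *\<^sub>R Xr q + b *\<^sub>R Xs q" for a b using X'_eq[of q "(a, b)"] by simp
    show 1: "(norm (Xr q))\<^sup>2 = (E1 (D j) q)\<^sup>2" using L(2)[of 1 0] by (simp add: L')
    show 2: "(norm (Xs q))\<^sup>2 = (E2 (D j) q)\<^sup>2" using L(2)[of 0 1] by (simp add: L')
    \<comment> \<open>Polarisation: the vectors (1, 0) and (0, 1) give the lengths, and (1, 1) the
      orthogonality.\<close>
    have "(norm (Xr q + Xs q))\<^sup>2 = (E1 (D j) q)\<^sup>2 + (E2 (D j) q)\<^sup>2" using L(2)[of 1 1] by (simp add: L')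
    moreover have "(norm (Xr q + Xs q))\<^sup>2 = (norm (Xr q))\<^sup>2 + (norm (Xs q))\<^sup>2 + 2 * (Xr q \<bullet> Xs q)"
      by (simp add: power2_norm_eq_inner inner_add_left inner_add_right inner_commute)
    ultimately show "Xr q \<bullet> Xs q = 0" using 1 2 by simp
  qed
  have bounds: "1 / K \<le> E1 (D j) q \<and> 1 / K \<le> E2 (D j) q" if "q \<in> I" for q
  proof -
    obtain \<rho> \<xi> where q: "q = (\<rho>, \<xi>)" by (cases q)
    have "\<rho> \<in> rho_range (D j)" using that by (auto simp: q rho_range_def)
    then show ?thesis using tube_facts(2) unfolding coordinate_bounds_def q by simp
  qed
  have lines: "\<exists>\<gamma>. (\<forall>s. \<gamma> s \<in> X ` I \<and> (\<gamma> has_vector_derivative u (\<gamma> s)) (at s)) \<and> (\<forall>s. fst (ch (\<gamma> s)) = r)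
      \<and> (\<forall>s. \<exists>t. \<gamma> t = X (r, s))"
    if r: "r \<in> {centre (D j) - half_width (D j)<..<centre (D j) + half_width (D j)}" for r
  proof -
    have "r \<in> rho_range (D j)" using r by (simp add: rho_range_def)
    then obtain \<gamma> where \<gamma>: "\<And>t. (\<gamma> has_vector_derivative u (\<gamma> t)) (at t)" "{z \<in> R. fst (ch z) = r} = range \<gamma>"
      by (rule line_stream) blast
    have m: "\<gamma> s \<in> R" "fst (ch (\<gamma> s)) = r" for s using \<gamma>(2) by blast+
    have "\<gamma> s \<in> X ` I" for s using V_iff[OF m(1)] m(2) r by simp
    moreover have "\<exists>t. \<gamma> t = X (r, s)" for s
    proof -
      have "(r, s) \<in> coord_strip (D j)" using r by (simp add: coord_strip_def rho_range_def)
      then have "X (r, s) \<in> {z \<in> R. fst (ch z) = r}" using X_R by simp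
      then show ?thesis unfolding \<gamma>(2) by (auto simp: image_iff)
    qed
    ultimately show ?thesis using \<gamma>(1) m by blast
  qed
  have strip_iff: "q \<in> I \<longleftrightarrow> fst q \<in> {centre (D j) - half_width (D j)<..<centre (D j) + half_width (D j)}" for q
    by (cases q) auto
  have "tube_geometry u H K (half_width (D j)) (centre (D j)) (E1u_sup u (D j)) X ch
     (\<lambda>z. blinfun_apply (ch' z)) Xr Xs (E1 (D j)) (E2 (D j)) rx ry rxy ryx I (X ` I)"
  proof unfold_locales
    show "0 < H" "0 < K" "0 < half_width (D j)" "0 \<le> E1u_sup u (D j)"
      using H K half_width_pos Gs_nonneg by auto
    show "ch (X q) = q" if "q \<in> I" for q using X_R I_sub that by blast
    show "(X has_derivative (\<lambda>v. fst v *\<^sub>R Xr q + snd v *\<^sub>R Xs q)) (at q)" if "q \<in> I" for q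
      using X_at[OF that] unfolding X'_eq[abs_def] .
    have cX': "continuous_on I X'" using C1_on_continuous[OF X'(2)] I_sub by (rule continuous_on_subset)
    show "continuous_on I Xr" "continuous_on I Xs"
      unfolding Xr_def Xs_def by (intro continuous_intros cX')+
    show "(norm (Xr q))\<^sup>2 = (E1 (D j) q)\<^sup>2" "(norm (Xs q))\<^sup>2 = (E2 (D j) q)\<^sup>2" "Xr q \<bullet> Xs q = 0"
      if "q \<in> I" for q using metric[OF that] by auto
    show "1 / K \<le> E1 (D j) q" "1 / K \<le> E2 (D j) q" if "q \<in> I" for q using bounds[OF that] by auto
    show "(ch has_derivative blinfun_apply (ch' z)) (at z)" if "z \<in> X ` I" for z by (rule ch_at[OF that])
    show "fst (blinfun_apply (ch' (x, y)) v) = fst v * rx x y + snd v * ry x y" for x y v by (rule ch'_fst)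
    show "(\<lambda>(x, y). rx x y) differentiable (at z)" "(\<lambda>(x, y). ry x y) differentiable (at z)" if "z \<in> X ` I" for z
      using r_der[OF that] unfolding differentiable_def rx_def ry_def by (auto simp: case_prod_unfold)
    show "((\<lambda>r. rx x r) has_real_derivative rxy x y) (at y)" "((\<lambda>r. ry r y) has_real_derivative ryx x y) (at x)"
      if "(x, y) \<in> X ` I" for x y
      using DERIV_line_real[OF r_der[OF that]] unfolding rx_def ry_def rxy_def ryx_def by auto
    have c: "continuous_on (X ` I) ch''" using ch''(2) V_sub by (rule continuous_on_subset)
    have "continuous_on (X ` I) (\<lambda>z. fst (blinfun_apply (blinfun_apply (ch'' z) v) w))" for v w
      by (intro continuous_intros c)
    then show "continuous_on (X ` I) (\<lambda>(x, y). rxy x y)" "continuous_on (X ` I) (\<lambda>(x, y). ryx x y)"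
      unfolding rxy_def ryx_def by (simp_all add: case_prod_unfold)
    show "\<exists>L. (u has_derivative L) (at z) \<and> fst (L (1, 0)) + snd (L (0, 1)) = 0" if z: "z \<in> X ` I" for z
    proof -
      have "z \<in> domain b H" using z V_sub R_sub by blast
      then obtain L where L: "(u has_derivative L) (at z within domain b H)" "fst (L (1, 0)) + snd (L (0, 1)) = 0"
        using flow_facts(2) unfolding divergence_free_on_def by blast
      then show ?thesis using at_V[OF z _ L(1)] V_sub R_sub by blast
    qed
    \<comment> \<open>The derivative of \<xi> along u is nonzero, whereas a linear map vanishes at
      0.\<close>
    show "u z \<noteq> 0" if z: "z \<in> X ` I" for z
    proof -
      have "z \<in> R" using z V_sub by blast
      then obtain L where L: "((\<lambda>z. snd (ch z)) has_derivative L) (at z within R)"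
        "case orient (D j) of Plus \<Rightarrow> 0 < L (u z) | Minus \<Rightarrow> L (u z) < 0"
        using tube_facts(5)[of z] by blast
      have "L 0 = 0" using linear_0[OF has_derivative_linear[OF L(1)]] .
      then show ?thesis using L(2) by (auto split: orientation.splits)
    qed
    \<comment> \<open>\<rho> is constant along the trajectory through the point; the chain rule
      gives orthogonality of u to its gradient.\<close>
    show "fst (u (x, y)) * rx x y + snd (u (x, y)) * ry x y = 0" if z: "(x, y) \<in> X ` I" for x y
    proof -
      define q where "q = ch (x, y)"
      have q: "q \<in> I" "X q = (x, y)" using z X_R I_sub by (auto simp: q_def)
      obtain \<gamma> where \<gamma>: "\<And>s. \<gamma> s \<in> X ` I" "\<And>s. (\<gamma> has_vector_derivative u (\<gamma> s)) (at s)"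
        "\<And>s. fst (ch (\<gamma> s)) = fst q" "\<And>s. \<exists>t. \<gamma> t = X (fst q, s)"
        using lines[of "fst q"] q(1) strip_iff by blast
      obtain t where t: "\<gamma> t = (x, y)" using \<gamma>(4)[of "snd q"] q(2) by auto
      have "((\<lambda>s. fst (ch (\<gamma> s))) has_derivative (\<lambda>s. fst (blinfun_apply (ch' (\<gamma> t)) (s *\<^sub>R u (\<gamma> t))))) (at t)"
        using has_derivative_fst[OF diff_chain_at[OF \<gamma>(2)[unfolded has_vector_derivative_def] ch_at[OF \<gamma>(1)], of t]]
        by (simp add: o_def)
      moreover have "((\<lambda>s. fst (ch (\<gamma> s))) has_derivative (\<lambda>s. 0)) (at t)" unfolding \<gamma>(3) by simp
      ultimately have "(\<lambda>s. fst (blinfun_apply (ch' (\<gamma> t)) (s *\<^sub>R u (\<gamma> t)))) = (\<lambda>s. 0)" by (rule has_derivative_unique)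
      from fun_cong[OF this, of 1] have "fst (blinfun_apply (ch' (x, y)) (u (x, y))) = 0" by (simp add: t)
      then show ?thesis unfolding ch'_fst .
    qed
    show "\<exists>\<gamma> t t'. (\<forall>s. \<gamma> s \<in> X ` I \<and> (\<gamma> has_vector_derivative u (\<gamma> s)) (at s)) \<and> \<gamma> t = X q \<and> \<gamma> t' = X q'"
      if q: "q \<in> I" "q' \<in> I" "fst q = fst q'" for q q'
    proof -
      obtain \<gamma> where \<gamma>: "\<forall>s. \<gamma> s \<in> X ` I \<and> (\<gamma> has_vector_derivative u (\<gamma> s)) (at s)" "\<And>s. \<exists>t. \<gamma> t = X (fst q, s)"
        using lines[of "fst q"] q(1) strip_iff by blast
      have "X (fst q, snd q') = X q'" using q(3) by (metis prod.collapse)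
      then obtain t t' where "\<gamma> t = X q" "\<gamma> t' = X q'"
        using \<gamma>(2)[of "snd q"] \<gamma>(2)[of "snd q'"] by (metis prod.collapse)
      then show ?thesis using \<gamma>(1) by blast
    qed
    show "range (\<lambda>s. fst (X (r, s))) = UNIV"
      if r: "r \<in> {centre (D j) - half_width (D j)<..<centre (D j) + half_width (D j)}" for r
    proof -
      define A where "A = {z \<in> R. fst (ch z) = r}"
      have "r \<in> rho_range (D j)" using r by (simp add: rho_range_def)
      then have "fst ` A = UNIV" using tube_facts(3)[of r] tube_facts(4)[of A] unfolding A_def by blast
      moreover have "fst ` A \<subseteq> range (\<lambda>s. fst (X (r, s)))"
      proof
        fix a assume "a \<in> fst ` A"
        then obtain z where z: "z \<in> R" "fst (ch z) = r" "a = fst z" by (auto simp: A_def)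
        have "X (r, snd (ch z)) = z" using X_ch[OF z(1)] z(2) by (metis prod.collapse)
        then have "a = fst (X (r, snd (ch z)))" using z(3) by simp
        then show "a \<in> range (\<lambda>s. fst (X (r, s)))" by (rule range_eqI)
      qed
      ultimately show ?thesis by blast
    qed
    show "z + (0, of_int k * H) \<notin> X ` I" if k: "k \<noteq> (0::int)" and z: "z \<in> X ` I" for k z
    proof (cases b)
      \<comment> \<open>Two heights strictly between 0 and H differ by less than H, so the only
        possible shift is zero.\<close>
      case Neumann
      show ?thesis
      proof
        assume "z + (0, of_int k * H) \<in> X ` I"
        from V_snd[OF Neumann this] V_snd[OF Neumann z]
        have "\<bar>of_int k * H\<bar> < H"
          unfolding snd_add snd_conv greaterThanLessThan_iff abs_less_iff by linarith
        then have "\<bar>of_int k\<bar> * H < 1 * H" using H by (simp add: abs_mult)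
        then have "\<bar>of_int k :: real\<bar> < 1" using H by (simp add: mult_less_cancel_right)
        then show False using k by linarith
      qed
    next
      case Periodic
      then have "(\<lambda>z. z + (0, of_int k * H)) ` R \<inter> R = {}"
        using flow_facts(3) j k unfolding disjoint_regions_def by simp
      then show ?thesis using z V_sub by blast
    qed
    show "u (z + (0, of_int k * H)) = u z" if z: "z \<in> X ` I" "z + (0, of_int k * H) \<in> UNIV \<times> {0..H}" for k z
    proof (cases b)
      case Neumann
      have "snd z \<in> {0<..<H}" by (rule V_snd[OF Neumann z(1)])
      moreover have "snd z + of_int k * H \<in> {0..H}" using z(2) by (cases z) auto
      ultimately have "\<bar>of_int k * H\<bar> < H"
        unfolding greaterThanLessThan_iff atLeastAtMost_iff abs_less_iff by linarith
      then have "\<bar>of_int k\<bar> * H < 1 * H" using H by (simp add: abs_mult)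
      then have "\<bar>of_int k :: real\<bar> < 1" using H by (simp add: mult_less_cancel_right)
      then have "k = 0" by linarith
      then have "z + (0, of_int k * H) = z" by (simp add: prod_eq_iff)
      then show ?thesis by (simp only:)
    next
      case Periodic
      then have "u (fst z, y + H) = u (fst z, y)" for y
        using flow unfolding percolating_flow_def by simp
      from per_int[of "\<lambda>y. u (fst z, y)", OF this, of "snd z" k] show ?thesis by (cases z) simp
    qed
    show "continuous_on (UNIV \<times> {0..H}) u"
      by (rule continuous_on_subset[OF C1_on_continuous[OF flow_facts(1)] slab_subset_domain])
    show "E1u_sup u (D j) / 2 \<le> E1 (D j) q * norm (u (X q))" if "q \<in> I" for q
      using tube_facts(6)[of q] that I_sub unfolding E1u_def by blast
  qed simp_all
  then show ?thesis by blast
qed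

end

text \<open>At each point at most one lifted test function is nonzero. Under Neumann conditions both
  translates are in the open strip, hence equal; under periodicity disjointness modulo vertical
  translations is part of the hypothesis.\<close>

lemma (in tube_chart) V_unique:
  assumes i: "i < n" and V: "z + (0, of_int k * H) \<in> X ` I"
    and V': "z + (0, of_int k' * H) \<in> point_at (D i) ` open_strip (D i)"
  shows "i = j"
proof (rule ccontr)
  assume ne: "i \<noteq> j"
  interpret i: tube_chart b H p K u n D i by unfold_locales (use H K flow i in auto)
  have R: "z + (0, of_int k * H) \<in> R" "z + (0, of_int k' * H) \<in> region (D i)"
    using V V' V_sub i.V_sub by auto
  show False
  proof (cases b)
    case Neumann
    have "snd z + of_int k * H \<in> {0<..<H}" "snd z + of_int k' * H \<in> {0<..<H}"
      using V_snd[OF Neumann V] i.V_snd[OF Neumann V'] by simp_all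
    then have "\<bar>(of_int k - of_int k') * H\<bar> < 1 * H"
      unfolding greaterThanLessThan_iff left_diff_distrib abs_less_iff mult_1 by linarith
    then have "\<bar>of_int k - of_int k' :: real\<bar> < 1" using H by (simp add: abs_mult mult_less_cancel_right)
    then have "k = k'" by linarith
    moreover have "region (D i) \<inter> R = {}"
      using flow_facts(3) Neumann ne i j by (simp add: disjoint_regions_def)
    ultimately show False using R by blast
  next
    case Periodic
    have "\<forall>k::int. i \<noteq> j \<or> k \<noteq> 0 \<longrightarrow> (\<lambda>z. z + (0, of_int k * H)) ` region (D i) \<inter> region (D j) = {}"
      using flow_facts(3) i j unfolding disjoint_regions_def Periodic bdry.case by blast
    then have "(\<lambda>z. z + (0, of_int (k - k') * H)) ` region (D i) \<inter> R = {}"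
      using ne by blast
    moreover have "z + (0, of_int k * H) = z + (0, of_int k' * H) + (0, of_int (k - k') * H)"
      by (simp add: prod_eq_iff algebra_simps)
    then have "z + (0, of_int k * H) \<in> (\<lambda>z. z + (0, of_int (k - k') * H)) ` region (D i)"
      using R(2) by blast
    ultimately show False using R(1) by blast
  qed
qed

text \<open>Each tube has its own coordinate data, chosen existentially. This predicate keeps of
  them only what is needed to add up the test functions of several tubes. The flux bound is phrased
  for any constant value of the flux, so that constancy can be supplied later by
  \<open>flux_constant\<close>.\<close>

definition tube_test ::
  "real \<Rightarrow> real \<Rightarrow> (real \<times> real \<Rightarrow> real \<times> real) \<Rightarrow> tube \<Rightarrow> (real \<times> real \<Rightarrow> real) \<Rightarrow> (real \<times> real \<Rightarrow> real) \<Rightarrow> (real \<times> real \<Rightarrow> real) \<Rightarrow> bool" where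
  "tube_test H K u D \<psi> \<psi>x \<psi>y \<longleftrightarrow>
     (\<forall>g\<in>{\<psi>, \<psi>x, \<psi>y}. continuous_on UNIV g \<and> (\<forall>z. g z \<noteq> 0 \<longrightarrow> (\<exists>k::int. z + (0, of_int k * H) \<in> point_at D ` open_strip D)))
   \<and> (\<forall>x y. ((\<lambda>r. \<psi> (r, y)) has_real_derivative \<psi>x (x, y)) (at x))
   \<and> (\<forall>x y. ((\<lambda>r. \<psi> (x, r)) has_real_derivative \<psi>y (x, y)) (at y))
   \<and> (\<forall>x y. \<psi> (x, y + H) = \<psi> (x, y))
   \<and> (\<forall>z. 0 \<le> \<psi> z \<and> \<psi> z \<le> 1 \<and> \<bar>\<psi>x z\<bar> \<le> 8 * K / half_width D \<and> \<bar>\<psi>y z\<bar> \<le> 8 * K / half_width D)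
   \<and> (\<forall>x. \<forall>y\<in>{0..H}. fst (u (x, y)) * \<psi>x (x, y) + snd (u (x, y)) * \<psi>y (x, y) = 0)
   \<and> (\<forall>F. (\<forall>x. integral {0..H} (\<lambda>y. \<psi> (x, y) * fst (u (x, y))) = F) \<longrightarrow> half_width D * E1u_sup u D / 8 \<le> \<bar>F\<bar>)"

lemma tube_testD:
  assumes "tube_test H K u D \<psi> \<psi>x \<psi>y"
  shows "\<And>g. g \<in> {\<psi>, \<psi>x, \<psi>y} \<Longrightarrow> continuous_on UNIV g"
    "\<And>g z. g \<in> {\<psi>, \<psi>x, \<psi>y} \<Longrightarrow> g z \<noteq> 0 \<Longrightarrow> \<exists>k::int. z + (0, of_int k * H) \<in> point_at D ` open_strip D"
    "\<And>x y. ((\<lambda>r. \<psi> (r, y)) has_real_derivative \<psi>x (x, y)) (at x)"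
    "\<And>x y. ((\<lambda>r. \<psi> (x, r)) has_real_derivative \<psi>y (x, y)) (at y)"
    "\<And>x y. \<psi> (x, y + H) = \<psi> (x, y)"
    "\<And>z. 0 \<le> \<psi> z \<and> \<psi> z \<le> 1 \<and> \<bar>\<psi>x z\<bar> \<le> 8 * K / half_width D \<and> \<bar>\<psi>y z\<bar> \<le> 8 * K / half_width D"
    "\<And>x y. y \<in> {0..H} \<Longrightarrow> fst (u (x, y)) * \<psi>x (x, y) + snd (u (x, y)) * \<psi>y (x, y) = 0"
    "\<And>F. (\<And>x. integral {0..H} (\<lambda>y. \<psi> (x, y) * fst (u (x, y))) = F) \<Longrightarrow> half_width D * E1u_sup u D / 8 \<le> \<bar>F\<bar>"
proof -
  note t = assms[unfolded tube_test_def]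
  note t2 = conjunct2[OF t] note t3 = conjunct2[OF t2] note t4 = conjunct2[OF t3] note t5 = conjunct2[OF t4]
  note t6 = conjunct2[OF t5] note t7 = conjunct2[OF t6]
  show "continuous_on UNIV g" if "g \<in> {\<psi>, \<psi>x, \<psi>y}" for g
    by (rule conjunct1[OF bspec[OF conjunct1[OF t] that]])
  show "\<exists>k::int. z + (0, of_int k * H) \<in> point_at D ` open_strip D" if "g \<in> {\<psi>, \<psi>x, \<psi>y}" "g z \<noteq> 0" for g z
    by (rule mp[OF spec[OF conjunct2[OF bspec[OF conjunct1[OF t] that(1)]]] that(2)])
  show "((\<lambda>r. \<psi> (r, y)) has_real_derivative \<psi>x (x, y)) (at x)" for x y
    by (rule spec[OF spec[OF conjunct1[OF t2]]])
  show "((\<lambda>r. \<psi> (x, r)) has_real_derivative \<psi>y (x, y)) (at y)" for x y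
    by (rule spec[OF spec[OF conjunct1[OF t3]]])
  show "\<psi> (x, y + H) = \<psi> (x, y)" for x y by (rule spec[OF spec[OF conjunct1[OF t4]]])
  show "0 \<le> \<psi> z \<and> \<psi> z \<le> 1 \<and> \<bar>\<psi>x z\<bar> \<le> 8 * K / half_width D \<and> \<bar>\<psi>y z\<bar> \<le> 8 * K / half_width D" for z
    by (rule spec[OF conjunct1[OF t5]])
  show "fst (u (x, y)) * \<psi>x (x, y) + snd (u (x, y)) * \<psi>y (x, y) = 0" if "y \<in> {0..H}" for x y
    by (rule bspec[OF spec[OF conjunct1[OF t6]] that])
  show "half_width D * E1u_sup u D / 8 \<le> \<bar>F\<bar>"
    if "\<And>x. integral {0..H} (\<lambda>y. \<psi> (x, y) * fst (u (x, y))) = F" for F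
    by (rule mp[OF spec[OF t7]]) (rule allI, rule that)
qed

lemma (in tube_chart) ex_test: "\<exists>\<psi> \<psi>x \<psi>y. tube_test H K u (D j) \<psi> \<psi>x \<psi>y"
proof -
  obtain Ch Xr Xs rx ry rxy ryx where "tube_geometry u H K (half_width (D j)) (centre (D j)) (E1u_sup u (D j)) X ch
     Ch Xr Xs (E1 (D j)) (E2 (D j)) rx ry rxy ryx I (X ` I)"
    using ex_geometry by blast
  then interpret g: tube_geometry u H K "half_width (D j)" "centre (D j)" "E1u_sup u (D j)" X ch
     Ch Xr Xs "E1 (D j)" "E2 (D j)" rx ry rxy ryx I "X ` I" .
  have "tube_test H K u (D j) g.psi g.psi_x g.psi_y"
    unfolding tube_test_def
  proof (intro conjI ballI allI impI)
    fix q assume q: "q \<in> {g.psi, g.psi_x, g.psi_y}"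
    then show "continuous_on UNIV q" using g.psi_cont by auto
    fix z assume "q z \<noteq> 0"
    moreover obtain q' where "q = g.lift q'" using q unfolding g.psi_def g.psi_x_def g.psi_y_def by blast
    ultimately show "\<exists>k::int. z + (0, of_int k * H) \<in> X ` I"
      using g.lift_support[of q' z] by blast
  next
    fix F assume "\<forall>x. integral {0..H} (\<lambda>y. g.psi (x, y) * fst (u (x, y))) = F"
    then show "half_width (D j) * E1u_sup u (D j) / 8 \<le> \<bar>F\<bar>" using g.flux_lower by blast
  qed (use g.psi_deriv g.psi_periodic g.psi_range g.psi_grad_bound g.psi_flow in auto)
  then show ?thesis by blast
qed

text \<open>Joint continuity of T is not part of the notion of a classical solution. On a box the
  partial derivatives are bounded, and moving along the three axes in turn shows that T is Lipschitz
  there.\<close>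

lemma continuous_of_partials:
  fixes T Tx Ty Tt :: "real \<Rightarrow> real \<Rightarrow> real \<Rightarrow> real"
  assumes c: "continuous_on (slab (0, 0) (H, \<tau>)) (\<lambda>z. Tx (fst z) (fst (snd z)) (snd (snd z)))"
      "continuous_on (slab (0, 0) (H, \<tau>)) (\<lambda>z. Ty (fst z) (fst (snd z)) (snd (snd z)))"
      "continuous_on (slab (0, 0) (H, \<tau>)) (\<lambda>z. Tt (fst z) (fst (snd z)) (snd (snd z)))"
    and d: "\<And>x y t. y \<in> {0..H} \<Longrightarrow> t \<in> {0..\<tau>} \<Longrightarrow> ((\<lambda>r. T r y t) has_real_derivative Tx x y t) (at x)"
      "\<And>x y t. y \<in> {0..H} \<Longrightarrow> t \<in> {0..\<tau>} \<Longrightarrow> ((\<lambda>r. T x r t) has_real_derivative Ty x y t) (at y within {0..H})"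
      "\<And>x y t. y \<in> {0..H} \<Longrightarrow> t \<in> {0..\<tau>} \<Longrightarrow> ((\<lambda>r. T x y r) has_real_derivative Tt x y t) (at t within {0..\<tau>})"
  shows "continuous_on (slab (0, 0) (H, \<tau>)) (\<lambda>z. T (fst z) (fst (snd z)) (snd (snd z)))"
    (is "continuous_on ?Q ?T")
proof -
  have box: "continuous_on (cbox (-R, 0, 0) (R, H, \<tau>)) ?T" for R
  proof -
    let ?C = "cbox (-R, 0, 0) (R, H, \<tau>)"
    have sub: "?C \<subseteq> ?Q" by (auto simp: cbox_Pair_eq)
    have ex: "\<exists>M\<ge>0. \<forall>z\<in>?C. \<bar>g z\<bar> \<le> M" if "continuous_on ?Q g" for g :: "real \<times> real \<times> real \<Rightarrow> real"
    proof -
      have "bounded (g ` ?C)"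
        by (intro compact_imp_bounded compact_continuous_image compact_cbox continuous_on_subset[OF that sub])
      then obtain M where M: "\<forall>w\<in>g ` ?C. norm w \<le> M" unfolding bounded_iff by blast
      show ?thesis
      proof (intro exI[of _ "max 0 M"] conjI ballI)
        fix z assume "z \<in> ?C"
        with M have "norm (g z) \<le> M" by blast
        then show "\<bar>g z\<bar> \<le> max 0 M" by simp
      qed simp
    qed
    obtain M1 where M1: "0 \<le> M1" "\<forall>z\<in>?C. \<bar>Tx (fst z) (fst (snd z)) (snd (snd z))\<bar> \<le> M1" using ex[OF c(1)] by (elim exE conjE) 
    obtain M2 where M2: "0 \<le> M2" "\<forall>z\<in>?C. \<bar>Ty (fst z) (fst (snd z)) (snd (snd z))\<bar> \<le> M2" using ex[OF c(2)] by (elim exE conjE)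
    obtain M3 where M3: "0 \<le> M3" "\<forall>z\<in>?C. \<bar>Tt (fst z) (fst (snd z)) (snd (snd z))\<bar> \<le> M3" using ex[OF c(3)] by (elim exE conjE)
    have M: "\<bar>Tx x y t\<bar> \<le> M1" "\<bar>Ty x y t\<bar> \<le> M2" "\<bar>Tt x y t\<bar> \<le> M3" if "(x, y, t) \<in> ?C" for x y t
      using bspec[OF M1(2) that] bspec[OF M2(2) that] bspec[OF M3(2) that] by simp_all
    have lip: "dist (?T z) (?T w) \<le> (M1 + M2 + M3) * dist z w" if zw: "z \<in> ?C" "w \<in> ?C" for z w
    proof -
      obtain x y t x' y' t' where e: "z = (x, y, t)" "w = (x', y', t')" by (cases z, cases w) auto
      have m: "x \<in> {-R..R}" "y \<in> {0..H}" "t \<in> {0..\<tau>}" "x' \<in> {-R..R}" "y' \<in> {0..H}" "t' \<in> {0..\<tau>}"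
        using zw by (auto simp: e cbox_Pair_eq)
      have 1: "norm (T x y t - T x' y t) \<le> M1 * norm (x - x')"
        by (rule field_differentiable_bound[where S = "{-R..R}" and f = "\<lambda>r. T r y t" and f' = "\<lambda>r. Tx r y t"])
          (use m M(1) d(1) in \<open>auto intro: has_field_derivative_at_within simp: cbox_Pair_eq\<close>)
      have 2: "norm (T x' y t - T x' y' t) \<le> M2 * norm (y - y')"
        by (rule field_differentiable_bound[where S = "{0..H}" and f = "\<lambda>r. T x' r t" and f' = "\<lambda>r. Ty x' r t"])
          (use m M(2) d(2) in \<open>auto simp: cbox_Pair_eq\<close>)
      have 3: "norm (T x' y' t - T x' y' t') \<le> M3 * norm (t - t')"
        by (rule field_differentiable_bound[where S = "{0..\<tau>}" and f = "\<lambda>r. T x' y' r" and f' = "\<lambda>r. Tt x' y' r"])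
          (use m M(3) d(3) in \<open>auto simp: cbox_Pair_eq\<close>)
      have n: "norm (x - x') \<le> dist z w" "norm (y - y') \<le> dist z w" "norm (t - t') \<le> dist z w"
        using dist_fst_le[of z w] dist_fst_le[of "snd z" "snd w"] dist_snd_le[of "snd z" "snd w"] dist_snd_le[of z w]
        by (auto simp: e dist_real_def)
      have "dist (?T z) (?T w) \<le> M1 * norm (x - x') + M2 * norm (y - y') + M3 * norm (t - t')"
        using 1 2 3 unfolding e dist_real_def real_norm_def fst_conv snd_conv by linarith
      also have "\<dots> \<le> M1 * dist z w + M2 * dist z w + M3 * dist z w"
        using n M1(1) M2(1) M3(1) by (intro add_mono mult_left_mono) auto
      finally show ?thesis by (simp add: distrib_right)
    qed
    have "(M1 + M2 + M3)-lipschitz_on ?C ?T" by (rule lipschitz_onI[OF lip]) (use M1(1) M2(1) M3(1) in auto)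
    then show ?thesis by (rule lipschitz_on_continuous_on)
  qed
  show ?thesis
    unfolding continuous_on_eq_continuous_within
  proof
    fix z assume z: "z \<in> ?Q"
    define R where "R = \<bar>fst z\<bar> + 1"
    let ?W = "{-R<..<R} \<times> UNIV"
    have "z \<in> cbox (-R, 0, 0) (R, H, \<tau>)" using z by (cases z) (auto simp: R_def cbox_Pair_eq)
    then have "continuous (at z within cbox (-R, 0, 0) (R, H, \<tau>)) ?T"
      using box[of R] by (simp add: continuous_on_eq_continuous_within)
    moreover have "at z within ?Q = at z within cbox (-R, 0, 0) (R, H, \<tau>)"
    proof (rule at_within_nhd[of z ?W])
      show "z \<in> ?W" by (cases z) (auto simp: R_def abs_if)
      show "open ?W" by (intro open_Times) auto
      show "?Q \<inter> ?W - {z} = cbox (-R, 0, 0) (R, H, \<tau>) \<inter> ?W - {z}" by (auto simp: cbox_Pair_eq)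
    qed
    ultimately show "continuous (at z within ?Q) ?T" by simp
  qed
qed

text \<open>The assumptions of \<open>front\<close> are read off for both boundary conditions. In
  the periodic case the derivatives are two-sided in y and are restricted to [0, H].\<close>

lemma wave_front:
  assumes pos: "0 < \<kappa>" "0 < v" "0 < H" and flow: "percolating_flow b H p K u n D"
    and wave: "traveling_wave b H p \<kappa> v f u U c"
    and f: "\<And>s. s \<in> {0..1} \<Longrightarrow> (f has_real_derivative f' s) (at s within {0..1})" "continuous_on {0..1} f'"
      "\<And>s. s \<in> {0..1} \<Longrightarrow> 0 \<le> f s"
  shows "\<exists>\<tau> m u1x u2y Tt Tx Ty Txx Tyy. front H \<tau> p c \<kappa> v m (\<lambda>x y. fst (u (x, y))) (\<lambda>x y. snd (u (x, y))) u1x u2y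
     (\<lambda>x y t. U (x - c * t) x y) Tt Tx Ty Txx Tyy f f'"
proof -
  define T where "T = (\<lambda>x y t. U (x - c * t) x y)"
  have fl: "C1_on (domain b H) u" "divergence_free_on (domain b H) u"
    "\<And>x. integral {0..H} (\<lambda>y. fst (u (x, y))) = 0" "0 < p" "\<And>x y. y \<in> y_range b H \<Longrightarrow> u (x + p, y) = u (x, y)"
    "b = Neumann \<Longrightarrow> snd (u (x, 0)) = 0 \<and> snd (u (x, H)) = 0"
    "b = Periodic \<Longrightarrow> u (x, y + H) = u (x, y)" for x y
    using flow by (auto simp: percolating_flow_def)
  have wv: "classical_solution b H \<kappa> v f u T" "boundary_condition b H T"
    "\<And>s x y. y \<in> y_range b H \<Longrightarrow> U s x y \<in> {0..1}" "\<And>s x y. y \<in> y_range b H \<Longrightarrow> U s (x + p) y = U s x y"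
    "\<And>x y. y \<in> y_range b H \<Longrightarrow> ((\<lambda>s. U s x y) \<longlongrightarrow> 1) at_bot" "\<And>x y. y \<in> y_range b H \<Longrightarrow> ((\<lambda>s. U s x y) \<longlongrightarrow> 0) at_top"
    using wave unfolding traveling_wave_def T_def by auto
  have I: "{0..H} \<subseteq> y_range b H" by (cases b) (auto simp: y_range_def)
  obtain Tt Tx Ty Txx Tyy where
    cont: "\<forall>g\<in>{Tt, Tx, Ty, Txx, Tyy}. continuous_on (UNIV \<times> y_range b H \<times> UNIV) (\<lambda>(x, y, t). g x y t)"
    and eq: "\<forall>x t. \<forall>y\<in>y_range b H.
        ((\<lambda>r. T x y r) has_real_derivative Tt x y t) (at t)
      \<and> ((\<lambda>r. T r y t) has_real_derivative Tx x y t) (at x)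
      \<and> ((\<lambda>r. Tx r y t) has_real_derivative Txx x y t) (at x)
      \<and> ((\<lambda>r. T x r t) has_real_derivative Ty x y t) (at y within y_range b H)
      \<and> ((\<lambda>r. Ty x r t) has_real_derivative Tyy x y t) (at y within y_range b H)
      \<and> Tt x y t + (fst (u (x, y)) * Tx x y t + snd (u (x, y)) * Ty x y t)
          = \<kappa> * (Txx x y t + Tyy x y t) + v\<^sup>2 / \<kappa> * f (T x y t)"
    using wv(1) unfolding classical_solution_def by blast
  \<comment> \<open>For c \<noteq> 0 the front moves by exactly one period in time p / |c|, to the
    left if c < 0, since the sign is not yet known. For c = 0 the solution is stationary and any
    positive time will do.\<close>
  define \<tau> where "\<tau> = (if c = 0 then 1 else p / \<bar>c\<bar>)"
  define m :: int where "m = (if c = 0 then 0 else if c > 0 then 1 else -1)"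
  have \<tau>: "0 < \<tau>" "c * \<tau> = of_int m * p" using fl(4) by (auto simp: \<tau>_def m_def abs_if)
  obtain u' where u': "\<And>z. z \<in> domain b H \<Longrightarrow> (u has_derivative blinfun_apply (u' z)) (at z within domain b H)"
    "continuous_on (domain b H) u'"
    using fl(1) unfolding C1_on_def by blast
  define u1x where "u1x = (\<lambda>x y. fst (blinfun_apply (u' (x, y)) (1, 0)))"
  define u2y where "u2y = (\<lambda>x y. snd (blinfun_apply (u' (x, y)) (0, 1)))"
  have dom: "(x, y) \<in> domain b H" if "y \<in> {0..H}" for x y using slab_subset_domain that by blast
  have cu: "continuous_on (UNIV \<times> {0..H}) u"
    by (rule continuous_on_subset[OF C1_on_continuous[OF fl(1)] slab_subset_domain])
  have cu': "continuous_on (UNIV \<times> {0..H}) u'"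
    by (rule continuous_on_subset[OF u'(2) slab_subset_domain])
  have d1: "((\<lambda>r. fst (u (r, y))) has_real_derivative u1x x y) (at x)" if "y \<in> {0..H}" for x y
    unfolding u1x_def using dom[OF that] by (intro partials_within(1)[OF has_derivative_fst[OF u'(1)]]) auto
  have d2: "((\<lambda>r. snd (u (x, r))) has_real_derivative u2y x y) (at y within {0..H})" if "y \<in> {0..H}" for x y
    unfolding u2y_def using dom that by (intro partials_within(2)[OF has_derivative_snd[OF u'(1)]]) auto
  have dv: "u1x x y + u2y x y = 0" if y: "y \<in> {0..H}" for x y
  proof -
    obtain L where L: "(u has_derivative L) (at (x, y) within domain b H)" "fst (L (1, 0)) + snd (L (0, 1)) = 0"
      using fl(2) dom[OF y, of x] unfolding divergence_free_on_def by blast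
    have "((\<lambda>r. fst (u (r, y))) has_real_derivative fst (L (1, 0))) (at x)"
      using dom[OF y] by (intro partials_within(1)[OF has_derivative_fst[OF L(1)]]) auto
    then have "fst (L (1, 0)) = u1x x y" using d1[OF y] by (rule DERIV_unique)
    moreover have "((\<lambda>r. snd (u (x, r))) has_real_derivative snd (L (0, 1))) (at y within {0..H})"
      using dom by (intro partials_within(2)[OF has_derivative_snd[OF L(1)]]) auto
    then have "snd (L (0, 1)) = u2y x y" using d2[OF y] y pos(3) by (rule DERIV_unique_Icc)
    ultimately show ?thesis using L(2) by simp
  qed
  have cT: "continuous_on (slab (0, 0) (H, \<tau>)) (\<lambda>z. g (fst z) (fst (snd z)) (snd (snd z)))"
    if "g \<in> {Tt, Tx, Ty, Txx, Tyy}" for g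
  proof -
    have "continuous_on (UNIV \<times> y_range b H \<times> UNIV) (\<lambda>z. g (fst z) (fst (snd z)) (snd (snd z)))"
      using bspec[OF cont that] by (simp add: case_prod_unfold)
    then show ?thesis by (rule continuous_on_subset) (use I in auto)
  qed
  have per: "U s (x + of_int i * p) y = U s x y" if "y \<in> {0..H}" for s x y i
    by (rule per_int) (use wv(4) I that in blast)
  have tcont: "continuous_on (slab (0, 0) (H, \<tau>)) (\<lambda>z. T (fst z) (fst (snd z)) (snd (snd z)))"
  proof (rule continuous_of_partials[where Tx = Tx and Ty = Ty and Tt = Tt])
    fix x y t assume "y \<in> {0..H}"
    then have "y \<in> y_range b H" using I by blast
    note e = eq[rule_format, OF this, of x t]
    show "((\<lambda>r. T r y t) has_real_derivative Tx x y t) (at x)" using e by blast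
    show "((\<lambda>r. T x r t) has_real_derivative Ty x y t) (at y within {0..H})"
      using e I by (blast intro: has_field_derivative_subset)
    show "((\<lambda>r. T x y r) has_real_derivative Tt x y t) (at t within {0..\<tau>})"
      using e by (blast intro: has_field_derivative_at_within)
  qed (rule cT; simp)+
  have "front H \<tau> p c \<kappa> v m (\<lambda>x y. fst (u (x, y))) (\<lambda>x y. snd (u (x, y))) u1x u2y T Tt Tx Ty Txx Tyy f f'"
  proof unfold_locales
    show "0 < H" "0 < \<tau>" "0 < p" "0 < \<kappa>" "0 < v" using pos \<tau> fl(4) by auto
    show "c * \<tau> = of_int m * p" by (rule \<tau>(2))
    show "continuous_on (slab 0 H) (\<lambda>z. fst (u (fst z, snd z)))" "continuous_on (slab 0 H) (\<lambda>z. snd (u (fst z, snd z)))"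
      using cu by (auto intro!: continuous_intros)
    show "continuous_on (slab 0 H) (\<lambda>z. u1x (fst z) (snd z))" "continuous_on (slab 0 H) (\<lambda>z. u2y (fst z) (snd z))"
      using cu' unfolding u1x_def u2y_def by (auto intro!: continuous_intros)
    show "((\<lambda>r. fst (u (r, y))) has_real_derivative u1x x y) (at x)" if "y \<in> {0..H}" for x y by (rule d1[OF that])
    show "((\<lambda>r. snd (u (x, r))) has_real_derivative u2y x y) (at y within {0..H})" if "y \<in> {0..H}" for x y by (rule d2[OF that])
    show "u1x x y + u2y x y = 0" if "y \<in> {0..H}" for x y by (rule dv[OF that])
    show "integral {0..H} (\<lambda>y. fst (u (x, y))) = 0" for x by (rule fl(3))
    show "fst (u (x + p, y)) = fst (u (x, y))" "snd (u (x + p, y)) = snd (u (x, y))" if "y \<in> {0..H}" for x y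
      using fl(5)[of y x] I that by auto
    show "continuous_on (slab (0, 0) (H, \<tau>)) (\<lambda>z. T (fst z) (fst (snd z)) (snd (snd z)))" by (rule tcont)
    show "continuous_on (slab (0, 0) (H, \<tau>)) (\<lambda>z. Tt (fst z) (fst (snd z)) (snd (snd z)))"
      "continuous_on (slab (0, 0) (H, \<tau>)) (\<lambda>z. Tx (fst z) (fst (snd z)) (snd (snd z)))"
      "continuous_on (slab (0, 0) (H, \<tau>)) (\<lambda>z. Ty (fst z) (fst (snd z)) (snd (snd z)))"
      "continuous_on (slab (0, 0) (H, \<tau>)) (\<lambda>z. Txx (fst z) (fst (snd z)) (snd (snd z)))"
      "continuous_on (slab (0, 0) (H, \<tau>)) (\<lambda>z. Tyy (fst z) (fst (snd z)) (snd (snd z)))"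
      by (rule cT; simp)+
    show "((\<lambda>r. T x y r) has_real_derivative Tt x y t) (at t within {0..\<tau>})"
      "((\<lambda>r. T r y t) has_real_derivative Tx x y t) (at x)"
      "((\<lambda>r. Tx r y t) has_real_derivative Txx x y t) (at x)"
      "((\<lambda>r. T x r t) has_real_derivative Ty x y t) (at y within {0..H})"
      "((\<lambda>r. Ty x r t) has_real_derivative Tyy x y t) (at y within {0..H})"
      "Tt x y t + (fst (u (x, y)) * Tx x y t + snd (u (x, y)) * Ty x y t)
          = \<kappa> * (Txx x y t + Tyy x y t) + v\<^sup>2 / \<kappa> * f (T x y t)"
      if y: "y \<in> {0..H}" for x y t
    proof -
      have y': "y \<in> y_range b H" using y I by blast
      note e = eq[rule_format, OF y', of x t]
      show "((\<lambda>r. T x y r) has_real_derivative Tt x y t) (at t within {0..\<tau>})"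
        using e by (blast intro: has_field_derivative_at_within)
      show "((\<lambda>r. T r y t) has_real_derivative Tx x y t) (at x)" using e by blast
      show "((\<lambda>r. Tx r y t) has_real_derivative Txx x y t) (at x)" using e by blast
      show "((\<lambda>r. T x r t) has_real_derivative Ty x y t) (at y within {0..H})"
        using e I by (blast intro: has_field_derivative_subset)
      show "((\<lambda>r. Ty x r t) has_real_derivative Tyy x y t) (at y within {0..H})"
        using e I by (blast intro: has_field_derivative_subset)
      show "Tt x y t + (fst (u (x, y)) * Tx x y t + snd (u (x, y)) * Ty x y t)
          = \<kappa> * (Txx x y t + Tyy x y t) + v\<^sup>2 / \<kappa> * f (T x y t)" using e by blast
    qed
    show "T x y t \<in> {0..1}" if "y \<in> {0..H}" for x y t unfolding T_def using wv(3) I that by blast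
    show "snd (u (x, 0)) = snd (u (x, H))" for x
      using fl(6)[of x] fl(7)[of x 0] by (cases b) auto
    have T0H: "b = Periodic \<Longrightarrow> T x (y + H) t = T x y t" for x y t
      using wv(2) by (simp add: boundary_condition_def)
    have Ty0: "Ty x y t = 0" if "b = Neumann" "y \<in> {0, H}" for x y t
    proof -
      have y: "y \<in> {0..H}" using that(2) pos by auto
      have "((\<lambda>r. T x r t) has_real_derivative 0) (at y within {0..H})"
        using wv(2) that by (auto simp: boundary_condition_def)
      moreover have "((\<lambda>r. T x r t) has_real_derivative Ty x y t) (at y within {0..H})"
        using eq y I that(1) by (auto simp: y_range_def)
      ultimately show ?thesis using DERIV_unique_Icc[OF _ _ y pos(3)] by blast
    qed
    show "Ty x 0 t = Ty x H t" for x t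
    proof (cases b)
      case Neumann then show ?thesis using Ty0 by simp
    next
      case Periodic
      have d: "((\<lambda>r. T x r t) has_real_derivative Ty x y t) (at y)" for y
        using eq Periodic by (auto simp: y_range_def)
      \<comment> \<open>Differentiating the periodicity relation at y = 0 gives equality of the
        derivatives at the ends.\<close>
      have "((\<lambda>r. T x (r + H) t) has_real_derivative Ty x H t) (at 0)"
        using d[of H] DERIV_shift[of "\<lambda>r. T x r t" "Ty x H t" 0 H] by simp
      then show ?thesis unfolding T0H[OF Periodic] using d[of 0] DERIV_unique by blast
    qed
    show "(snd (u (x, 0)) = 0 \<and> Ty x 0 t = 0) \<or> T x 0 t = T x H t" for x t
      using fl(6)[of x] Ty0[of 0 x t] T0H[of x 0 t] by (cases b) auto
    have kp: "filterlim (\<lambda>k. real k * p) at_top sequentially"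
      using fl(4) by (intro filterlim_at_top_mult_tendsto_pos[OF tendsto_const] filterlim_real_sequentially) auto
    show "(\<lambda>k. T (x - real k * p) y t) \<longlonglongrightarrow> 1" if y: "y \<in> {0..H}" for x y t
    proof -
      \<comment> \<open>By periodicity in the second argument the translation acts on
        \<open>s\<close> alone, where the limit is assumed.\<close>
      have "T (x - real k * p) y t = U (x - c * t - real k * p) x y" for k
        using per[OF y, of _ x "- int k"] by (simp add: T_def algebra_simps)
      moreover have "filterlim (\<lambda>k. x - c * t - real k * p) at_bot sequentially"
        using filterlim_tendsto_add_at_top[OF tendsto_const[of "c * t - x"] kp]
        unfolding filterlim_uminus_at_top by (simp add: algebra_simps)
      then have "(\<lambda>k. U (x - c * t - real k * p) x y) \<longlonglongrightarrow> 1"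
        using filterlim_compose[OF wv(5)] I y by blast
      ultimately show ?thesis by simp
    qed
    show "(\<lambda>k. T (x + real k * p) y t) \<longlonglongrightarrow> 0" if y: "y \<in> {0..H}" for x y t
    proof -
      have "T (x + real k * p) y t = U (x - c * t + real k * p) x y" for k
        using per[OF y, of _ x "int k"] by (simp add: T_def algebra_simps)
      moreover have "filterlim (\<lambda>k. x - c * t + real k * p) at_top sequentially"
        by (rule filterlim_tendsto_add_at_top[OF tendsto_const kp])
      then have "(\<lambda>k. U (x - c * t + real k * p) x y) \<longlonglongrightarrow> 0"
        using filterlim_compose[OF wv(6)] I y by blast
      ultimately show ?thesis by simp
    qed
    show "T x y \<tau> = T (x - c * \<tau>) y 0" if y: "y \<in> {0..H}" for x y
      using per[OF y, of "x - c * \<tau>" x "- m"] by (simp add: T_def \<tau>(2))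
    show "(f has_real_derivative f' s) (at s within {0..1})" "0 \<le> f s" if "s \<in> {0..1}" for s
      using f that by auto
    show "continuous_on {0..1} f'" by (rule f(2))
  qed
  then show ?thesis unfolding T_def by blast
qed

text \<open>Interval length times supremum. The right side is what the flux of the tube dominates,
  so only this upper bound on the integral in the theorem is needed.\<close>

lemma profile_integral_bound:
  assumes tube: "percolating_tube S u K D" and H: "0 < H"
  shows "integral {centre D - half_width D .. centre D + half_width D}
      (\<lambda>\<rho>. norm (u (point_at D (\<rho>, \<xi>))) * E1 D (\<rho>, \<xi>) / H) \<le> 2 * half_width D * E1u_sup u D / H"
    (is "integral ?A ?g \<le> _")
proof -
  have h: "0 < half_width D" using tube by (simp add: percolating_tube_def C2_coordinates_def)
  have b: "E1u_sup u D / 2 \<le> E1u u D q \<and> E1u u D q \<le> E1u_sup u D" if "q \<in> coord_strip D" for q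
    using tube that by (simp add: percolating_tube_def)
  have le: "?g \<rho> \<le> E1u_sup u D / H" if "\<rho> \<in> ?A" for \<rho>
  proof -
    have "(\<rho>, \<xi>) \<in> coord_strip D" using that by (simp add: coord_strip_def rho_range_def)
    then show ?thesis using b[of "(\<rho>, \<xi>)"] H by (simp add: E1u_def divide_right_mono mult.commute)
  qed
  have "(centre D, 0) \<in> coord_strip D" using h by (simp add: coord_strip_def rho_range_def)
  then have Gs: "0 \<le> E1u_sup u D" using b by fastforce
  show ?thesis
  proof (cases "?g integrable_on ?A")
    case True
    have "integral ?A ?g \<le> integral ?A (\<lambda>_. E1u_sup u D / H)"
      by (rule integral_le[OF True _ le]) auto
    also have "\<dots> = 2 * half_width D * E1u_sup u D / H" using h by simp
    finally show ?thesis .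
  next
    \<comment> \<open>A non-integrable function has \<open>integral\<close> 0, and the bound is
      nonnegative.\<close>
    case False
    then show ?thesis using Gs h H by (simp add: not_integrable_integral)
  qed
qed

text \<open>The nonlinearity influences the final constant only through the total integral of f and
  the bounds on f and f' obtained here. Positivity of the integral holds because f is continuous,
  nonnegative and not identically zero.\<close>

lemma nonlinearity_data:
  assumes "nonlinearity f"
  obtains f' Mf Mf' where "\<And>s. s \<in> {0..1} \<Longrightarrow> (f has_real_derivative f' s) (at s within {0..1})"
    "continuous_on {0..1} f'" "\<And>s. s \<in> {0..1} \<Longrightarrow> 0 \<le> f s" "0 < integral {0..1} f"
    "\<And>s. s \<in> {0..1} \<Longrightarrow> f s \<le> Mf" "\<And>s. s \<in> {0..1} \<Longrightarrow> \<bar>f' s\<bar> \<le> Mf'"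
proof -
  obtain g where g: "\<And>s. s \<in> {0..1} \<Longrightarrow> (f has_derivative blinfun_apply (g s)) (at s within {0..1})"
    "continuous_on {0..1} g"
    using assms unfolding nonlinearity_def C1_on_def by blast
  define f' where "f' = (\<lambda>s. blinfun_apply (g s) 1)"
  have d: "(f has_real_derivative f' s) (at s within {0..1})" if "s \<in> {0..1}" for s
  proof -
    have "blinfun_apply (g s) = (*) (f' s)"
    proof
      fix h :: real
      have "blinfun_apply (g s) (h *\<^sub>R 1) = h *\<^sub>R blinfun_apply (g s) 1" by (rule blinfun.scaleR_right)
      then show "blinfun_apply (g s) h = f' s * h" by (simp add: f'_def mult.commute)
    qed
    then show ?thesis using g(1)[OF that] by (simp add: has_field_derivative_def)
  qed
  have c': "continuous_on {0..1} f'" unfolding f'_def by (intro continuous_intros g(2))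
  have c: "continuous_on {0..1} f" using d by (rule DERIV_continuous_on)
  have nn: "0 \<le> f s" if "s \<in> {0..1}" for s
  proof (cases "s \<in> {0<..<1}")
    case True then show ?thesis using assms by (simp add: nonlinearity_def)
  next
    case False
    then have "s = 0 \<or> s = 1" using that by auto
    then show ?thesis using assms by (auto simp: nonlinearity_def)
  qed
  have "0 \<le> integral {0..1} f"
    by (rule integral_nonneg[OF integrable_continuous_real[OF c] nn])
  moreover have "integral {0..1} f \<noteq> 0"
  proof
    assume 0: "integral {0..1} f = 0"
    have hi: "(f has_integral 0) (cbox 0 1)"
      using integrable_integral[OF integrable_continuous_real[OF c]] 0 by simp
    have "f s = 0" if "s \<in> {0..1}" for s
      using has_integral_0_cbox_imp_0[of 0 1 f s] c nn hi that by simp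
    then show False using assms by (auto simp: nonlinearity_def)
  qed
  ultimately have pos: "0 < integral {0..1} f" by linarith
  have bd: "\<exists>M. \<forall>s\<in>{0..1}. \<bar>q s\<bar> \<le> M" if "continuous_on {0..1} q" for q :: "real \<Rightarrow> real"
    using compact_imp_bounded[OF compact_continuous_image[OF that compact_Icc]] unfolding bounded_iff by force
  obtain Mf where "\<And>s. s \<in> {0..1} \<Longrightarrow> \<bar>f s\<bar> \<le> Mf" using bd[OF c] by blast
  moreover obtain Mf' where "\<And>s. s \<in> {0..1} \<Longrightarrow> \<bar>f' s\<bar> \<le> Mf'" using bd[OF c'] by blast
  ultimately show ?thesis by (intro that[OF d c' nn pos, of Mf Mf']) (auto intro: abs_le_D1)
qed

text \<open>At most one summand is nonzero; thus the bounds on the combined test function do not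
  deteriorate with the number of tubes.\<close>

lemma sum_disjoint_bound:
  fixes g :: "nat \<Rightarrow> real"
  assumes "\<And>i j. i < n \<Longrightarrow> j < n \<Longrightarrow> g i \<noteq> 0 \<Longrightarrow> g j \<noteq> 0 \<Longrightarrow> i = j"
    and "\<And>i. i < n \<Longrightarrow> \<bar>g i\<bar> \<le> M" "0 \<le> M"
  shows "\<bar>\<Sum>i<n. g i\<bar> \<le> M"
proof (cases "\<exists>i<n. g i \<noteq> 0")
  case True
  then obtain i where i: "i < n" "g i \<noteq> 0" by blast
  have "(\<Sum>j<n. g j) = (\<Sum>j\<in>{i}. g j)"
    using assms(1)[OF _ i(1) _ i(2)] i(1) by (intro sum.mono_neutral_right) auto
  then show ?thesis using assms(2)[OF i(1)] by simp
next
  case False then show ?thesis using assms(3) by simp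
qed

text \<open>The gradient of the test function of tube j is at most 8 K / h, while
  \<open>flux_bound\<close> tolerates B v / \<kappa>. The weight is chosen so that divided by h it
  equals 1 / (h + \<kappa> / v) \<le> v / \<kappa>, and so that it never exceeds 1. Thus B = 8 K
  works for all tubes at once, and wide tubes keep almost their full flux.\<close>

lemma tube_sum_bound:
  assumes pos: "0 < \<kappa>" "0 < v" "0 < H" "0 < K" and flow: "percolating_flow b H p K u n D"
    and wave: "traveling_wave b H p \<kappa> v f u U c"
    and f: "\<And>s. s \<in> {0..1} \<Longrightarrow> (f has_real_derivative f' s) (at s within {0..1})" "continuous_on {0..1} f'"
      "\<And>s. s \<in> {0..1} \<Longrightarrow> 0 \<le> f s"
    and Mf: "\<And>s. s \<in> {0..1} \<Longrightarrow> f s \<le> Mf" "\<And>s. s \<in> {0..1} \<Longrightarrow> \<bar>f' s\<bar> \<le> Mf'"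
  shows "integral {0..1} f * (\<Sum>j<n. inverse (1 + (\<kappa> / v) / half_width (D j)) * (half_width (D j) * E1u_sup u (D j) / 8))
      \<le> (integral {0..1} f + 3 / 2 * (Mf + 8 * K * (1 + Mf) + Mf')) * c * H"
    and "2 * v * integral {0..1} f \<le> 3 * (1 + Mf) * c"
proof -
  obtain \<tau> m u1x u2y Tt Tx Ty Txx Tyy where front: "front H \<tau> p c \<kappa> v m (\<lambda>x y. fst (u (x, y))) (\<lambda>x y. snd (u (x, y))) u1x u2y
     (\<lambda>x y t. U (x - c * t) x y) Tt Tx Ty Txx Tyy f f'"
    using wave_front[OF pos(1-3) flow wave f] by blast
  interpret fr: front H \<tau> p c \<kappa> v m "\<lambda>x y. fst (u (x, y))" "\<lambda>x y. snd (u (x, y))" u1x u2y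
     "\<lambda>x y t. U (x - c * t) x y" Tt Tx Ty Txx Tyy f f' by (rule front)
  show "2 * v * integral {0..1} f \<le> 3 * (1 + Mf) * c" by (rule fr.reaction_speed[OF Mf(1)])
  have tc: "tube_chart b H p K u n D j" if "j < n" for j
    using pos flow that by unfold_locales
  have "\<forall>j. \<exists>\<psi> \<psi>x \<psi>y. j < n \<longrightarrow> tube_test H K u (D j) \<psi> \<psi>x \<psi>y"
    using tube_chart.ex_test[OF tc] by blast
  then obtain ps px py where "\<forall>j. j < n \<longrightarrow> tube_test H K u (D j) (ps j) (px j) (py j)"
    by metis
  then have tt: "\<And>j. j < n \<Longrightarrow> tube_test H K u (D j) (ps j) (px j) (py j)" by blast
  have cont: "continuous_on A (ps j)" "continuous_on A (px j)" "continuous_on A (py j)" if "j < n" for j A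
    by (rule continuous_on_subset[OF tube_testD(1)[OF tt[OF that]]]; simp)+
  have supp: "\<exists>k::int. z + (0, of_int k * H) \<in> point_at (D j) ` open_strip (D j)"
    if "j < n" "g \<in> {ps, px, py}" "g j z \<noteq> 0" for j g z
    by (rule tube_testD(2)[OF tt[OF that(1)], where g = "g j" and z = z]) (use that in auto)
  have dx: "((\<lambda>r. ps j (r, y)) has_real_derivative px j (x, y)) (at x)"
    and dy: "((\<lambda>r. ps j (x, r)) has_real_derivative py j (x, y)) (at y)"
    and per: "ps j (x, y + H) = ps j (x, y)"
    if "j < n" for j x y
    by (rule tube_testD(3-5)[OF tt[OF that]])+
  have orth: "fst (u (x, y)) * px j (x, y) + snd (u (x, y)) * py j (x, y) = 0" if "j < n" "y \<in> {0..H}" for j x y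
    by (rule tube_testD(7)[OF tt[OF that(1)] that(2)])
  have bnd: "\<bar>ps j z\<bar> \<le> 1" "\<bar>px j z\<bar> \<le> 8 * K / half_width (D j)" "\<bar>py j z\<bar> \<le> 8 * K / half_width (D j)"
    if "j < n" for j z
    using tube_testD(6)[OF tt[OF that], of z] by linarith+
  have c2: "continuous_on (slab 0 H) (\<lambda>z. g j (fst z, snd z))" if "j < n" "g \<in> {ps, px, py}" for g j
    using cont[OF that(1)] that(2) by auto
  have adm: "fr.admissible (\<lambda>x y. ps j (x, y)) (\<lambda>x y. px j (x, y)) (\<lambda>x y. py j (x, y))" if j: "j < n" for j
    unfolding fr.admissible_def
  proof (intro conjI allI ballI)
    show "ps j (x, 0) = ps j (x, H)" for x using per[OF j, of x 0] by simp
  qed (use c2[OF j] dx[OF j] dy[OF j] orth[OF j] in \<open>auto intro: has_field_derivative_at_within\<close>)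
  have "\<forall>j. \<exists>F. j < n \<longrightarrow> (\<forall>x. integral {0..H} (\<lambda>y. ps j (x, y) * fst (u (x, y))) = F)"
    using fr.flux_constant[OF adm] by metis
  then obtain Fl where "\<forall>j. j < n \<longrightarrow> (\<forall>x. integral {0..H} (\<lambda>y. ps j (x, y) * fst (u (x, y))) = Fl j)"
    by metis
  then have Fl: "\<And>j x. j < n \<Longrightarrow> integral {0..H} (\<lambda>y. ps j (x, y) * fst (u (x, y))) = Fl j" by blast
  have Fl_lower: "half_width (D j) * E1u_sup u (D j) / 8 \<le> \<bar>Fl j\<bar>" if "j < n" for j
    by (rule tube_testD(8)[OF tt[OF that] Fl[OF that]])
  define w where "w = (\<lambda>j. inverse (1 + (\<kappa> / v) / half_width (D j)))"
  \<comment> \<open>The sign of the flux of each tube makes every contribution to the total flux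
    nonnegative.\<close>
  define a where "a = (\<lambda>j. w j * sgn (Fl j))"
  have h: "0 < half_width (D j)" if "j < n" for j by (rule tube_chart.half_width_pos[OF tc[OF that]])
  have w: "0 \<le> w j" "w j \<le> 1" "w j / half_width (D j) \<le> v / \<kappa>" if j: "j < n" for j
  proof -
    have q: "0 < \<kappa> / v" "0 < (\<kappa> / v) / half_width (D j)" using pos h[OF j] by simp_all
    then show "0 \<le> w j" "w j \<le> 1" by (simp_all add: w_def inverse_le_1_iff)
    have "w j / half_width (D j) = 1 / (half_width (D j) + \<kappa> / v)"
      using h[OF j] q by (simp add: w_def field_simps)
    also have "\<dots> \<le> 1 / (\<kappa> / v)" by (rule frac_le) (use h[OF j] q(1) in linarith)+
    finally show "w j / half_width (D j) \<le> v / \<kappa>" by simp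
  qed
  have a: "\<bar>a j\<bar> \<le> w j" if "j < n" for j using w(1)[OF that] by (simp add: a_def abs_mult abs_sgn_eq)
  define \<Psi> where "\<Psi> = (\<lambda>x y. \<Sum>j<n. a j * ps j (x, y))"
  define \<Psi>x where "\<Psi>x = (\<lambda>x y. \<Sum>j<n. a j * px j (x, y))"
  define \<Psi>y where "\<Psi>y = (\<lambda>x y. \<Sum>j<n. a j * py j (x, y))"
  have adm\<Psi>: "fr.admissible \<Psi> \<Psi>x \<Psi>y"
    unfolding fr.admissible_def
  proof (intro conjI allI ballI)
    show "continuous_on (slab 0 H) (\<lambda>z. \<Psi> (fst z) (snd z))" "continuous_on (slab 0 H) (\<lambda>z. \<Psi>x (fst z) (snd z))"
      "continuous_on (slab 0 H) (\<lambda>z. \<Psi>y (fst z) (snd z))"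
      unfolding \<Psi>_def \<Psi>x_def \<Psi>y_def by (intro continuous_on_sum continuous_on_mult continuous_on_const c2; simp)+
    fix x
    show "\<Psi> x 0 = \<Psi> x H" unfolding \<Psi>_def using per[of _ x 0] by (intro sum.cong) auto
    fix y assume y: "y \<in> {0..H}"
    show "((\<lambda>r. \<Psi> r y) has_real_derivative \<Psi>x x y) (at x)"
      unfolding \<Psi>_def \<Psi>x_def by (intro DERIV_sum DERIV_cmult dx) auto
    show "((\<lambda>r. \<Psi> x r) has_real_derivative \<Psi>y x y) (at y within {0..H})"
      unfolding \<Psi>_def \<Psi>y_def by (intro DERIV_sum DERIV_cmult has_field_derivative_at_within[OF dy]) auto
    have "fst (u (x, y)) * \<Psi>x x y + snd (u (x, y)) * \<Psi>y x y
       = (\<Sum>j<n. a j * (fst (u (x, y)) * px j (x, y) + snd (u (x, y)) * py j (x, y)))"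
      unfolding \<Psi>x_def \<Psi>y_def by (simp add: sum_distrib_left sum.distrib[symmetric] algebra_simps)
    also have "\<dots> = 0" using orth[OF _ y] by simp
    finally show "fst (u (x, y)) * \<Psi>x x y + snd (u (x, y)) * \<Psi>y x y = 0" .
  qed
  have uniq: "i = j" if "i < n" "j < n" "a i * g i z \<noteq> 0" "a j * g j z \<noteq> 0" "g \<in> {ps, px, py}" for i j g z
  proof -
    note s = supp[OF that(1,5)] supp[OF that(2,5)]
    have nz: "g i z \<noteq> 0" "g j z \<noteq> 0" using that(3,4) by simp_all
    obtain k :: int where k: "z + (0, of_int k * H) \<in> point_at (D j) ` open_strip (D j)"
      using s(2)[OF nz(2)] by (elim exE)
    obtain k' :: int where k': "z + (0, of_int k' * H) \<in> point_at (D i) ` open_strip (D i)"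
      using s(1)[OF nz(1)] by (elim exE)
    show ?thesis by (rule tube_chart.V_unique[OF tc[OF that(2)] that(1) k k'])
  qed
  have b1: "\<bar>\<Psi> x y\<bar> \<le> 1" for x y
    unfolding \<Psi>_def
  proof (rule sum_disjoint_bound)
    fix i assume i: "i < n"
    have "\<bar>a i\<bar> * \<bar>ps i (x, y)\<bar> \<le> 1 * 1" using a[OF i] w(2)[OF i] bnd(1)[OF i] by (intro mult_mono) auto
    then show "\<bar>a i * ps i (x, y)\<bar> \<le> 1" by (simp add: abs_mult)
  qed (use uniq[of _ _ ps] in auto)
  have b2: "\<bar>\<Sum>j<n. a j * g j (x, y)\<bar> \<le> 8 * K * v / \<kappa>" if g: "g \<in> {px, py}" for g x y
  proof (rule sum_disjoint_bound)
    fix i assume i: "i < n"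
    have "\<bar>a i\<bar> * \<bar>g i (x, y)\<bar> \<le> w i * (8 * K / half_width (D i))"
      using a[OF i] w(1)[OF i] bnd(2,3)[OF i, of "(x, y)"] g by (intro mult_mono) auto
    also have "\<dots> = 8 * K * (w i / half_width (D i))" by simp
    also have "\<dots> \<le> 8 * K * (v / \<kappa>)" using w(3)[OF i] pos by (intro mult_left_mono) auto
    finally show "\<bar>a i * g i (x, y)\<bar> \<le> 8 * K * v / \<kappa>" by (simp add: abs_mult)
  next
    fix i j assume "i < n" "j < n" "a i * g i (x, y) \<noteq> 0" "a j * g j (x, y) \<noteq> 0"
    then show "i = j" using uniq[of i j g "(x, y)"] g by auto
  qed (use pos in simp)
  have flux: "integral {0..H} (\<lambda>y. \<Psi> x y * fst (u (x, y))) = (\<Sum>j<n. w j * \<bar>Fl j\<bar>)" for x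
  proof -
    have cu: "continuous_on (UNIV \<times> {0..H}) (\<lambda>z. fst (u z))" using fr.cont_u(1) by simp
    have "((\<lambda>y. ps j (x, y) * fst (u (x, y))) has_integral Fl j) {0..H}" if j: "j < n" for j
    proof -
      have "continuous_on (UNIV \<times> {0..H}) (\<lambda>z. ps j z * fst (u z))" by (intro continuous_on_mult cont[OF j] cu)
      then have "continuous_on {0..H} (\<lambda>y. ps j (x, y) * fst (u (x, y)))"
        by (rule continuous_on_compose2) (auto intro!: continuous_intros)
      from integrable_integral[OF integrable_continuous_real[OF this]] show ?thesis unfolding Fl[OF j] .
    qed
    then have "((\<lambda>y. \<Sum>j<n. a j * (ps j (x, y) * fst (u (x, y)))) has_integral (\<Sum>j<n. a j * Fl j)) {0..H}"
      by (intro has_integral_sum has_integral_mult_right) auto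
    moreover have "(\<lambda>y. \<Sum>j<n. a j * (ps j (x, y) * fst (u (x, y)))) = (\<lambda>y. \<Psi> x y * fst (u (x, y)))"
      by (simp add: \<Psi>_def sum_distrib_right mult.assoc)
    moreover have "a j * Fl j = w j * \<bar>Fl j\<bar>" for j by (simp add: a_def abs_sgn mult.commute)
    ultimately show ?thesis by (simp add: integral_unique)
  qed
  have "integral {0..1} f * \<bar>\<Sum>j<n. w j * \<bar>Fl j\<bar>\<bar>
     \<le> (integral {0..1} f + 3 / 2 * (Mf + 8 * K * (1 + Mf) + Mf')) * c * H"
    by (rule fr.flux_bound[OF adm\<Psi> flux b1 _ _ Mf]) (auto simp: \<Psi>x_def \<Psi>y_def intro!: b2[simplified])
  moreover have "(\<Sum>j<n. w j * (half_width (D j) * E1u_sup u (D j) / 8)) \<le> (\<Sum>j<n. w j * \<bar>Fl j\<bar>)"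
    using w(1) Fl_lower by (intro sum_mono mult_left_mono) auto
  moreover have "0 \<le> integral {0..1} f"
    by (rule integral_nonneg[OF integrable_continuous_real[OF fr.f_cont] f(3)])
  ultimately show "integral {0..1} f * (\<Sum>j<n. inverse (1 + (\<kappa> / v) / half_width (D j)) * (half_width (D j) * E1u_sup u (D j) / 8))
      \<le> (integral {0..1} f + 3 / 2 * (Mf + 8 * K * (1 + Mf) + Mf')) * c * H"
    unfolding w_def by (smt (verit) mult_left_mono)
qed

text \<open>Both types of nonlinearity are handled at once, through nonnegativity and positive
  integral of f. The constant is fixed before the flow, its tubes and the wave are
  introduced.\<close>

theorem corollary2:
  fixes f :: "real \<Rightarrow> real" and K :: real
  assumes "general_KPP_type f \<or> ignition_type f"
    and "K > 0"
  shows "\<exists>C>0. \<forall>(\<kappa>::real) (v\<^sub>0::real) (H::real) (b::bdry) (p::real)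
      (u::real \<times> real \<Rightarrow> real \<times> real) (n::nat) (D::nat \<Rightarrow> tube)
      (U::real \<Rightarrow> real \<Rightarrow> real \<Rightarrow> real) (c::real).
    \<kappa> > 0 \<and> v\<^sub>0 > 0 \<and> H > 0
      \<and> percolating_flow b H p K u n D
      \<and> traveling_wave b H p \<kappa> v\<^sub>0 f u U c
    \<longrightarrow> (\<forall>\<xi>::real. c \<ge> C * (v\<^sub>0 + (\<Sum>j<n. inverse (1 + (\<kappa> / v\<^sub>0) / half_width (D j))
          * integral {centre (D j) - half_width (D j) .. centre (D j) + half_width (D j)}
              (\<lambda>\<rho>. norm (u (point_at (D j) (\<rho>, \<xi>))) * E1 (D j) (\<rho>, \<xi>) / H))))"
proof -
  have "nonlinearity f" using assms(1) by (auto simp: general_KPP_type_def ignition_type_def)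
  then obtain f' Mf Mf' where f: "\<And>s. s \<in> {0..1} \<Longrightarrow> (f has_real_derivative f' s) (at s within {0..1})"
    "continuous_on {0..1} f'" "\<And>s. s \<in> {0..1} \<Longrightarrow> 0 \<le> f s" "0 < integral {0..1} f"
    "\<And>s. s \<in> {0..1} \<Longrightarrow> f s \<le> Mf" "\<And>s. s \<in> {0..1} \<Longrightarrow> \<bar>f' s\<bar> \<le> Mf'"
    by (rule nonlinearity_data) blast
  define G1 where "G1 = integral {0..1} f"
  define A1 where "A1 = G1 + 3 / 2 * (Mf + 8 * K * (1 + Mf) + Mf')"
  \<comment> \<open>The first summand bounds v / c by \<open>reaction_speed\<close>, the second the
    weighted sum over the tubes divided by c; the constant of the theorem is the reciprocal 1 /
    L.\<close>
  define L where "L = 3 * (1 + Mf) / (2 * G1) + 16 * A1 / G1"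
  have M: "0 \<le> Mf" "0 \<le> Mf'" using f(3,5,6)[of 0] by force+
  have G1: "0 < G1" using f(4) by (simp add: G1_def)
  have A1: "0 \<le> A1" using M G1 assms(2) by (simp add: A1_def)
  have L: "0 < L" using M G1 A1 by (simp add: L_def add_pos_nonneg)
  show ?thesis
  proof (intro exI[of _ "1 / L"] conjI allI impI)
    show "0 < 1 / L" using L by simp
    fix \<kappa> v\<^sub>0 H :: real and b p u n D U c \<xi>
    assume A: "\<kappa> > 0 \<and> v\<^sub>0 > 0 \<and> H > 0 \<and> percolating_flow b H p K u n D \<and> traveling_wave b H p \<kappa> v\<^sub>0 f u U c"
    have pos: "\<kappa> > 0" "v\<^sub>0 > 0" "H > 0" and flow: "percolating_flow b H p K u n D"
      and wave: "traveling_wave b H p \<kappa> v\<^sub>0 f u U c" using A by auto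
    define w where "w = (\<lambda>j. inverse (1 + (\<kappa> / v\<^sub>0) / half_width (D j)))"
    define S where "S = (\<Sum>j<n. w j * (half_width (D j) * E1u_sup u (D j) / 8))"
    define I where "I = (\<lambda>j. integral {centre (D j) - half_width (D j) .. centre (D j) + half_width (D j)}
              (\<lambda>\<rho>. norm (u (point_at (D j) (\<rho>, \<xi>))) * E1 (D j) (\<rho>, \<xi>) / H))"
    have S: "G1 * S \<le> A1 * c * H" and v: "2 * v\<^sub>0 * G1 \<le> 3 * (1 + Mf) * c"
      using tube_sum_bound[OF pos assms(2) flow wave f(1-3) f(5,6)]
      by (simp_all add: G1_def A1_def S_def w_def)
    have tube: "percolating_tube (domain b H) u K (D j)" if "j < n" for j
      using flow that by (simp add: percolating_flow_def)
    have "(\<Sum>j<n. w j * I j) \<le> (\<Sum>j<n. w j * (2 * half_width (D j) * E1u_sup u (D j) / H))"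
    proof (intro sum_mono mult_left_mono)
      fix j assume "j \<in> {..<n}"
      then have j: "j < n" by simp
      show "I j \<le> 2 * half_width (D j) * E1u_sup u (D j) / H"
        unfolding I_def by (rule profile_integral_bound[OF tube[OF j] pos(3)])
      have "0 < half_width (D j)" using tube[OF j] by (simp add: percolating_tube_def C2_coordinates_def)
      then show "0 \<le> w j" using pos by (simp add: w_def)
    qed
    \<comment> \<open>16 = 2 * 8: the upper bound on the profile integral contains 2 h, the lower
      bound on the flux h / 8.\<close>
    also have "\<dots> = 16 / H * S"
      by (simp add: S_def sum_distrib_left mult_ac)
    also have "\<dots> \<le> 16 * A1 / G1 * c"
    proof -
      have "S / H \<le> A1 * c / G1" using S G1 pos by (simp add: field_simps)
      then show ?thesis using mult_left_mono[of "S / H" "A1 * c / G1" 16] by simp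
    qed
    finally have 1: "(\<Sum>j<n. w j * I j) \<le> 16 * A1 / G1 * c" .
    have 2: "v\<^sub>0 \<le> 3 * (1 + Mf) / (2 * G1) * c"
      using v G1 by (simp add: field_simps)
    have "v\<^sub>0 + (\<Sum>j<n. w j * I j) \<le> L * c" using 1 2 unfolding L_def distrib_right by linarith
    then have "1 / L * (v\<^sub>0 + (\<Sum>j<n. w j * I j)) \<le> c" using L by (simp add: field_simps)
    then show "c \<ge> 1 / L * (v\<^sub>0 + (\<Sum>j<n. inverse (1 + (\<kappa> / v\<^sub>0) / half_width (D j))
          * integral {centre (D j) - half_width (D j) .. centre (D j) + half_width (D j)}
              (\<lambda>\<rho>. norm (u (point_at (D j) (\<rho>, \<xi>))) * E1 (D j) (\<rho>, \<xi>) / H)))"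
      by (simp add: w_def I_def)
  qed
qed

end
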